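(* Fix $\lambda\in\{1,1.5,2,2.5,3\}$, $\mu\in\mathbb{R}$, $\sigma>0$ and $\delta_1,\delta_2\in\mathbb{R}$. For each $n$, let $X_1,\ldots,X_n$ be i.i.d. with the $\mathrm{APD}_\lambda(\theta_{1,n},\theta_{2,n},\mu,\sigma)$ distribution, where $\theta_{1,n}=\frac12+\frac{\delta_1}{\sqrt n}(1+o(1))$ and $\theta_{2,n}=\lambda+\frac{\delta_2}{\sqrt n}(1+o(1))$ (the local alternatives $H_{1,n}(\delta_1,\delta_2)$). Let $Z(S_\lambda)$, $Z^*(S_\lambda)$, $Z(K_\lambda^{\mathrm{net}})$, $Z^*(K_\lambda)$ and $X_\lambda^{\mathrm{APD}}$ be the statistics computed from $X_1,\ldots,X_n$ as defined in the context. Then, as $n\to\infty$, $$\frac{Z(S_\lambda)}{Z^*(S_\lambda)}\xrightarrow{\ \mathrm{a.s.}\ }1,\qquad \frac{Z(K_\lambda^{\mathrm{net}})}{Z^*(K_\lambda)}\xrightarrow{\ \mathcal P\ }1,$$ $$\begin{pmatrix} Z(S_\lambda)\\ Z(K_\lambda^{\mathrm{net}})\end{pmatrix}\xrightarrow{\ \mathcal{D}\ }\mathcal{N}_2\left(\begin{pmatrix}-\delta_1V_{1,\lambda}^{1/2}\\-\delta_2V_{2,\lambda}^{1/2}\end{pmatrix},\begin{pmatrix}1&0\\0&1\end{pmatrix}\right)\quad\text{and}\quad X_\lambda^{\mathrm{APD}}\xrightarrow{\ \mathcal{D}\ }\chi_2^2\big(\delta_1^2V_{1,\lambda}+\delta_2^2V_{2,\lambda}\big),$$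 where $$V_{1,\lambda}=4(1+\lambda)-\frac{4\lambda^2}{\Gamma(2-1/\lambda)\Gamma(1/\lambda)},\qquad V_{2,\lambda}=\frac{(1+1/\lambda)\psi_1(1+1/\lambda)-1}{\lambda^3}.$$
   Context: $\mathrm{APD}_\lambda(\theta_1,\theta_2,\mu,\sigma)$, for $\theta_1\in(0,1)$, $\theta_2>0$, $\mu\in\mathbb{R}$, $\sigma>0$, is the distribution on $\mathbb{R}$ with density $f_\lambda(x\mid\theta_1,\theta_2,\mu,\sigma)=\frac{(\delta_{\theta_1,\theta_2}/\lambda)^{1/\theta_2}}{\sigma\Gamma(1+1/\theta_2)}\exp\left(-\frac1\lambda\frac{\delta_{\theta_1,\theta_2}}{A_{\theta_1,\theta_2}(y)}|y|^{\theta_2}\right)$, $y=(x-\mu)/\sigma$, where $\delta_{\theta_1,\theta_2}=\frac{2\theta_1^{\theta_2}(1-\theta_1)^{\theta_2}}{\theta_1^{\theta_2}+(1-\theta_1)^{\theta_2}}$ and $A_{\theta_1,\theta_2}(y)=\theta_1^{\theta_2}$ if $y<0$, $(1-\theta_1)^{\theta_2}$ if $y>0$. The $o(1)$ terms are deterministic sequences tending to $0$; $n$ is large enough that $\theta_{1,n}\in(0,1)$ and $\theta_{2,n}>0$. Estimators (computed from $X_1,\dots,X_n$): $\hat\mu_\lambda$ is the sample median if $\lambda=1$ (central order statistic if $n$ is odd, arithmetic mean of the two central order statistics if $n$ is even), and for $\lambda>1$ it is the unique solution $m$ of $\sum_{i=1}^n|X_i-m|^{\lambda-1}\mathrm{sign}(X_i-m)=0$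 (the sample mean when $\lambda=2$). $\hat\sigma_\lambda=\left(\frac1n\sum_{i=1}^n|X_i-\hat\mu_\lambda|^\lambda\right)^{1/\lambda}$. With $\hat Y_i=\hat\sigma_\lambda^{-1}(X_i-\hat\mu_\lambda)$ and the convention $|y|^\lambda\log|y|=0$ at $y=0$: $S_\lambda=\frac1n\sum_{i=1}^n|\hat Y_i|^\lambda\mathrm{sign}(\hat Y_i)$, $K_\lambda=\frac1n\sum_{i=1}^n|\hat Y_i|^\lambda\log|\hat Y_i|$, $K_\lambda^{\mathrm{net}}=\max\big(0,K_\lambda-(\lambda/2)S_\lambda^2\big)$. $\psi=(\log\Gamma)'$ is the digamma function and $\psi_1=\psi'$ the trigamma function. Put $V_S=1+\lambda-\frac{\lambda^2}{\Gamma(2-1/\lambda)\Gamma(1/\lambda)}$, $E_K=\frac{\lambda+\log\lambda+\psi(1/\lambda)}{\lambda}$, $V_K=\frac{(1+1/\lambda)\psi_1(1+1/\lambda)-1}{\lambda}$. Statistics: $Z^*(S_\lambda)=\sqrt n\,V_S^{-1/2}S_\lambda$, $Z^*(K_\lambda)=\sqrt n\,V_K^{-1/2}(K_\lambda-E_K)$, $Z(S_\lambda)=\sqrt n\,S_\lambda\left[V_S\left(1+\frac{c_1}{n^{\alpha_1}}\right)\right]^{-1/2}$, $Z(K_\lambda^{\mathrm{net}})=\sqrt n\left((K_\lambda^{\mathrm{net}})^{1/4}-E_K^{1/4}\left(1+\frac{c_2}{n^{\alpha_2}}\right)\right)\left[\tfrac1{16}E_K^{-3/2}V_K\left(1+\frac{c_3}{n^{\alpha_3}}+\frac{c_4}{n^{\alpha_4}}\right)\right]^{-1/2}$,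 $X_\lambda^{\mathrm{APD}}=Z(S_\lambda)^2+Z(K_\lambda^{\mathrm{net}})^2$. The constants $(\alpha_1,c_1,\alpha_2,c_2,\alpha_3,c_3,\alpha_4,c_4)$ depend on $\lambda$ (and on the parity of $n$ if $\lambda=1$): $\lambda=1$, $n$ even: $(1.06,-1.856,1.01,-0.422,0.92,-1.950,2.3,39.349)$; $\lambda=1$, $n$ odd: $(1.03,-0.281,0.86,-0.198,1.04,-3.827,1.0,0)$; $\lambda=1.5$: $(0.99,-0.952,0.99,-0.637,0.55,-3.488,0.5,2.434)$; $\lambda=2$: $(0.99,-1.890,1.00,-0.788,1.05,-9.327,1.4,14.208)$; $\lambda=2.5$: $(0.99,-2.981,0.99,-0.844,1.10,-23.104,1.3,30.028)$; $\lambda=3$: $(0.97,-3.855,0.98,-0.880,1.14,-95.743,1.2,103.871)$. (The statistics are considered for $n$ large enough that the quantities under the square roots are positive.) $\chi_2^2(\xi)$ is the noncentral chi-square distribution with 2 degrees of freedom and noncentrality parameter $\xi$ (law of $\|N\|^2$ for $N\sim\mathcal N_2(m,I_2)$ with $\|m\|^2=\xi$); $\xrightarrow{\mathcal D}$, $\xrightarrow{\mathcal P}$, $\xrightarrow{\mathrm{a.s.}}$ denote convergence in distribution, in probability and almost surely (for the latter, the samples for different $n$ may be taken on any common probability space). *)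

theory Defs
  imports "HOL-Probability.Probability"
begin

section \<open>The asymmetric power distribution\<close>

definition apd_delta :: "real \<Rightarrow> real \<Rightarrow> real" where
  "apd_delta \<theta>1 \<theta>2 =
     2 * \<theta>1 powr \<theta>2 * (1 - \<theta>1) powr \<theta>2 / (\<theta>1 powr \<theta>2 + (1 - \<theta>1) powr \<theta>2)"

text \<open>The value at \<open>y = 0\<close> is immaterial: the density multiplies its reciprocal by
  \<open>\<bar>y\<bar> powr \<theta>2\<close>, which vanishes there.\<close>

definition apd_A :: "real \<Rightarrow> real \<Rightarrow> real \<Rightarrow> real" where
  "apd_A \<theta>1 \<theta>2 y = (if y < 0 then \<theta>1 powr \<theta>2 else (1 - \<theta>1) powr \<theta>2)"

definition apd_density :: "real \<Rightarrow> real \<Rightarrow> real \<Rightarrow> real \<Rightarrow> real \<Rightarrow> real \<Rightarrow> real" where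
  "apd_density lam \<theta>1 \<theta>2 \<mu> \<sigma> x =
     (let y = (x - \<mu>) / \<sigma> in
       (apd_delta \<theta>1 \<theta>2 / lam) powr (1 / \<theta>2) / (\<sigma> * Gamma (1 + 1 / \<theta>2)) *
       exp (- (1 / lam) * (apd_delta \<theta>1 \<theta>2 / apd_A \<theta>1 \<theta>2 y) * \<bar>y\<bar> powr \<theta>2))"


section \<open>Estimators and empirical moments\<close>

text \<open>A sample of size \<open>n\<close> is given by the values \<open>x 0, \<dots>, x (n - 1)\<close> of \<open>x :: nat \<Rightarrow> real\<close>.\<close>

definition sample_median :: "nat \<Rightarrow> (nat \<Rightarrow> real) \<Rightarrow> real" where
  "sample_median n x =
     (let xs = sort (map x [0..<n]) in
       if odd n then xs ! (n div 2) else (xs ! (n div 2 - 1) + xs ! (n div 2)) / 2)"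

definition mu_hat :: "real \<Rightarrow> nat \<Rightarrow> (nat \<Rightarrow> real) \<Rightarrow> real" where
  "mu_hat lam n x =
     (if lam = 1 then sample_median n x
      else (THE m. (\<Sum>i<n. \<bar>x i - m\<bar> powr (lam - 1) * sgn (x i - m)) = 0))"

definition sigma_hat :: "real \<Rightarrow> nat \<Rightarrow> (nat \<Rightarrow> real) \<Rightarrow> real" where
  "sigma_hat lam n x = ((\<Sum>i<n. \<bar>x i - mu_hat lam n x\<bar> powr lam) / real n) powr (1 / lam)"

definition Y_hat :: "real \<Rightarrow> nat \<Rightarrow> (nat \<Rightarrow> real) \<Rightarrow> nat \<Rightarrow> real" where
  "Y_hat lam n x i = (x i - mu_hat lam n x) / sigma_hat lam n x"

definition S_stat :: "real \<Rightarrow> nat \<Rightarrow> (nat \<Rightarrow> real) \<Rightarrow> real" where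
  "S_stat lam n x = (\<Sum>i<n. \<bar>Y_hat lam n x i\<bar> powr lam * sgn (Y_hat lam n x i)) / real n"

text \<open>Since \<open>0 powr lam = 0\<close>, terms with \<open>Y_hat lam n x i = 0\<close> contribute \<open>0\<close>.\<close>

definition K_stat :: "real \<Rightarrow> nat \<Rightarrow> (nat \<Rightarrow> real) \<Rightarrow> real" where
  "K_stat lam n x = (\<Sum>i<n. \<bar>Y_hat lam n x i\<bar> powr lam * ln \<bar>Y_hat lam n x i\<bar>) / real n"

definition K_net :: "real \<Rightarrow> nat \<Rightarrow> (nat \<Rightarrow> real) \<Rightarrow> real" where
  "K_net lam n x = max 0 (K_stat lam n x - (lam / 2) * (S_stat lam n x)\<^sup>2)"


section \<open>Test statistics\<close>

definition V_S :: "real \<Rightarrow> real" where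
  "V_S lam = 1 + lam - lam\<^sup>2 / (Gamma (2 - 1 / lam) * Gamma (1 / lam))"

definition E_K :: "real \<Rightarrow> real" where
  "E_K lam = (lam + ln lam + Digamma (1 / lam)) / lam"

definition V_K :: "real \<Rightarrow> real" where
  "V_K lam = ((1 + 1 / lam) * Polygamma 1 (1 + 1 / lam) - 1) / lam"

text \<open>The tuple \<open>(\<alpha>1, c1, \<alpha>2, c2, \<alpha>3, c3, \<alpha>4, c4)\<close>; meaningful only for
  \<open>lam \<in> {1, 1.5, 2, 2.5, 3}\<close>.\<close>

definition apd_consts ::
  "real \<Rightarrow> nat \<Rightarrow> real \<times> real \<times> real \<times> real \<times> real \<times> real \<times> real \<times> real" where
  "apd_consts lam n =
     (if lam = 1 \<and> even n then (1.06, -1.856, 1.01, -0.422, 0.92, -1.950, 2.3, 39.349)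
      else if lam = 1 then (1.03, -0.281, 0.86, -0.198, 1.04, -3.827, 1.0, 0)
      else if lam = 1.5 then (0.99, -0.952, 0.99, -0.637, 0.55, -3.488, 0.5, 2.434)
      else if lam = 2 then (0.99, -1.890, 1.00, -0.788, 1.05, -9.327, 1.4, 14.208)
      else if lam = 2.5 then (0.99, -2.981, 0.99, -0.844, 1.10, -23.104, 1.3, 30.028)
      else (0.97, -3.855, 0.98, -0.880, 1.14, -95.743, 1.2, 103.871))"

definition Z_star_S :: "real \<Rightarrow> nat \<Rightarrow> (nat \<Rightarrow> real) \<Rightarrow> real" where
  "Z_star_S lam n x = sqrt (real n) * S_stat lam n x / sqrt (V_S lam)"

definition Z_star_K :: "real \<Rightarrow> nat \<Rightarrow> (nat \<Rightarrow> real) \<Rightarrow> real" where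
  "Z_star_K lam n x = sqrt (real n) * (K_stat lam n x - E_K lam) / sqrt (V_K lam)"

definition Z_S :: "real \<Rightarrow> nat \<Rightarrow> (nat \<Rightarrow> real) \<Rightarrow> real" where
  "Z_S lam n x =
     (case apd_consts lam n of (\<alpha>1, c1, \<alpha>2, c2, \<alpha>3, c3, \<alpha>4, c4) \<Rightarrow>
       sqrt (real n) * S_stat lam n x / sqrt (V_S lam * (1 + c1 / real n powr \<alpha>1)))"

definition Z_K_net :: "real \<Rightarrow> nat \<Rightarrow> (nat \<Rightarrow> real) \<Rightarrow> real" where
  "Z_K_net lam n x =
     (case apd_consts lam n of (\<alpha>1, c1, \<alpha>2, c2, \<alpha>3, c3, \<alpha>4, c4) \<Rightarrow>
       sqrt (real n) *
         (K_net lam n x powr (1 / 4) - E_K lam powr (1 / 4) * (1 + c2 / real n powr \<alpha>2)) /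
       sqrt (1 / 16 * E_K lam powr (- 3 / 2) * V_K lam *
               (1 + c3 / real n powr \<alpha>3 + c4 / real n powr \<alpha>4)))"

definition X_APD :: "real \<Rightarrow> nat \<Rightarrow> (nat \<Rightarrow> real) \<Rightarrow> real" where
  "X_APD lam n x = (Z_S lam n x)\<^sup>2 + (Z_K_net lam n x)\<^sup>2"

definition V1 :: "real \<Rightarrow> real" where
  "V1 lam = 4 * (1 + lam) - 4 * lam\<^sup>2 / (Gamma (2 - 1 / lam) * Gamma (1 / lam))"

definition V2 :: "real \<Rightarrow> real" where
  "V2 lam = ((1 + 1 / lam) * Polygamma 1 (1 + 1 / lam) - 1) / lam ^ 3"


section \<open>Limit laws and modes of convergence\<close>

definition multivariate_normal :: "real ^ 'd \<Rightarrow> real ^ 'd ^ 'd \<Rightarrow> (real ^ 'd) measure" where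
  "multivariate_normal m C = density lborel (\<lambda>x. ennreal
     (exp (- ((x - m) \<bullet> (matrix_inv C *v (x - m))) / 2) / sqrt ((2 * pi) ^ CARD('d) * det C)))"

text \<open>The law of the squared norm of a bivariate normal vector with mean \<open>m\<close> and identity
  covariance depends on \<open>m\<close> only through its norm (rotation invariance), so a representative
  mean with squared norm \<open>\<xi> \<ge> 0\<close> is used.\<close>

definition noncentral_chi_square2 :: "real \<Rightarrow> real measure" where
  "noncentral_chi_square2 \<xi> =
     distr (multivariate_normal (vector [sqrt \<xi>, 0] :: real ^ 2) (mat 1)) borel (\<lambda>z. (norm z)\<^sup>2)"

text \<open>Measurability is part of the next two notions, since \<open>measure\<close> and the Bochner integral are
  \<open>0\<close> on non-measurable arguments. It is required only for large \<open>n\<close>.\<close>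

definition converges_in_probability ::
  "'a measure \<Rightarrow> (nat \<Rightarrow> 'a \<Rightarrow> real) \<Rightarrow> real \<Rightarrow> bool" where
  "converges_in_probability M Z c \<longleftrightarrow>
     (\<forall>\<^sub>F n in sequentially. Z n \<in> borel_measurable M) \<and>
     (\<forall>\<epsilon>>0. (\<lambda>n. measure M {\<omega> \<in> space M. \<bar>Z n \<omega> - c\<bar> > \<epsilon>}) \<longlonglongrightarrow> 0)"

definition converges_in_distribution ::
  "'a measure \<Rightarrow> (nat \<Rightarrow> 'a \<Rightarrow> 'b::metric_space) \<Rightarrow> 'b measure \<Rightarrow> bool" where
  "converges_in_distribution M Z N \<longleftrightarrow>
     (\<forall>\<^sub>F n in sequentially. Z n \<in> borel_measurable M) \<and>
     (\<forall>f :: 'b \<Rightarrow> real. continuous_on UNIV f \<and> bounded (range f) \<longrightarrow>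
        (\<lambda>n. \<integral>\<omega>. f (Z n \<omega>) \<partial>M) \<longlonglongrightarrow> (\<integral>z. f z \<partial>N))"

end

theory Submission
  imports Defs
begin

text \<open>
  After standardizing the observations, the law of a row has density proportional to
  \<open>exp (- (1 + b * sgn y) * \<bar>y\<bar> powr \<theta>2 / lam)\<close>, where \<open>sqrt n * b\<close> tends to \<open>2 * lam * \<delta>1\<close>. A first-order
  expansion of this density in \<open>b\<close> and \<open>\<theta>2 - lam\<close> gives the limits of \<open>sqrt n\<close> times the means of fixed
  functions; no contiguity argument is needed.

  The location estimate is the root of a monotone score, hence asymptotically linear. Expanding the
  empirical moments around it and around the scale estimate shows that \<open>sqrt n * S\<close> and
  \<open>sqrt n * (K - E_K)\<close> are, up to terms vanishing in probability, normalized sums of two influence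
  functions, one odd and one even. These are orthogonal, with variances \<open>V_S\<close> and \<open>V_K\<close>, and their
  covariances with the two directions of the alternative give the limiting means. The central limit
  theorem for characteristic functions and the continuity theorem in the plane yield the joint limit;
  the fourth root and the finite-sample corrections are absorbed by the delta method. The almost sure
  statement only requires that \<open>S\<close> almost surely does not vanish, which holds because the equation
  \<open>S = 0\<close> determines an extreme observation from the others.
\<close>

text \<open>The obstacle is the origin. For small exponents the moment functions have singular
  derivatives at 0, and for \<open>lam = 1\<close> the location score is the sign function, which
  has no Taylor expansion. Three devices deal with this: bounds against a weight with an integrable
  singularity of order 1/2; a Taylor remainder of order 5/4 instead of 2, still enough because
  \<open>sqrt n\<close> times the location error is bounded; and an expansion of the score only
  after averaging, where for \<open>lam = 1\<close> its increment at scale \<open>1 / sqrt n\<close>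
  is read off from the density near 0. The skewness of the kernel is \<open>tanh\<close> of half of
  \<theta>2 times the logit of \<theta>1, whose slope turns \<delta>1 into
  \<open>2 * lam * \<delta>1\<close>. The variance of each influence function equals its covariance
  with the moment function that it comes from, and this moment function is, up to the factor
  \<open>- 1 / lam\<close>, also a direction of the alternative. Hence the limiting means are
  multiples of standard deviations, with \<open>V1 lam = 4 * V_S lam\<close> and
  \<open>V2 lam = V_K lam / lam\<^sup>2\<close>. The second ratio converges because the limit law
  has no mass at 0.\<close>

section \<open>Convergence in probability as a filter\<close>

text \<open>Limits along this filter on pairs of a sample size and an outcome are limits in probability, so
  the general rules for limits replace the calculus of stochastic order symbols.\<close>

definition prob_filter :: "'a measure \<Rightarrow> (nat \<times> 'a) filter" where
  "prob_filter M = Abs_filter (\<lambda>P. \<forall>\<eta>>0. \<forall>\<^sub>F n in sequentially.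
     \<exists>A\<in>sets M. measure M A \<le> \<eta> \<and> (\<forall>\<omega>\<in>space M - A. P (n, \<omega>)))"

text \<open>Exceptional events are measurable sets while \<open>W\<close> is unrestricted: the
  statistics are known to be measurable only for large \<open>n\<close>, and remainder terms then
  need no measurability proof.\<close>

definition stoch_bounded :: "'a measure \<Rightarrow> (nat \<times> 'a \<Rightarrow> real) \<Rightarrow> bool" where
  "stoch_bounded M W \<longleftrightarrow> (\<forall>\<eta>>0. \<exists>K. \<forall>\<^sub>F n in sequentially.
     \<exists>A\<in>sets M. measure M A \<le> \<eta> \<and> (\<forall>\<omega>\<in>space M - A. \<bar>W (n, \<omega>)\<bar> \<le> K))"

lemma (in prob_space) small_exception_conj:
  assumes "\<exists>A\<in>sets M. measure M A \<le> a \<and> (\<forall>\<omega>\<in>space M - A. P \<omega>)"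
    and "\<exists>A\<in>sets M. measure M A \<le> b \<and> (\<forall>\<omega>\<in>space M - A. Q \<omega>)"
    and "\<And>\<omega>. P \<omega> \<Longrightarrow> Q \<omega> \<Longrightarrow> R \<omega>" and "a + b \<le> c"
  shows "\<exists>A\<in>sets M. measure M A \<le> c \<and> (\<forall>\<omega>\<in>space M - A. R \<omega>)"
proof -
  obtain A B where AB: "A \<in> sets M" "measure M A \<le> a" "\<forall>\<omega>\<in>space M - A. P \<omega>"
    "B \<in> sets M" "measure M B \<le> b" "\<forall>\<omega>\<in>space M - B. Q \<omega>"
    using assms(1,2) by blast
  have "measure M (A \<union> B) \<le> c"
    using AB assms(4) measure_Un_le[of A M B] by linarith
  with AB assms(3) show ?thesis
    by (intro bexI[of _ "A \<union> B"]) auto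
qed

lemma (in prob_space) eventually_prob_filter:
  "eventually P (prob_filter M) \<longleftrightarrow> (\<forall>\<eta>>0. \<forall>\<^sub>F n in sequentially.
     \<exists>A\<in>sets M. measure M A \<le> \<eta> \<and> (\<forall>\<omega>\<in>space M - A. P (n, \<omega>)))"
  unfolding prob_filter_def
proof (rule eventually_Abs_filter, unfold_locales, goal_cases)
  case 1
  show ?case by (intro allI impI always_eventually bexI[of _ "{}"]) auto
next
  case (2 P Q)
  show ?case
  proof (intro allI impI)
    fix \<eta> :: real assume "\<eta> > 0"
    then have "\<eta>/2 > 0" by simp
    with 2 have "\<forall>\<^sub>F n in sequentially. (\<exists>A\<in>sets M. measure M A \<le> \<eta>/2 \<and> (\<forall>\<omega>\<in>space M - A. P (n, \<omega>)))
      \<and> (\<exists>A\<in>sets M. measure M A \<le> \<eta>/2 \<and> (\<forall>\<omega>\<in>space M - A. Q (n, \<omega>)))"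
      using eventually_conj by blast
    then show "\<forall>\<^sub>F n in sequentially. \<exists>A\<in>sets M. measure M A \<le> \<eta> \<and> (\<forall>\<omega>\<in>space M - A. P (n, \<omega>) \<and> Q (n, \<omega>))"
    proof (rule eventually_mono, elim conjE)
      fix n
      assume "\<exists>A\<in>sets M. measure M A \<le> \<eta>/2 \<and> (\<forall>\<omega>\<in>space M - A. P (n, \<omega>))"
        "\<exists>A\<in>sets M. measure M A \<le> \<eta>/2 \<and> (\<forall>\<omega>\<in>space M - A. Q (n, \<omega>))"
      then show "\<exists>A\<in>sets M. measure M A \<le> \<eta> \<and> (\<forall>\<omega>\<in>space M - A. P (n, \<omega>) \<and> Q (n, \<omega>))"
        by (rule small_exception_conj) auto
    qed
  qed
next
  case (3 P Q)
  show ?case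
  proof (intro allI impI)
    fix \<eta> :: real assume "\<eta> > 0"
    with 3(2) have "\<forall>\<^sub>F n in sequentially. \<exists>A\<in>sets M. measure M A \<le> \<eta> \<and> (\<forall>\<omega>\<in>space M - A. P (n, \<omega>))"
      by blast
    then show "\<forall>\<^sub>F n in sequentially. \<exists>A\<in>sets M. measure M A \<le> \<eta> \<and> (\<forall>\<omega>\<in>space M - A. Q (n, \<omega>))"
      by (rule eventually_mono) (use 3(1) in blast)
  qed
qed

lemma (in prob_space) eventually_prob_filter_AE:
  assumes "\<forall>\<^sub>F n in sequentially. AE \<omega> in M. P (n, \<omega>)"
  shows "eventually P (prob_filter M)"
  unfolding eventually_prob_filter
proof (intro allI impI)
  fix \<eta> :: real assume "\<eta> > 0"
  show "\<forall>\<^sub>F n in sequentially. \<exists>A\<in>sets M. measure M A \<le> \<eta> \<and> (\<forall>\<omega>\<in>space M - A. P (n, \<omega>))"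
    using assms
  proof (rule eventually_mono)
    fix n assume "AE \<omega> in M. P (n, \<omega>)"
    then obtain N where "{\<omega>\<in>space M. \<not> P (n, \<omega>)} \<subseteq> N" "emeasure M N = 0" "N \<in> sets M"
      by (rule AE_E)
    then show "\<exists>A\<in>sets M. measure M A \<le> \<eta> \<and> (\<forall>\<omega>\<in>space M - A. P (n, \<omega>))"
      using \<open>\<eta> > 0\<close> by (intro bexI[of _ N]) (auto simp: measure_def)
  qed
qed

text \<open>Through this projection every deterministic limit in the sample size becomes a limit in
  probability.\<close>

lemma (in prob_space) filterlim_fst_prob_filter: "filterlim fst sequentially (prob_filter M)"
  unfolding filterlim_def le_filter_def eventually_filtermap
proof (intro allI impI)
  fix P :: "nat \<Rightarrow> bool" assume "eventually P sequentially"
  then show "\<forall>\<^sub>F x in prob_filter M. P (fst x)"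
    by (intro eventually_prob_filter_AE) (auto elim: eventually_mono)
qed

lemmas (in prob_space) tendsto_fst_prob_filter = filterlim_compose[OF _ filterlim_fst_prob_filter]

lemma (in prob_space) stoch_bounded_mono:
  assumes "stoch_bounded M V" "\<forall>\<^sub>F p in prob_filter M. \<bar>W p\<bar> \<le> c * \<bar>V p\<bar>" "c \<ge> 0"
  shows "stoch_bounded M W"
  unfolding stoch_bounded_def
proof (intro allI impI)
  fix \<eta> :: real assume "\<eta> > 0"
  then have "\<eta>/2 > 0" by simp
  then obtain K where K: "\<forall>\<^sub>F n in sequentially.
     \<exists>A\<in>sets M. measure M A \<le> \<eta>/2 \<and> (\<forall>\<omega>\<in>space M - A. \<bar>V (n, \<omega>)\<bar> \<le> K)"
    using assms(1) unfolding stoch_bounded_def by blast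
  have L: "\<forall>\<^sub>F n in sequentially.
     \<exists>A\<in>sets M. measure M A \<le> \<eta>/2 \<and> (\<forall>\<omega>\<in>space M - A. \<bar>W (n, \<omega>)\<bar> \<le> c * \<bar>V (n, \<omega>)\<bar>)"
    using assms(2) \<open>\<eta>/2 > 0\<close> unfolding eventually_prob_filter by blast
  have *: "\<bar>W (n, \<omega>)\<bar> \<le> c * K" if "\<bar>V (n, \<omega>)\<bar> \<le> K" "\<bar>W (n, \<omega>)\<bar> \<le> c * \<bar>V (n, \<omega>)\<bar>" for n \<omega>
    using that mult_left_mono[OF that(1) assms(3)] by linarith
  show "\<exists>K. \<forall>\<^sub>F n in sequentially.
     \<exists>A\<in>sets M. measure M A \<le> \<eta> \<and> (\<forall>\<omega>\<in>space M - A. \<bar>W (n, \<omega>)\<bar> \<le> K)"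
    by (intro exI[of _ "c*K"], rule eventually_elim2[OF K L])
       (rule small_exception_conj[where a="\<eta>/2" and b="\<eta>/2"], assumption, assumption, auto intro: *)
qed

lemma (in prob_space) stoch_bounded_binop:
  assumes "stoch_bounded M V" "stoch_bounded M W"
    and "\<And>a b x y. \<bar>x\<bar> \<le> a \<Longrightarrow> \<bar>y\<bar> \<le> b \<Longrightarrow> \<bar>f x y\<bar> \<le> g a b"
  shows "stoch_bounded M (\<lambda>p. f (V p) (W p))"
  unfolding stoch_bounded_def
proof (intro allI impI)
  fix \<eta> :: real assume "\<eta> > 0"
  then have "\<eta>/2 > 0" by simp
  then obtain K where K: "\<forall>\<^sub>F n in sequentially.
     \<exists>A\<in>sets M. measure M A \<le> \<eta>/2 \<and> (\<forall>\<omega>\<in>space M - A. \<bar>V (n, \<omega>)\<bar> \<le> K)"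
    using assms(1) unfolding stoch_bounded_def by blast
  obtain L where L: "\<forall>\<^sub>F n in sequentially.
     \<exists>A\<in>sets M. measure M A \<le> \<eta>/2 \<and> (\<forall>\<omega>\<in>space M - A. \<bar>W (n, \<omega>)\<bar> \<le> L)"
    using assms(2) \<open>\<eta>/2 > 0\<close> unfolding stoch_bounded_def by blast
  show "\<exists>K. \<forall>\<^sub>F n in sequentially.
     \<exists>A\<in>sets M. measure M A \<le> \<eta> \<and> (\<forall>\<omega>\<in>space M - A. \<bar>f (V (n, \<omega>)) (W (n, \<omega>))\<bar> \<le> K)"
    by (intro exI[of _ "g K L"], rule eventually_elim2[OF K L])
       (rule small_exception_conj[where a="\<eta>/2" and b="\<eta>/2"], assumption, assumption, auto intro: assms(3))
qed

lemma (in prob_space) stoch_bounded_add: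
  "stoch_bounded M V \<Longrightarrow> stoch_bounded M W \<Longrightarrow> stoch_bounded M (\<lambda>p. V p + W p)"
  by (rule stoch_bounded_binop[where f="(+)" and g="(+)"]) auto

lemma (in prob_space) stoch_bounded_mult:
  "stoch_bounded M V \<Longrightarrow> stoch_bounded M W \<Longrightarrow> stoch_bounded M (\<lambda>p. V p * W p)"
  by (rule stoch_bounded_binop[where f="(*)" and g="(*)"]) (auto simp: abs_mult intro!: mult_mono)

lemma (in prob_space) tendsto_imp_stoch_bounded:
  assumes "(W \<longlongrightarrow> c) (prob_filter M)"
  shows "stoch_bounded M W"
proof -
  have "\<forall>\<^sub>F p in prob_filter M. \<bar>W p\<bar> \<le> \<bar>c\<bar> + 1"
    using tendstoD[OF assms, of 1] by (auto simp: dist_real_def elim!: eventually_mono)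
  then show ?thesis
    unfolding stoch_bounded_def eventually_prob_filter by blast
qed

lemma (in prob_space) stoch_bounded_cmult:
  "stoch_bounded M W \<Longrightarrow> stoch_bounded M (\<lambda>p. c * W p)"
  by (rule stoch_bounded_mono[where c="\<bar>c\<bar>"]) (auto simp: abs_mult)

lemma (in prob_space) tendsto_0_mult_stoch_bounded:
  assumes "(W \<longlongrightarrow> 0) (prob_filter M)" "stoch_bounded M V"
  shows "((\<lambda>p. W p * V p) \<longlongrightarrow> 0) (prob_filter M)"
proof (rule tendstoI)
  fix e :: real assume "e > 0"
  show "\<forall>\<^sub>F p in prob_filter M. dist (W p * V p) 0 < e"
    unfolding eventually_prob_filter
  proof (intro allI impI)
    fix \<eta> :: real assume "\<eta> > 0"
    then have "\<eta>/2 > 0" by simp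
    then obtain K where K: "\<forall>\<^sub>F n in sequentially.
       \<exists>A\<in>sets M. measure M A \<le> \<eta>/2 \<and> (\<forall>\<omega>\<in>space M - A. \<bar>V (n, \<omega>)\<bar> \<le> K)"
      using assms(2) unfolding stoch_bounded_def by blast
    \<comment> \<open>\<open>K\<close> may be 0 or negative, hence the divisor
      \<open>\<bar>K\<bar> + 1\<close>.\<close>
    have "e / (\<bar>K\<bar> + 1) > 0" using \<open>e > 0\<close> by (intro divide_pos_pos) auto
    from tendstoD[OF assms(1) this] \<open>\<eta>/2 > 0\<close>
    have L: "\<forall>\<^sub>F n in sequentially. \<exists>A\<in>sets M. measure M A \<le> \<eta>/2 \<and>
        (\<forall>\<omega>\<in>space M - A. dist (W (n, \<omega>)) 0 < e / (\<bar>K\<bar> + 1))"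
      unfolding eventually_prob_filter by blast
    have "dist (w * v) 0 < e" if "\<bar>v\<bar> \<le> K" "dist w 0 < e / (\<bar>K\<bar> + 1)" for v w
    proof -
      have "\<bar>w\<bar> * \<bar>v\<bar> \<le> \<bar>w\<bar> * (\<bar>K\<bar> + 1)" using that by (intro mult_left_mono) auto
      also have "\<dots> < e" using that by (simp add: pos_less_divide_eq)
      finally show ?thesis by (simp add: abs_mult)
    qed
    then show "\<forall>\<^sub>F n in sequentially.
        \<exists>A\<in>sets M. measure M A \<le> \<eta> \<and> (\<forall>\<omega>\<in>space M - A. dist (W (n, \<omega>) * V (n, \<omega>)) 0 < e)"
      by (intro eventually_elim2[OF K L])
        (rule small_exception_conj[where a="\<eta>/2" and b="\<eta>/2"], assumption, assumption, auto)
  qed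
qed

section \<open>Moment bounds and bounded convergence along the filter\<close>

lemma (in prob_space) markov_exception:
  fixes U :: "'a \<Rightarrow> real"
  assumes "integrable M U" "\<And>\<omega>. 0 \<le> U \<omega>" "c > 0" "expectation U \<le> c * \<eta>"
  shows "\<exists>A\<in>sets M. measure M A \<le> \<eta> \<and> (\<forall>\<omega>\<in>space M - A. \<bar>U \<omega>\<bar> < c)"
proof (intro bexI[of _ "{\<omega>\<in>space M. c \<le> U \<omega>}"] conjI)
  show S: "{\<omega>\<in>space M. c \<le> U \<omega>} \<in> sets M"
    using assms(1) by measurable
  have "measure M {\<omega>\<in>space M. c \<le> U \<omega>} \<le> expectation U / c"
    using assms by (intro integral_Markov_inequality_measure[where A="{}"]) auto
  also have "\<dots> \<le> \<eta>" using assms by (simp add: divide_le_eq mult.commute)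
  finally show "measure M {\<omega>\<in>space M. c \<le> U \<omega>} \<le> \<eta>" .
qed (use assms(2) in auto)

lemma (in prob_space) markov_tendsto_0:
  fixes U :: "nat \<Rightarrow> 'a \<Rightarrow> real"
  assumes "\<forall>\<^sub>F n in sequentially. integrable M (U n)" "\<And>n \<omega>. 0 \<le> U n \<omega>"
    and "(\<lambda>n. expectation (U n)) \<longlonglongrightarrow> 0"
  shows "((\<lambda>p. U (fst p) (snd p)) \<longlongrightarrow> 0) (prob_filter M)"
proof (rule tendstoI)
  fix e :: real assume "e > 0"
  show "\<forall>\<^sub>F p in prob_filter M. dist (U (fst p) (snd p)) 0 < e"
    unfolding eventually_prob_filter
  proof (intro allI impI)
    fix \<eta> :: real assume "\<eta> > 0"
    then have "e * \<eta> > 0" using \<open>e > 0\<close> by simp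
    from order_tendstoD(2)[OF assms(3) this] assms(1)
    show "\<forall>\<^sub>F n in sequentially.
       \<exists>A\<in>sets M. measure M A \<le> \<eta> \<and> (\<forall>\<omega>\<in>space M - A. dist (U (fst (n, \<omega>)) (snd (n, \<omega>))) 0 < e)"
      by eventually_elim (use markov_exception[OF _ assms(2) \<open>e > 0\<close>] in auto)
  qed
qed

lemma (in prob_space) markov_stoch_bounded:
  fixes U :: "nat \<Rightarrow> 'a \<Rightarrow> real"
  assumes "\<forall>\<^sub>F n in sequentially. integrable M (U n)" "\<And>n \<omega>. 0 \<le> U n \<omega>"
    and "\<forall>\<^sub>F n in sequentially. expectation (U n) \<le> B"
  shows "stoch_bounded M (\<lambda>p. U (fst p) (snd p))"
  unfolding stoch_bounded_def
proof (intro allI impI)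
  fix \<eta> :: real assume "\<eta> > 0"
  define c where "c = (\<bar>B\<bar> + 1) / \<eta>"
  have c: "c > 0" "B \<le> c * \<eta>" using \<open>\<eta> > 0\<close> by (auto simp: c_def intro!: divide_pos_pos)
  have "\<forall>\<^sub>F n in sequentially.
     \<exists>A\<in>sets M. measure M A \<le> \<eta> \<and> (\<forall>\<omega>\<in>space M - A. \<bar>U n \<omega>\<bar> \<le> c)"
    using assms(1,3)
  proof eventually_elim
    case (elim n)
    then have "expectation (U n) \<le> c * \<eta>" using c by linarith
    from markov_exception[OF elim(1) assms(2) c(1) this] show ?case by force
  qed
  then show "\<exists>K. \<forall>\<^sub>F n in sequentially.
     \<exists>A\<in>sets M. measure M A \<le> \<eta> \<and> (\<forall>\<omega>\<in>space M - A. \<bar>U (fst (n, \<omega>)) (snd (n, \<omega>))\<bar> \<le> K)"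
    by auto
qed

lemma (in prob_space) tendsto_imp_converges_in_probability:
  assumes "((\<lambda>p. W (fst p) (snd p)) \<longlongrightarrow> c) (prob_filter M)"
    and "\<forall>\<^sub>F n in sequentially. W n \<in> borel_measurable M"
  shows "converges_in_probability M W c"
  unfolding converges_in_probability_def
proof (intro conjI allI impI assms(2))
  fix \<epsilon> :: real assume "\<epsilon> > 0"
  show "(\<lambda>n. measure M {\<omega> \<in> space M. \<bar>W n \<omega> - c\<bar> > \<epsilon>}) \<longlonglongrightarrow> 0"
  proof (rule tendstoI)
    fix e :: real assume "e > 0"
    then have "e/2 > 0" by simp
    from tendstoD[OF assms(1) \<open>\<epsilon> > 0\<close>] this
    have "\<forall>\<^sub>F n in sequentially. \<exists>A\<in>sets M. measure M A \<le> e/2 \<and>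
        (\<forall>\<omega>\<in>space M - A. dist (W n \<omega>) c < \<epsilon>)"
      unfolding eventually_prob_filter fst_conv snd_conv by blast
    then show "\<forall>\<^sub>F n in sequentially. dist (measure M {\<omega> \<in> space M. \<bar>W n \<omega> - c\<bar> > \<epsilon>}) 0 < e"
    proof (rule eventually_mono)
      fix n assume "\<exists>A\<in>sets M. measure M A \<le> e/2 \<and> (\<forall>\<omega>\<in>space M - A. dist (W n \<omega>) c < \<epsilon>)"
      then obtain A where A: "A \<in> sets M" "measure M A \<le> e/2" "\<forall>\<omega>\<in>space M - A. dist (W n \<omega>) c < \<epsilon>"
        by blast
      have "measure M {\<omega> \<in> space M. \<bar>W n \<omega> - c\<bar> > \<epsilon>} \<le> measure M A"
        using A by (intro finite_measure_mono) (auto simp: dist_real_def, force)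
      then show "dist (measure M {\<omega> \<in> space M. \<bar>W n \<omega> - c\<bar> > \<epsilon>}) 0 < e"
        using A \<open>e > 0\<close> by simp
    qed
  qed
qed

text \<open>Bounded convergence: off an exceptional event of small probability the integrand is
  small, and on it the uniform bound \<open>B\<close> suffices.\<close>

lemma (in prob_space) expectation_tendsto_0:
  fixes h :: "nat \<times> 'a \<Rightarrow> 'b::{banach,second_countable_topology}"
  assumes "(h \<longlongrightarrow> 0) (prob_filter M)" "\<And>p. norm (h p) \<le> B"
    and "\<forall>\<^sub>F n in sequentially. (\<lambda>\<omega>. h (n, \<omega>)) \<in> borel_measurable M"
  shows "(\<lambda>n. \<integral>\<omega>. h (n, \<omega>) \<partial>M) \<longlonglongrightarrow> 0"
proof (rule tendstoI)
  fix e :: real assume "e > 0"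
  have B: "B \<ge> 0" using order_trans[OF norm_ge_zero assms(2)] by auto
  define \<eta> where "\<eta> = e / (4 * (B + 1))"
  have \<eta>: "\<eta> > 0" "B * \<eta> \<le> e/4" using \<open>e > 0\<close> B by (auto simp: \<eta>_def field_simps)
  have "e/4 > 0" using \<open>e > 0\<close> by simp
  from tendstoD[OF assms(1) this] \<eta>(1)
  have "\<forall>\<^sub>F n in sequentially. \<exists>A\<in>sets M. measure M A \<le> \<eta> \<and> (\<forall>\<omega>\<in>space M - A. norm (h (n, \<omega>)) < e/4)"
    unfolding eventually_prob_filter by simp
  with assms(3) show "\<forall>\<^sub>F n in sequentially. dist (\<integral>\<omega>. h (n, \<omega>) \<partial>M) 0 < e"
  proof eventually_elim
    case (elim n)
    then obtain A where A: "A \<in> sets M" "measure M A \<le> \<eta>" "\<forall>\<omega>\<in>space M - A. norm (h (n, \<omega>)) < e/4"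
      by blast
    have int: "integrable M (\<lambda>\<omega>. h (n, \<omega>))"
      using elim(1) assms(2) by (intro integrable_const_bound[where B=B]) auto
    have "norm (\<integral>\<omega>. h (n, \<omega>) \<partial>M) \<le> (\<integral>\<omega>. norm (h (n, \<omega>)) \<partial>M)"
      by (rule integral_norm_bound)
    also have "\<dots> \<le> (\<integral>\<omega>. e/4 + B * indicator A \<omega> \<partial>M)"
    proof (rule integral_mono)
      show "integrable M (\<lambda>\<omega>. e/4 + B * indicator A \<omega>)"
        using A by (intro Bochner_Integration.integrable_add integrable_const
            integrable_mult_right) (simp add: less_top[symmetric])
      show "norm (h (n, \<omega>)) \<le> e/4 + B * indicator A \<omega>" if "\<omega> \<in> space M" for \<omega>
        using A(3) that assms(2)[of "(n, \<omega>)"] \<open>e > 0\<close>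
        by (cases "\<omega> \<in> A") (auto simp: less_imp_le)
    qed (use int in simp)
    also have "\<dots> = e/4 + B * measure M A"
      using A by (subst Bochner_Integration.integral_add)
        (auto simp: prob_space less_top[symmetric])
    also have "\<dots> \<le> e/4 + B * \<eta>" using A B by (intro add_left_mono mult_left_mono) auto
    also have "\<dots> < e" using \<eta> \<open>e > 0\<close> by simp
    finally show ?case by simp
  qed
qed

text \<open>Caratheodory's form of differentiability: the slope extends continuously to
  \<open>a\<close>, so points with \<open>W p = a\<close> need no separate treatment.\<close>

lemma tendsto_slope:
  fixes f :: "real \<Rightarrow> real"
  assumes "(f has_real_derivative D) (at a)" "(W \<longlongrightarrow> a) F"
  obtains s where "(s \<longlongrightarrow> D) F" "\<And>p. f (W p) - f a = s p * (W p - a)"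
proof -
  obtain g where g: "\<forall>z. f z - f a = g z * (z - a)" "isCont g a" "g a = D"
    using assms(1) unfolding CARAT_DERIV by blast
  have "((\<lambda>p. g (W p)) \<longlongrightarrow> D) F"
    using isCont_tendsto_compose[OF g(2) assms(2)] g(3) by simp
  with g(1) that show thesis by blast
qed

lemma delta_tendsto:
  fixes f :: "real \<Rightarrow> real"
  assumes "(f has_real_derivative D) (at a)" "(W \<longlongrightarrow> a) F" "((\<lambda>p. r p * (W p - a)) \<longlongrightarrow> d) F"
  shows "((\<lambda>p. r p * (f (W p) - f a)) \<longlongrightarrow> D * d) F"
proof -
  obtain s where s: "(s \<longlongrightarrow> D) F" "\<And>p. f (W p) - f a = s p * (W p - a)"
    using tendsto_slope[OF assms(1,2)] by metis
  have "((\<lambda>p. s p * (r p * (W p - a))) \<longlongrightarrow> D * d) F"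
    by (intro tendsto_mult s assms)
  then show ?thesis by (simp add: s(2) mult.left_commute)
qed

text \<open>Tightness replaces a limit law in the hypothesis, so the linearization is available
  before any central limit theorem.\<close>

lemma (in prob_space) delta_method:
  fixes f :: "real \<Rightarrow> real"
  assumes "(f has_real_derivative D) (at a)" "(W \<longlongrightarrow> a) (prob_filter M)"
    and "stoch_bounded M (\<lambda>p. r p * (W p - a))"
  shows "((\<lambda>p. r p * (f (W p) - f a) - D * (r p * (W p - a))) \<longlongrightarrow> 0) (prob_filter M)"
proof -
  obtain s where s: "(s \<longlongrightarrow> D) (prob_filter M)" "\<And>p. f (W p) - f a = s p * (W p - a)"
    using tendsto_slope[OF assms(1,2)] by metis
  have "((\<lambda>p. s p - D) \<longlongrightarrow> 0) (prob_filter M)"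
    using s(1) by (simp add: LIM_zero_iff)
  from tendsto_0_mult_stoch_bounded[OF this assms(3)]
  show ?thesis by (simp add: s(2) algebra_simps)
qed

section \<open>Levy continuity in the plane\<close>

text \<open>The span of the characters, on which convergence of expectations follows from that of
  characteristic functions by linearity alone. Complex coefficients put sines and cosines into the
  class, which makes it an algebra with enough real members.\<close>

inductive trig_poly :: "('b::real_inner \<Rightarrow> complex) \<Rightarrow> bool" where
  trig_poly_iexp: "trig_poly (\<lambda>z. iexp (t \<bullet> z))"
| trig_poly_add: "trig_poly f \<Longrightarrow> trig_poly g \<Longrightarrow> trig_poly (\<lambda>z. f z + g z)"
| trig_poly_cmult: "trig_poly f \<Longrightarrow> trig_poly (\<lambda>z. c * f z)"

lemma trig_poly_const: "trig_poly (\<lambda>z. c)"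
  using trig_poly_cmult[OF trig_poly_iexp[of 0], of c] by simp

lemma trig_poly_mult:
  assumes "trig_poly f" "trig_poly g"
  shows "trig_poly (\<lambda>z. f z * g z)"
  using assms
proof (induction f rule: trig_poly.induct)
  case (trig_poly_iexp t)
  then show ?case
  proof (induction g rule: trig_poly.induct)
    case (trig_poly_iexp s)
    have "(\<lambda>z. iexp (t \<bullet> z) * iexp (s \<bullet> z)) = (\<lambda>z. iexp ((t + s) \<bullet> z))"
      by (simp add: exp_add[symmetric] inner_add_left ring_distribs)
    then show ?case by (simp add: trig_poly.trig_poly_iexp)
  qed (auto simp: ring_distribs mult.left_commute intro: trig_poly.intros)
qed (auto simp: ring_distribs mult.assoc intro: trig_poly.intros)

lemma trig_poly_cos_sin:
  "trig_poly (\<lambda>z. complex_of_real (cos (t \<bullet> z)))" "trig_poly (\<lambda>z. complex_of_real (sin (t \<bullet> z)))"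
proof -
  have "trig_poly (\<lambda>z. 1/2 * (iexp (t \<bullet> z) + iexp ((-t) \<bullet> z)))"
    by (intro trig_poly.intros)
  moreover have "(\<lambda>z. 1/2 * (iexp (t \<bullet> z) + iexp ((-t) \<bullet> z))) = (\<lambda>z. complex_of_real (cos (t \<bullet> z)))"
    by (simp add: cos_exp_eq cos_of_real[symmetric])
  ultimately show "trig_poly (\<lambda>z. complex_of_real (cos (t \<bullet> z)))" by simp
  have "trig_poly (\<lambda>z. (- \<i>/2) * (iexp (t \<bullet> z) + (-1) * iexp ((-t) \<bullet> z)))"
    by (intro trig_poly.intros)
  moreover have "(\<lambda>z. (- \<i>/2) * (iexp (t \<bullet> z) + (-1) * iexp ((-t) \<bullet> z)))
      = (\<lambda>z. complex_of_real (sin (t \<bullet> z)))"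
    by (simp add: sin_exp_eq sin_of_real[symmetric] complex_eq_iff Re_divide Im_divide
        power2_eq_square fun_eq_iff)
  ultimately show "trig_poly (\<lambda>z. complex_of_real (sin (t \<bullet> z)))" by simp
qed

lemma trig_poly_continuous: "trig_poly f \<Longrightarrow> continuous_on UNIV f"
  by (induction rule: trig_poly.induct) (auto intro!: continuous_intros)

lemma trig_poly_bounded: "trig_poly f \<Longrightarrow> \<exists>B. \<forall>z. norm (f z) \<le> B"
proof (induction rule: trig_poly.induct)
  case (trig_poly_iexp t)
  show ?case by (intro exI[of _ 1]) simp
next
  case (trig_poly_add f g)
  then obtain B C where "\<forall>z. norm (f z) \<le> B" "\<forall>z. norm (g z) \<le> C" by blast
  then show ?case
    by (intro exI[of _ "B + C"]) (meson add_mono norm_triangle_ineq order_trans)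
next
  case (trig_poly_cmult f c)
  then obtain B where "\<forall>z. norm (f z) \<le> B" by blast
  then show ?case
    by (intro exI[of _ "norm c * B"]) (auto simp: norm_mult intro: mult_left_mono)
qed

lemma (in prob_space) trig_poly_integral_conv:
  fixes Z :: "nat \<Rightarrow> 'a \<Rightarrow> 'b::euclidean_space"
  assumes "trig_poly f" and N: "prob_space N" "sets N = sets borel"
    and Z: "\<forall>\<^sub>F n in sequentially. Z n \<in> borel_measurable M"
    and char: "\<And>t. (\<lambda>n. \<integral>\<omega>. iexp (t \<bullet> Z n \<omega>) \<partial>M) \<longlonglongrightarrow> (\<integral>z. iexp (t \<bullet> z) \<partial>N)"
  shows "(\<lambda>n. \<integral>\<omega>. f (Z n \<omega>) \<partial>M) \<longlonglongrightarrow> (\<integral>z. f z \<partial>N)"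
proof -
  interpret N: prob_space N by fact
  have intN: "integrable N g" if g: "trig_poly g" for g :: "'b \<Rightarrow> complex"
  proof -
    obtain B where "\<forall>z. norm (g z) \<le> B" using trig_poly_bounded[OF g] by blast
    moreover have "g \<in> borel_measurable N"
      using borel_measurable_continuous_onI[OF trig_poly_continuous[OF g]] N(2)
      by (simp cong: measurable_cong_sets)
    ultimately show ?thesis by (intro N.integrable_const_bound[of _ B]) auto
  qed
  have intM: "\<forall>\<^sub>F n in sequentially. integrable M (\<lambda>\<omega>. g (Z n \<omega>))"
    if g: "trig_poly g" for g :: "'b \<Rightarrow> complex"
    using Z
  proof (rule eventually_mono)
    fix n assume [measurable]: "Z n \<in> borel_measurable M"
    obtain B where B: "\<forall>z. norm (g z) \<le> B" using trig_poly_bounded[OF g] by blast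
    have [measurable]: "g \<in> borel_measurable borel"
      using borel_measurable_continuous_onI[OF trig_poly_continuous[OF g]] .
    show "integrable M (\<lambda>\<omega>. g (Z n \<omega>))" using B by (intro integrable_const_bound[of _ B]) auto
  qed
  show ?thesis using assms(1)
  proof (induction rule: trig_poly.induct)
    case (trig_poly_iexp t)
    show ?case by (rule char)
  next
    case (trig_poly_add f g)
    have "\<forall>\<^sub>F n in sequentially. (\<integral>\<omega>. f (Z n \<omega>) \<partial>M) + (\<integral>\<omega>. g (Z n \<omega>) \<partial>M)
        = (\<integral>\<omega>. f (Z n \<omega>) + g (Z n \<omega>) \<partial>M)"
      using intM[OF trig_poly_add(1)] intM[OF trig_poly_add(2)] by eventually_elim simp
    then show ?case
      using tendsto_add[OF trig_poly_add(3,4)] intN[OF trig_poly_add(1)] intN[OF trig_poly_add(2)]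
      by (simp add: filterlim_cong[OF refl refl, symmetric])
  next
    case (trig_poly_cmult f c)
    then show ?case by (simp add: tendsto_mult_left)
  qed
qed

lemma cis_Ln: "\<bar>x\<bar> < pi \<Longrightarrow> Im (Ln (cis x)) = x"
  by (simp add: cis_conv_exp)

text \<open>A continuous function vanishing off a small ball lives on the torus, where it is a uniform
  limit of polynomials in the coordinates, that is, of trigonometric polynomials.\<close>

lemma trig_poly_approx:
  fixes h :: "real^2 \<Rightarrow> real"
  assumes h: "continuous_on UNIV h" and B: "\<And>z. \<bar>h z\<bar> \<le> B" and L: "L > 0"
    and supp: "\<And>z. norm z \<ge> L/2 \<Longrightarrow> h z = 0" and e: "e > 0"
  obtains p where "trig_poly (\<lambda>z. complex_of_real (p z))" "\<And>z. \<bar>p z\<bar> \<le> B + e"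
    "\<And>z. norm z < L \<Longrightarrow> \<bar>h z - p z\<bar> \<le> e"
proof -
  define T :: "(complex \<times> complex) set" where "T = sphere 0 1 \<times> sphere 0 1"
  \<comment> \<open>Reads the two angles back from the unit circles and rescales them. Where both
    coordinates of \<open>z\<close> are below \<open>L\<close> in modulus this inverts
    \<open>E\<close>, so that \<open>\<Phi> (E z) = h z\<close>.\<close>
  define \<Phi> where "\<Phi> = (\<lambda>w::complex\<times>complex. h (vector [L * Im (Ln (fst w)) / pi, L * Im (Ln (snd w)) / pi]))"
  define E where "E = (\<lambda>z::real^2. (cis (pi * z$1 / L), cis (pi * z$2 / L)))"
  \<comment> \<open>The algebra for the Stone-Weierstrass theorem: functions that become
    trigonometric polynomials when pulled back along \<open>E\<close>.\<close>
  define P where "P = (\<lambda>q::complex\<times>complex \<Rightarrow> real. continuous_on UNIV q \<and>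
     trig_poly (\<lambda>z. complex_of_real (q (E z))))"
  have comp_norm: "\<bar>x\<bar> \<le> norm (vector [x, y] :: real^2)" "\<bar>y\<bar> \<le> norm (vector [x, y] :: real^2)" for x y :: real
    using component_le_norm_cart[of "vector [x,y] :: real^2" 1]
      component_le_norm_cart[of "vector [x,y] :: real^2" 2] by simp_all
  have vec_cont: "continuous_on S (\<lambda>w. vector [f w, g w] :: real^2)"
    if "continuous_on S f" "continuous_on S g" for S and f g :: "complex\<times>complex \<Rightarrow> real"
  proof -
    have "(\<lambda>w. vector [f w, g w] :: real^2) = (\<lambda>w. \<chi> i. if i = 1 then f w else g w)"
      by (auto simp: vec_eq_iff forall_2)
    moreover have "continuous_on S (\<lambda>w. if i = 1 then f w else g w)" for i :: 2
      using that by (cases "i = 1") auto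
    ultimately show ?thesis by (simp only: continuous_on_vec_lambda)
  qed
  \<comment> \<open>On \<open>U\<close> both principal logarithms are continuous. On
    \<open>V\<close> some angle exceeds a right angle, so the argument of \<open>h\<close> has norm
    at least \<open>L/2\<close> and \<open>\<Phi>\<close> is 0. The two sets cover the torus, since
    a nonpositive real number of modulus 1 is -1.\<close>
  define U where "U = {w::complex\<times>complex. fst w \<notin> \<real>\<^sub>\<le>\<^sub>0 \<and> snd w \<notin> \<real>\<^sub>\<le>\<^sub>0}"
  define V where "V = {w::complex\<times>complex. Re (fst w) < 0 \<or> Re (snd w) < 0}"
  have "closed {z::complex. z \<in> \<real>\<^sub>\<le>\<^sub>0}" using closed_nonpos_Reals_complex by simp
  then have "closed (fst -` {z::complex. z \<in> \<real>\<^sub>\<le>\<^sub>0} :: (complex\<times>complex) set)"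
      "closed (snd -` {z::complex. z \<in> \<real>\<^sub>\<le>\<^sub>0} :: (complex\<times>complex) set)"
    by (auto intro!: continuous_closed_vimage continuous_intros)
  then have "open (- (fst -` {z::complex. z \<in> \<real>\<^sub>\<le>\<^sub>0}) \<inter> - (snd -` {z::complex. z \<in> \<real>\<^sub>\<le>\<^sub>0}) :: (complex\<times>complex) set)"
    by auto
  moreover have "U = - (fst -` {z::complex. z \<in> \<real>\<^sub>\<le>\<^sub>0}) \<inter> - (snd -` {z::complex. z \<in> \<real>\<^sub>\<le>\<^sub>0})"
    by (auto simp: U_def)
  ultimately have "open U" by simp
  have "open V"
    unfolding V_def by (intro open_Collect_disj open_Collect_less continuous_intros)
  have "continuous_on U \<Phi>"
  proof -
    have "continuous_on U (\<lambda>w. Im (Ln (fst w)))" "continuous_on U (\<lambda>w. Im (Ln (snd w)))"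
      by (auto simp: U_def intro!: continuous_intros)
    then have "continuous_on U (\<lambda>w. vector [L * Im (Ln (fst w)) / pi, L * Im (Ln (snd w)) / pi] :: real^2)"
      by (intro vec_cont) (auto intro!: continuous_intros)
    then show ?thesis
      unfolding \<Phi>_def by (rule continuous_on_compose2[OF h]) auto
  qed
  moreover have "continuous_on V \<Phi>"
  proof -
    have "\<Phi> w = 0" if "w \<in> V" for w
    proof -
      have big: "\<bar>L * Im (Ln z) / pi\<bar> \<ge> L/2" if "Re z < 0" for z
      proof -
        have "z \<noteq> 0" using that by auto
        then have "\<bar>Im (Ln z)\<bar> > pi/2" using Re_Ln_pos_le[of z] that by auto
        then show ?thesis using L by (simp add: abs_mult field_simps)
      qed
      have "norm (vector [L * Im (Ln (fst w)) / pi, L * Im (Ln (snd w)) / pi] :: real^2) \<ge> L/2"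
        using that big comp_norm unfolding V_def by (metis (mono_tags, lifting) mem_Collect_eq order_trans)
      then show ?thesis unfolding \<Phi>_def by (rule supp)
    qed
    then show ?thesis by (metis (mono_tags, lifting) continuous_on_cong continuous_on_const)
  qed
  ultimately have "continuous_on (U \<union> V) \<Phi>"
    using \<open>open U\<close> \<open>open V\<close> by (intro continuous_on_open_Un)
  moreover have "T \<subseteq> U \<union> V"
    by (auto simp: T_def U_def V_def complex_nonpos_Reals_iff complex_eq_iff)
       (auto simp: cmod_def complex_eq_iff less_eq_real_def)
  ultimately have \<Phi>: "continuous_on T \<Phi>" by (rule continuous_on_subset)
  have "\<exists>q. P q \<and> (\<forall>w\<in>T. \<bar>\<Phi> w - q w\<bar> < e)"
  proof (rule Stone_Weierstrass_HOL[where P=P and S=T])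
    show "compact T" unfolding T_def by (intro compact_Times) auto
    show "P (\<lambda>x. c)" for c by (simp add: P_def trig_poly_const)
    show "continuous_on T f" if "P f" for f
      using that unfolding P_def by (meson continuous_on_subset top_greatest)
    show "P (\<lambda>x. f x + g x)" if "P f \<and> P g" for f g
      using that trig_poly_add[of "\<lambda>z. complex_of_real (f (E z))" "\<lambda>z. complex_of_real (g (E z))"]
      unfolding P_def by (auto intro!: continuous_intros)
    show "P (\<lambda>x. f x * g x)" if "P f \<and> P g" for f g
      using that trig_poly_mult[of "\<lambda>z. complex_of_real (f (E z))" "\<lambda>z. complex_of_real (g (E z))"]
      unfolding P_def by (auto intro!: continuous_intros)
    show "\<exists>f. P f \<and> f x \<noteq> f y" if xy: "x \<in> T \<and> y \<in> T \<and> x \<noteq> y" for x y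
    proof -
      have ax: "(axis k (pi/L) :: real^2) \<bullet> z = pi * z$k / L" for k z
        by (simp add: inner_axis' )
      have "P (\<lambda>w. Re (fst w))" "P (\<lambda>w. Re (snd w))" "P (\<lambda>w. Im (fst w))" "P (\<lambda>w. Im (snd w))"
        using trig_poly_cos_sin[of "axis 1 (pi/L) :: real^2"] trig_poly_cos_sin[of "axis 2 (pi/L) :: real^2"]
        unfolding P_def E_def by (auto simp: ax intro!: continuous_intros)
      moreover have "Re (fst x) \<noteq> Re (fst y) \<or> Im (fst x) \<noteq> Im (fst y) \<or>
          Re (snd x) \<noteq> Re (snd y) \<or> Im (snd x) \<noteq> Im (snd y)"
        using xy by (auto simp: prod_eq_iff complex_eq_iff)
      ultimately show ?thesis by blast
    qed
  qed (use \<Phi> e in auto)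
  then obtain q where q: "P q" "\<And>w. w \<in> T \<Longrightarrow> \<bar>\<Phi> w - q w\<bar> < e" by blast
  have ET: "E z \<in> T" for z by (simp add: E_def T_def)
  show thesis
  proof (rule that[of "\<lambda>z. q (E z)"])
    show "trig_poly (\<lambda>z. complex_of_real (q (E z)))" using q(1) by (simp add: P_def)
    \<comment> \<open>\<open>E z\<close> lies on the torus for every \<open>z\<close>, so this bound
      persists far outside the ball, where the polynomial is periodic and no longer close to
      \<open>h\<close>.\<close>
    show "\<bar>q (E z)\<bar> \<le> B + e" for z
      using q(2)[OF ET, of z] B[of "vector [L * Im (Ln (fst (E z))) / pi, L * Im (Ln (snd (E z))) / pi]"]
      unfolding \<Phi>_def by linarith
    show "\<bar>h z - q (E z)\<bar> \<le> e" if "norm z < L" for z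
    proof -
      have "\<bar>z$i\<bar> < L" for i using component_le_norm_cart[of z i] that by linarith
      then have "\<bar>pi * z$i / L\<bar> < pi" for i using L by (simp add: abs_mult field_simps)
      then have "\<Phi> (E z) = h (vector [z$1, z$2])"
        using L unfolding \<Phi>_def E_def by (simp add: cis_Ln)
      also have "vector [z$1, z$2] = z" by (simp add: vec_eq_iff forall_2)
      finally show ?thesis using q(2)[OF ET, of z] by simp
    qed
  qed
qed

lemma (in prob_space) integral_close_off_exception:
  fixes f g :: "'a \<Rightarrow> real"
  assumes [measurable]: "f \<in> borel_measurable M" "g \<in> borel_measurable M" "A \<in> sets M"
    and f: "\<And>\<omega>. \<omega> \<in> space M \<Longrightarrow> \<bar>f \<omega>\<bar> \<le> B" and g: "\<And>\<omega>. \<omega> \<in> space M \<Longrightarrow> \<bar>g \<omega>\<bar> \<le> C"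
    and e: "\<And>\<omega>. \<omega> \<in> space M - A \<Longrightarrow> \<bar>f \<omega> - g \<omega>\<bar> \<le> e" and "e \<ge> 0" "B + C \<ge> 0"
  shows "\<bar>(\<integral>\<omega>. f \<omega> \<partial>M) - (\<integral>\<omega>. g \<omega> \<partial>M)\<bar> \<le> e + (B + C) * measure M A"
proof -
  have int: "integrable M f" "integrable M g"
    using integrable_const_bound[of f B] integrable_const_bound[of g C] f g by auto
  then have "\<bar>(\<integral>\<omega>. f \<omega> \<partial>M) - (\<integral>\<omega>. g \<omega> \<partial>M)\<bar> = \<bar>\<integral>\<omega>. f \<omega> - g \<omega> \<partial>M\<bar>"
    by simp
  also have "\<dots> \<le> (\<integral>\<omega>. \<bar>f \<omega> - g \<omega>\<bar> \<partial>M)"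
    by (rule integral_abs_bound)
  also have "\<dots> \<le> (\<integral>\<omega>. e + (B + C) * indicator A \<omega> \<partial>M)"
  proof (rule integral_mono)
    show "integrable M (\<lambda>\<omega>. e + (B + C) * indicator A \<omega>)"
      by (intro Bochner_Integration.integrable_add integrable_const integrable_mult_right)
         (simp add: less_top[symmetric])
    show "\<bar>f \<omega> - g \<omega>\<bar> \<le> e + (B + C) * indicator A \<omega>" if "\<omega> \<in> space M" for \<omega>
    proof (cases "\<omega> \<in> A")
      case True
      then show ?thesis using f[OF that] g[OF that] assms(7) by (simp add: abs_if split: if_splits)
    qed (use e that in auto)
  qed (use int in simp)
  also have "\<dots> = e + (B + C) * measure M A"
    by (subst Bochner_Integration.integral_add) (auto simp: prob_space less_top[symmetric])
  finally show ?thesis .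
qed

text \<open>A cutoff makes \<open>f\<close> compactly supported, a trigonometric polynomial
  approximates it on a large ball and stays bounded elsewhere, and tightness of the sequence and of
  \<open>N\<close> controls the rest. Tightness is a hypothesis because the statistics are
  stochastically bounded by their expansions, so it need not be extracted from the characteristic
  functions.\<close>

theorem (in prob_space) bivariate_levy_continuity:
  fixes Z :: "nat \<Rightarrow> 'a \<Rightarrow> real^2" and f :: "real^2 \<Rightarrow> real"
  assumes N: "prob_space N" "sets N = sets borel"
    and Z: "\<forall>\<^sub>F n in sequentially. Z n \<in> borel_measurable M"
    and char: "\<And>t. (\<lambda>n. \<integral>\<omega>. iexp (t \<bullet> Z n \<omega>) \<partial>M) \<longlonglongrightarrow> (\<integral>z. iexp (t \<bullet> z) \<partial>N)"
    and tight: "stoch_bounded M (\<lambda>p. norm (Z (fst p) (snd p)))"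
    and f: "continuous_on UNIV f" "bounded (range f)"
  shows "(\<lambda>n. \<integral>\<omega>. f (Z n \<omega>) \<partial>M) \<longlonglongrightarrow> (\<integral>z. f z \<partial>N)"
proof (rule tendstoI)
  fix \<epsilon> :: real assume "\<epsilon> > 0"
  interpret N: prob_space N by fact
  obtain B where B: "\<And>z. \<bar>f z\<bar> \<le> B" using f(2) unfolding bounded_iff by auto
  have B0: "B \<ge> 0" using B[of 0] by linarith
  \<comment> \<open>The three errors below add up to
    \<open>3 * e + 4 * (B * e) + 2 * (e * e)\<close>, which is at most
    \<open>8 * (B + 1) * e\<close> when \<open>e \<le> 1\<close>.\<close>
  define e where "e = min 1 (\<epsilon> / (8 * (B + 1)))"
  have e: "0 < e" "e \<le> 1" "8 * (B + 1) * e \<le> \<epsilon>"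
  proof -
    have "e \<le> \<epsilon> / (8 * (B + 1))" by (simp add: e_def)
    then show "8 * (B + 1) * e \<le> \<epsilon>" using B0 by (simp add: pos_le_divide_eq mult.commute)
  qed (use \<open>\<epsilon> > 0\<close> B0 in \<open>auto simp: e_def\<close>)
  obtain K1 where K1: "\<forall>\<^sub>F n in sequentially.
     \<exists>A\<in>sets M. measure M A \<le> e \<and> (\<forall>\<omega>\<in>space M - A. \<bar>norm (Z n \<omega>)\<bar> \<le> K1)"
    using tight e(1) unfolding stoch_bounded_def by auto
  have [measurable]: "f \<in> borel_measurable borel"
    by (rule borel_measurable_continuous_onI[OF f(1)])
  have measN: "(\<lambda>z. norm z) \<in> borel_measurable N"
    using N(2) by (simp cong: measurable_cong_sets)
  have "(\<lambda>n. measure N {z\<in>space N. real n < norm z}) \<longlonglongrightarrow> measure N (\<Inter>n. {z\<in>space N. real n < norm z})"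
    by (rule N.finite_Lim_measure_decseq) (use measN in \<open>auto simp: decseq_def\<close>)
  moreover have "(\<Inter>n. {z\<in>space N. real n < norm z}) = {}"
    by auto (metis less_asym reals_Archimedean2)
  ultimately have "(\<lambda>n. measure N {z\<in>space N. real n < norm z}) \<longlonglongrightarrow> 0" by simp
  from order_tendstoD(2)[OF this e(1)]
  obtain K2 where K2: "measure N {z\<in>space N. real K2 < norm z} < e"
    unfolding eventually_sequentially by blast
  define K where "K = 1 + max \<bar>K1\<bar> (real K2)"
  have K: "K > 0" "K > K1" "K > K2" by (auto simp: K_def)
  \<comment> \<open>Equal to 1 up to norm \<open>K\<close> and 0 from \<open>2 * K\<close> on, which
    is half of the radius \<open>4 * K\<close> handed to the approximation.\<close>
  define ch where "ch = (\<lambda>z::real^2. max 0 (min 1 (2 - norm z / K)))"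
  have chi: "0 \<le> ch z" "ch z \<le> 1" "norm z \<le> K \<Longrightarrow> ch z = 1" "norm z \<ge> 2 * K \<Longrightarrow> ch z = 0" for z
    using K by (auto simp: ch_def field_simps max_def min_def)
  define h where "h = (\<lambda>z. ch z * f z)"
  have "continuous_on UNIV h"
    unfolding h_def ch_def using K(1) by (intro continuous_intros f(1)) auto
  moreover have "\<bar>h z\<bar> \<le> B" for z
    using mult_mono[OF chi(2)[of z] B[of z]] chi(1)[of z] by (simp add: h_def abs_mult)
  moreover have "h z = 0" if "norm z \<ge> 4 * K / 2" for z
    using chi(4)[of z] that by (simp add: h_def)
  ultimately obtain p where p: "trig_poly (\<lambda>z. complex_of_real (p z))" "\<And>z. \<bar>p z\<bar> \<le> B + e"
    "\<And>z. norm z < 4 * K \<Longrightarrow> \<bar>h z - p z\<bar> \<le> e"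
    using trig_poly_approx[of h B "4*K" e] K(1) e(1) by (metis mult_pos_pos zero_less_numeral)
  have fp: "\<bar>f z - p z\<bar> \<le> e" if "norm z \<le> K" for z
    using p(3)[of z] chi(3)[OF that] that K(1) by (simp add: h_def)
  have [measurable]: "p \<in> borel_measurable borel"
  proof -
    have "(\<lambda>z. complex_of_real (p z)) \<in> borel_measurable borel"
      by (rule borel_measurable_continuous_onI[OF trig_poly_continuous[OF p(1)]])
    from measurable_compose[OF this borel_measurable_Re] show ?thesis by simp
  qed
  have "(\<lambda>n. \<integral>\<omega>. complex_of_real (p (Z n \<omega>)) \<partial>M) \<longlonglongrightarrow> (\<integral>z. complex_of_real (p z) \<partial>N)"
    by (rule trig_poly_integral_conv[OF p(1) N Z char])
  then have pconv: "(\<lambda>n. \<integral>\<omega>. p (Z n \<omega>) \<partial>M) \<longlonglongrightarrow> (\<integral>z. p z \<partial>N)"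
    by (simp add: tendsto_of_real_iff)
  have "\<bar>(\<integral>z. f z \<partial>N) - (\<integral>z. p z \<partial>N)\<bar> \<le> e + (B + (B + e)) * measure N {z\<in>space N. real K2 < norm z}"
    using measN N(2) B p(2) K B0 e
    by (intro N.integral_close_off_exception fp) (auto cong: measurable_cong_sets)
  also have "\<dots> \<le> e + (B + (B + e)) * e" using K2 B0 e by (intro add_left_mono mult_left_mono) auto
  finally have Nb: "\<bar>(\<integral>z. f z \<partial>N) - (\<integral>z. p z \<partial>N)\<bar> \<le> e + (B + (B + e)) * e" .
  have "\<forall>\<^sub>F n in sequentially. dist (\<integral>\<omega>. p (Z n \<omega>) \<partial>M) (\<integral>z. p z \<partial>N) < e"
    using tendstoD[OF pconv e(1)] .
  with Z K1 show "\<forall>\<^sub>F n in sequentially. dist (\<integral>\<omega>. f (Z n \<omega>) \<partial>M) (\<integral>z. f z \<partial>N) < \<epsilon>"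
  proof eventually_elim
    case (elim n)
    then obtain A where A: "A \<in> sets M" "measure M A \<le> e" "\<forall>\<omega>\<in>space M - A. \<bar>norm (Z n \<omega>)\<bar> \<le> K1"
      by blast
    note [measurable] = elim(1)
    have "\<bar>(\<integral>\<omega>. f (Z n \<omega>) \<partial>M) - (\<integral>\<omega>. p (Z n \<omega>) \<partial>M)\<bar> \<le> e + (B + (B + e)) * measure M A"
      using A(1,3) B p(2) K B0 e
      by (intro integral_close_off_exception fp) (auto intro: order_trans less_imp_le)
    also have "\<dots> \<le> e + (B + (B + e)) * e" using A(2) B0 e by (intro add_left_mono mult_left_mono) auto
    finally have Mb: "\<bar>(\<integral>\<omega>. f (Z n \<omega>) \<partial>M) - (\<integral>\<omega>. p (Z n \<omega>) \<partial>M)\<bar> \<le> e + (B + (B + e)) * e" .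
    have "\<bar>(\<integral>\<omega>. f (Z n \<omega>) \<partial>M) - (\<integral>z. f z \<partial>N)\<bar> < e + 2 * (e + (B + (B + e)) * e)"
    proof -
      have "\<bar>x - z\<bar> < e + 2 * d" if "\<bar>x - y\<bar> \<le> d" "\<bar>z - w\<bar> \<le> d" "\<bar>y - w\<bar> < e" for x y z w d :: real
        using that by linarith
      with Nb elim(3) show ?thesis using Mb unfolding dist_real_def by blast
    qed
    also have "\<dots> \<le> 8 * (B + 1) * e"
    proof -
      have "e * e \<le> e" using e by (simp add: mult_left_le)
      moreover have "B * e \<ge> 0" using B0 e(1) by simp
      moreover have "e + 2 * (e + (B + (B + e)) * e) = 3 * e + 4 * (B * e) + 2 * (e * e)"
        "8 * (B + 1) * e = 8 * (B * e) + 8 * e"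
        by (simp_all add: algebra_simps)
      ultimately show ?thesis using e(1) by linarith
    qed
    also have "\<dots> \<le> \<epsilon>" by (rule e(3))
    finally show ?case by (simp add: dist_real_def)
  qed
qed

section \<open>Normal laws and a triangular central limit theorem\<close>

lemma char_normal_density:
  "(\<integral>x. normal_density m 1 x *\<^sub>R iexp (s * x) \<partial>lborel) = iexp (s * m) * exp (- s\<^sup>2 / 2)"
proof -
  have "(\<integral>x. normal_density m 1 x *\<^sub>R iexp (s * x) \<partial>lborel)
      = (\<integral>x. iexp (s * m) * (std_normal_density x *\<^sub>R iexp (s * x)) \<partial>lborel)"
  proof -
    have "normal_density m 1 (m + 1 * x) *\<^sub>R iexp (s * (m + 1 * x))
        = iexp (s * m) * (std_normal_density x *\<^sub>R iexp (s * x))" for x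
    proof -
      have "iexp (s * (m + 1 * x)) = iexp (s * m) * iexp (s * x)"
        by (simp add: exp_add[symmetric] ring_distribs)
      then show ?thesis by (simp only: normal_density_def scaleR_conv_of_real) simp
    qed
    then show ?thesis
      by (subst lborel_integral_real_affine[where c=1 and t=m]) (simp_all only: abs_one scaleR_one)
  qed
  also have "\<dots> = iexp (s * m) * char std_normal_distribution s"
    unfolding char_def
    by (subst integral_density) (auto simp flip: mult_scaleR_right)
  also have "\<dots> = iexp (s * m) * exp (- s\<^sup>2 / 2)"
    by (simp add: char_std_normal_distribution exp_of_real[symmetric])
  finally show ?thesis .
qed

text \<open>With identity covariance the density splits over the basis, so that total mass and
  characteristic function can be computed by Fubini's theorem.\<close>

lemma multivariate_normal_identity:
  fixes m :: "real^'d"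
  shows "multivariate_normal m (mat 1)
    = density lborel (\<lambda>x. ennreal (\<Prod>b\<in>Basis. normal_density (m \<bullet> b) 1 (x \<bullet> b)))"
proof -
  have inv: "matrix_inv (mat 1) = (mat 1 :: real^'d^'d)"
    unfolding matrix_inv_def by (rule some_equality) auto
  have "exp (- ((x - m) \<bullet> (x - m)) / 2) / sqrt ((2 * pi) ^ CARD('d))
      = (\<Prod>b\<in>Basis. normal_density (m \<bullet> b) 1 (x \<bullet> b))" for x :: "real^'d"
  proof -
    have "(\<Prod>b\<in>(Basis::(real^'d) set). normal_density (m \<bullet> b) 1 (x \<bullet> b))
        = (\<Prod>b\<in>(Basis::(real^'d) set). exp (- (x \<bullet> b - m \<bullet> b)\<^sup>2 / 2) / sqrt (2 * pi))"
      by (simp add: normal_density_def)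
    also have "\<dots> = exp (\<Sum>b\<in>(Basis::(real^'d) set). - (x \<bullet> b - m \<bullet> b)\<^sup>2 / 2) / sqrt (2 * pi) ^ DIM(real^'d)"
      by (simp add: prod_dividef exp_sum)
    also have "(\<Sum>b\<in>(Basis::(real^'d) set). - (x \<bullet> b - m \<bullet> b)\<^sup>2 / 2) = - ((x - m) \<bullet> (x - m)) / 2"
      by (subst (3) euclidean_inner)
         (simp add: inner_diff_left power2_eq_square sum_divide_distrib[symmetric] sum_negf)
    also have "sqrt (2 * pi) ^ DIM(real^'d) = sqrt ((2 * pi) ^ CARD('d))"
      by (simp only: real_sqrt_power DIM_cart DIM_real mult_1_right)
    finally show ?thesis by simp
  qed
  then show ?thesis
    unfolding multivariate_normal_def inv by simp
qed

lemma sets_multivariate_normal [simp]: "sets (multivariate_normal m C) = sets borel"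
  by (simp add: multivariate_normal_def)

lemma prob_space_multivariate_normal: "prob_space (multivariate_normal (m :: real^'d) (mat 1))"
proof
  have "emeasure (multivariate_normal m (mat 1)) UNIV
      = (\<integral>\<^sup>+x. (\<Prod>b\<in>Basis. ennreal (normal_density (m \<bullet> b) 1 (x \<bullet> b))) \<partial>lborel)"
    unfolding multivariate_normal_identity
    by (subst emeasure_density) (auto simp: prod_ennreal normal_density_nonneg)
  also have "\<dots> = (\<Prod>b\<in>(Basis :: (real^'d) set). (\<integral>\<^sup>+x. ennreal (normal_density (m \<bullet> b) 1 x) \<partial>lborel))"
    by (rule nn_integral_lborel_prod) auto
  also have "\<dots> = 1"
    by (simp add: nn_integral_eq_integral normal_density_nonneg)
  finally show "emeasure (multivariate_normal m (mat 1)) (space (multivariate_normal m (mat 1))) = 1"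
    by (simp add: multivariate_normal_def)
qed

lemma char_multivariate_normal:
  fixes m :: "real^'d"
  shows "(\<integral>z. iexp (t \<bullet> z) \<partial>multivariate_normal m (mat 1)) = iexp (t \<bullet> m) * exp (- (norm t)\<^sup>2 / 2)"
proof -
  interpret product_sigma_finite "\<lambda>b::real^'d. lborel :: real measure"
    by unfold_locales
  have "(\<integral>z. iexp (t \<bullet> z) \<partial>multivariate_normal m (mat 1))
      = (\<integral>z. (\<Prod>b\<in>Basis. normal_density (m \<bullet> b) 1 (z \<bullet> b)) *\<^sub>R iexp (t \<bullet> z) \<partial>lborel)"
    unfolding multivariate_normal_identity
    by (subst integral_density) (auto intro!: prod_nonneg normal_density_nonneg)
  also have "\<dots> = (\<integral>z. (\<Prod>b\<in>(Basis::(real^'d) set). normal_density (m \<bullet> b) 1 (z \<bullet> b) *\<^sub>R iexp ((t \<bullet> b) * (z \<bullet> b))) \<partial>lborel)"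
  proof (intro Bochner_Integration.integral_cong refl)
    fix z
    have "iexp (t \<bullet> z) = (\<Prod>b\<in>(Basis::(real^'d) set). iexp ((t \<bullet> b) * (z \<bullet> b)))"
      by (subst euclidean_inner) (simp add: exp_sum[symmetric] sum_distrib_left)
    then show "(\<Prod>b\<in>Basis. normal_density (m \<bullet> b) 1 (z \<bullet> b)) *\<^sub>R iexp (t \<bullet> z) =
        (\<Prod>b\<in>Basis. normal_density (m \<bullet> b) 1 (z \<bullet> b) *\<^sub>R iexp ((t \<bullet> b) * (z \<bullet> b)))"
      by (simp add: scaleR_conv_of_real prod.distrib)
  qed
  also have "\<dots> = (\<integral>f. (\<Prod>b\<in>(Basis::(real^'d) set). normal_density (m \<bullet> b) 1 (f b) *\<^sub>R iexp ((t \<bullet> b) * f b))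
      \<partial>(\<Pi>\<^sub>M b\<in>(Basis::(real^'d) set). lborel))"
    by (subst lborel_eq, subst integral_distr)
       (auto intro!: Bochner_Integration.integral_cong prod.cong)
  also have "\<dots> = (\<Prod>b\<in>(Basis::(real^'d) set). \<integral>x. normal_density (m \<bullet> b) 1 x *\<^sub>R iexp ((t \<bullet> b) * x) \<partial>lborel)"
  proof (rule product_integral_prod)
    show "integrable lborel (\<lambda>x. normal_density (m \<bullet> b) 1 x *\<^sub>R iexp ((t \<bullet> b) * x))" for b
      by (rule Bochner_Integration.integrable_bound[OF integrable_normal_density[of 1 "m \<bullet> b"]]) auto
  qed simp
  also have "\<dots> = (\<Prod>b\<in>(Basis::(real^'d) set). iexp ((t \<bullet> b) * (m \<bullet> b)) * exp (- (t \<bullet> b)\<^sup>2 / 2))"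
    by (simp only: char_normal_density)
  also have "\<dots> = iexp (\<Sum>b\<in>(Basis::(real^'d) set). (t \<bullet> b) * (m \<bullet> b)) *
      exp (complex_of_real (\<Sum>b\<in>(Basis::(real^'d) set). - (t \<bullet> b)\<^sup>2 / 2))"
    by (simp only: prod.distrib of_real_sum sum_distrib_left exp_sum[OF finite_Basis] exp_of_real)
  also have "(\<Sum>b\<in>(Basis::(real^'d) set). (t \<bullet> b) * (m \<bullet> b)) = t \<bullet> m"
    by (subst (3) euclidean_inner) simp
  also have "(\<Sum>b\<in>(Basis::(real^'d) set). - (t \<bullet> b)\<^sup>2 / 2) = - (norm t)\<^sup>2 / 2"
    unfolding power2_norm_eq_inner
    by (subst euclidean_inner[of t t])
       (simp add: power2_eq_square sum_negf sum_divide_distrib[symmetric])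
  finally show ?thesis by (simp only: exp_of_real)
qed

text \<open>A rotation \<open>Q\<close> carries \<open>m\<close> to \<open>m'\<close>. The image law
  and the target have the same characteristic function, and the continuity theorem applied to the
  constant sequence \<open>Q\<close> turns this into equality of integrals.\<close>

lemma multivariate_normal_norm_invariant:
  fixes m m' :: "real^2" and f :: "real \<Rightarrow> real"
  assumes m: "norm m = norm m'" and f: "continuous_on UNIV f" "bounded (range f)"
  shows "(\<integral>z. f ((norm z)\<^sup>2) \<partial>multivariate_normal m (mat 1))
    = (\<integral>z. f ((norm z)\<^sup>2) \<partial>multivariate_normal m' (mat 1))"
proof -
  interpret prob_space "multivariate_normal m (mat 1)" by (rule prob_space_multivariate_normal)
  obtain Q where Q: "orthogonal_transformation Q" "Q m = m'"
    using orthogonal_transformation_exists[OF m] by blast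
  have nQ: "norm (Q z) = norm z" for z using Q(1) by (rule orthogonal_transformation_norm)
  have "continuous_on UNIV Q"
    using Q(1) by (intro linear_continuous_on linear_conv_bounded_linear[THEN iffD1])
      (simp add: orthogonal_transformation_linear)
  then have meas: "Q \<in> borel_measurable (multivariate_normal m (mat 1))"
    using borel_measurable_continuous_onI[of Q] by (simp cong: measurable_cong_sets)
  have "(\<lambda>n::nat. \<integral>\<omega>. f ((norm (Q \<omega>))\<^sup>2) \<partial>multivariate_normal m (mat 1))
      \<longlonglongrightarrow> (\<integral>z. f ((norm z)\<^sup>2) \<partial>multivariate_normal m' (mat 1))"
  proof (rule bivariate_levy_continuity)
    show "(\<lambda>n::nat. \<integral>\<omega>. iexp (t \<bullet> Q \<omega>) \<partial>multivariate_normal m (mat 1))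
        \<longlonglongrightarrow> (\<integral>z. iexp (t \<bullet> z) \<partial>multivariate_normal m' (mat 1))" for t
    proof -
      obtain s where s: "t = Q s"
        using orthogonal_transformation_surj[OF Q(1)] by (metis surjD)
      have "Q s \<bullet> Q z = s \<bullet> z" for z
        using Q(1) by (simp add: orthogonal_transformation_def)
      then show ?thesis
        using Q(2) by (simp add: s char_multivariate_normal nQ) (metis tendsto_const)
    qed
    show "stoch_bounded (multivariate_normal m (mat 1)) (\<lambda>p. norm (Q (snd p)))"
      unfolding stoch_bounded_def
    proof (intro allI impI)
      fix \<eta> :: real assume \<eta>: "\<eta> > 0"
      let ?N = "multivariate_normal m (mat 1)"
      have measN: "(\<lambda>z. norm z) \<in> borel_measurable ?N"
        by (simp cong: measurable_cong_sets)
      have "(\<lambda>n. measure ?N {z\<in>space ?N. real n < norm z}) \<longlonglongrightarrow> measure ?N (\<Inter>n. {z\<in>space ?N. real n < norm z})"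
      proof (rule finite_Lim_measure_decseq)
        have "{z\<in>space ?N. real n < norm z} \<in> sets ?N" for n using measN by measurable
        then show "range (\<lambda>n. {z\<in>space ?N. real n < norm z}) \<subseteq> sets ?N" by blast
      qed (auto simp: decseq_def)
      moreover have "(\<Inter>n. {z\<in>space ?N. real n < norm z}) = {}"
        by auto (metis less_asym reals_Archimedean2)
      ultimately have "(\<lambda>n. measure ?N {z\<in>space ?N. real n < norm z}) \<longlonglongrightarrow> 0" by simp
      from order_tendstoD(2)[OF this \<eta>]
      obtain k where k: "measure ?N {z\<in>space ?N. real k < norm z} < \<eta>"
        unfolding eventually_sequentially by blast
      have "{z\<in>space ?N. real k < norm z} \<in> sets ?N" using measN by measurable
      then show "\<exists>K. \<forall>\<^sub>F n in sequentially. \<exists>A\<in>sets ?N. measure ?N A \<le> \<eta> \<and>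
         (\<forall>\<omega>\<in>space ?N - A. \<bar>norm (Q (snd (n, \<omega>)))\<bar> \<le> K)"
        by (intro exI[of _ "real k"] always_eventually allI
            bexI[of _ "{z\<in>space ?N. real k < norm z}"])
           (use k measN in \<open>auto simp: nQ\<close>)
    qed
    show "continuous_on UNIV (\<lambda>z::real^2. f ((norm z)\<^sup>2))"
      by (intro continuous_on_compose2[OF f(1)] continuous_intros) auto
    show "bounded (range (\<lambda>z::real^2. f ((norm z)\<^sup>2)))"
      by (rule bounded_subset[OF f(2)]) auto
  qed (use meas prob_space_multivariate_normal in auto)
  then show ?thesis by (simp add: nQ LIMSEQ_const_iff)
qed

text \<open>No complex logarithm of \<open>c n\<close> is taken: \<open>c n ^ n\<close> is compared
  with the \<open>n\<close>-th power of \<open>exp (z / n)\<close>, and for factors of modulus at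
  most 1 the powers differ by at most \<open>n\<close> times the difference of the bases. The sign
  of \<open>Re z\<close> keeps the exponential in the unit disc.\<close>

lemma power_limit_exp:
  fixes c :: "nat \<Rightarrow> complex"
  assumes c: "\<forall>\<^sub>F n in sequentially. norm (c n) \<le> 1"
    and lim: "(\<lambda>n. of_nat n * (c n - 1)) \<longlonglongrightarrow> z" and z: "Re z \<le> 0"
  shows "(\<lambda>n. c n ^ n) \<longlonglongrightarrow> exp z"
proof -
  have "((\<lambda>h::complex. (exp (h * z) - 1) / h) \<longlongrightarrow> z) (at 0)"
  proof -
    have "((\<lambda>h. exp (h * z)) has_field_derivative z) (at 0)"
      by (auto intro!: derivative_eq_intros)
    then show ?thesis by (simp add: has_field_derivative_iff)
  qed
  moreover have "filterlim (\<lambda>n. 1 / of_nat n :: complex) (at 0) sequentially"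
    unfolding filterlim_at
    by (auto intro!: lim_1_over_n eventually_sequentiallyI[of 1])
  ultimately have "(\<lambda>n. (exp (1 / of_nat n * z) - 1) / (1 / of_nat n)) \<longlonglongrightarrow> z"
    by (rule filterlim_compose)
  then have "(\<lambda>n. of_nat n * (exp (z / of_nat n) - 1)) \<longlonglongrightarrow> z"
    by (simp add: mult.commute)
  from tendsto_diff[OF lim this]
  have "(\<lambda>n. of_nat n * (c n - exp (z / of_nat n))) \<longlonglongrightarrow> 0"
    by (simp add: algebra_simps)
  then have "(\<lambda>n. norm (of_nat n * (c n - exp (z / of_nat n)))) \<longlonglongrightarrow> 0"
    by (rule tendsto_norm_zero)
  then have "(\<lambda>n. c n ^ n - exp (z / of_nat n) ^ n) \<longlonglongrightarrow> 0"
  proof (rule Lim_null_comparison[rotated])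
    show "\<forall>\<^sub>F n in sequentially. norm (c n ^ n - exp (z / of_nat n) ^ n)
        \<le> norm (of_nat n * (c n - exp (z / of_nat n)))"
      using c
    proof eventually_elim
      case (elim n)
      have "norm (exp (z / of_nat n)) \<le> 1"
        using z by (simp add: Re_divide_of_nat divide_nonpos_nonneg)
      from norm_power_diff[OF elim this, of n] show ?case by (simp add: norm_mult)
    qed
  qed
  then have "(\<lambda>n. c n ^ n - exp z) \<longlonglongrightarrow> 0"
  proof (rule Lim_transform_eventually)
    show "\<forall>\<^sub>F n in sequentially. c n ^ n - exp (z / of_nat n) ^ n = c n ^ n - exp z"
      using eventually_gt_at_top[of 0]
    proof eventually_elim
      case (elim n)
      have "exp (z / of_nat n) ^ n = exp (of_nat n * (z / of_nat n))"
        by (rule exp_of_nat_mult[symmetric])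
      also have "of_nat n * (z / of_nat n) = z" using elim by simp
      finally show ?case by simp
    qed
  qed
  then show ?thesis by (rule LIM_zero_cancel)
qed

text \<open>The characteristic function of a row sum is the \<open>n\<close>-th power of that of one
  summand, whose second-order expansion leaves, after multiplication by \<open>n\<close>, a
  remainder of at most \<open>B / 6 / sqrt n\<close> by the third moments. Means of order
  \<open>1 / sqrt n\<close> survive as the shift \<open>m\<close>, while their squares vanish, so
  \<open>v\<close> may be the limit of uncentred second moments.\<close>

theorem (in prob_space) triangular_clt_char:
  fixes Y :: "nat \<Rightarrow> nat \<Rightarrow> 'a \<Rightarrow> real" and g :: "real \<Rightarrow> real" and Q :: "nat \<Rightarrow> real measure"
  assumes indep: "\<forall>\<^sub>F n in sequentially. indep_vars (\<lambda>_. borel) (Y n) {..<n}"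
    and distr: "\<forall>\<^sub>F n in sequentially. \<forall>i<n. distr M borel (Y n i) = Q n"
    and g[measurable]: "g \<in> borel_measurable borel"
    and int: "\<forall>\<^sub>F n in sequentially. integrable (Q n) (\<lambda>y. \<bar>g y\<bar> ^ 3) \<and> (\<integral>y. \<bar>g y\<bar> ^ 3 \<partial>Q n) \<le> B"
    and mean: "(\<lambda>n. sqrt (real n) * (\<integral>y. g y \<partial>Q n)) \<longlonglongrightarrow> m"
    and var: "(\<lambda>n. \<integral>y. (g y)\<^sup>2 \<partial>Q n) \<longlonglongrightarrow> v"
  shows "(\<lambda>n. \<integral>\<omega>. iexp ((\<Sum>i<n. g (Y n i \<omega>)) / sqrt (real n)) \<partial>M) \<longlonglongrightarrow> exp (\<i> * m - v / 2)"
proof -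
  define c where "c n = (\<integral>y. iexp (g y / sqrt (real n)) \<partial>Q n)" for n
  have Q: "\<forall>\<^sub>F n in sequentially. n > 0 \<and> prob_space (Q n) \<and> sets (Q n) = sets borel"
    using indep distr eventually_gt_at_top[of 0]
  proof eventually_elim
    case (elim n)
    then have "Y n 0 \<in> borel_measurable M" "distr M borel (Y n 0) = Q n"
      unfolding indep_vars_def by auto
    then have "prob_space (Q n)" "sets (Q n) = sets borel"
      using prob_space_distr[of "Y n 0" borel] sets_distr[of M borel "Y n 0"] by metis+
    with elim show ?case by blast
  qed
  have v0: "v \<ge> 0"
    by (rule tendsto_lowerbound[OF var]) (auto intro!: always_eventually)
  have "(\<lambda>n. of_nat n * (c n - 1) - (\<i> * (sqrt (real n) * (\<integral>y. g y \<partial>Q n)) - (\<integral>y. (g y)\<^sup>2 \<partial>Q n) / 2)) \<longlonglongrightarrow> 0"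
  proof (rule Lim_null_comparison)
    show "(\<lambda>n. B / 6 / sqrt (real n)) \<longlonglongrightarrow> 0"
      by (intro tendsto_divide_0[OF tendsto_const] filterlim_at_top_imp_at_infinity
          filterlim_compose[OF sqrt_at_top filterlim_real_sequentially])
    show "\<forall>\<^sub>F n in sequentially. norm (of_nat n * (c n - 1) -
        (\<i> * (sqrt (real n) * (\<integral>y. g y \<partial>Q n)) - (\<integral>y. (g y)\<^sup>2 \<partial>Q n) / 2)) \<le> B / 6 / sqrt (real n)"
      using Q int
    proof eventually_elim
      case (elim n)
      interpret Q: prob_space "Q n" using elim by blast
      have [measurable_cong]: "sets (Q n) = sets borel" using elim by blast
      have n: "n > 0" and i3: "integrable (Q n) (\<lambda>y. \<bar>g y\<bar> ^ 3)" using elim by auto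
      have p: "x \<le> 1 + x ^ 3" "x\<^sup>2 \<le> 1 + x ^ 3" if "x \<ge> 0" for x :: real
      proof -
        have x3: "x ^ 3 \<ge> 0" using that by simp
        have "x\<^sup>2 \<le> max 1 (x ^ 3)"
          using that power_increasing[of 2 3 x] power_le_one[of x 2] by (cases "x \<le> 1") auto
        with x3 show "x\<^sup>2 \<le> 1 + x ^ 3" by linarith
        have "x \<le> max 1 (x ^ 3)"
          using power_increasing[of 1 3 x] by (cases "x \<le> 1") auto
        with x3 show "x \<le> 1 + x ^ 3" by linarith
      qed
      have i1: "integrable (Q n) g" and i2: "integrable (Q n) (\<lambda>y. (g y)\<^sup>2)"
        by (rule Bochner_Integration.integrable_bound[of _ "\<lambda>y. 1 + \<bar>g y\<bar> ^ 3"],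
            use i3 p[of "\<bar>g _\<bar>"] in \<open>auto intro!: AE_I2\<close>)+
      let ?s = "sqrt (real n)"
      let ?e = "\<lambda>y. iexp (g y / ?s) - (1 + \<i> * (g y / ?s) - (g y / ?s)\<^sup>2 / 2)"
      have ie: "integrable (Q n) (\<lambda>y. iexp (g y / ?s))"
        by (rule Q.integrable_const_bound[of _ 1]) auto
      have iE: "integrable (Q n) ?e"
        using i1 i2 ie
        by (intro Bochner_Integration.integrable_diff Bochner_Integration.integrable_add
            integrable_mult_right integrable_of_real Q.integrable_const) (auto simp: power_divide)
      have eq: "of_nat n * (c n - 1) - (\<i> * (?s * (\<integral>y. g y \<partial>Q n)) - (\<integral>y. (g y)\<^sup>2 \<partial>Q n) / 2)
          = of_nat n * (\<integral>y. ?e y \<partial>Q n)"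
      proof -
        have "(\<integral>y. ?e y \<partial>Q n) = c n - (1 + \<i> * ((\<integral>y. g y \<partial>Q n) / ?s) - (\<integral>y. (g y)\<^sup>2 \<partial>Q n) / real n / 2)"
        proof -
          have ig: "integrable (Q n) (\<lambda>y. complex_of_real (g y / ?s))"
            "integrable (Q n) (\<lambda>y. complex_of_real ((g y / ?s)\<^sup>2 / 2))"
            using i1 i2 by (auto intro!: integrable_of_real simp: power_divide simp del: of_real_divide of_real_power)
          have "(\<integral>y. ?e y \<partial>Q n) = (\<integral>y. iexp (g y / ?s) \<partial>Q n) - ((\<integral>y. 1 \<partial>Q n) +
              \<i> * (\<integral>y. complex_of_real (g y / ?s) \<partial>Q n) - (\<integral>y. complex_of_real ((g y / ?s)\<^sup>2 / 2) \<partial>Q n))"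
            using ie ig
            by (simp only: Bochner_Integration.integral_diff Bochner_Integration.integral_add
                Bochner_Integration.integrable_diff Bochner_Integration.integrable_add
                integrable_mult_right integral_mult_right_zero Q.integrable_const)
          moreover have "(\<integral>y. (g y / ?s)\<^sup>2 / 2 \<partial>Q n) = (\<integral>y. (g y)\<^sup>2 \<partial>Q n) / real n / 2"
            by (simp add: power_divide)
          moreover have "(\<integral>y. g y / ?s \<partial>Q n) = (\<integral>y. g y \<partial>Q n) / ?s"
            by simp
          moreover have "(\<integral>y. 1 \<partial>Q n) = (1 :: complex)" by (simp add: Q.prob_space)
          ultimately show ?thesis unfolding c_def by (simp only: integral_complex_of_real)
        qed
        moreover have "complex_of_real (real n) = complex_of_real ?s * complex_of_real ?s"
          using n by (simp flip: of_real_mult)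
        moreover have "complex_of_real ?s \<noteq> 0" using n by simp
        ultimately show ?thesis by (simp only: of_real_divide of_real_of_nat_eq) (simp add: field_simps)
      qed
      have "norm (of_nat n * (\<integral>y. ?e y \<partial>Q n)) \<le> real n * (\<integral>y. norm (?e y) \<partial>Q n)"
        by (simp add: norm_mult mult_left_mono)
      also have "\<dots> \<le> real n * (\<integral>y. \<bar>g y\<bar> ^ 3 / (6 * ?s ^ 3) \<partial>Q n)"
      proof (intro mult_left_mono integral_mono integrable_norm iE)
        fix y
        show "norm (?e y) \<le> \<bar>g y\<bar> ^ 3 / (6 * ?s ^ 3)"
        proof -
          have taylor: "norm (iexp x - (1 + \<i> * x - x\<^sup>2 / 2)) \<le> \<bar>x\<bar> ^ 3 / 6" for x :: real
          proof -
            have "(\<Sum>k\<le>2. (\<i> * complex_of_real x) ^ k / fact k) = 1 + \<i> * x - x\<^sup>2 / 2"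
              by (simp add: numeral_2_eq_2 algebra_simps)
            then show ?thesis using iexp_approx1[of x 2] by (simp add: fact_numeral)
          qed
          show ?thesis
            using taylor[of "g y / ?s"] by (simp only: power_divide abs_divide abs_of_nonneg
                real_sqrt_ge_zero of_nat_0_le_iff) (simp add: mult.commute)
        qed
      qed (use i3 in auto)
      also have "\<dots> = (\<integral>y. \<bar>g y\<bar> ^ 3 \<partial>Q n) / 6 / ?s"
        using n by (simp add: power3_eq_cube field_simps)
      also have "\<dots> \<le> B / 6 / ?s" using elim by (intro divide_right_mono) auto
      finally show ?case unfolding eq .
    qed
  qed
  moreover have "(\<lambda>n. \<i> * (sqrt (real n) * (\<integral>y. g y \<partial>Q n)) - (\<integral>y. (g y)\<^sup>2 \<partial>Q n) / 2 :: complex)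
      \<longlonglongrightarrow> \<i> * m - v / 2"
    by (intro tendsto_intros) (use mean var in \<open>auto simp flip: of_real_mult intro!: tendsto_of_real\<close>)
  ultimately have "(\<lambda>n. of_nat n * (c n - 1)) \<longlonglongrightarrow> \<i> * m - v / 2"
    using tendsto_add by fastforce
  moreover have "\<forall>\<^sub>F n in sequentially. norm (c n) \<le> 1"
    using Q
  proof eventually_elim
    case (elim n)
    interpret Q: prob_space "Q n" using elim by blast
    have "norm (c n) \<le> (\<integral>y. norm (iexp (g y / sqrt (real n))) \<partial>Q n)"
      unfolding c_def by (rule integral_norm_bound)
    then show ?case by (simp add: Q.prob_space)
  qed
  ultimately have "(\<lambda>n. c n ^ n) \<longlonglongrightarrow> exp (\<i> * m - v / 2)"
    using v0 by (intro power_limit_exp) auto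
  then show ?thesis
  proof (rule Lim_transform_eventually)
    show "\<forall>\<^sub>F n in sequentially. c n ^ n = (\<integral>\<omega>. iexp ((\<Sum>i<n. g (Y n i \<omega>)) / sqrt (real n)) \<partial>M)"
      using indep distr Q
    proof eventually_elim
      case (elim n)
      have [measurable]: "Y n i \<in> borel_measurable M" if "i < n" for i
        using elim(1) that unfolding indep_vars_def by auto
      have "(\<integral>\<omega>. iexp ((\<Sum>i<n. g (Y n i \<omega>)) / sqrt (real n)) \<partial>M)
          = (\<integral>\<omega>. (\<Prod>i<n. iexp (g (Y n i \<omega>) / sqrt (real n))) \<partial>M)"
        by (simp add: exp_sum[symmetric] sum_distrib_left sum_divide_distrib)
      also have "\<dots> = (\<Prod>i<n. \<integral>\<omega>. iexp (g (Y n i \<omega>) / sqrt (real n)) \<partial>M)"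
      proof (rule indep_vars_lebesgue_integral)
        show "indep_vars (\<lambda>_. borel) (\<lambda>i \<omega>. iexp (g (Y n i \<omega>) / sqrt (real n))) {..<n}"
          by (rule indep_vars_compose2[OF elim(1)]) measurable
        show "integrable M (\<lambda>\<omega>. iexp (g (Y n i \<omega>) / sqrt (real n)))" if "i \<in> {..<n}" for i
          using that by (intro integrable_const_bound[of _ 1]) auto
      qed simp
      also have "\<dots> = (\<Prod>i<n. c n)"
      proof (rule prod.cong[OF refl])
        fix i assume "i \<in> {..<n}"
        then have i: "distr M borel (Y n i) = Q n" "Y n i \<in> borel_measurable M" using elim by auto
        show "(\<integral>\<omega>. iexp (g (Y n i \<omega>) / sqrt (real n)) \<partial>M) = c n"
          unfolding c_def i(1)[symmetric] using i(2) by (subst integral_distr) auto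
      qed
      finally show ?case by simp
    qed
  qed
qed

section \<open>Location estimates\<close>

text \<open>The signed power. The exponent \<open>lam - 1\<close> gives the location score, and the
  exponent 0 gives the sign function, which brings the median into the same framework.\<close>

definition spow :: "real \<Rightarrow> real \<Rightarrow> real" where
  "spow p u = \<bar>u\<bar> powr p * sgn u"

lemma spow_0 [simp]: "spow 0 u = sgn u" "spow p 0 = 0"
  by (auto simp: spow_def sgn_if)

lemma spow_pos: "u \<ge> 0 \<Longrightarrow> p > 0 \<Longrightarrow> spow p u = u powr p"
  by (auto simp: spow_def sgn_if)

lemma spow_minus: "spow p (- u) = - spow p u"
  by (simp add: spow_def sgn_minus)

lemma abs_spow: "p > 0 \<Longrightarrow> \<bar>spow p u\<bar> = \<bar>u\<bar> powr p"
  by (auto simp: spow_def abs_mult sgn_if)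

lemma sgn_spow: "sgn (spow p u) = sgn u"
  by (auto simp: spow_def sgn_mult sgn_if)

lemma spow_spow: "p > 0 \<Longrightarrow> q > 0 \<Longrightarrow> spow p (spow q u) = spow (p * q) u"
  by (simp add: spow_def[of p] sgn_spow abs_spow powr_powr) (simp add: spow_def mult.commute)

lemma spow_strict_mono: "p > 0 \<Longrightarrow> u < v \<Longrightarrow> spow p u < spow p v"
proof -
  assume p: "p > 0" and uv: "u < v"
  have pos: "spow p a < spow p b" if "0 \<le> a" "a < b" for a b
    using that p by (simp add: spow_pos powr_less_mono2)
  consider "0 \<le> u" | "v \<le> 0" | "u < 0" "0 < v" by linarith
  then show ?thesis
  proof cases
    case 2
    then show ?thesis using pos[of "-v" "-u"] uv by (simp add: spow_minus)
  next
    case 3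
    then show ?thesis using pos[of 0 v] pos[of 0 "-u"] by (simp add: spow_minus)
  qed (use pos uv in auto)
qed

lemma spow_mono: "p \<ge> 0 \<Longrightarrow> u \<le> v \<Longrightarrow> spow p u \<le> spow p v"
  using spow_strict_mono[of p u v] by (cases "p = 0"; cases "u = v") (auto simp: sgn_if)

lemma continuous_on_spow [continuous_intros]:
  assumes "p > 0" "continuous_on A f"
  shows "continuous_on A (\<lambda>x. spow p (f x))"
proof -
  \<comment> \<open>Powers of the positive and of the negative part are continuous across the
    origin, which the form with \<open>sgn\<close> does not show.\<close>
  have eq: "spow p = (\<lambda>u. (max 0 u) powr p - (max 0 (-u)) powr p)"
    using assms(1) by (auto simp: spow_def sgn_if max_def fun_eq_iff)
  have "continuous_on UNIV (\<lambda>u. (max 0 u) powr p - (max 0 (-u)) powr p)"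
    using assms(1) by (intro continuous_on_diff continuous_on_powr' continuous_intros) auto
  then have "continuous_on UNIV (spow p)" unfolding eq .
  from continuous_on_compose2[OF this assms(2)] show ?thesis by simp
qed

lemma spow_measurable [measurable]: "spow p \<in> borel_measurable borel"
  unfolding spow_def by measurable

definition mscore :: "real \<Rightarrow> nat \<Rightarrow> (nat \<Rightarrow> real) \<Rightarrow> real \<Rightarrow> real" where
  "mscore lam n x h = (\<Sum>i<n. spow (lam - 1) (x i - h))"

lemma mscore_strict_antimono:
  "lam > 1 \<Longrightarrow> n > 0 \<Longrightarrow> h < h' \<Longrightarrow> mscore lam n x h' < mscore lam n x h"
  unfolding mscore_def by (intro sum_strict_mono spow_strict_mono) auto

lemma mscore_root:
  assumes "lam > 1" "n > 0"
  shows "\<exists>!m. mscore lam n x m = 0"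
proof -
  let ?a = "Min (x ` {..<n})" and ?b = "Max (x ` {..<n})"
  have ab: "?a \<le> x i" "x i \<le> ?b" if "i < n" for i using that by auto
  have "\<exists>m\<ge>?a. m \<le> ?b \<and> mscore lam n x m = 0"
  proof (rule IVT2')
    have "spow (lam - 1) (x i - ?b) \<le> 0" "spow (lam - 1) (x i - ?a) \<ge> 0" if "i < n" for i
      using ab[OF that] assms(1) spow_mono[of "lam - 1" "x i - ?b" 0] spow_mono[of "lam - 1" 0 "x i - ?a"]
      by auto
    then show "mscore lam n x ?b \<le> 0" "0 \<le> mscore lam n x ?a"
      unfolding mscore_def by (auto intro!: sum_nonpos sum_nonneg)
    show "?a \<le> ?b" using ab[of 0] assms(2) by linarith
    show "continuous_on {?a..?b} (mscore lam n x)"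
      unfolding mscore_def using assms by (auto intro!: continuous_intros)
  qed
  then obtain m where "mscore lam n x m = 0" by blast
  then show ?thesis
    using mscore_strict_antimono[OF assms] by (metis less_irrefl linorder_less_linear)
qed

lemma mu_hat_eq:
  assumes "lam > 1" "n > 0"
  shows "mu_hat lam n x = m \<longleftrightarrow> mscore lam n x m = 0"
proof -
  have "mu_hat lam n x = (THE m. mscore lam n x m = 0)"
    using assms by (simp add: mu_hat_def mscore_def spow_def)
  then show ?thesis
    using theI'[OF mscore_root[OF assms, of x]] the1_equality[OF mscore_root[OF assms, of x], of m] by auto
qed

lemma mscore_mu_hat: "lam > 1 \<Longrightarrow> n > 0 \<Longrightarrow> mscore lam n x (mu_hat lam n x) = 0"
  using mu_hat_eq by blast

lemma mu_hat_le_iff: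
  assumes "lam > 1" "n > 0"
  shows "mu_hat lam n x \<le> c \<longleftrightarrow> mscore lam n x c \<le> 0"
proof -
  define m where "m = mu_hat lam n x"
  have "mscore lam n x m = 0" using mscore_mu_hat[OF assms] by (simp add: m_def)
  moreover have "m < c \<Longrightarrow> mscore lam n x c < mscore lam n x m" "c < m \<Longrightarrow> mscore lam n x m < mscore lam n x c"
    by (rule mscore_strict_antimono[OF assms]; assumption)+
  ultimately show ?thesis unfolding m_def[symmetric] by (metis less_eq_real_def linorder_not_le order_refl)
qed

section \<open>Order statistics, the median and measurability of the location estimate\<close>

lemma nth_le_iff_filter:
  fixes c :: "'a::linorder"
  shows "sorted xs \<Longrightarrow> k < length xs \<Longrightarrow> xs ! k \<le> c \<longleftrightarrow> k < length (filter (\<lambda>x. x \<le> c) xs)"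
proof (induction xs arbitrary: k)
  case (Cons a ys)
  show ?case
  proof (cases "a \<le> c")
    case True
    then show ?thesis using Cons by (cases k) auto
  next
    case False
    then have "filter (\<lambda>x. x \<le> c) (a # ys) = []" using Cons(2) by (auto simp: filter_empty_conv)
    moreover have "(a # ys) ! k \<ge> a" using Cons(2,3) by (cases k) auto
    ultimately show ?thesis using False by auto
  qed
qed auto

definition order_stat :: "nat \<Rightarrow> (nat \<Rightarrow> real) \<Rightarrow> nat \<Rightarrow> real" where
  "order_stat n x k = sort (map x [0..<n]) ! k"

text \<open>Replaces sorting by a count of observations, from which both the comparison with the
  sign score and measurability follow.\<close>

lemma order_stat_le_iff:
  assumes "k < n"
  shows "order_stat n x k \<le> c \<longleftrightarrow> k < card {i. i < n \<and> x i \<le> c}"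
proof -
  have "length (filter (\<lambda>y. y \<le> c) (sort (map x [0..<n]))) = length (filter (\<lambda>y. y \<le> c) (map x [0..<n]))"
    by (metis mset_filter mset_sort size_mset)
  also have "\<dots> = card {i. i < n \<and> x i \<le> c}"
    by (subst length_filter_conv_card) (auto intro!: arg_cong[where f=card])
  finally show ?thesis
    unfolding order_stat_def using assms by (subst nth_le_iff_filter) auto
qed

lemma order_stat_mono: "j \<le> k \<Longrightarrow> k < n \<Longrightarrow> order_stat n x j \<le> order_stat n x k"
  unfolding order_stat_def by (intro sorted_nth_mono) auto

lemma sample_median_order_stat:
  "sample_median n x = (if odd n then order_stat n x (n div 2)
     else (order_stat n x (n div 2 - 1) + order_stat n x (n div 2)) / 2)"
  by (simp add: sample_median_def order_stat_def Let_def)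

lemma mscore_1:
  "mscore 1 n x h = real (card {i. i < n \<and> x i > h}) - real (card {i. i < n \<and> x i < h})"
proof -
  have "mscore 1 n x h = (\<Sum>i<n. of_bool (x i > h) - of_bool (x i < h))"
    unfolding mscore_def by (intro sum.cong) (auto simp: sgn_if)
  also have "\<dots> = (\<Sum>i<n. of_bool (x i > h)) - (\<Sum>i<n. of_bool (x i < h))"
    by (rule sum_subtractf)
  also have "(\<Sum>i<n. of_bool (x i > h)) = real (card {i. i < n \<and> x i > h})"
    by (subst sum_of_bool_eq) (auto intro!: arg_cong[where f=card])
  also have "(\<Sum>i<n. of_bool (x i < h)) = real (card {i. i < n \<and> x i < h})"
    by (subst sum_of_bool_eq) (auto intro!: arg_cong[where f=card])
  finally show ?thesis .
qed

lemma card_le_gt: "card {i. i < n \<and> x i \<le> h} + card {i. i < n \<and> x i > (h::real)} = n"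
proof -
  have "card ({i. i < n \<and> x i \<le> h} \<union> {i. i < n \<and> x i > h}) = card {i. i < n \<and> x i \<le> h} + card {i. i < n \<and> x i > h}"
    by (rule card_Un_disjoint) auto
  moreover have "{i. i < n \<and> x i \<le> h} \<union> {i. i < n \<and> x i > h} = {..<n}" by auto
  ultimately show ?thesis by simp
qed

text \<open>The score of the median is a step function that may jump over 0 or vanish on an
  interval, so only its strict sign locates the estimate. For an even sample both central order
  statistics end up on the same side of \<open>h\<close>, and so does their mean.\<close>

lemma mu_hat_le:
  assumes "lam \<ge> 1" "n > 0" "mscore lam n x h < 0"
  shows "mu_hat lam n x \<le> h"
proof (cases "lam = 1")
  case True
  have "card {i. i < n \<and> x i < h} \<le> card {i. i < n \<and> x i \<le> h}"
    by (rule card_mono) auto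
  with assms(3) card_le_gt[of n x h] have "n < 2 * card {i. i < n \<and> x i \<le> h}"
    unfolding True mscore_1 by linarith
  then have "order_stat n x (n div 2) \<le> h"
    using assms(2) by (subst order_stat_le_iff) auto
  moreover have "order_stat n x (n div 2 - 1) \<le> order_stat n x (n div 2)"
    using assms(2) by (intro order_stat_mono) auto
  ultimately show ?thesis
    unfolding True mu_hat_def by (auto simp: sample_median_order_stat)
qed (use assms mu_hat_le_iff[of lam n x h] in auto)

lemma mu_hat_ge:
  assumes "lam \<ge> 1" "n > 0" "mscore lam n x h > 0"
  shows "mu_hat lam n x \<ge> h"
proof (cases "lam = 1")
  case True
  have c: "2 * card {i. i < n \<and> x i < h} < n"
  proof -
    have "card {i. i < n \<and> x i < h} + card {i. i < n \<and> x i > h} = card ({i. i < n \<and> x i < h} \<union> {i. i < n \<and> x i > h})"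
      by (rule card_Un_disjoint[symmetric]) auto
    also have "\<dots> \<le> card {..<n}" by (rule card_mono) auto
    finally show ?thesis using assms(3) unfolding True mscore_1 by auto
  qed
  have ge: "order_stat n x k \<ge> h" if "k < n" "card {i. i < n \<and> x i < h} \<le> k" for k
  proof (rule ccontr)
    assume "\<not> ?thesis"
    then have lt: "order_stat n x k < h" by simp
    have "k < card {i. i < n \<and> x i \<le> order_stat n x k}"
      using order_stat_le_iff[OF that(1), of x "order_stat n x k"] by simp
    also have "\<dots> \<le> card {i. i < n \<and> x i < h}"
      using lt by (intro card_mono) auto
    finally show False using that by simp
  qed
  show ?thesis
  proof (cases "odd n")
    case True
    then show ?thesis
      using ge[of "n div 2"] c assms(2) \<open>lam = 1\<close> by (auto simp: mu_hat_def sample_median_order_stat)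
  next
    case False
    \<comment> \<open>For even \<open>n\<close> the strict inequality \<open>2 * card < n\<close>
      leaves room for the lower central index \<open>n div 2 - 1\<close> too.\<close>
    then have "card {i. i < n \<and> x i < h} \<le> n div 2 - 1" "card {i. i < n \<and> x i < h} \<le> n div 2" "n div 2 < n" "n div 2 - 1 < n"
      using c assms(2) by auto
    then have "h \<le> order_stat n x (n div 2)" "h \<le> order_stat n x (n div 2 - 1)" by (simp_all only: ge)
    then show ?thesis
      using False \<open>lam = 1\<close> by (auto simp: mu_hat_def sample_median_order_stat)
  qed
qed (use assms mu_hat_le_iff[of lam n x h] mscore_strict_antimono[of lam n "mu_hat lam n x" h x]
    mscore_mu_hat[of lam n x] in \<open>auto intro: ccontr simp: not_le\<close>)

text \<open>A definite description or a sorted list is not composed of measurable operations. Its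
  sublevel sets are nevertheless events about the score at a fixed point, or about counts of
  observations.\<close>

lemma mu_hat_measurable [measurable (raw)]:
  assumes "lam \<ge> 1" "n > 0" and X: "\<And>i. i < n \<Longrightarrow> X i \<in> borel_measurable M"
  shows "(\<lambda>\<omega>. mu_hat lam n (\<lambda>i. X i \<omega>)) \<in> borel_measurable M"
proof (cases "lam = 1")
  case True
  have "(\<lambda>\<omega>. order_stat n (\<lambda>i. X i \<omega>) k) \<in> borel_measurable M" if "k < n" for k
    unfolding borel_measurable_iff_le
  proof
    fix c
    have "{\<omega> \<in> space M. order_stat n (\<lambda>i. X i \<omega>) k \<le> c}
        = {\<omega> \<in> space M. real k < (\<Sum>i<n. indicator {..c} (X i \<omega>))}"
    proof -
      have "real (card {i. i < n \<and> X i \<omega> \<le> c}) = (\<Sum>i<n. indicator {..c} (X i \<omega>))" for \<omega>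
      proof -
        have "(\<Sum>i<n. indicator {..c} (X i \<omega>) :: real) = (\<Sum>i<n. of_bool (X i \<omega> \<le> c))"
          by (intro sum.cong refl) (simp add: indicator_def)
        also have "\<dots> = real (card {i. i < n \<and> X i \<omega> \<le> c})"
          by (subst sum_of_bool_eq) (auto intro!: arg_cong[where f=card])
        finally show ?thesis by simp
      qed
      then show ?thesis by (simp only: order_stat_le_iff[OF that] of_nat_less_iff[symmetric, where 'a=real])
    qed
    also have "\<dots> \<in> sets M"
    proof -
      have "(\<lambda>\<omega>. indicator {..c} (X i \<omega>) :: real) \<in> borel_measurable M" if "i \<in> {..<n}" for i
        using measurable_compose[OF X borel_measurable_indicator[of "{..c}" borel]] that by simp
      then have "(\<lambda>\<omega>. \<Sum>i<n. indicator {..c} (X i \<omega>) :: real) \<in> borel_measurable M"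
        by (rule borel_measurable_sum)
      then show ?thesis by measurable
    qed
    finally show "{\<omega> \<in> space M. order_stat n (\<lambda>i. X i \<omega>) k \<le> c} \<in> sets M" .
  qed
  then show ?thesis
    using assms(2) unfolding True mu_hat_def sample_median_order_stat by (cases "odd n") auto
next
  case False
  then have "{\<omega> \<in> space M. mu_hat lam n (\<lambda>i. X i \<omega>) \<le> c}
      = {\<omega> \<in> space M. (\<Sum>i<n. spow (lam - 1) (X i \<omega> - c)) \<le> 0}" for c
    using assms(1,2) by (simp add: mu_hat_le_iff mscore_def)
  moreover have "{\<omega> \<in> space M. (\<Sum>i<n. spow (lam - 1) (X i \<omega> - c)) \<le> 0} \<in> sets M" for c
  proof -
    have "(\<lambda>\<omega>. spow (lam - 1) (X i \<omega> - c)) \<in> borel_measurable M" if "i \<in> {..<n}" for i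
      using X that by (intro measurable_compose[OF _ spow_measurable] borel_measurable_diff) auto
    then have "(\<lambda>\<omega>. \<Sum>i<n. spow (lam - 1) (X i \<omega> - c)) \<in> borel_measurable M"
      by (rule borel_measurable_sum)
    then show ?thesis by measurable
  qed
  ultimately show ?thesis by (simp add: borel_measurable_iff_le)
qed

text \<open>Allows passing to samples restricted to \<open>{..<n}\<close>, the points of the product
  space used in the null set argument.\<close>

lemma sample_cong:
  assumes "\<And>i. i < n \<Longrightarrow> x i = y i"
  shows "mu_hat lam n x = mu_hat lam n y" "S_stat lam n x = S_stat lam n y"
proof -
  have "map x [0..<n] = map y [0..<n]" using assms by auto
  then have "sample_median n x = sample_median n y" by (simp only: sample_median_def)
  moreover have "(\<Sum>i<n. \<bar>x i - m\<bar> powr (lam - 1) * sgn (x i - m))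
      = (\<Sum>i<n. \<bar>y i - m\<bar> powr (lam - 1) * sgn (y i - m))" for m
    using assms by (intro sum.cong) auto
  ultimately show mu: "mu_hat lam n x = mu_hat lam n y" by (simp add: mu_hat_def)
  have "sigma_hat lam n x = sigma_hat lam n y"
    unfolding sigma_hat_def mu using assms by (intro arg_cong2[where f="(powr)"] arg_cong2[where f="(/)"] sum.cong) auto
  then show "S_stat lam n x = S_stat lam n y"
    unfolding S_stat_def Y_hat_def mu using assms by (intro arg_cong2[where f="(/)"] sum.cong) auto
qed

text \<open>A positive scale is a common factor that cancels. If the scale estimate is 0, then every
  residual is 0, and the sum vanishes trivially.\<close>

lemma S_stat_0_imp:
  assumes "S_stat lam n x = 0" "n > 0"
  shows "(\<Sum>i<n. spow lam (x i - mu_hat lam n x)) = 0"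
proof (cases "sigma_hat lam n x = 0")
  case True
  then have "(\<Sum>i<n. \<bar>x i - mu_hat lam n x\<bar> powr lam) = 0"
    using assms(2) by (simp add: sigma_hat_def)
  then have "\<bar>x i - mu_hat lam n x\<bar> powr lam = 0" if "i < n" for i
    using that by (subst (asm) sum_nonneg_eq_0_iff) auto
  then show ?thesis by (intro sum.neutral) (auto simp: spow_def)
next
  case False
  then have pos: "sigma_hat lam n x > 0" by (simp add: sigma_hat_def)
  then have "\<bar>Y_hat lam n x i\<bar> powr lam * sgn (Y_hat lam n x i)
      = spow lam (x i - mu_hat lam n x) / sigma_hat lam n x powr lam" for i
    by (simp add: Y_hat_def spow_def powr_divide sgn_divide abs_divide)
  with assms pos show ?thesis
    by (simp add: S_stat_def sum_divide_distrib[symmetric])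
qed

section \<open>Convexity of powers and uniqueness of the extreme observation\<close>

lemma powr_increment_strict_mono:
  fixes p :: real
  assumes "p > 1" "0 \<le> s" "s < t" "a > 0"
  shows "(s + a) powr p - s powr p < (t + a) powr p - t powr p"
proof (rule DERIV_pos_imp_increasing_open[OF assms(3)])
  show "\<exists>y. ((\<lambda>x. (x + a) powr p - x powr p) has_real_derivative y) (at x) \<and> 0 < y"
    if "s < x" "x < t" for x
  proof (intro exI conjI)
    have "x > 0" using that assms by linarith
    then show "((\<lambda>x. (x + a) powr p - x powr p) has_real_derivative
        (p * (x + a) powr (p - 1) - p * x powr (p - 1))) (at x)"
      using assms by (auto intro!: derivative_eq_intros)
    have "x powr (p - 1) < (x + a) powr (p - 1)"
      using \<open>x > 0\<close> assms by (intro powr_less_mono2) auto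
    then show "0 < p * (x + a) powr (p - 1) - p * x powr (p - 1)" using assms by simp
  qed
  show "continuous_on {s..t} (\<lambda>x. (x + a) powr p - x powr p)"
    using assms by (intro continuous_on_diff continuous_on_powr' continuous_intros) auto
qed

text \<open>By convexity the increment over a segment of length \<open>l\<close> grows as the
  segment moves away from 0, and the segment \<open>[T, T + l]\<close> is farther out. A segment
  across 0 consists of two pieces of lengths \<open>b\<close> and \<open>l - b\<close> starting at
  0; moved out to \<open>T\<close> and \<open>T + b\<close>, they fill exactly that segment.\<close>

lemma spow_increment_le:
  assumes p: "p > 1" and b: "\<bar>b\<bar> \<le> T" and l: "l > 0"
  shows "spow p b - spow p (b - l) \<le> (T + l) powr p - T powr p"
proof -
  have inc: "(s + a) powr p - s powr p \<le> (t + a) powr p - t powr p" if "0 \<le> s" "s \<le> t" "a > 0" for s t a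
    using powr_increment_strict_mono[OF p that(1), of t a] that by (cases "s = t") auto
  consider "b - l \<ge> 0" | "b \<le> 0" | "b > 0" "b - l < 0" by linarith
  then show ?thesis
  proof cases
    case 1
    then show ?thesis using inc[of "b - l" T l] b l p by (simp add: spow_pos)
  next
    case 2
    then have "spow p b - spow p (b - l) = (- b + l) powr p - (- b) powr p"
      using p l spow_minus[of p "-b"] spow_minus[of p "-b + l"] by (simp add: spow_pos)
    then show ?thesis using inc[of "-b" T l] b l 2 by simp
  next
    case 3
    then have "spow p b - spow p (b - l) = b powr p + (l - b) powr p"
      using p spow_minus[of p "l - b"] by (simp add: spow_pos)
    then show ?thesis using inc[of 0 T b] inc[of 0 "T + b" "l - b"] b 3 p by simp
  qed
qed

text \<open>Laying the lengths end to end from \<open>T\<close> lets every later increment start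
  farther out, where convexity makes it strictly larger. The strict gain takes two lengths, whence
  samples of at least three observations.\<close>

lemma powr_increment_superadditive:
  assumes p: "p > 1" and T: "T \<ge> 0" and "finite J" "J \<noteq> {}" "\<And>j. j \<in> J \<Longrightarrow> l j > (0::real)"
  shows "(\<Sum>j\<in>J. (T + l j) powr p - T powr p) \<le> (T + sum l J) powr p - T powr p"
    and "card J \<ge> 2 \<Longrightarrow> (\<Sum>j\<in>J. (T + l j) powr p - T powr p) < (T + sum l J) powr p - T powr p"
proof -
  have "(\<Sum>j\<in>J. (T + l j) powr p - T powr p) \<le> (T + sum l J) powr p - T powr p \<and>
    (card J \<ge> 2 \<longrightarrow> (\<Sum>j\<in>J. (T + l j) powr p - T powr p) < (T + sum l J) powr p - T powr p)"
    using assms(3-5)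
  proof (induction J rule: finite_ne_induct)
    case (insert j F)
    have pos: "sum l F > 0" using insert by (intro sum_pos) auto
    have "(T + l j) powr p - T powr p < (T + sum l F + l j) powr p - (T + sum l F) powr p"
      using powr_increment_strict_mono[OF p T, of "T + sum l F" "l j"] pos insert by simp
    then show ?case using insert by (simp add: algebra_simps)
  qed simp
  then show "(\<Sum>j\<in>J. (T + l j) powr p - T powr p) \<le> (T + sum l J) powr p - T powr p"
    and "card J \<ge> 2 \<Longrightarrow> (\<Sum>j\<in>J. (T + l j) powr p - T powr p) < (T + sum l J) powr p - T powr p"
    by blast+
qed

text \<open>Raising the observation farthest to the right of the location estimate keeps it the farthest
  one and strictly increases the skewness sum, by convexity of \<open>t \<mapsto> t powr (lam / (lam - 1))\<close>.\<close>

lemma skewness_zero_unique_right: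
  assumes lam: "lam > 1" and n: "n \<ge> 3" and i: "i < n"
    and eq: "\<And>j. j < n \<Longrightarrow> j \<noteq> i \<Longrightarrow> x j = x' j"
    and far: "\<And>j. j < n \<Longrightarrow> \<bar>x j - mu_hat lam n x\<bar> \<le> x i - mu_hat lam n x"
    and z: "(\<Sum>j<n. spow lam (x j - mu_hat lam n x)) = 0"
    and z': "(\<Sum>j<n. spow lam (x' j - mu_hat lam n x')) = 0"
  shows "\<not> x i < x' i"
proof
  assume less: "x i < x' i"
  define m m' where "m = mu_hat lam n x" and "m' = mu_hat lam n x'"
  define J where "J = {..<n} - {i}"
  have n0: "n > 0" using n by simp
  have split: "(\<Sum>j<n. f j) = f i + (\<Sum>j\<in>J. f j)" for f :: "nat \<Rightarrow> real"
    unfolding J_def using i by (simp add: sum.remove)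
  \<comment> \<open>With this exponent \<open>spow lam\<close> is \<open>spow p\<close> applied to
    the score. In the scores the location equation is linear: the others add up to
    \<open>- T\<close>, respectively \<open>- T'\<close>, and only the skewness equation is
    nonlinear.\<close>
  define p where "p = lam / (lam - 1)"
  have p: "p > 1" "p * (lam - 1) = lam" using lam by (auto simp: p_def field_simps)
  define T T' where "T = spow (lam - 1) (x i - m)" and "T' = spow (lam - 1) (x' i - m')"
  define a b where "a j = spow (lam - 1) (x j - m')" and "b j = spow (lam - 1) (x j - m)" for j
  have m0: "mscore lam n x m = 0" "mscore lam n x' m' = 0"
    using mscore_mu_hat[OF lam n0] by (auto simp: m_def m'_def)
  have "mscore lam n x m < mscore lam n x' m"
    unfolding mscore_def split using less lam eq
    by (intro add_less_le_mono spow_strict_mono) (auto simp: J_def)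
  then have mm: "m < m'"
    using m0 mscore_strict_antimono[OF lam n0, of m' m x'] by (cases m m' rule: linorder_cases) auto
  have ab: "b j - a j > 0" for j
    unfolding a_def b_def using spow_strict_mono[of "lam - 1" "x j - m'" "x j - m"] lam mm by simp
  have sb: "sum b J = - T" using m0(1) unfolding mscore_def split b_def T_def by linarith
  have sa: "sum a J = - T'"
  proof -
    have "(\<Sum>j\<in>J. spow (lam - 1) (x' j - m')) = sum a J"
      unfolding a_def using eq by (intro sum.cong) (auto simp: J_def)
    then show ?thesis using m0(2) unfolding mscore_def split T'_def by linarith
  qed
  have T: "T \<ge> 0" "x i - m \<ge> 0"
    using far[OF i] lam spow_mono[of "lam - 1" 0 "x i - m"] by (auto simp: T_def m_def)
  have T': "T' = T + (\<Sum>j\<in>J. b j - a j)" using sa sb by (simp add: sum_subtractf)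
  have bT: "\<bar>b j\<bar> \<le> T" if "j \<in> J" for j
    using far[of j] that lam T unfolding b_def T_def
    by (auto simp: abs_spow J_def m_def spow_pos intro!: powr_mono2)
  have J: "finite J" "J \<noteq> {}" "card J \<ge> 2"
  proof -
    have "card J = n - 1" using i by (simp add: J_def)
    then show "card J \<ge> 2" using n by simp
    then show "J \<noteq> {}" by auto
  qed (simp add: J_def)
  have psi: "spow lam u = spow p (spow (lam - 1) u)" for u
    using lam p by (simp add: spow_spow)
  have "(\<Sum>j\<in>J. spow p (b j)) = - spow p T"
    using z unfolding split m_def[symmetric] psi T_def b_def by linarith
  moreover have "(\<Sum>j\<in>J. spow p (a j)) = - spow p T'"
  proof -
    have "(\<Sum>j\<in>J. spow p (spow (lam - 1) (x' j - m'))) = (\<Sum>j\<in>J. spow p (a j))"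
      unfolding a_def using eq by (intro sum.cong) (auto simp: J_def)
    then show ?thesis using z' unfolding split m'_def[symmetric] psi T'_def by linarith
  qed
  moreover have "T' \<ge> 0" using T' T ab sum_nonneg[of J "\<lambda>j. b j - a j"] by (simp add: less_imp_le)
  \<comment> \<open>Two vanishing skewness sums force this equality, while convexity makes the right
    side strictly smaller than the left.\<close>
  ultimately have "T' powr p - T powr p = (\<Sum>j\<in>J. spow p (b j) - spow p (a j))"
    using T p by (simp add: sum_subtractf spow_pos)
  also have "\<dots> \<le> (\<Sum>j\<in>J. (T + (b j - a j)) powr p - T powr p)"
  proof (rule sum_mono)
    fix j assume "j \<in> J"
    show "spow p (b j) - spow p (a j) \<le> (T + (b j - a j)) powr p - T powr p"
      using spow_increment_le[OF p(1) bT[OF \<open>j \<in> J\<close>] ab[of j]] by simp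
  qed
  also have "\<dots> < (T + (\<Sum>j\<in>J. b j - a j)) powr p - T powr p"
    using J ab T p by (intro powr_increment_superadditive) auto
  finally show False by (simp add: T')
qed

lemma mu_hat_minus: "lam > 1 \<Longrightarrow> n > 0 \<Longrightarrow> mu_hat lam n (\<lambda>i. - x i) = - mu_hat lam n x"
proof (subst mu_hat_eq)
  assume "lam > 1" "n > 0"
  have "spow (lam - 1) (- x i - - m) = - spow (lam - 1) (x i - m)" for i m
    using spow_minus[of "lam - 1" "x i - m"] by simp
  then show "mscore lam n (\<lambda>i. - x i) (- mu_hat lam n x) = 0"
    using mscore_mu_hat[OF \<open>lam > 1\<close> \<open>n > 0\<close>, of x] unfolding mscore_def by (simp add: sum_negf)
qed auto

text \<open>Reflecting the sample exchanges left and right.\<close>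

lemma skewness_zero_unique_left:
  assumes lam: "lam > 1" and n: "n \<ge> 3" and i: "i < n"
    and eq: "\<And>j. j < n \<Longrightarrow> j \<noteq> i \<Longrightarrow> x j = x' j"
    and far: "\<And>j. j < n \<Longrightarrow> \<bar>x j - mu_hat lam n x\<bar> \<le> mu_hat lam n x - x i"
    and z: "(\<Sum>j<n. spow lam (x j - mu_hat lam n x)) = 0"
    and z': "(\<Sum>j<n. spow lam (x' j - mu_hat lam n x')) = 0"
  shows "\<not> x' i < x i"
proof -
  have n0: "n > 0" using n by simp
  have sp: "spow lam (- u - - v) = - spow lam (u - v)" for u v
    using spow_minus[of lam "u - v"] by simp
  have "\<not> - x i < - x' i"
  proof (rule skewness_zero_unique_right[OF lam n i])
    show "\<bar>- x j - mu_hat lam n (\<lambda>j. - x j)\<bar> \<le> - x i - mu_hat lam n (\<lambda>j. - x j)" if "j < n" for j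
      using far[OF that] unfolding mu_hat_minus[OF lam n0] by linarith
    show "(\<Sum>j<n. spow lam (- x j - mu_hat lam n (\<lambda>j. - x j))) = 0"
      "(\<Sum>j<n. spow lam (- x' j - mu_hat lam n (\<lambda>j. - x' j))) = 0"
      unfolding mu_hat_minus[OF lam n0] sp using z z' by (simp_all add: sum_negf)
  qed (use eq in auto)
  then show ?thesis by simp
qed

text \<open>For the median: raising the largest observation moves the mean but not the median.\<close>

lemma skewness_zero_unique_max:
  assumes n: "n \<ge> 3" and i: "i < n"
    and eq: "\<And>j. j < n \<Longrightarrow> j \<noteq> i \<Longrightarrow> x j = x' j"
    and mx: "\<And>j. j < n \<Longrightarrow> x j \<le> x i"
    and z: "(\<Sum>j<n. spow 1 (x j - mu_hat 1 n x)) = 0"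
    and z': "(\<Sum>j<n. spow 1 (x' j - mu_hat 1 n x')) = 0"
  shows "\<not> x i < x' i"
proof
  assume less: "x i < x' i"
  have os: "order_stat n x k = order_stat n x' k" if k: "k < n - 1" for k
  proof -
    have "order_stat n x k \<le> c \<longleftrightarrow> order_stat n x' k \<le> c" for c
    proof (cases "x i \<le> c \<and> c < x' i")
      case True
      \<comment> \<open>For a threshold between the old and the new maximum the counts are
        \<open>n\<close> and \<open>n - 1\<close>, and both exceed \<open>k\<close>.\<close>
      have "{j. j < n \<and> x j \<le> c} = {..<n}" using mx True by (auto intro: order_trans)
      moreover have "{j. j < n \<and> x' j \<le> c} = {..<n} - {i}"
        using mx True eq by (auto intro: order_trans simp: not_le) (metis mx order_trans)
      ultimately show ?thesis using k i by (simp add: order_stat_le_iff)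
    next
      case False
      then have "x j \<le> c \<longleftrightarrow> x' j \<le> c" if "j < n" for j
        using eq[OF that] less by (cases "j = i") auto
      then have "{j. j < n \<and> x j \<le> c} = {j. j < n \<and> x' j \<le> c}" by auto
      then show ?thesis using k by (simp add: order_stat_le_iff)
    qed
    from this[of "order_stat n x k"] this[of "order_stat n x' k"] show ?thesis by auto
  qed
  \<comment> \<open>From three observations on, the central indices stay below the index
    \<open>n - 1\<close> of the maximum.\<close>
  have "n div 2 < n - 1 \<or> \<not> odd n \<and> n div 2 < n" "n div 2 - 1 < n - 1" "n div 2 < n - 1" using n by auto
  then have mu: "mu_hat 1 n x = mu_hat 1 n x'"
    using os by (simp add: mu_hat_def sample_median_order_stat)
  have "(\<Sum>j<n. spow 1 (x j - mu_hat 1 n x')) < (\<Sum>j<n. spow 1 (x' j - mu_hat 1 n x'))"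
  proof (rule sum_strict_mono_ex1)
    show "\<forall>j\<in>{..<n}. spow 1 (x j - mu_hat 1 n x') \<le> spow 1 (x' j - mu_hat 1 n x')"
      using eq less by (metis lessThan_iff diff_right_mono less_imp_le order_refl spow_mono zero_le_one)
    show "\<exists>j\<in>{..<n}. spow 1 (x j - mu_hat 1 n x') < spow 1 (x' j - mu_hat 1 n x')"
      using i less by (intro bexI[of _ i] spow_strict_mono) auto
  qed simp
  with z z' mu show False by simp
qed

section \<open>Nonvanishing and measurability of the statistics\<close>

text \<open>By Fubini: with the other coordinates fixed, the section of the event contains at most
  one point, which is null for a law without atoms.\<close>

lemma (in prob_space) AE_coordinate_determined:
  fixes X :: "nat \<Rightarrow> 'a \<Rightarrow> real"
  assumes indep: "indep_vars (\<lambda>_. borel) X {..<n}" and i: "i < n"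
    and atom: "\<And>c. emeasure (distr M borel (X i)) {c} = 0"
    and P: "{x \<in> space (PiM {..<n} (\<lambda>_. borel)). P x} \<in> sets (PiM {..<n} (\<lambda>_. borel))"
    and uniq: "\<And>x y. P x \<Longrightarrow> P y \<Longrightarrow> (\<And>j. j < n \<Longrightarrow> j \<noteq> i \<Longrightarrow> x j = y j) \<Longrightarrow> x i = y i"
  shows "AE \<omega> in M. \<not> P (\<lambda>j\<in>{..<n}. X j \<omega>)"
proof -
  define I where "I = {..<n}"
  \<comment> \<open>Extension by 0 outside the sample gives a probability law at every index, as the
    product construction asks for.\<close>
  define Y where "Y j \<omega> = (if j \<in> I then X j \<omega> else 0)" for j \<omega>
  have rvX: "random_variable borel (X j)" if "j \<in> I" for j
    using indep that by (auto simp: indep_vars_def I_def)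
  have rvY: "random_variable borel (Y j)" for j
    unfolding Y_def using rvX by (cases "j \<in> I") auto
  define D where "D j = distr M borel (Y j)" for j
  interpret D: prob_space "D j" for j
    unfolding D_def by (rule prob_space_distr[OF rvY])
  interpret product_sigma_finite D ..
  have DX: "D j = distr M borel (X j)" if "j \<in> I" for j
    unfolding D_def Y_def using that by simp
  have I: "I \<noteq> {}" "finite (I - {i})" "insert i (I - {i}) = I" using i by (auto simp: I_def)
  have "distr M (Pi\<^sub>M I (\<lambda>_. borel)) (\<lambda>x. \<lambda>j\<in>I. X j x) = Pi\<^sub>M I (\<lambda>j. distr M borel (X j))"
    using indep_vars_iff_distr_eq_PiM'[of I X "\<lambda>_. borel"] I rvX indep by (simp add: I_def)
  also have "\<dots> = Pi\<^sub>M I D" by (rule PiM_cong) (auto simp: DX)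
  finally have distr: "distr M (Pi\<^sub>M I (\<lambda>_. borel)) (\<lambda>x. \<lambda>j\<in>I. X j x) = Pi\<^sub>M I D" .
  define A where "A = {x \<in> space (PiM I (\<lambda>_. borel :: real measure)). P x}"
  have setsD: "sets (PiM I D) = sets (PiM I (\<lambda>_. borel))"
    by (intro sets_PiM_cong) (auto simp: D_def)
  have A: "A \<in> sets (PiM I D)" using P unfolding A_def I_def[symmetric] setsD .
  have "emeasure (PiM I D) A = (\<integral>\<^sup>+x. indicator A x \<partial>PiM (insert i (I - {i})) D)"
    using A I by simp
  also have "\<dots> = (\<integral>\<^sup>+x. \<integral>\<^sup>+y. indicator A (x(i := y)) \<partial>D i \<partial>PiM (I - {i}) D)"
    using A I(2,3) by (intro product_nn_integral_insert) auto
  also have "\<dots> = (\<integral>\<^sup>+x. 0 \<partial>PiM (I - {i}) D)"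
  proof (intro nn_integral_cong)
    fix x
    show "(\<integral>\<^sup>+y. indicator A (x(i := y)) \<partial>D i) = 0"
    proof (cases "\<exists>c. x(i := c) \<in> A")
      case True
      then obtain c where c: "x(i := c) \<in> A" by blast
      have "indicator A (x(i := y)) \<le> (indicator {c} y :: ennreal)" for y
        using uniq[of "x(i := y)" "x(i := c)"] c by (auto simp: A_def indicator_def)
      then have "(\<integral>\<^sup>+y. indicator A (x(i := y)) \<partial>D i) \<le> (\<integral>\<^sup>+y. indicator {c} y \<partial>D i)"
        by (intro nn_integral_mono) auto
      also have "\<dots> = 0" using atom[of c] DX[of i] i by (simp add: I_def)
      finally show ?thesis by simp
    qed auto
  qed
  finally have "emeasure (distr M (Pi\<^sub>M I (\<lambda>_. borel)) (\<lambda>x. \<lambda>j\<in>I. X j x)) A = 0"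
    by (simp add: distr)
  then have "emeasure M ((\<lambda>x. \<lambda>j\<in>I. X j x) -` A \<inter> space M) = 0"
    using rvX A setsD by (subst (asm) emeasure_distr) (auto intro!: measurable_restrict)
  moreover have "(\<lambda>x. \<lambda>j\<in>I. X j x) -` A \<inter> space M \<in> sets M"
    using A setsD rvX by (intro measurable_sets[of _ _ "PiM I (\<lambda>_. borel)"] measurable_restrict) auto
  ultimately have "(\<lambda>x. \<lambda>j\<in>I. X j x) -` A \<inter> space M \<in> null_sets M" by auto
  then show ?thesis
    by (rule AE_I') (auto simp: A_def I_def space_PiM)
qed

text \<open>A sample with \<open>S = 0\<close> lies in one of finitely many events, according to
  which observation is the farthest from the estimate and on which side, or for the median which one
  is the largest. In each of them that observation is determined by the others. Uniqueness is proved
  as the absence of strict inequality and used in both directions.\<close>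

lemma (in prob_space) AE_S_stat_nonzero:
  fixes X :: "nat \<Rightarrow> 'a \<Rightarrow> real"
  assumes lam: "lam \<ge> 1" and n: "n \<ge> 3"
    and indep: "indep_vars (\<lambda>_. borel) X {..<n}"
    and atom: "\<And>i c. i < n \<Longrightarrow> emeasure (distr M borel (X i)) {c} = 0"
  shows "AE \<omega> in M. S_stat lam n (\<lambda>i. X i \<omega>) \<noteq> 0"
proof -
  have n0: "n > 0" using n by simp
  let ?B = "PiM {..<n} (\<lambda>_. borel :: real measure)"
  have comp [measurable]: "(\<lambda>x. x j) \<in> borel_measurable ?B" if "j < n" for j
    using that by simp
  have mu [measurable]: "(\<lambda>x. mu_hat lam n x) \<in> borel_measurable ?B"
    using mu_hat_measurable[OF lam n0, of "\<lambda>j x. x j" ?B] by simp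
  have sum [measurable]: "(\<lambda>x. \<Sum>j<n. spow lam (x j - mu_hat lam n x)) \<in> borel_measurable ?B"
    by (intro borel_measurable_sum measurable_compose[OF _ spow_measurable] borel_measurable_diff mu) auto
  define Z where "Z x \<longleftrightarrow> (\<Sum>j<n. spow lam (x j - mu_hat lam n x)) = 0" for x
  have setZ: "{x \<in> space ?B. Z x} \<in> sets ?B"
    unfolding Z_def using sum by (intro borel_measurable_eq) auto
  define R where "R i x \<longleftrightarrow> Z x \<and> (\<forall>j\<in>{..<n}. if lam = 1 then x j \<le> x i
     else \<bar>x j - mu_hat lam n x\<bar> \<le> x i - mu_hat lam n x)" for i x
  define L where "L i x \<longleftrightarrow> Z x \<and> (\<forall>j\<in>{..<n}. lam \<noteq> 1 \<and>
     \<bar>x j - mu_hat lam n x\<bar> \<le> mu_hat lam n x - x i)" for i x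
  have "AE \<omega> in M. \<not> R i (\<lambda>j\<in>{..<n}. X j \<omega>)" if i: "i < n" for i
  proof (rule AE_coordinate_determined[OF indep i atom[OF i]])
    have cj: "{x \<in> space ?B. if lam = 1 then x j \<le> x i else \<bar>x j - mu_hat lam n x\<bar> \<le> x i - mu_hat lam n x} \<in> sets ?B"
      if "j \<in> {..<n}" for j
      using comp[OF i] comp[of j] that by (cases "lam = 1") auto
    have all: "{x \<in> space ?B. \<forall>j\<in>{..<n}. if lam = 1 then x j \<le> x i
        else \<bar>x j - mu_hat lam n x\<bar> \<le> x i - mu_hat lam n x} \<in> sets ?B"
      by (rule sets.sets_Collect_finite_All'[OF cj]) (use n0 in auto)
    show "{x \<in> space ?B. R i x} \<in> sets ?B"
      unfolding R_def using sets.Int[OF setZ all] by (rule back_subst) auto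
    have uR: "\<not> x i < y i" if "R i x" "R i y" "\<And>j. j < n \<Longrightarrow> j \<noteq> i \<Longrightarrow> x j = y j" for x y
      using skewness_zero_unique_max[OF n i, of x y] skewness_zero_unique_right[OF _ n i, of lam x y] lam that
      unfolding R_def Z_def by (cases "lam = 1") auto
    show "x i = y i" if "R i x" "R i y" "\<And>j. j < n \<Longrightarrow> j \<noteq> i \<Longrightarrow> x j = y j" for x y
      using uR[OF that] uR[OF that(2,1) that(3)[symmetric]] by linarith
  qed
  moreover have "AE \<omega> in M. \<not> L i (\<lambda>j\<in>{..<n}. X j \<omega>)" if i: "i < n" for i
  proof (rule AE_coordinate_determined[OF indep i atom[OF i]])
    have cj: "{x \<in> space ?B. lam \<noteq> 1 \<and> \<bar>x j - mu_hat lam n x\<bar> \<le> mu_hat lam n x - x i} \<in> sets ?B"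
      if "j \<in> {..<n}" for j
      using comp[OF i] comp[of j] that by (cases "lam = 1") auto
    have all: "{x \<in> space ?B. \<forall>j\<in>{..<n}. lam \<noteq> 1 \<and>
        \<bar>x j - mu_hat lam n x\<bar> \<le> mu_hat lam n x - x i} \<in> sets ?B"
      by (rule sets.sets_Collect_finite_All'[OF cj]) (use n0 in auto)
    show "{x \<in> space ?B. L i x} \<in> sets ?B"
      unfolding L_def using sets.Int[OF setZ all] by (rule back_subst) auto
    have uL: "\<not> y i < x i" if "L i x" "L i y" "\<And>j. j < n \<Longrightarrow> j \<noteq> i \<Longrightarrow> x j = y j" for x y
      using skewness_zero_unique_left[OF _ n i, of lam x y] lam that n0
      unfolding L_def Z_def by (cases "lam = 1") auto
    show "x i = y i" if "L i x" "L i y" "\<And>j. j < n \<Longrightarrow> j \<noteq> i \<Longrightarrow> x j = y j" for x y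
      using uL[OF that] uL[OF that(2,1) that(3)[symmetric]] by linarith
  qed
  ultimately have "AE \<omega> in M. \<forall>i\<in>{..<n}. \<not> R i (\<lambda>j\<in>{..<n}. X j \<omega>) \<and> \<not> L i (\<lambda>j\<in>{..<n}. X j \<omega>)"
    by (intro AE_finite_allI) auto
  then show ?thesis
  proof (rule AE_mp, intro AE_I2 impI notI)
    fix \<omega> assume no: "\<forall>i\<in>{..<n}. \<not> R i (\<lambda>j\<in>{..<n}. X j \<omega>) \<and> \<not> L i (\<lambda>j\<in>{..<n}. X j \<omega>)"
      and S: "S_stat lam n (\<lambda>i. X i \<omega>) = 0"
    define x where "x = (\<lambda>j\<in>{..<n}. X j \<omega>)"
    have "S_stat lam n x = 0"
      using S sample_cong(2)[of n x "\<lambda>i. X i \<omega>" lam] by (simp add: x_def)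
    then have Zx: "Z x" unfolding Z_def by (rule S_stat_0_imp[OF _ n0])
    define f where "f j = (if lam = 1 then x j else \<bar>x j - mu_hat lam n x\<bar>)" for j
    have "Max (f ` {..<n}) \<in> f ` {..<n}" using n0 by (intro Max_in) auto
    then obtain i where "i < n" "Max (f ` {..<n}) = f i" by auto
    then have i: "i < n" "\<And>j. j < n \<Longrightarrow> f j \<le> f i"
      using Max_ge[of "f ` {..<n}"] by (metis finite_imageI finite_lessThan imageI lessThan_iff)+
    then have "R i x \<or> L i x"
      using Zx unfolding R_def L_def f_def by (cases "lam = 1"; cases "x i \<ge> mu_hat lam n x") auto
    then show False using no i(1) unfolding x_def by blast
  qed
qed

section \<open>Measurability of the test statistics\<close>

context
  fixes lam :: real and n :: nat and M :: "'a measure" and X :: "nat \<Rightarrow> 'a \<Rightarrow> real"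
  assumes lam: "lam \<ge> 1" and n: "n > 0" and X: "\<And>i. i < n \<Longrightarrow> X i \<in> borel_measurable M"
begin

lemma Y_hat_measurable:
  assumes i: "i < n"
  shows "(\<lambda>\<omega>. Y_hat lam n (\<lambda>i. X i \<omega>) i) \<in> borel_measurable M"
proof -
  note [measurable] = mu_hat_measurable[OF lam n X] X[OF i]
  have "(\<lambda>\<omega>. \<bar>X j \<omega> - mu_hat lam n (\<lambda>i. X i \<omega>)\<bar> powr lam) \<in> borel_measurable M" if "j \<in> {..<n}" for j
  proof -
    have [measurable]: "X j \<in> borel_measurable M" using X that by simp
    show ?thesis by measurable
  qed
  then have [measurable]: "(\<lambda>\<omega>. \<Sum>j<n. \<bar>X j \<omega> - mu_hat lam n (\<lambda>i. X i \<omega>)\<bar> powr lam) \<in> borel_measurable M"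
    by (rule borel_measurable_sum)
  show ?thesis unfolding Y_hat_def sigma_hat_def by measurable
qed

lemma S_stat_measurable: "(\<lambda>\<omega>. S_stat lam n (\<lambda>i. X i \<omega>)) \<in> borel_measurable M"
  unfolding S_stat_def
proof (intro borel_measurable_divide borel_measurable_sum borel_measurable_const)
  fix i assume "i \<in> {..<n}"
  then have [measurable]: "(\<lambda>\<omega>. Y_hat lam n (\<lambda>i. X i \<omega>) i) \<in> borel_measurable M"
    using Y_hat_measurable by simp
  show "(\<lambda>\<omega>. \<bar>Y_hat lam n (\<lambda>i. X i \<omega>) i\<bar> powr lam * sgn (Y_hat lam n (\<lambda>i. X i \<omega>) i)) \<in> borel_measurable M"
    by measurable
qed

lemma K_stat_measurable: "(\<lambda>\<omega>. K_stat lam n (\<lambda>i. X i \<omega>)) \<in> borel_measurable M"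
  unfolding K_stat_def
proof (intro borel_measurable_divide borel_measurable_sum borel_measurable_const)
  fix i assume "i \<in> {..<n}"
  then have [measurable]: "(\<lambda>\<omega>. Y_hat lam n (\<lambda>i. X i \<omega>) i) \<in> borel_measurable M"
    using Y_hat_measurable by simp
  show "(\<lambda>\<omega>. \<bar>Y_hat lam n (\<lambda>i. X i \<omega>) i\<bar> powr lam * ln \<bar>Y_hat lam n (\<lambda>i. X i \<omega>) i\<bar>) \<in> borel_measurable M"
    by measurable
qed

lemma Z_measurable:
  "(\<lambda>\<omega>. Z_S lam n (\<lambda>i. X i \<omega>)) \<in> borel_measurable M"
  "(\<lambda>\<omega>. Z_K_net lam n (\<lambda>i. X i \<omega>)) \<in> borel_measurable M"
  "(\<lambda>\<omega>. Z_star_K lam n (\<lambda>i. X i \<omega>)) \<in> borel_measurable M"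
proof -
  note [measurable] = S_stat_measurable K_stat_measurable
  show "(\<lambda>\<omega>. Z_S lam n (\<lambda>i. X i \<omega>)) \<in> borel_measurable M"
    "(\<lambda>\<omega>. Z_K_net lam n (\<lambda>i. X i \<omega>)) \<in> borel_measurable M"
    "(\<lambda>\<omega>. Z_star_K lam n (\<lambda>i. X i \<omega>)) \<in> borel_measurable M"
    unfolding Z_S_def Z_K_net_def Z_star_K_def K_net_def case_prod_beta by measurable
qed

end

lemma vector_2_eq: "(vector [a, b] :: real^2) = a *\<^sub>R axis 1 1 + b *\<^sub>R axis 2 1"
  by (simp add: vec_eq_iff forall_2 axis_def)

lemma vector_2_measurable [measurable]:
  "f \<in> borel_measurable M \<Longrightarrow> g \<in> borel_measurable M \<Longrightarrow>
    (\<lambda>x. vector [f x, g x] :: real^2) \<in> borel_measurable M"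
  unfolding vector_2_eq
  by (intro borel_measurable_add borel_measurable_scaleR borel_measurable_const)

section \<open>Moments of the exponential power distribution\<close>

definition epd_kernel :: "real \<Rightarrow> real \<Rightarrow> real" where
  "epd_kernel lam y = exp (- (\<bar>y\<bar> powr lam) / lam)"

text \<open>The value of the integral of \<open>y powr r * epd_kernel lam y\<close> over the
  positive half-line, that is, the Mellin transform of the kernel.\<close>

definition epd_mom :: "real \<Rightarrow> real \<Rightarrow> real" where
  "epd_mom lam r = lam powr ((r + 1) / lam - 1) * Gamma ((r + 1) / lam)"

text \<open>The substitution \<open>u = y powr lam / lam\<close> turns the integral into Euler's
  integral for \<open>Gamma ((r + 1) / lam)\<close>.\<close>

lemma half_line_moment:
  assumes lam: "lam > 0" and r: "r > -1"
  shows "has_bochner_integral lborel (\<lambda>y. indicator {0<..} y * (y powr r * epd_kernel lam y)) (epd_mom lam r)"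
proof -
  define p where "p = (r + 1) / lam"
  have p: "p > 0" "lam * p = r + 1" using lam r by (auto simp: p_def)
  define f where "f u = lam powr (p - 1) * (u powr (p - 1) / exp u)" for u
  define g where "g y = y powr lam / lam" for y
  define h where "h y = y powr r * epd_kernel lam y" for y
  have "((\<lambda>u. u powr (p - 1) / exp u) has_integral Gamma p) {0<..}"
    by (rule has_integral_spike_set_eq[THEN iffD1, OF _ _ Gamma_integral_real[OF p(1)]])
       (auto intro!: negligible_subset[OF negligible_sing[of 0]])
  then have int: "(f has_integral epd_mom lam r) {0<..}"
    unfolding f_def epd_mom_def p_def[symmetric] by (rule has_integral_mult_right)
  have f: "f absolutely_integrable_on {0<..} \<and> integral {0<..} f = epd_mom lam r"
    using int by (auto intro!: nonnegative_absolutely_integrable_1 has_integral_integrable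
        integral_unique simp: f_def)
  have img: "g ` {0<..} = {0<..}"
  proof (intro set_eqI iffI)
    fix u :: real assume "u \<in> {0<..}"
    then have "u = g ((lam * u) powr (1 / lam))" "(lam * u) powr (1 / lam) \<in> {0<..}"
      using lam by (auto simp: g_def powr_powr)
    then show "u \<in> g ` {0<..}" by blast
  qed (use lam in \<open>auto simp: g_def\<close>)
  have inj: "inj_on g {0<..}"
  proof (rule inj_onI)
    fix x y assume xy: "x \<in> {0<..}" "y \<in> {0<..}" "g x = g y"
    then have "(x powr lam) powr (1 / lam) = (y powr lam) powr (1 / lam)" using lam by (simp add: g_def)
    then show "x = y" using xy lam by (simp add: powr_powr)
  qed
  have der: "(g has_field_derivative y powr (lam - 1)) (at y within {0<..})" if "y \<in> {0<..}" for y
    unfolding g_def using that lam by (auto intro!: derivative_eq_intros)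
  have eq: "\<bar>y powr (lam - 1)\<bar> * f (g y) = h y" if "y \<in> {0<..}" for y
  proof -
    have y: "y > 0" using that by simp
    have "g y powr (p - 1) = y powr (lam * p - lam) * lam powr (1 - p)"
      using y lam by (simp add: g_def powr_divide powr_powr right_diff_distrib powr_minus_divide
          powr_diff)
    then have "y powr (lam - 1) * (lam powr (p - 1) * g y powr (p - 1)) = y powr r"
      using y lam p by (simp add: powr_add[symmetric] mult_ac)
    then have "\<bar>y powr (lam - 1)\<bar> * f (g y) = y powr r / exp (g y)"
      by (simp add: f_def mult.assoc[symmetric])
    then show ?thesis
      using y by (simp add: h_def epd_kernel_def g_def exp_minus divide_inverse)
  qed
  have "(\<lambda>y. \<bar>y powr (lam - 1)\<bar> * f (g y)) absolutely_integrable_on {0<..} \<and>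
      integral {0<..} (\<lambda>y. \<bar>y powr (lam - 1)\<bar> * f (g y)) = epd_mom lam r"
    using has_absolute_integral_change_of_variables_1'[of "{0<..}" g "\<lambda>y. y powr (lam - 1)" f "epd_mom lam r"]
      der inj f unfolding img by auto
  then have h: "h absolutely_integrable_on {0<..}" "integral {0<..} h = epd_mom lam r"
    using set_integrable_cong[of lebesgue lebesgue "{0<..}" "{0<..}" "\<lambda>y. \<bar>y powr (lam - 1)\<bar> * f (g y)" h]
      Henstock_Kurzweil_Integration.integral_cong[of "{0<..}" "\<lambda>y. \<bar>y powr (lam - 1)\<bar> * f (g y)" h] eq
    by simp_all
  \<comment> \<open>The change of variables takes place in the completed measure; Borel
    measurability of the integrand brings the result back to \<open>lborel\<close>.\<close>
  have meas: "(\<lambda>y. indicator {0<..} y *\<^sub>R h y) \<in> borel_measurable lborel"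
    unfolding h_def epd_kernel_def by measurable
  have "set_lebesgue_integral lebesgue {0<..} h = epd_mom lam r"
    using set_lebesgue_integral_eq_integral(2)[OF h(1)] h(2) by simp
  then have "integral\<^sup>L lborel (\<lambda>y. indicator {0<..} y *\<^sub>R h y) = epd_mom lam r"
    unfolding set_lebesgue_integral_def integral_completion[OF meas] .
  moreover have "integrable lborel (\<lambda>y. indicator {0<..} y *\<^sub>R h y)"
    using h(1) unfolding set_integrable_def integrable_completion[OF meas] .
  ultimately show ?thesis
    by (simp add: has_bochner_integral_iff h_def)
qed

text \<open>The inequality \<open>ln x \<le> x - 1\<close> at \<open>u powr a\<close> controls large
  \<open>u\<close>, and at the reciprocal small \<open>u\<close>.\<close>

lemma abs_ln_le:
  fixes u :: real
  assumes "u > 0" "a > 0"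
  shows "\<bar>ln u\<bar> \<le> (u powr a + u powr (- a)) / a"
proof -
  have "a * ln u = ln (u powr a)" using assms by (simp add: powr_def)
  also have "\<dots> \<le> u powr a" using ln_le_minus_one[of "u powr a"] assms by simp
  finally have 1: "a * ln u \<le> u powr a" .
  have "- a * ln u = ln (u powr (- a))" using assms by (simp add: powr_def)
  also have "\<dots> \<le> u powr (- a)" using ln_le_minus_one[of "u powr (- a)"] assms by simp
  finally have 2: "- a * ln u \<le> u powr (- a)" by simp
  have "a * \<bar>ln u\<bar> \<le> u powr a + u powr (- a)"
    using 1 2 by (cases "ln u \<ge> 0") (auto intro: add_increasing add_increasing2)
  then show ?thesis using assms by (simp add: pos_le_divide_eq mult.commute)
qed

text \<open>A bound uniform in the step \<open>h\<close>, used as a dominating function. The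
  logarithm and the growth of the power each cost the exponents \<open>a\<close> and
  \<open>- a\<close>, so their product reaches \<open>2 * a\<close> and
  \<open>- (2 * a)\<close>.\<close>

lemma powr_diff_quotient_le:
  fixes u :: real
  assumes u: "u > 0" and h: "0 < h" "h \<le> a"
  shows "\<bar>(u powr h - 1) / h\<bar> \<le> (u powr (2 * a) + 2 + u powr (- (2 * a))) / a"
proof -
  have "\<bar>u powr h - 1\<bar> \<le> h * \<bar>ln u\<bar> * max 1 (u powr h)"
  proof -
    have "\<bar>exp t - 1\<bar> \<le> \<bar>t\<bar> * max 1 (exp t)" for t :: real
    proof (cases "t \<ge> 0")
      case True
      have "1 - exp (-t) \<le> t" using exp_ge_add_one_self[of "-t"] by simp
      then have "exp t * (1 - exp (-t)) \<le> exp t * t" by (intro mult_left_mono) auto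
      then show ?thesis using True by (simp add: algebra_simps exp_minus max_def)
    next
      case False
      then have "\<bar>exp t - 1\<bar> = 1 - exp t" "max 1 (exp t) = 1" by auto
      moreover have "1 - exp t \<le> - t" using exp_ge_add_one_self[of t] by linarith
      ultimately show ?thesis using False by simp
    qed
    from this[of "h * ln u"] show ?thesis using u h by (simp add: powr_def abs_mult)
  qed
  then have "\<bar>(u powr h - 1) / h\<bar> \<le> \<bar>ln u\<bar> * max 1 (u powr h)"
    using h by (simp add: abs_divide divide_le_eq mult_ac)
  also have "\<dots> \<le> (u powr a + u powr (- a)) / a * (u powr a + u powr (- a))"
  proof (intro mult_mono abs_ln_le)
    have "u powr h \<le> u powr a + u powr (-a)" "1 \<le> u powr a + u powr (-a)"
    proof -
      have t: "u powr a > 0" "u powr (- a) = 1 / u powr a" using u by (auto simp: powr_minus_divide)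
      have "1 \<le> t + 1 / t" if "t > 0" for t :: real
        using that by (cases "t \<ge> 1") (auto simp: add_increasing2 add_increasing)
      with t show "1 \<le> u powr a + u powr (-a)" by metis
      show "u powr h \<le> u powr a + u powr (-a)"
      proof (cases "u \<ge> 1")
        case True
        then have "u powr h \<le> u powr a" using h by (intro powr_mono) auto
        then show ?thesis by (simp add: add_increasing2)
      next
        case False
        then have "u powr h \<le> 1" using u h by (intro powr_le1) auto
        with \<open>1 \<le> u powr a + u powr (-a)\<close> show ?thesis by linarith
      qed
    qed
    then show "max 1 (u powr h) \<le> u powr a + u powr (- a)" by simp
  qed (use u h in auto)
  also have "\<dots> = (u powr (2 * a) + 2 + u powr (- (2 * a))) / a"
  proof -
    have "(x + y) / a * (x + y) = (x * x + 2 * (x * y) + y * y) / a" for x y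
      by (simp add: algebra_simps add_divide_distrib)
    then have "(u powr a + u powr (- a)) / a * (u powr a + u powr (- a)) =
      (u powr a * u powr a + 2 * (u powr a * u powr (- a)) + u powr (- a) * u powr (- a)) / a" .
    moreover have "u powr a * u powr a = u powr (2 * a)" "u powr (- a) * u powr (- a) = u powr (- (2 * a))"
      "u powr a * u powr (- a) = 1"
      using u by (simp_all add: powr_add[symmetric])
    ultimately show ?thesis by simp
  qed
  finally show ?thesis .
qed

text \<open>Differentiation under the integral sign with respect to the exponent brings down
  \<open>ln y\<close>. The difference quotients are dominated by the integrands at the exponents
  \<open>r - e\<close>, \<open>r\<close> and \<open>r + e\<close>, and the known derivative of
  \<open>G\<close> gives the value.\<close>

lemma mellin_derivative:
  fixes w :: "real \<Rightarrow> real" and G :: "real \<Rightarrow> real"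
  assumes e: "e > 0" and w: "\<And>y. y \<le> 0 \<Longrightarrow> w y = 0" "w \<in> borel_measurable borel"
    and G: "\<And>s. \<bar>s - r\<bar> \<le> e \<Longrightarrow> has_bochner_integral lborel (\<lambda>y. y powr s * w y) (G s)"
    and D: "(G has_real_derivative D) (at r)"
  shows "has_bochner_integral lborel (\<lambda>y. y powr r * (ln y * w y)) D"
proof -
  \<comment> \<open>Half of \<open>e\<close>, because the quotient bound doubles the
    exponent.\<close>
  define a where "a = e / 2"
  have a: "a > 0" "2 * a = e" using e by (auto simp: a_def)
  define h where "h k = a / real (Suc k)" for k :: nat
  have h: "0 < h k" "h k \<le> a" for k using a(1) by (auto simp: h_def field_simps)
  have h0: "h \<longlonglongrightarrow> 0" unfolding h_def by (intro LIMSEQ_Suc[of "\<lambda>n. a / real n"] lim_const_over_n)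
  note [measurable] = w(2)
  define s where "s k y = (y powr (r + h k) * w y - y powr r * w y) / h k" for k y
  have sh: "s k y = y powr r * w y * ((y powr h k - 1) / h k)" for k y
    using w(1)[of y] by (cases "y > 0") (auto simp: s_def powr_add field_simps)
  have Gk: "has_bochner_integral lborel (\<lambda>y. y powr (r + h k) * w y) (G (r + h k))" for k
    using h[of k] a by (intro G) auto
  have Gr: "has_bochner_integral lborel (\<lambda>y. y powr r * w y) (G r)" using e by (intro G) auto
  have isum: "integral\<^sup>L lborel (s k) = (G (r + h k) - G r) / h k" for k
    unfolding s_def using Gk[of k] Gr by (simp add: has_bochner_integral_iff)
  have "filterlim h (at 0) sequentially"
    unfolding filterlim_at using h0 h by (auto intro!: always_eventually simp: less_imp_neq[symmetric])
  then have Dlim: "(\<lambda>k. integral\<^sup>L lborel (s k)) \<longlonglongrightarrow> D"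
    using filterlim_compose[OF D[unfolded DERIV_def]] unfolding isum by blast
  define W where "W y = (y powr (r + e) * \<bar>w y\<bar> + 2 * (y powr r * \<bar>w y\<bar>) + y powr (r - e) * \<bar>w y\<bar>) / a" for y
  have iabs: "integrable lborel (\<lambda>y. y powr q * \<bar>w y\<bar>)" if "\<bar>q - r\<bar> \<le> e" for q
    using integrable_abs[of lborel "\<lambda>y. y powr q * w y"] G[OF that]
    by (simp add: has_bochner_integral_iff abs_mult)
  have W: "integrable lborel W"
    unfolding W_def using e iabs[of "r + e"] iabs[of r] iabs[of "r - e"] by auto
  have bound: "norm (s k y) \<le> W y" for k y
  proof (cases "y > 0")
    case True
    have "norm (s k y) = y powr r * \<bar>w y\<bar> * \<bar>(y powr h k - 1) / h k\<bar>"
      by (simp add: sh abs_mult)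
    also have "\<dots> \<le> y powr r * \<bar>w y\<bar> * ((y powr (2 * a) + 2 + y powr (- (2 * a))) / a)"
      by (intro mult_left_mono powr_diff_quotient_le True h) auto
    also have "\<dots> = W y"
      unfolding a(2) W_def using True by (simp add: powr_add powr_diff powr_minus_divide field_simps)
    finally show ?thesis .
  qed (use w(1)[of y] in \<open>simp add: s_def W_def\<close>)
  have lim: "(\<lambda>k. s k y) \<longlonglongrightarrow> y powr r * (ln y * w y)" for y
  proof (cases "y > 0")
    case True
    have "((\<lambda>t. y powr t) has_real_derivative ln y) (at 0)"
      using True by (auto intro!: derivative_eq_intros)
    then have "((\<lambda>t. (y powr t - 1) / t) \<longlongrightarrow> ln y) (at 0)"
      using True by (simp add: has_field_derivative_iff)
    then have "(\<lambda>k. (y powr h k - 1) / h k) \<longlonglongrightarrow> ln y"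
      using \<open>filterlim h (at 0) sequentially\<close> by (rule filterlim_compose)
    from tendsto_mult_left[OF this, of "y powr r * w y"]
    have "(\<lambda>k. s k y) \<longlonglongrightarrow> y powr r * w y * ln y" by (simp only: sh)
    also have "y powr r * w y * ln y = y powr r * (ln y * w y)" by simp
    finally show ?thesis .
  qed (use w(1)[of y] in \<open>simp add: s_def\<close>)
  have meas: "s k \<in> borel_measurable lborel" for k unfolding s_def by measurable
  have "integrable lborel (\<lambda>y. y powr r * (ln y * w y))"
    by (rule integrable_dominated_convergence[where w=W and s=s]) (use W meas lim bound in auto)
  moreover have "(\<lambda>k. integral\<^sup>L lborel (s k)) \<longlonglongrightarrow> integral\<^sup>L lborel (\<lambda>y. y powr r * (ln y * w y))"
    by (rule integral_dominated_convergence[where w=W]) (use W meas lim bound in auto)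
  ultimately show ?thesis
    using LIMSEQ_unique[OF Dlim] by (simp add: has_bochner_integral_iff)
qed

text \<open>The derivative of \<open>epd_mom lam\<close> in the exponent, hence the moment with one
  factor \<open>ln y\<close>; differentiating once more gives \<open>epd_mom2\<close> and the
  squared logarithm.\<close>

definition epd_mom1 :: "real \<Rightarrow> real \<Rightarrow> real" where
  "epd_mom1 lam r = epd_mom lam r * ((ln lam + Digamma ((r + 1) / lam)) / lam)"

definition epd_mom2 :: "real \<Rightarrow> real \<Rightarrow> real" where
  "epd_mom2 lam r = epd_mom lam r *
     (((ln lam + Digamma ((r + 1) / lam)) / lam)\<^sup>2 + Polygamma 1 ((r + 1) / lam) / lam\<^sup>2)"

lemma pos_not_nonpos_Int: "x > (0::real) \<Longrightarrow> x \<notin> \<int>\<^sub>\<le>\<^sub>0"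
  by (auto elim!: nonpos_Ints_cases)

lemma epd_mom_deriv:
  assumes lam: "lam > 0" and r: "r > -1"
  shows "(epd_mom lam has_real_derivative epd_mom1 lam r) (at r)"
    and "(epd_mom1 lam has_real_derivative epd_mom2 lam r) (at r)"
proof -
  have n: "(r + 1) / lam \<notin> \<int>\<^sub>\<le>\<^sub>0"
    using lam r by (intro pos_not_nonpos_Int) simp
  show 1: "(epd_mom lam has_real_derivative epd_mom1 lam r) (at r)"
    unfolding epd_mom_def[abs_def] epd_mom1_def using lam n
    by (auto intro!: derivative_eq_intros simp: field_simps)
  have P: "((\<lambda>r. Digamma ((r + 1) / lam)) has_real_derivative Polygamma 1 ((r + 1) / lam) / lam) (at r)"
  proof -
    have "((\<lambda>r. (r + 1) / lam) has_real_derivative 1 / lam) (at r)"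
      using lam by (auto intro!: derivative_eq_intros)
    from DERIV_chain2[OF has_field_derivative_Polygamma[OF n, of 0] this] show ?thesis by simp
  qed
  show "(epd_mom1 lam has_real_derivative epd_mom2 lam r) (at r)"
    unfolding epd_mom1_def[abs_def] epd_mom2_def
    using DERIV_mult[OF 1 DERIV_cdivide[OF DERIV_add[OF DERIV_const P, of "ln lam"], of lam]]
    by (rule back_subst) (use lam in \<open>simp add: epd_mom1_def field_simps power2_eq_square\<close>)
qed

lemma half_line_log_moments:
  assumes lam: "lam > 0" and r: "r > -1"
  shows "has_bochner_integral lborel (\<lambda>y. y powr r * (ln y * (indicator {0<..} y * epd_kernel lam y))) (epd_mom1 lam r)"
    and "has_bochner_integral lborel (\<lambda>y. y powr r * (ln y * (ln y * (indicator {0<..} y * epd_kernel lam y)))) (epd_mom2 lam r)"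
proof -
  have [measurable]: "epd_kernel lam \<in> borel_measurable borel"
    unfolding epd_kernel_def by measurable
  have 1: "has_bochner_integral lborel (\<lambda>y. y powr r * (ln y * (indicator {0<..} y * epd_kernel lam y))) (epd_mom1 lam r)"
    if "r > -1" for r
  \<comment> \<open>This radius keeps all exponents above -1, the range in which the moments
    exist.\<close>
  proof (rule mellin_derivative[where G="epd_mom lam" and e="(r + 1) / 2"])
    show "has_bochner_integral lborel (\<lambda>y. y powr s * (indicator {0<..} y * epd_kernel lam y)) (epd_mom lam s)"
      if "\<bar>s - r\<bar> \<le> (r + 1) / 2" for s
    proof -
      have "s > -1" using that \<open>r > -1\<close> by (auto simp: abs_if field_simps split: if_splits)
      from half_line_moment[OF lam this] show ?thesis by (simp add: mult_ac)
    qed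
    show "(epd_mom lam has_real_derivative epd_mom1 lam r) (at r)"
      by (rule epd_mom_deriv[OF lam that])
  qed (use that in auto)
  from 1[OF r] show "has_bochner_integral lborel (\<lambda>y. y powr r * (ln y * (indicator {0<..} y * epd_kernel lam y))) (epd_mom1 lam r)" .
  show "has_bochner_integral lborel (\<lambda>y. y powr r * (ln y * (ln y * (indicator {0<..} y * epd_kernel lam y)))) (epd_mom2 lam r)"
  proof (rule mellin_derivative[where G="epd_mom1 lam" and e="(r + 1) / 2"])
    show "has_bochner_integral lborel (\<lambda>y. y powr s * (ln y * (indicator {0<..} y * epd_kernel lam y))) (epd_mom1 lam s)"
      if "\<bar>s - r\<bar> \<le> (r + 1) / 2" for s
    proof -
      have "s > -1" using that r by (auto simp: abs_if field_simps split: if_splits)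
      from 1[OF this] show ?thesis .
    qed
    show "(epd_mom1 lam has_real_derivative epd_mom2 lam r) (at r)"
      by (rule epd_mom_deriv[OF lam r])
  qed (use r in auto)
qed

section \<open>Recurrences for the moments and positivity of the limiting constants\<close>

lemma Gamma_plus1_real: "x > 0 \<Longrightarrow> Gamma (x + 1) = x * Gamma (x::real)"
  by (intro Gamma_plus1) (auto elim!: nonpos_Ints_cases)

lemma epd_mom_pos: "lam > 0 \<Longrightarrow> r > -1 \<Longrightarrow> epd_mom lam r > 0"
  unfolding epd_mom_def by (intro mult_pos_pos Gamma_real_pos) auto

lemma epd_mom_plus:
  assumes "lam > 0" "r > -1"
  shows "epd_mom lam (r + lam) = (r + 1) * epd_mom lam r"
proof -
  have "(r + lam + 1) / lam = (r + 1) / lam + 1" using assms by (simp add: field_simps)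
  moreover have "(r + 1) / lam > 0" using assms by simp
  moreover have "lam powr ((r + 1) / lam) = lam * lam powr ((r + 1) / lam - 1)"
    using assms by (simp add: powr_diff)
  ultimately show ?thesis
    using assms by (simp add: epd_mom_def Gamma_plus1_real)
qed

lemma epd_mom_base:
  assumes "lam > 0"
  shows "epd_mom lam lam = epd_mom lam 0" "epd_mom lam (2 * lam) = (1 + lam) * epd_mom lam 0"
  using epd_mom_plus[OF assms, of 0] epd_mom_plus[OF assms, of lam] assms by (auto simp: mult_2 algebra_simps)

text \<open>Mean value theorem for \<open>ln_Gamma\<close> over a unit interval, where the increment
  is \<open>ln x\<close>. At \<open>x = 1 / lam\<close> it yields \<open>E_K lam > 0\<close>,
  without which the fourth root could not be linearized.\<close>

lemma Digamma_plus1_gt_ln: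
  assumes "x > (0::real)"
  shows "Digamma (x + 1) > ln x"
proof -
  have "\<exists>z. x < z \<and> z < x + 1 \<and> ln_Gamma (x + 1) - ln_Gamma x = (x + 1 - x) * Digamma z"
    by (rule MVT2) (use assms in \<open>auto intro!: derivative_eq_intros\<close>)
  then obtain z where z: "x < z" "z < x + 1" "ln_Gamma (x + 1) - ln_Gamma x = Digamma z" by auto
  have "ln_Gamma (x + 1) - ln_Gamma x = ln x"
    using assms ln_mult_pos[OF assms Gamma_real_pos[OF assms]] by (simp add: ln_Gamma_real_pos Gamma_plus1_real)
  then show ?thesis using z assms Digamma_real_strict_mono[of z "x + 1"] by simp
qed

text \<open>Mean value theorem for \<open>Digamma\<close> over a unit interval, where the increment
  is \<open>1 / x\<close>. At \<open>x = 1 + 1 / lam\<close> it yields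
  \<open>V_K lam > 0\<close>.\<close>

lemma Polygamma_1_gt:
  assumes "x > (0::real)"
  shows "x * Polygamma 1 x > 1"
proof -
  have "\<exists>z. x < z \<and> z < x + 1 \<and> Digamma (x + 1) - Digamma x = (x + 1 - x) * Polygamma 1 z"
    by (rule MVT2) (use assms in \<open>auto intro!: derivative_eq_intros elim!: nonpos_Ints_cases\<close>)
  then obtain z where z: "x < z" "z < x + 1" "Digamma (x + 1) - Digamma x = Polygamma 1 z" by auto
  then have "1 / x = Polygamma 1 z" using assms by (simp add: Digamma_plus1)
  moreover have "Polygamma 1 z < Polygamma 1 x"
    using z assms by (intro Polygamma_real_strict_antimono) auto
  ultimately have "x * (1 / x) < x * Polygamma 1 x" using assms by (intro mult_strict_left_mono) auto
  then show ?thesis using assms by simp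
qed

lemma E_K_eq: "lam > 0 \<Longrightarrow> E_K lam = (ln lam + Digamma (1 / lam + 1)) / lam"
  by (simp add: E_K_def Digamma_plus1)

lemma E_K_pos: "lam > 0 \<Longrightarrow> E_K lam > 0"
  using Digamma_plus1_gt_ln[of "1 / lam"] by (simp add: E_K_eq ln_div)

lemma V_K_pos: "lam > 0 \<Longrightarrow> V_K lam > 0"
  unfolding V_K_def using Polygamma_1_gt[of "1 + 1 / lam"] by (simp add: add_pos_pos)

text \<open>The shift formulas for \<open>Digamma\<close> and \<open>Polygamma 1\<close> reduce the
  argument \<open>1 / lam + 2\<close> to \<open>1 / lam + 1\<close>, in which \<open>E_K\<close> and
  \<open>V_K\<close> are expressed. These are the logarithmic moments behind the variance of the
  kurtosis statistic.\<close>

lemma epd_mom1_base: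
  assumes lam: "lam > 0"
  shows "epd_mom1 lam lam = epd_mom lam 0 * E_K lam"
    and "epd_mom1 lam (2 * lam) = epd_mom lam 0 * ((1 + lam) * E_K lam + 1)"
    and "epd_mom2 lam (2 * lam) = epd_mom lam 0 * (V_K lam + (E_K lam)\<^sup>2 + (E_K lam + 1 / lam) * (lam * E_K lam + 1))"
proof -
  define d where "d = Digamma (1 / lam + 1)"
  define t where "t = Polygamma 1 (1 / lam + 1)"
  have x: "(lam + 1) / lam = 1 / lam + 1" "(2 * lam + 1) / lam = (1 / lam + 1) + 1"
    using lam by (auto simp: field_simps)
  have nz: "1 / lam + 1 \<noteq> 0" using lam by (simp add: add_pos_pos less_imp_neq[symmetric])
  have D: "Digamma (1 / lam + 1 + 1) = d + lam / (1 + lam)"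
    unfolding d_def using nz lam by (subst Digamma_plus1) (auto simp: field_simps)
  have T: "Polygamma 1 (1 / lam + 1 + 1) = t - lam\<^sup>2 / (1 + lam)\<^sup>2"
    unfolding t_def using nz lam by (subst Polygamma_plus1) (auto simp: field_simps power2_eq_square)
  have E: "E_K lam = (ln lam + d) / lam" using E_K_eq[OF lam] by (simp add: d_def)
  have V: "V_K lam = ((1 + 1 / lam) * t - 1) / lam" by (simp add: V_K_def t_def add.commute)
  have l: "1 + lam \<noteq> 0" "lam \<noteq> 0" using lam by auto
  have aux: "a * b = c \<Longrightarrow> a * m * b = m * c" for a b c m :: real by auto
  show "epd_mom1 lam lam = epd_mom lam 0 * E_K lam"
    unfolding epd_mom1_def x E d_def using epd_mom_base[OF lam] by simp
  show "epd_mom1 lam (2 * lam) = epd_mom lam 0 * ((1 + lam) * E_K lam + 1)"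
  proof -
    have "(1 + lam) * ((L + lam / (1 + lam)) / lam) = (1 + lam) * (L / lam) + 1" for L
    proof -
      have "(1 + lam) * (L + lam / (1 + lam)) = (1 + lam) * L + lam"
        using l by (simp add: distrib_left)
      then have "(1 + lam) * (L + lam / (1 + lam)) / lam = (1 + lam) * L / lam + 1"
        using l(2) by (metis add_divide_distrib divide_self)
      then show ?thesis by (simp only: times_divide_eq_right)
    qed
    from this[of "ln lam + d"] show ?thesis
      unfolding epd_mom1_def x D E epd_mom_base[OF lam] unfolding add.assoc by (rule aux)
  qed
  have "(1 + lam) * (((L + lam / (1 + lam)) / lam)\<^sup>2 + (t - lam\<^sup>2 / (1 + lam)\<^sup>2) / lam\<^sup>2)
      = ((1 + 1 / lam) * t - 1) / lam + (L / lam)\<^sup>2 + (L / lam + 1 / lam) * (L + 1)" for L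
  proof -
    have "(1 + lam) * (((L + lam / (1 + lam)) / lam)\<^sup>2 + (t - lam\<^sup>2 / (1 + lam)\<^sup>2) / lam\<^sup>2)
       = (1 + lam) * (L\<^sup>2 / lam\<^sup>2 + 2 * L / (lam * (1 + lam)) + t / lam\<^sup>2)"
      using l by (simp add: power2_eq_square add_divide_distrib diff_divide_distrib algebra_simps)
    also have "\<dots> = (1 + lam) * L\<^sup>2 / lam\<^sup>2 + 2 * L / lam + (1 + lam) * t / lam\<^sup>2"
    proof -
      have "(1 + lam) * (2 * L / (lam * (1 + lam))) = 2 * L / lam" using l by simp
      then show ?thesis by (simp only: distrib_left times_divide_eq_right)
    qed
    also have "\<dots> = ((1 + 1 / lam) * t - 1) / lam + (L / lam)\<^sup>2 + (L / lam + 1 / lam) * (L + 1)"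
      using l by (simp add: power2_eq_square field_simps)
    finally show ?thesis .
  qed
  from this[of "ln lam + d"] show "epd_mom2 lam (2 * lam) = epd_mom lam 0 * (V_K lam + (E_K lam)\<^sup>2 + (E_K lam + 1 / lam) * (lam * E_K lam + 1))"
    unfolding epd_mom2_def x D T E V epd_mom_base[OF lam] using l by (intro aux) (simp add: add.assoc)
qed

section \<open>From half-line integrals to the null law\<close>

lemma epd_kernel_measurable [measurable]: "epd_kernel lam \<in> borel_measurable borel"
  unfolding epd_kernel_def by measurable

lemma epd_kernel_pos: "epd_kernel lam y > 0"
  by (simp add: epd_kernel_def)

lemma epd_kernel_minus: "epd_kernel lam (- y) = epd_kernel lam y"
  by (simp add: epd_kernel_def)

lemma whole_line_even:
  fixes f :: "real \<Rightarrow> real"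
  assumes "has_bochner_integral lborel (\<lambda>y. indicator {0<..} y * f y) v" "f 0 = 0" "\<And>y. f (- y) = f y"
  shows "has_bochner_integral lborel f (2 * v)"
proof -
  have "(\<lambda>y. indicator {0<..} y * f y) = (\<lambda>y. indicator {0..} y *\<^sub>R f y)"
    using assms(2) by (auto simp: indicator_def fun_eq_iff less_le)
  with assms(1) have "has_bochner_integral lborel (\<lambda>y. indicator {0..} y *\<^sub>R f y) v" by simp
  from has_bochner_integral_even_function[OF this assms(3)] show ?thesis by simp
qed

lemma whole_line_moments:
  assumes lam: "lam > 0" and r: "r > -1"
  shows "has_bochner_integral lborel (\<lambda>y. \<bar>y\<bar> powr r * epd_kernel lam y) (2 * epd_mom lam r)"
    and "has_bochner_integral lborel (\<lambda>y. \<bar>y\<bar> powr r * ln \<bar>y\<bar> * epd_kernel lam y) (2 * epd_mom1 lam r)"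
    and "has_bochner_integral lborel (\<lambda>y. \<bar>y\<bar> powr r * (ln \<bar>y\<bar>)\<^sup>2 * epd_kernel lam y) (2 * epd_mom2 lam r)"
proof -
  have eq: "(\<lambda>y. indicator {0<..} y * (\<bar>y\<bar> powr r * epd_kernel lam y)) = (\<lambda>y. indicator {0<..} y * (y powr r * epd_kernel lam y))"
    "(\<lambda>y. indicator {0<..} y * (\<bar>y\<bar> powr r * ln \<bar>y\<bar> * epd_kernel lam y)) = (\<lambda>y. y powr r * (ln y * (indicator {0<..} y * epd_kernel lam y)))"
    "(\<lambda>y. indicator {0<..} y * (\<bar>y\<bar> powr r * (ln \<bar>y\<bar>)\<^sup>2 * epd_kernel lam y)) = (\<lambda>y. y powr r * (ln y * (ln y * (indicator {0<..} y * epd_kernel lam y))))"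
    by (auto simp: indicator_def power2_eq_square)
  show "has_bochner_integral lborel (\<lambda>y. \<bar>y\<bar> powr r * epd_kernel lam y) (2 * epd_mom lam r)"
    by (rule whole_line_even) (use half_line_moment[OF lam r] eq in \<open>auto simp: epd_kernel_minus\<close>)
  show "has_bochner_integral lborel (\<lambda>y. \<bar>y\<bar> powr r * ln \<bar>y\<bar> * epd_kernel lam y) (2 * epd_mom1 lam r)"
    by (rule whole_line_even) (use half_line_log_moments[OF lam r] eq in \<open>auto simp: epd_kernel_minus\<close>)
  show "has_bochner_integral lborel (\<lambda>y. \<bar>y\<bar> powr r * (ln \<bar>y\<bar>)\<^sup>2 * epd_kernel lam y) (2 * epd_mom2 lam r)"
    by (rule whole_line_even) (use half_line_log_moments[OF lam r] eq in \<open>auto simp: epd_kernel_minus\<close>)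
qed

lemma AE_neq_0: "AE y in lborel. y \<noteq> (0::real)"
  by (rule AE_lborel_singleton)

lemma has_bochner_kernel:
  assumes "lam > 0"
  shows "has_bochner_integral lborel (epd_kernel lam) (2 * epd_mom lam 0)"
proof -
  have "has_bochner_integral lborel (\<lambda>y. \<bar>y\<bar> powr 0 * epd_kernel lam y) (2 * epd_mom lam 0)"
    using assms by (intro whole_line_moments) auto
  moreover have "AE y in lborel. \<bar>y\<bar> powr 0 * epd_kernel lam y = epd_kernel lam y"
    using AE_neq_0 by eventually_elim simp
  ultimately show ?thesis
    by (subst has_bochner_integral_cong_AE[symmetric, rotated 2]) auto
qed

text \<open>The law of a standardized observation under the null hypothesis;
  \<open>2 * epd_mom lam 0\<close> is the total mass of the kernel.\<close>

definition epd :: "real \<Rightarrow> real measure" where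
  "epd lam = density lborel (\<lambda>y. ennreal (epd_kernel lam y / (2 * epd_mom lam 0)))"

lemma sets_epd [simp, measurable_cong]: "sets (epd lam) = sets borel"
  by (simp add: epd_def)

lemma space_epd [simp]: "space (epd lam) = UNIV"
  by (simp add: epd_def)

lemma has_bochner_epd:
  assumes lam: "lam > 0" and g: "g \<in> borel_measurable borel"
    and "has_bochner_integral lborel (\<lambda>y. g y * epd_kernel lam y) v"
  shows "has_bochner_integral (epd lam) g (v / (2 * epd_mom lam 0))"
proof -
  have m: "epd_mom lam 0 > 0" using lam by (intro epd_mom_pos) auto
  have "has_bochner_integral lborel (\<lambda>y. (g y * epd_kernel lam y) / (2 * epd_mom lam 0)) (v / (2 * epd_mom lam 0))"
    by (rule has_bochner_integral_divide_zero) (use assms in auto)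
  then have "has_bochner_integral lborel (\<lambda>y. (epd_kernel lam y / (2 * epd_mom lam 0)) *\<^sub>R g y) (v / (2 * epd_mom lam 0))"
    by (simp add: mult.commute)
  then show ?thesis unfolding epd_def
    using g m by (intro has_bochner_integral_density) (auto simp: less_imp_le epd_kernel_pos)
qed

lemma integral_epd:
  fixes g :: "real \<Rightarrow> real"
  assumes lam: "lam > 0" and g: "g \<in> borel_measurable borel"
  shows "integral\<^sup>L (epd lam) g = (\<integral>y. g y * epd_kernel lam y \<partial>lborel) / (2 * epd_mom lam 0)"
    and "integrable (epd lam) g \<longleftrightarrow> integrable lborel (\<lambda>y. g y * epd_kernel lam y)"
proof -
  have m: "epd_mom lam 0 > 0" using lam by (intro epd_mom_pos) auto
  show "integral\<^sup>L (epd lam) g = (\<integral>y. g y * epd_kernel lam y \<partial>lborel) / (2 * epd_mom lam 0)"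
    unfolding epd_def using g m
    by (subst integral_density) (auto simp: less_imp_le epd_kernel_pos mult.commute)
  show "integrable (epd lam) g \<longleftrightarrow> integrable lborel (\<lambda>y. g y * epd_kernel lam y)"
  proof -
    have "integrable (epd lam) g \<longleftrightarrow> integrable lborel (\<lambda>y. (epd_kernel lam y / (2 * epd_mom lam 0)) *\<^sub>R g y)"
      unfolding epd_def using g m
      by (subst integrable_density) (auto simp: less_imp_le epd_kernel_pos)
    moreover have "(epd_kernel lam y / (2 * epd_mom lam 0)) *\<^sub>R g y = inverse (2 * epd_mom lam 0) * (g y * epd_kernel lam y)" for y
      unfolding divide_inverse real_scaleR_def by (simp only: mult_ac)
    moreover have "inverse (2 * epd_mom lam 0) \<noteq> 0" using m by simp
    ultimately show ?thesis by (simp only: integrable_mult_left_iff) simp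
  qed
qed

lemma prob_space_epd: "lam > 0 \<Longrightarrow> prob_space (epd lam)"
proof
  assume lam: "lam > 0"
  have m: "epd_mom lam 0 > 0" using lam by (intro epd_mom_pos) auto
  have "emeasure (epd lam) UNIV = (\<integral>\<^sup>+y. ennreal (epd_kernel lam y / (2 * epd_mom lam 0)) \<partial>lborel)"
    unfolding epd_def by (subst emeasure_density) auto
  also have "\<dots> = ennreal (\<integral>y. epd_kernel lam y / (2 * epd_mom lam 0) \<partial>lborel)"
    using has_bochner_kernel[OF lam] m
    by (intro nn_integral_eq_integral) (auto simp: has_bochner_integral_iff less_imp_le epd_kernel_pos)
  also have "\<dots> = 1"
    using has_bochner_kernel[OF lam] m by (simp add: has_bochner_integral_iff)
  finally show "emeasure (epd lam) (space (epd lam)) = 1" by simp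
qed

lemma epd_moments:
  assumes lam: "lam > 0" and r: "r > -1"
  shows "has_bochner_integral (epd lam) (\<lambda>y. \<bar>y\<bar> powr r) (epd_mom lam r / epd_mom lam 0)"
    and "has_bochner_integral (epd lam) (\<lambda>y. \<bar>y\<bar> powr r * ln \<bar>y\<bar>) (epd_mom1 lam r / epd_mom lam 0)"
    and "has_bochner_integral (epd lam) (\<lambda>y. \<bar>y\<bar> powr r * (ln \<bar>y\<bar>)\<^sup>2) (epd_mom2 lam r / epd_mom lam 0)"
  using has_bochner_epd[OF lam _ whole_line_moments(1)[OF lam r]]
    has_bochner_epd[OF lam _ whole_line_moments(2)[OF lam r]]
    has_bochner_epd[OF lam _ whole_line_moments(3)[OF lam r]] by auto

lemma integral_epd_odd:
  fixes g :: "real \<Rightarrow> real"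
  assumes lam: "lam > 0" and g: "g \<in> borel_measurable borel" and odd: "\<And>y. g (- y) = - g y"
  shows "integral\<^sup>L (epd lam) g = 0"
proof -
  have "(\<integral>y. g y * epd_kernel lam y \<partial>lborel) = - (\<integral>y. g y * epd_kernel lam y \<partial>lborel)"
    by (subst lborel_integral_real_affine[where c="-1" and t=0]) (simp_all add: odd epd_kernel_minus)
  then show ?thesis using integral_epd(1)[OF lam g] by simp
qed

section \<open>Influence functions\<close>

definition kap :: "real \<Rightarrow> real \<Rightarrow> real" where
  "kap lam y = \<bar>y\<bar> powr lam * ln \<bar>y\<bar>"

text \<open>The second moment of the location score under the null law. It is also minus the slope
  of the mean score under a shift of location, which for \<open>lam = 1\<close> means twice the
  density at 0.\<close>

definition J_epd :: "real \<Rightarrow> real" where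
  "J_epd lam = epd_mom lam (2 * lam - 2) / epd_mom lam 0"

text \<open>The regression coefficient of \<open>spow lam\<close> on the location score.\<close>

definition infl_coeff :: "real \<Rightarrow> real" where
  "infl_coeff lam = epd_mom lam (2 * lam - 1) / epd_mom lam (2 * lam - 2)"

text \<open>Each influence function is the residual of a moment function after its projection on the
  location, respectively scale, score.\<close>

definition infl_S :: "real \<Rightarrow> real \<Rightarrow> real" where
  "infl_S lam y = spow lam y - infl_coeff lam * spow (lam - 1) y"

definition infl_K :: "real \<Rightarrow> real \<Rightarrow> real" where
  "infl_K lam y = kap lam y - E_K lam - (E_K lam + 1 / lam) * (\<bar>y\<bar> powr lam - 1)"

lemma infl_measurable [measurable]:
  "kap lam \<in> borel_measurable borel" "infl_S lam \<in> borel_measurable borel" "infl_K lam \<in> borel_measurable borel"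
  unfolding kap_def[abs_def] infl_S_def[abs_def] infl_K_def[abs_def] by measurable

lemma infl_minus:
  "kap lam (- y) = kap lam y" "infl_S lam (- y) = - infl_S lam y" "infl_K lam (- y) = infl_K lam y"
  by (simp_all add: kap_def infl_S_def infl_K_def spow_minus algebra_simps)

lemma spow_mult: "y \<noteq> 0 \<Longrightarrow> spow p y * spow q y = \<bar>y\<bar> powr (p + q)"
  by (auto simp: spow_def powr_add sgn_if)

lemma has_bochner_cong_0:
  assumes "has_bochner_integral (epd lam) f v" "f \<in> borel_measurable borel" "g \<in> borel_measurable borel"
    "\<And>y. y \<noteq> 0 \<Longrightarrow> f y = g y"
  shows "has_bochner_integral (epd lam) g v"
proof -
  have "AE y in epd lam. y \<noteq> 0"
    unfolding epd_def by (subst AE_density) (use AE_neq_0 in auto)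
  then have "AE y in epd lam. f y = g y" by (rule AE_mp) (auto simp: assms(4))
  with assms(1-3) show ?thesis
    by (subst has_bochner_integral_cong_AE[symmetric, of f]) auto
qed

context
  fixes lam :: real
  assumes lam: "lam \<ge> 1"
begin

lemma lam_pos: "lam > 0" using lam by simp

lemma m_pos: "epd_mom lam 0 > 0" "epd_mom lam (2 * lam - 2) > 0" "epd_mom lam (2 * lam - 1) > 0"
  using lam by (auto intro!: epd_mom_pos)

lemma J_epd_pos: "J_epd lam > 0"
  using m_pos by (simp add: J_epd_def)

text \<open>Identifies \<open>V_S\<close> as a residual variance: \<open>1 + lam\<close> is the
  second moment of \<open>spow lam\<close>, and the subtracted term is the part explained by the
  location score.\<close>

lemma V_S_eq: "V_S lam = 1 + lam - infl_coeff lam * (epd_mom lam (2 * lam - 1) / epd_mom lam 0)"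
proof -
  have x: "(2 * lam - 1 + 1) / lam = 2" "(2 * lam - 2 + 1) / lam = 2 - 1 / lam"
    using lam by (auto simp: field_simps)
  have "infl_coeff lam * (epd_mom lam (2 * lam - 1) / epd_mom lam 0)
      = (lam * lam) / (lam powr (1 - 1 / lam) * lam powr (1 / lam - 1)) / (Gamma (2 - 1 / lam) * Gamma (1 / lam))"
    unfolding infl_coeff_def epd_mom_def x using lam by (simp add: Gamma_numeral)
  also have "lam powr (1 - 1 / lam) * lam powr (1 / lam - 1) = 1"
    using lam by (simp add: powr_add[symmetric])
  finally show ?thesis by (simp add: V_S_def power2_eq_square)
qed

text \<open>A regression residual is orthogonal to the regressor, so its variance coincides with its
  covariance with \<open>spow lam\<close>, the skewness direction of the alternative.\<close>

lemma infl_S_moments: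
  shows "has_bochner_integral (epd lam) (\<lambda>y. infl_S lam y * spow lam y) (V_S lam)"
    and "has_bochner_integral (epd lam) (\<lambda>y. infl_S lam y * spow (lam - 1) y) 0"
    and "has_bochner_integral (epd lam) (\<lambda>y. (infl_S lam y)\<^sup>2) (V_S lam)"
proof -
  have r: "2 * lam > -1" "2 * lam - 1 > -1" "2 * lam - 2 > -1" using lam by auto
  note mom = epd_moments(1)[OF lam_pos r(1)] epd_moments(1)[OF lam_pos r(2)] epd_moments(1)[OF lam_pos r(3)]
  have "has_bochner_integral (epd lam) (\<lambda>y. \<bar>y\<bar> powr (2 * lam) - infl_coeff lam * \<bar>y\<bar> powr (2 * lam - 1))
      (epd_mom lam (2 * lam) / epd_mom lam 0 - infl_coeff lam * (epd_mom lam (2 * lam - 1) / epd_mom lam 0))"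
    by (intro has_bochner_integral_diff has_bochner_integral_mult_right mom)
  also have "epd_mom lam (2 * lam) / epd_mom lam 0 - infl_coeff lam * (epd_mom lam (2 * lam - 1) / epd_mom lam 0) = V_S lam"
    using m_pos V_S_eq epd_mom_base[OF lam_pos] by simp
  finally show 1: "has_bochner_integral (epd lam) (\<lambda>y. infl_S lam y * spow lam y) (V_S lam)"
    by (rule has_bochner_cong_0)
       (auto simp: infl_S_def left_diff_distrib spow_mult mult.assoc, (simp add: mult_2 algebra_simps)?)
  have "has_bochner_integral (epd lam) (\<lambda>y. \<bar>y\<bar> powr (2 * lam - 1) - infl_coeff lam * \<bar>y\<bar> powr (2 * lam - 2))
      (epd_mom lam (2 * lam - 1) / epd_mom lam 0 - infl_coeff lam * (epd_mom lam (2 * lam - 2) / epd_mom lam 0))"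
    by (intro has_bochner_integral_diff has_bochner_integral_mult_right mom)
  also have "epd_mom lam (2 * lam - 1) / epd_mom lam 0 - infl_coeff lam * (epd_mom lam (2 * lam - 2) / epd_mom lam 0) = 0"
    using m_pos by (simp add: infl_coeff_def)
  finally show 2: "has_bochner_integral (epd lam) (\<lambda>y. infl_S lam y * spow (lam - 1) y) 0"
    by (rule has_bochner_cong_0)
       (auto simp: infl_S_def left_diff_distrib spow_mult mult.assoc, (simp add: mult_2 algebra_simps)?)
  have "has_bochner_integral (epd lam) (\<lambda>y. infl_S lam y * spow lam y - infl_coeff lam * (infl_S lam y * spow (lam - 1) y))
      (V_S lam - infl_coeff lam * 0)"
    by (intro has_bochner_integral_diff has_bochner_integral_mult_right 1 2)
  moreover have "(\<lambda>y. infl_S lam y * spow lam y - infl_coeff lam * (infl_S lam y * spow (lam - 1) y))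
      = (\<lambda>y. (infl_S lam y)\<^sup>2)"
    by (auto simp: infl_S_def power2_eq_square algebra_simps)
  ultimately show "has_bochner_integral (epd lam) (\<lambda>y. (infl_S lam y)\<^sup>2) (V_S lam)" by simp
qed

text \<open>The influence function vanishes at no more than three points, so its square cannot
  integrate to 0.\<close>

lemma V_S_pos: "V_S lam > 0"
proof -
  interpret prob_space "epd lam" by (rule prob_space_epd[OF lam_pos])
  have c: "infl_coeff lam > 0" using m_pos by (simp add: infl_coeff_def)
  have nz: "infl_S lam y \<noteq> 0" if "y \<noteq> 0" "\<bar>y\<bar> \<noteq> infl_coeff lam" for y
  proof
    assume "infl_S lam y = 0"
    then have "\<bar>y\<bar> powr lam * sgn y = infl_coeff lam * \<bar>y\<bar> powr (lam - 1) * sgn y"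
      by (simp add: infl_S_def spow_def)
    then have "\<bar>y\<bar> powr lam = infl_coeff lam * \<bar>y\<bar> powr (lam - 1)" using that by (simp add: sgn_if split: if_splits)
    moreover have "\<bar>y\<bar> powr lam = \<bar>y\<bar> * \<bar>y\<bar> powr (lam - 1)"
      using that by (simp add: powr_diff)
    ultimately show False using that by simp
  qed
  have AE: "AE y in lborel. infl_S lam y \<noteq> 0"
    using AE_lborel_singleton[of 0] AE_lborel_singleton[of "infl_coeff lam"] AE_lborel_singleton[of "- infl_coeff lam"]
  proof eventually_elim
    case (elim y)
    then show ?case using nz[of y] by linarith
  qed
  have AE': "AE y in epd lam. infl_S lam y \<noteq> 0"
    unfolding epd_def by (subst AE_density) (use AE in auto)
  have "V_S lam \<ge> 0"
  proof -
    have "V_S lam = (\<integral>y. (infl_S lam y)\<^sup>2 \<partial>epd lam)"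
      using infl_S_moments(3) by (simp add: has_bochner_integral_iff)
    also have "\<dots> \<ge> 0" by (rule integral_nonneg_AE) simp
    finally show ?thesis .
  qed
  moreover have "V_S lam \<noteq> 0"
  proof
    assume "V_S lam = 0"
    then have "AE y in epd lam. (infl_S lam y)\<^sup>2 = 0"
      using infl_S_moments(3) integral_nonneg_eq_0_iff_AE[of "epd lam" "\<lambda>y. (infl_S lam y)\<^sup>2"]
      by (auto simp: has_bochner_integral_iff)
    with AE' have "AE y in epd lam. False" by eventually_elim auto
    then show False by simp
  qed
  ultimately show ?thesis by simp
qed

text \<open>The residual is orthogonal to constants and to \<open>\<bar>y\<bar> powr lam\<close>, so
  its variance coincides with its covariance with \<open>kap\<close>, the shape direction of the
  alternative.\<close>

lemma infl_K_moments:
  shows "has_bochner_integral (epd lam) (infl_K lam) 0"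
    and "has_bochner_integral (epd lam) (\<lambda>y. infl_K lam y * kap lam y) (V_K lam)"
    and "has_bochner_integral (epd lam) (\<lambda>y. (infl_K lam y)\<^sup>2) (V_K lam)"
    and "has_bochner_integral (epd lam) (kap lam) (E_K lam)"
    and "has_bochner_integral (epd lam) (\<lambda>y. \<bar>y\<bar> powr lam) 1"
proof -
  interpret prob_space "epd lam" by (rule prob_space_epd[OF lam_pos])
  define E where "E = E_K lam"
  define b where "b = E + 1 / lam"
  have r: "2 * lam > -1" "lam > -1" using lam by auto
  have sq: "\<bar>y\<bar> powr lam * \<bar>y\<bar> powr lam = \<bar>y\<bar> powr (2 * lam)" for y
    by (simp add: powr_add[symmetric])
  show a: "has_bochner_integral (epd lam) (\<lambda>y. \<bar>y\<bar> powr lam) 1"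
    using epd_moments(1)[OF lam_pos r(2)] m_pos epd_mom_base[OF lam_pos] by simp
  have aa: "has_bochner_integral (epd lam) (\<lambda>y. \<bar>y\<bar> powr lam * \<bar>y\<bar> powr lam) (1 + lam)"
    using epd_moments(1)[OF lam_pos r(1)] m_pos epd_mom_base[OF lam_pos] by (simp add: sq)
  show k: "has_bochner_integral (epd lam) (kap lam) (E_K lam)"
    using epd_moments(2)[OF lam_pos r(2)] m_pos epd_mom1_base[OF lam_pos] by (simp add: kap_def[abs_def])
  have ka: "has_bochner_integral (epd lam) (\<lambda>y. kap lam y * \<bar>y\<bar> powr lam) ((1 + lam) * E + 1)"
  proof -
    have "(\<lambda>y. kap lam y * \<bar>y\<bar> powr lam) = (\<lambda>y. \<bar>y\<bar> powr (2 * lam) * ln \<bar>y\<bar>)"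
      by (auto simp: kap_def sq[symmetric])
    then show ?thesis
      using epd_moments(2)[OF lam_pos r(1)] m_pos epd_mom1_base[OF lam_pos] by (simp add: E_def)
  qed
  have kk: "has_bochner_integral (epd lam) (\<lambda>y. kap lam y * kap lam y) (V_K lam + E\<^sup>2 + b * (lam * E + 1))"
  proof -
    have "(\<lambda>y. kap lam y * kap lam y) = (\<lambda>y. \<bar>y\<bar> powr (2 * lam) * (ln \<bar>y\<bar>)\<^sup>2)"
      by (auto simp: kap_def sq[symmetric] power2_eq_square)
    then show ?thesis
      using epd_moments(3)[OF lam_pos r(1)] m_pos epd_mom1_base[OF lam_pos] by (simp add: E_def b_def)
  qed
  have one: "has_bochner_integral (epd lam) (\<lambda>y. c) c" for c :: real
    using integrable_const[of c] prob_space by (simp add: has_bochner_integral_iff)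
  have "has_bochner_integral (epd lam) (\<lambda>y. kap lam y - E - b * (\<bar>y\<bar> powr lam - 1)) (E_K lam - E - b * (1 - 1))"
    by (intro has_bochner_integral_diff has_bochner_integral_mult_right k one a)
  then show g: "has_bochner_integral (epd lam) (infl_K lam) 0"
    by (simp add: infl_K_def[abs_def] E_def b_def)
  have "has_bochner_integral (epd lam) (\<lambda>y. kap lam y * kap lam y - E * kap lam y - b * (kap lam y * \<bar>y\<bar> powr lam - kap lam y))
      (V_K lam + E\<^sup>2 + b * (lam * E + 1) - E * E_K lam - b * ((1 + lam) * E + 1 - E_K lam))"
    by (intro has_bochner_integral_diff has_bochner_integral_mult_right kk ka k)
  moreover have "V_K lam + E\<^sup>2 + b * (lam * E + 1) - E * E_K lam - b * ((1 + lam) * E + 1 - E_K lam) = V_K lam"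
    unfolding E_def[symmetric] by (simp add: algebra_simps power2_eq_square)
  moreover have "(\<lambda>y. kap lam y * kap lam y - E * kap lam y - b * (kap lam y * \<bar>y\<bar> powr lam - kap lam y))
      = (\<lambda>y. infl_K lam y * kap lam y)"
    by (auto simp: infl_K_def E_def b_def algebra_simps)
  ultimately show gk: "has_bochner_integral (epd lam) (\<lambda>y. infl_K lam y * kap lam y) (V_K lam)" by simp
  have "has_bochner_integral (epd lam) (\<lambda>y. kap lam y * \<bar>y\<bar> powr lam - E * \<bar>y\<bar> powr lam - b * (\<bar>y\<bar> powr lam * \<bar>y\<bar> powr lam - \<bar>y\<bar> powr lam))
      ((1 + lam) * E + 1 - E * 1 - b * (1 + lam - 1))"
    by (intro has_bochner_integral_diff has_bochner_integral_mult_right aa ka a)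
  moreover have "(1 + lam) * E + 1 - E * 1 - b * (1 + lam - 1) = 0"
    using lam by (simp add: b_def algebra_simps)
  moreover have "(\<lambda>y. kap lam y * \<bar>y\<bar> powr lam - E * \<bar>y\<bar> powr lam - b * (\<bar>y\<bar> powr lam * \<bar>y\<bar> powr lam - \<bar>y\<bar> powr lam))
      = (\<lambda>y. infl_K lam y * \<bar>y\<bar> powr lam)"
    by (auto simp: infl_K_def E_def b_def algebra_simps)
  ultimately have ga: "has_bochner_integral (epd lam) (\<lambda>y. infl_K lam y * \<bar>y\<bar> powr lam) 0" by simp
  have "has_bochner_integral (epd lam) (\<lambda>y. infl_K lam y * kap lam y - E * infl_K lam y - b * (infl_K lam y * \<bar>y\<bar> powr lam - infl_K lam y))
      (V_K lam - E * 0 - b * (0 - 0))"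
    by (intro has_bochner_integral_diff has_bochner_integral_mult_right gk ga g)
  moreover have "(\<lambda>y. infl_K lam y * kap lam y - E * infl_K lam y - b * (infl_K lam y * \<bar>y\<bar> powr lam - infl_K lam y))
      = (\<lambda>y. (infl_K lam y)\<^sup>2)"
  proof
    fix y
    have "infl_K lam y = kap lam y - E - b * (\<bar>y\<bar> powr lam - 1)" by (simp add: infl_K_def E_def b_def)
    then show "infl_K lam y * kap lam y - E * infl_K lam y - b * (infl_K lam y * \<bar>y\<bar> powr lam - infl_K lam y)
      = (infl_K lam y)\<^sup>2" unfolding power2_eq_square by algebra
  qed
  ultimately show "has_bochner_integral (epd lam) (\<lambda>y. (infl_K lam y)\<^sup>2) (V_K lam)" by simp
qed

end

section \<open>Kernels of the alternatives and a common integrable bound\<close>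

definition apd_kernel :: "real \<Rightarrow> real \<Rightarrow> real \<Rightarrow> real \<Rightarrow> real" where
  "apd_kernel lam b th y = exp (- ((1 + b * sgn y) * \<bar>y\<bar> powr th / lam))"

lemma apd_kernel_measurable [measurable]: "apd_kernel lam b th \<in> borel_measurable borel"
  unfolding apd_kernel_def by measurable

lemma apd_kernel_pos: "apd_kernel lam b th y > 0"
  by (simp add: apd_kernel_def)

lemma apd_kernel_0: "apd_kernel lam 0 lam = epd_kernel lam"
  by (auto simp: apd_kernel_def epd_kernel_def)

text \<open>Polynomial growth at infinity and an integrable singularity at 0. The order 1/2
  accommodates logarithms and also \<open>\<bar>y\<bar> powr (lam - 2)\<close>, the derivative of
  the score, down to \<open>lam = 3/2\<close>.\<close>

definition wt :: "nat \<Rightarrow> real \<Rightarrow> real" where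
  "wt p y = (1 + \<bar>y\<bar>) ^ p * \<bar>y\<bar> powr (- 1 / 2)"

lemma wt_measurable [measurable]: "wt p \<in> borel_measurable borel"
  unfolding wt_def by measurable

lemma wt_nonneg: "wt p y \<ge> 0"
  by (simp add: wt_def)

lemma wt_integrable: "lam > 0 \<Longrightarrow> integrable lborel (\<lambda>y. wt p y * epd_kernel lam y)"
proof -
  assume lam: "lam > 0"
  have "integrable lborel (\<lambda>y. 2 ^ p * (\<bar>y\<bar> powr (-1/2) * epd_kernel lam y + \<bar>y\<bar> powr (real p - 1/2) * epd_kernel lam y))"
    using whole_line_moments(1)[OF lam, of "-1/2"] whole_line_moments(1)[OF lam, of "real p - 1/2"]
    by (simp add: has_bochner_integral_iff)
  then show ?thesis
  proof (rule Bochner_Integration.integrable_bound)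
    show "AE y in lborel. norm (wt p y * epd_kernel lam y)
        \<le> norm (2 ^ p * (\<bar>y\<bar> powr (-1/2) * epd_kernel lam y + \<bar>y\<bar> powr (real p - 1/2) * epd_kernel lam y))"
      using AE_neq_0
    proof eventually_elim
      case (elim y)
      have "(1 + \<bar>y\<bar>) ^ p \<le> (2 * max 1 \<bar>y\<bar>) ^ p" by (intro power_mono) auto
      also have "\<dots> = 2 ^ p * (max 1 \<bar>y\<bar>) ^ p" by (simp add: power_mult_distrib)
      also have "(max 1 \<bar>y\<bar>) ^ p \<le> 1 + \<bar>y\<bar> ^ p" by (auto simp: max_def)
      finally have "(1 + \<bar>y\<bar>) ^ p \<le> 2 ^ p * (1 + \<bar>y\<bar> ^ p)" by simp
      then have "wt p y \<le> 2 ^ p * (1 + \<bar>y\<bar> ^ p) * \<bar>y\<bar> powr (-1/2)"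
        unfolding wt_def by (intro mult_right_mono) auto
      also have "\<dots> = 2 ^ p * (\<bar>y\<bar> powr (-1/2) + \<bar>y\<bar> powr (real p - 1/2))"
        using elim by (simp add: powr_diff powr_minus_divide powr_realpow add_divide_distrib distrib_left)
      finally have "wt p y * epd_kernel lam y \<le> 2 ^ p * (\<bar>y\<bar> powr (-1/2) + \<bar>y\<bar> powr (real p - 1/2)) * epd_kernel lam y"
        using epd_kernel_pos[of lam y] by (intro mult_right_mono) auto
      then show ?case
        using wt_nonneg[of p y] epd_kernel_pos[of lam y] by (simp add: algebra_simps)
    qed
  qed measurable
qed

text \<open>One integrable bound for all parameters near the null values: at least half of the
  exponent remains, and \<open>\<bar>y\<bar> powr th\<close> is at least
  \<open>\<bar>y\<bar> powr (1/2) - 1\<close>. The kernel of exponent 1/4 is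
  \<open>exp (- 4 * t)\<close> with \<open>t\<close> the fourth root of
  \<open>\<bar>y\<bar>\<close>, so a quadratic in \<open>t\<close> has to beat a linear one.\<close>

lemma apd_kernel_le:
  assumes "\<bar>b\<bar> \<le> 1/2" "th \<ge> 1/2" "lam \<ge> 1" "lam \<le> 3"
  shows "apd_kernel lam b th y \<le> exp 25 * epd_kernel (1/4) y"
proof -
  have s: "\<bar>y\<bar> powr (1/2) - 1 \<le> \<bar>y\<bar> powr th"
    using powr_mono[OF assms(2), of "\<bar>y\<bar>"] powr_le1[of "1/2" "\<bar>y\<bar>"]
    by (cases "\<bar>y\<bar> \<ge> 1") (auto intro: add_increasing2 add_increasing simp: diff_le_eq)
  define t where "t = \<bar>y\<bar> powr (1/4)"
  have t2: "\<bar>y\<bar> powr (1/2) = t * t" by (simp add: t_def powr_add[symmetric])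
  have "1/2 \<le> 1 + b * sgn y" using assms(1) by (auto simp: sgn_if)
  then have "(1/2) * \<bar>y\<bar> powr th \<le> (1 + b * sgn y) * \<bar>y\<bar> powr th"
    by (rule mult_right_mono) simp
  moreover have "0 \<le> (1/2) * \<bar>y\<bar> powr th" by simp
  ultimately have "(1/2) * \<bar>y\<bar> powr th / 3 \<le> (1 + b * sgn y) * \<bar>y\<bar> powr th / lam"
    using assms(3,4) by (intro frac_le) linarith+
  then have "- ((1 + b * sgn y) * \<bar>y\<bar> powr th / lam) \<le> - (t * t - 1) / 6"
    using s unfolding t2 by simp
  also have "\<dots> \<le> 25 - 4 * t"
  proof -
    \<comment> \<open>Completing the square: the largest value of
      \<open>4 * t - (t * t - 1) / 6\<close> is 24 + 1/6, rounded up to 25.\<close>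
    have "0 \<le> (t - 12) * (t - 12)" by simp
    then have "24 * t \<le> t * t + 144" by (simp add: algebra_simps)
    then show ?thesis by simp
  qed
  finally have "apd_kernel lam b th y \<le> exp (25 - 4 * t)" by (simp add: apd_kernel_def)
  also have "\<dots> = exp 25 * epd_kernel (1/4) y"
    unfolding epd_kernel_def exp_add[symmetric] by (simp add: t_def)
  finally show ?thesis .
qed

section \<open>Local asymptotics of the asymmetric power distribution\<close>

text \<open>The class \<open>poly_bdd\<close> is closed under products and powers, and
  \<open>wt_bdd\<close> is what dominated convergence can use. Both exclude \<open>y = 0\<close>; in
  particular \<open>wt p 0 = 0\<close>, so a weighted bound there would force the function to
  vanish.\<close>

definition poly_bdd :: "(real \<Rightarrow> real) \<Rightarrow> bool" where
  "poly_bdd g \<longleftrightarrow> g \<in> borel_measurable borel \<and> (\<exists>C\<ge>0. \<exists>p. \<forall>y. y \<noteq> 0 \<longrightarrow> \<bar>g y\<bar> \<le> C * (1 + \<bar>y\<bar>) ^ p)"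

definition wt_bdd :: "(real \<Rightarrow> real) \<Rightarrow> bool" where
  "wt_bdd g \<longleftrightarrow> g \<in> borel_measurable borel \<and> (\<exists>C\<ge>0. \<exists>p. \<forall>y. y \<noteq> 0 \<longrightarrow> \<bar>g y\<bar> \<le> C * wt p y)"

lemma poly_bddI:
  "g \<in> borel_measurable borel \<Longrightarrow> C \<ge> 0 \<Longrightarrow> (\<And>y. y \<noteq> 0 \<Longrightarrow> \<bar>g y\<bar> \<le> C * (1 + \<bar>y\<bar>) ^ p) \<Longrightarrow> poly_bdd g"
  unfolding poly_bdd_def by blast

lemma wt_bddI:
  "g \<in> borel_measurable borel \<Longrightarrow> C \<ge> 0 \<Longrightarrow> (\<And>y. y \<noteq> 0 \<Longrightarrow> \<bar>g y\<bar> \<le> C * wt p y) \<Longrightarrow> wt_bdd g"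
  unfolding wt_bdd_def by blast

lemma poly_bdd_measurable: "poly_bdd g \<Longrightarrow> g \<in> borel_measurable borel"
  and wt_bdd_measurable: "wt_bdd g \<Longrightarrow> g \<in> borel_measurable borel"
  by (auto simp: poly_bdd_def wt_bdd_def)

lemma power_1_abs_mono: "p \<le> q \<Longrightarrow> (1 + \<bar>y\<bar>) ^ p \<le> (1 + \<bar>y::real\<bar>) ^ q"
  by (rule power_increasing) auto

lemma one_le_wt: "y \<noteq> 0 \<Longrightarrow> (1 + \<bar>y\<bar>) ^ p \<le> wt (Suc p) y"
proof -
  assume y: "y \<noteq> 0"
  have "\<bar>y\<bar> powr (1/2) \<le> (1 + \<bar>y\<bar>) powr (1/2)" by (intro powr_mono2) auto
  also have "\<dots> \<le> (1 + \<bar>y\<bar>) powr 1" by (intro powr_mono) auto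
  finally have "1 \<le> (1 + \<bar>y\<bar>) * \<bar>y\<bar> powr (-1/2)"
    using y by (simp add: powr_minus_divide pos_le_divide_eq)
  then have "(1 + \<bar>y\<bar>) ^ p * 1 \<le> (1 + \<bar>y\<bar>) ^ p * ((1 + \<bar>y\<bar>) * \<bar>y\<bar> powr (-1/2))"
    by (intro mult_left_mono) auto
  then show ?thesis by (simp add: wt_def mult_ac)
qed

lemma poly_bdd_add: "poly_bdd f \<Longrightarrow> poly_bdd g \<Longrightarrow> poly_bdd (\<lambda>y. f y + g y)"
proof -
  assume "poly_bdd f" "poly_bdd g"
  then obtain C p D q where
    m: "f \<in> borel_measurable borel" "g \<in> borel_measurable borel" and C: "C \<ge> 0" "D \<ge> 0"
    and b: "\<And>y. y \<noteq> 0 \<Longrightarrow> \<bar>f y\<bar> \<le> C * (1 + \<bar>y\<bar>) ^ p" "\<And>y. y \<noteq> 0 \<Longrightarrow> \<bar>g y\<bar> \<le> D * (1 + \<bar>y\<bar>) ^ q"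
    unfolding poly_bdd_def by blast
  show ?thesis
  proof (rule poly_bddI[of _ "C + D" "p + q"])
    fix y :: real assume "y \<noteq> 0"
    have "C * (1 + \<bar>y\<bar>) ^ p \<le> C * (1 + \<bar>y\<bar>) ^ (p + q)" "D * (1 + \<bar>y\<bar>) ^ q \<le> D * (1 + \<bar>y\<bar>) ^ (p + q)"
      using C by (auto intro!: mult_left_mono power_1_abs_mono)
    with b[OF \<open>y \<noteq> 0\<close>] show "\<bar>f y + g y\<bar> \<le> (C + D) * (1 + \<bar>y\<bar>) ^ (p + q)"
      unfolding distrib_right by linarith
  qed (use m C in auto)
qed

lemma poly_bdd_mult: "poly_bdd f \<Longrightarrow> poly_bdd g \<Longrightarrow> poly_bdd (\<lambda>y. f y * g y)"
proof -
  assume "poly_bdd f" "poly_bdd g"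
  then obtain C p D q where
    m: "f \<in> borel_measurable borel" "g \<in> borel_measurable borel" and C: "C \<ge> 0" "D \<ge> 0"
    and b: "\<And>y. y \<noteq> 0 \<Longrightarrow> \<bar>f y\<bar> \<le> C * (1 + \<bar>y\<bar>) ^ p" "\<And>y. y \<noteq> 0 \<Longrightarrow> \<bar>g y\<bar> \<le> D * (1 + \<bar>y\<bar>) ^ q"
    unfolding poly_bdd_def by blast
  show ?thesis
  proof (rule poly_bddI[of _ "C * D" "p + q"])
    fix y :: real assume "y \<noteq> 0"
    have "\<bar>f y\<bar> * \<bar>g y\<bar> \<le> (C * (1 + \<bar>y\<bar>) ^ p) * (D * (1 + \<bar>y\<bar>) ^ q)"
      using C b[OF \<open>y \<noteq> 0\<close>] by (intro mult_mono) auto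
    then show "\<bar>f y * g y\<bar> \<le> (C * D) * (1 + \<bar>y\<bar>) ^ (p + q)"
      by (simp add: abs_mult power_add mult_ac)
  qed (use m C in auto)
qed

lemma poly_bdd_const: "poly_bdd (\<lambda>y. c)"
  by (rule poly_bddI[of _ "\<bar>c\<bar>" 0]) auto

lemma poly_bdd_diff: "poly_bdd f \<Longrightarrow> poly_bdd g \<Longrightarrow> poly_bdd (\<lambda>y. f y - g y)"
  using poly_bdd_add[of f "\<lambda>y. (-1) * g y"] poly_bdd_mult[OF poly_bdd_const[of "-1"]] by simp

lemma poly_bdd_power: "poly_bdd f \<Longrightarrow> poly_bdd (\<lambda>y. f y ^ k)"
  by (induction k) (auto intro: poly_bdd_const poly_bdd_mult)

lemma poly_bdd_abs: "poly_bdd f \<Longrightarrow> poly_bdd (\<lambda>y. \<bar>f y\<bar>)"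
  unfolding poly_bdd_def by auto

lemma poly_bdd_imp_wt_bdd: "poly_bdd g \<Longrightarrow> wt_bdd g"
proof -
  assume "poly_bdd g"
  then obtain C p where m: "g \<in> borel_measurable borel" "C \<ge> 0" "\<And>y. y \<noteq> 0 \<Longrightarrow> \<bar>g y\<bar> \<le> C * (1 + \<bar>y\<bar>) ^ p"
    unfolding poly_bdd_def by blast
  then show ?thesis
    by (intro wt_bddI[of g C "Suc p"]) (auto intro: order_trans mult_left_mono[OF one_le_wt])
qed

lemma abs_powr_le:
  assumes "0 \<le> t" "t \<le> real p"
  shows "\<bar>y\<bar> powr t \<le> (1 + \<bar>y\<bar>) ^ p"
proof -
  have "\<bar>y\<bar> powr t \<le> (1 + \<bar>y\<bar>) powr t" using assms by (intro powr_mono2) auto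
  also have "\<dots> \<le> (1 + \<bar>y\<bar>) powr real p" using assms by (intro powr_mono) auto
  also have "\<dots> = (1 + \<bar>y\<bar>) ^ p" by (simp add: powr_realpow)
  finally show ?thesis .
qed

lemma poly_bdd_powr: "0 \<le> t \<Longrightarrow> poly_bdd (\<lambda>y. \<bar>y\<bar> powr t)"
  by (rule poly_bddI[of _ 1 "nat \<lceil>t\<rceil>"]) (auto intro!: abs_powr_le real_nat_ceiling_ge)

lemma poly_bdd_spow: "0 \<le> t \<Longrightarrow> poly_bdd (spow t)"
proof (rule poly_bddI[of _ 1 "nat \<lceil>t\<rceil>"])
  fix y :: real assume "0 \<le> t" "y \<noteq> 0"
  then have "\<bar>spow t y\<bar> = \<bar>y\<bar> powr t" by (auto simp: spow_def abs_mult sgn_if)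
  then show "\<bar>spow t y\<bar> \<le> 1 * (1 + \<bar>y\<bar>) ^ nat \<lceil>t\<rceil>"
    using abs_powr_le[of t "nat \<lceil>t\<rceil>" y] \<open>0 \<le> t\<close> real_nat_ceiling_ge[of t] by simp
qed auto

lemma abs_ln_le_wt: "y \<noteq> 0 \<Longrightarrow> \<bar>ln \<bar>y\<bar>\<bar> \<le> 2 * wt 1 y"
proof -
  assume y: "y \<noteq> 0"
  have "\<bar>y\<bar> * \<bar>y\<bar> powr (-1/2) = \<bar>y\<bar> powr (1 + (-1/2))" by (rule powr_mult_base) simp
  then have "\<bar>y\<bar> * \<bar>y\<bar> powr (-1/2) = \<bar>y\<bar> powr (1/2)" by simp
  then have "wt 1 y = \<bar>y\<bar> powr (1/2) + \<bar>y\<bar> powr (- (1/2))" by (simp add: wt_def distrib_right)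
  then show ?thesis using abs_ln_le[of "\<bar>y\<bar>" "1/2"] y by simp
qed

lemma poly_bdd_kap: "lam \<ge> 1 \<Longrightarrow> poly_bdd (kap lam)"
proof (rule poly_bddI[of _ 4 "nat \<lceil>lam + 1/2\<rceil>"])
  fix y :: real assume lam: "lam \<ge> 1" and y: "y \<noteq> 0"
  define q where "q = nat \<lceil>lam + 1/2\<rceil>"
  have q: "lam + 1/2 \<le> real q" unfolding q_def by (rule real_nat_ceiling_ge)
  have "\<bar>kap lam y\<bar> = \<bar>y\<bar> powr lam * \<bar>ln \<bar>y\<bar>\<bar>" by (simp add: kap_def abs_mult)
  also have "\<dots> \<le> \<bar>y\<bar> powr lam * ((\<bar>y\<bar> powr (1/2) + \<bar>y\<bar> powr (- (1/2))) / (1/2))"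
    using y by (intro mult_left_mono abs_ln_le) auto
  also have "\<dots> = 2 * (\<bar>y\<bar> powr (lam + 1/2) + \<bar>y\<bar> powr (lam - 1/2))"
    using y by (simp add: powr_add powr_diff powr_minus_divide distrib_left)
  also have "\<dots> \<le> 2 * ((1 + \<bar>y\<bar>) ^ q + (1 + \<bar>y\<bar>) ^ q)"
    using lam q by (intro mult_left_mono add_mono abs_powr_le) auto
  finally show "\<bar>kap lam y\<bar> \<le> 4 * (1 + \<bar>y\<bar>) ^ q" by simp
qed auto

lemma poly_bdd_infl:
  assumes "lam \<ge> 1"
  shows "poly_bdd (infl_S lam)" "poly_bdd (infl_K lam)"
  unfolding infl_S_def[abs_def] infl_K_def[abs_def] using assms
  by (auto intro!: poly_bdd_diff poly_bdd_mult poly_bdd_const poly_bdd_spow poly_bdd_kap poly_bdd_powr)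

lemma abs_exp_diff_le: "\<bar>exp a - exp b\<bar> \<le> \<bar>a - b\<bar> * max (exp a) (exp (b::real))"
proof -
  have le: "exp a - exp b \<le> (a - b) * exp a" if "b \<le> a" for a b :: real
  proof -
    have "1 + (b - a) \<le> exp (b - a)" by (rule exp_ge_add_one_self)
    then have "(1 + (b - a)) * exp a \<le> exp (b - a) * exp a" by (intro mult_right_mono) auto
    also have "exp (b - a) * exp a = exp b" by (simp add: exp_add[symmetric])
    finally show ?thesis by (simp add: algebra_simps)
  qed
  show ?thesis
  proof (cases "b \<le> a")
    case True
    then show ?thesis using le[OF True] by (simp add: max_def)
  next
    case False
    then show ?thesis using le[of a b] by (simp add: max_def)
  qed
qed

text \<open>The domination is available for large \<open>n\<close> only, so the sequence is shifted
  before the convergence theorem is applied.\<close>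

lemma dominated_convergence_kernel:
  fixes s :: "nat \<Rightarrow> real \<Rightarrow> real"
  assumes meas: "\<And>n. s n \<in> borel_measurable borel" "f \<in> borel_measurable borel"
    and bound: "\<forall>\<^sub>F n in sequentially. \<forall>y. y \<noteq> 0 \<longrightarrow> \<bar>s n y\<bar> \<le> C * wt p y * epd_kernel (1/4) y"
    and lim: "\<And>y. y \<noteq> 0 \<Longrightarrow> (\<lambda>n. s n y) \<longlonglongrightarrow> f y"
  shows "(\<lambda>n. integral\<^sup>L lborel (s n)) \<longlonglongrightarrow> integral\<^sup>L lborel f"
    and "\<forall>\<^sub>F n in sequentially. integrable lborel (s n)"
    and "integrable lborel f"
proof -
  obtain N where N: "\<And>n y. n \<ge> N \<Longrightarrow> y \<noteq> 0 \<Longrightarrow> \<bar>s n y\<bar> \<le> C * wt p y * epd_kernel (1/4) y"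
    using bound unfolding eventually_sequentially by blast
  let ?w = "\<lambda>y. C * wt p y * epd_kernel (1/4) y"
  have w: "integrable lborel ?w" using wt_integrable[of "1/4" p] by (simp add: mult.assoc)
  have bd: "AE y in lborel. norm (s (n + N) y) \<le> ?w y" for n
    using AE_neq_0 by eventually_elim (use N in auto)
  have lm: "AE y in lborel. (\<lambda>n. s (n + N) y) \<longlonglongrightarrow> f y"
    using AE_neq_0 by eventually_elim (use lim LIMSEQ_ignore_initial_segment in auto)
  have "(\<lambda>n. integral\<^sup>L lborel (s (n + N))) \<longlonglongrightarrow> integral\<^sup>L lborel f"
    by (rule integral_dominated_convergence[where w="?w"]) (use meas w bd lm in auto)
  then show "(\<lambda>n. integral\<^sup>L lborel (s n)) \<longlonglongrightarrow> integral\<^sup>L lborel f" by (rule LIMSEQ_offset)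
  show "integrable lborel f"
    by (rule integrable_dominated_convergence[where w="?w" and s="\<lambda>n. s (n + N)"]) (use meas w bd lm in auto)
  show "\<forall>\<^sub>F n in sequentially. integrable lborel (s n)"
  proof (rule eventually_sequentiallyI[of N])
    fix n assume "n \<ge> N"
    show "integrable lborel (s n)"
    proof (rule Bochner_Integration.integrable_bound[OF w])
      show "AE y in lborel. norm (s n y) \<le> norm (?w y)"
        using AE_neq_0 by eventually_elim (use N[OF \<open>n \<ge> N\<close>] in force)
    qed (use meas in auto)
  qed
qed

lemma scaled_limit_0:
  assumes "(\<lambda>n. sqrt (real n) * x n) \<longlonglongrightarrow> l"
  shows "x \<longlonglongrightarrow> 0"
proof -
  have "(\<lambda>n. 1 / sqrt (real n)) \<longlonglongrightarrow> 0"
    by (intro tendsto_divide_0[OF tendsto_const] filterlim_at_top_imp_at_infinity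
        filterlim_compose[OF sqrt_at_top filterlim_real_sequentially])
  from tendsto_mult[OF this assms] have "(\<lambda>n. 1 / sqrt (real n) * (sqrt (real n) * x n)) \<longlonglongrightarrow> 0" by simp
  then show ?thesis
    by (rule Lim_transform_eventually) (use eventually_gt_at_top[of "0::nat"] in eventually_elim, simp)
qed

text \<open>The local alternatives in standardized form: \<open>b\<close> is the skewness of the
  kernel and \<open>th\<close> its shape. Only their limits at scale \<open>sqrt n\<close> are
  kept.\<close>

locale apd_seq =
  fixes lam \<beta> \<delta> :: real and b th :: "nat \<Rightarrow> real"
  assumes lam: "1 \<le> lam" "lam \<le> 3"
    and b_lim: "(\<lambda>n. sqrt (real n) * b n) \<longlonglongrightarrow> \<beta>"
    and th_lim: "(\<lambda>n. sqrt (real n) * (th n - lam)) \<longlonglongrightarrow> \<delta>"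
begin

lemma lam0: "lam > 0" using lam by simp

lemma b_0: "b \<longlonglongrightarrow> 0" by (rule scaled_limit_0[OF b_lim])

lemma th_lam: "th \<longlonglongrightarrow> lam"
  using scaled_limit_0[OF th_lim] by (simp add: LIM_zero_iff)

lemma param_bounds: "\<forall>\<^sub>F n in sequentially. \<bar>b n\<bar> \<le> 1/2 \<and> 1/2 \<le> th n \<and> th n \<le> 4"
proof -
  have "\<forall>\<^sub>F n in sequentially. \<bar>b n\<bar> < 1/2" using tendstoD[OF b_0, of "1/2"] by simp
  moreover have "\<forall>\<^sub>F n in sequentially. 1/2 < th n" "\<forall>\<^sub>F n in sequentially. th n < 4"
    using order_tendstoD(1)[OF th_lam, of "1/2"] order_tendstoD(2)[OF th_lam, of 4] lam by auto
  ultimately show ?thesis by eventually_elim auto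
qed

definition kn :: "nat \<Rightarrow> real \<Rightarrow> real" where
  "kn n = apd_kernel lam (b n) (th n)"

lemma kn_measurable [measurable]: "kn n \<in> borel_measurable borel"
  by (simp add: kn_def)

lemma kn_pos: "kn n y > 0"
  by (simp add: kn_def apd_kernel_pos)

lemma kn_le: "\<forall>\<^sub>F n in sequentially. \<forall>y. kn n y \<le> exp 25 * epd_kernel (1/4) y"
  using param_bounds by eventually_elim (use lam in \<open>auto simp: kn_def intro: apd_kernel_le\<close>)

text \<open>The two directions of the alternative appear here: up to the factor
  \<open>1 / lam\<close>, \<open>spow lam\<close> is the derivative of the exponent in the skewness
  and \<open>kap lam\<close> that in the shape.\<close>

lemma exponent_lim:
  assumes "y \<noteq> 0"
  shows "(\<lambda>n. sqrt (real n) * ((1 + b n * sgn y) * \<bar>y\<bar> powr th n / lam - \<bar>y\<bar> powr lam / lam))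
     \<longlonglongrightarrow> (\<beta> * spow lam y + \<delta> * kap lam y) / lam"
proof -
  have "((\<lambda>t. \<bar>y\<bar> powr t) has_real_derivative kap lam y) (at lam)"
    using assms unfolding kap_def by (auto intro!: derivative_eq_intros)
  from delta_tendsto[OF this th_lam th_lim]
  have 1: "(\<lambda>n. sqrt (real n) * (\<bar>y\<bar> powr th n - \<bar>y\<bar> powr lam)) \<longlonglongrightarrow> kap lam y * \<delta>" .
  have 2: "(\<lambda>n. (sqrt (real n) * b n) * (sgn y * \<bar>y\<bar> powr th n)) \<longlonglongrightarrow> \<beta> * (sgn y * \<bar>y\<bar> powr lam)"
    using assms by (intro tendsto_mult b_lim tendsto_const tendsto_powr th_lam) auto
  have "(\<lambda>n. ((sqrt (real n) * b n) * (sgn y * \<bar>y\<bar> powr th n) +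
      sqrt (real n) * (\<bar>y\<bar> powr th n - \<bar>y\<bar> powr lam)) / lam)
     \<longlonglongrightarrow> (\<beta> * (sgn y * \<bar>y\<bar> powr lam) + kap lam y * \<delta>) / lam"
    using lam by (intro tendsto_divide tendsto_add 1 2 tendsto_const) auto
  moreover have "((sqrt (real n) * b n) * (sgn y * \<bar>y\<bar> powr th n) + sqrt (real n) * (\<bar>y\<bar> powr th n - \<bar>y\<bar> powr lam)) / lam
      = sqrt (real n) * ((1 + b n * sgn y) * \<bar>y\<bar> powr th n / lam - \<bar>y\<bar> powr lam / lam)" for n
    using lam by (simp add: field_simps)
  moreover have "(\<beta> * (sgn y * \<bar>y\<bar> powr lam) + kap lam y * \<delta>) / lam = (\<beta> * spow lam y + \<delta> * kap lam y) / lam"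
    by (simp add: spow_def mult_ac)
  ultimately show ?thesis by simp
qed

lemma kn_conv: "y \<noteq> 0 \<Longrightarrow> (\<lambda>n. kn n y) \<longlonglongrightarrow> epd_kernel lam y"
proof -
  assume y: "y \<noteq> 0"
  have "(\<lambda>n. exp (- ((1 + b n * sgn y) * \<bar>y\<bar> powr th n / lam))) \<longlonglongrightarrow> exp (- ((1 + 0 * sgn y) * \<bar>y\<bar> powr lam / lam))"
    using y lam by (intro tendsto_intros b_0 th_lam) auto
  then show ?thesis by (simp add: kn_def apd_kernel_def epd_kernel_def)
qed

lemma kn_score_conv:
  assumes y: "y \<noteq> 0"
  shows "(\<lambda>n. sqrt (real n) * (kn n y - epd_kernel lam y))
    \<longlonglongrightarrow> - ((\<beta> * spow lam y + \<delta> * kap lam y) / lam) * epd_kernel lam y"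
proof -
  have D: "((\<lambda>a. exp (- a)) has_real_derivative - exp (- (\<bar>y\<bar> powr lam / lam))) (at (\<bar>y\<bar> powr lam / lam))"
    by (auto intro!: derivative_eq_intros)
  have "(\<lambda>n. (1 + b n * sgn y) * \<bar>y\<bar> powr th n / lam) \<longlonglongrightarrow> (1 + 0 * sgn y) * \<bar>y\<bar> powr lam / lam"
    using y lam by (intro tendsto_intros b_0 th_lam) auto
  then have "(\<lambda>n. (1 + b n * sgn y) * \<bar>y\<bar> powr th n / lam) \<longlonglongrightarrow> \<bar>y\<bar> powr lam / lam" by simp
  from delta_tendsto[OF D this exponent_lim[OF y]] show ?thesis
    by (simp add: kn_def apd_kernel_def epd_kernel_def mult.commute)
qed

text \<open>The domination needed to integrate the first-order expansion of the kernel. The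
  exponential is Lipschitz with the larger kernel as constant, and the logarithm produced by varying
  the shape is absorbed by the weight.\<close>

lemma kn_score_le:
  obtains B where "B \<ge> 0" "\<forall>\<^sub>F n in sequentially. \<forall>y. y \<noteq> 0 \<longrightarrow>
    \<bar>sqrt (real n) * (kn n y - epd_kernel lam y)\<bar> \<le> B * wt 5 y * epd_kernel (1/4) y"
proof -
  obtain B where B: "B > 0" "\<And>n. \<bar>sqrt (real n) * b n\<bar> \<le> B" "\<And>n. \<bar>sqrt (real n) * (th n - lam)\<bar> \<le> B"
  proof -
    obtain B1 where "\<And>n. norm (sqrt (real n) * b n) \<le> B1"
      using convergent_imp_Bseq[OF convergentI[OF b_lim]] unfolding Bseq_def by blast
    moreover obtain B2 where "\<And>n. norm (sqrt (real n) * (th n - lam)) \<le> B2"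
      using convergent_imp_Bseq[OF convergentI[OF th_lim]] unfolding Bseq_def by blast
    ultimately show thesis
      using that[of "max 1 (max B1 B2)"] by (auto simp: le_max_iff_disj)
  qed
  show thesis
  \<comment> \<open>The shape contributes \<open>4 * B\<close>, the skewness \<open>B\<close>, and
    both kernels are below \<open>exp 25\<close> times the common bound.\<close>
  proof (rule that[of "5 * B * exp 25"])
    show "\<forall>\<^sub>F n in sequentially. \<forall>y. y \<noteq> 0 \<longrightarrow>
      \<bar>sqrt (real n) * (kn n y - epd_kernel lam y)\<bar> \<le> (5 * B * exp 25) * wt 5 y * epd_kernel (1/4) y"
      using param_bounds
    proof (eventually_elim, intro allI impI)
      fix n and y :: real assume n: "\<bar>b n\<bar> \<le> 1/2 \<and> 1/2 \<le> th n \<and> th n \<le> 4" and y: "y \<noteq> 0"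
      let ?s = "sqrt (real n)"
      define A where "A = (1 + b n * sgn y) * \<bar>y\<bar> powr th n / lam"
      define A0 where "A0 = \<bar>y\<bar> powr lam / lam"
      have k: "kn n y = exp (- A)" "epd_kernel lam y = exp (- A0)"
        by (auto simp: kn_def apd_kernel_def epd_kernel_def A_def A0_def)
      have kb: "max (exp (- A)) (exp (- A0)) \<le> exp 25 * epd_kernel (1/4) y"
        using apd_kernel_le[of "b n" "th n" lam y] apd_kernel_le[of 0 lam lam y] n lam
        unfolding k[symmetric] by (simp add: kn_def apd_kernel_0)
      have "\<bar>\<bar>y\<bar> powr th n - \<bar>y\<bar> powr lam\<bar> \<le> \<bar>th n - lam\<bar> * \<bar>ln \<bar>y\<bar>\<bar> * (2 * (1 + \<bar>y\<bar>) ^ 4)"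
      proof -
        have "\<bar>\<bar>y\<bar> powr th n - \<bar>y\<bar> powr lam\<bar> \<le> \<bar>th n * ln \<bar>y\<bar> - lam * ln \<bar>y\<bar>\<bar> * max (\<bar>y\<bar> powr th n) (\<bar>y\<bar> powr lam)"
          using abs_exp_diff_le[of "th n * ln \<bar>y\<bar>" "lam * ln \<bar>y\<bar>"] y by (simp add: powr_def)
        also have "\<dots> \<le> \<bar>th n * ln \<bar>y\<bar> - lam * ln \<bar>y\<bar>\<bar> * (2 * (1 + \<bar>y\<bar>) ^ 4)"
        proof (intro mult_left_mono max.boundedI)
          have "0 \<le> (1 + \<bar>y\<bar>) ^ 4" by simp
          moreover have "\<bar>y\<bar> powr th n \<le> (1 + \<bar>y\<bar>) ^ 4" "\<bar>y\<bar> powr lam \<le> (1 + \<bar>y\<bar>) ^ 4"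
            using abs_powr_le[of "th n" 4 y] abs_powr_le[of lam 4 y] n lam by auto
          ultimately show "\<bar>y\<bar> powr th n \<le> 2 * (1 + \<bar>y\<bar>) ^ 4" "\<bar>y\<bar> powr lam \<le> 2 * (1 + \<bar>y\<bar>) ^ 4"
            by linarith+
        qed simp
        also have "\<bar>th n * ln \<bar>y\<bar> - lam * ln \<bar>y\<bar>\<bar> = \<bar>th n - lam\<bar> * \<bar>ln \<bar>y\<bar>\<bar>"
          by (simp add: abs_mult[symmetric] algebra_simps)
        finally show ?thesis .
      qed
      then have "?s * \<bar>\<bar>y\<bar> powr th n - \<bar>y\<bar> powr lam\<bar> \<le> ?s * (\<bar>th n - lam\<bar> * \<bar>ln \<bar>y\<bar>\<bar> * (2 * (1 + \<bar>y\<bar>) ^ 4))"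
        by (intro mult_left_mono) auto
      also have "\<dots> = \<bar>?s * (th n - lam)\<bar> * (\<bar>ln \<bar>y\<bar>\<bar> * (2 * (1 + \<bar>y\<bar>) ^ 4))"
        by (simp add: abs_mult)
      also have "\<dots> \<le> B * (2 * wt 1 y * (2 * (1 + \<bar>y\<bar>) ^ 4))"
        using abs_ln_le_wt[OF y] B by (intro mult_mono) auto
      also have "\<dots> = 4 * B * wt 5 y" by (simp add: wt_def power_add[symmetric] mult_ac eval_nat_numeral)
      finally have 1: "?s * \<bar>\<bar>y\<bar> powr th n - \<bar>y\<bar> powr lam\<bar> \<le> 4 * B * wt 5 y" .
      have "?s * \<bar>b n * sgn y * \<bar>y\<bar> powr th n\<bar> = \<bar>?s * b n\<bar> * \<bar>y\<bar> powr th n"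
        using y by (simp add: abs_mult sgn_if)
      also have "\<dots> \<le> B * wt 5 y"
        using B abs_powr_le[of "th n" 4 y] one_le_wt[OF y, of 4] n
        by (intro mult_mono) (auto simp: eval_nat_numeral)
      finally have 2: "?s * \<bar>b n * sgn y * \<bar>y\<bar> powr th n\<bar> \<le> B * wt 5 y" .
      have "A - A0 = (b n * sgn y * \<bar>y\<bar> powr th n + (\<bar>y\<bar> powr th n - \<bar>y\<bar> powr lam)) / lam"
      proof -
        have "(1 + u) * p - q = u * p + (p - q)" for u p q :: real by (simp add: algebra_simps)
        then show ?thesis by (simp only: A_def A0_def diff_divide_distrib[symmetric])
      qed
      then have "\<bar>A - A0\<bar> = \<bar>b n * sgn y * \<bar>y\<bar> powr th n + (\<bar>y\<bar> powr th n - \<bar>y\<bar> powr lam)\<bar> / lam"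
        using lam by (simp add: abs_divide)
      also have "\<dots> \<le> \<bar>b n * sgn y * \<bar>y\<bar> powr th n + (\<bar>y\<bar> powr th n - \<bar>y\<bar> powr lam)\<bar> / 1"
        using lam by (intro divide_left_mono) auto
      also have "\<dots> \<le> \<bar>b n * sgn y * \<bar>y\<bar> powr th n\<bar> + \<bar>\<bar>y\<bar> powr th n - \<bar>y\<bar> powr lam\<bar>"
          unfolding div_by_1 by (rule abs_triangle_ineq)
      finally have "?s * \<bar>A - A0\<bar> \<le> ?s * (\<bar>b n * sgn y * \<bar>y\<bar> powr th n\<bar> + \<bar>\<bar>y\<bar> powr th n - \<bar>y\<bar> powr lam\<bar>)"
        by (intro mult_left_mono) auto
      then have 3: "?s * \<bar>A - A0\<bar> \<le> 5 * B * wt 5 y" using 1 2 unfolding distrib_left by linarith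
      have "\<bar>?s * (kn n y - epd_kernel lam y)\<bar> \<le> ?s * (\<bar>A - A0\<bar> * max (exp (- A)) (exp (- A0)))"
        using abs_exp_diff_le[of "- A" "- A0"] unfolding k abs_mult
        by (intro mult_mono) (auto simp: abs_minus_commute)
      also have "\<dots> = (?s * \<bar>A - A0\<bar>) * max (exp (- A)) (exp (- A0))" by simp
      also have "\<dots> \<le> (5 * B * wt 5 y) * (exp 25 * epd_kernel (1/4) y)"
        using B wt_nonneg[of 5 y] by (intro mult_mono[OF 3 kb]) (auto simp: le_max_iff_disj)
      finally show "\<bar>?s * (kn n y - epd_kernel lam y)\<bar> \<le> (5 * B * exp 25) * wt 5 y * epd_kernel (1/4) y"
        by (simp add: mult_ac)
    qed
  qed (use B in auto)
qed

definition Zn :: "nat \<Rightarrow> real" where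
  "Zn n = integral\<^sup>L lborel (kn n)"

text \<open>Normalization by the integral avoids the closed-form constant of the density;
  \<open>apd_standardized_distr\<close> shows that the two agree.\<close>

definition Qn :: "nat \<Rightarrow> real measure" where
  "Qn n = density lborel (\<lambda>y. ennreal (kn n y / Zn n))"

lemma sets_Qn [simp, measurable_cong]: "sets (Qn n) = sets borel"
  by (simp add: Qn_def)

lemma kn_integral_conv:
  assumes meas: "\<And>n. g n \<in> borel_measurable borel" "f \<in> borel_measurable borel"
    and bound: "\<forall>\<^sub>F n in sequentially. \<forall>y. y \<noteq> 0 \<longrightarrow> \<bar>g n y\<bar> \<le> C * wt p y"
    and lim: "\<And>y. y \<noteq> 0 \<Longrightarrow> (\<lambda>n. g n y) \<longlonglongrightarrow> f y"
  shows "(\<lambda>n. \<integral>y. g n y * kn n y \<partial>lborel) \<longlonglongrightarrow> (\<integral>y. f y * epd_kernel lam y \<partial>lborel)"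
    and "\<forall>\<^sub>F n in sequentially. integrable lborel (\<lambda>y. g n y * kn n y)"
    and "integrable lborel (\<lambda>y. f y * epd_kernel lam y)"
proof -
  have "\<forall>\<^sub>F n in sequentially. \<forall>y. y \<noteq> 0 \<longrightarrow> \<bar>g n y * kn n y\<bar> \<le> (C * exp 25) * wt p y * epd_kernel (1/4) y"
    using bound kn_le
  proof (eventually_elim, intro allI impI)
    fix n and y :: real
    assume n: "\<forall>y. y \<noteq> 0 \<longrightarrow> \<bar>g n y\<bar> \<le> C * wt p y" "\<forall>y. kn n y \<le> exp 25 * epd_kernel (1/4) y" and y: "y \<noteq> 0"
    have "\<bar>g n y * kn n y\<bar> = \<bar>g n y\<bar> * kn n y" using kn_pos[of n y] by (simp add: abs_mult)
    also have "\<dots> \<le> (C * wt p y) * (exp 25 * epd_kernel (1/4) y)"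
      using n y kn_pos[of n y] by (intro mult_mono) (auto intro: order_trans[OF abs_ge_zero] less_imp_le)
    finally show "\<bar>g n y * kn n y\<bar> \<le> (C * exp 25) * wt p y * epd_kernel (1/4) y" by (simp add: mult_ac)
  qed
  note bd = this
  have m: "(\<lambda>y. g n y * kn n y) \<in> borel_measurable borel" "(\<lambda>y. f y * epd_kernel lam y) \<in> borel_measurable borel" for n
    using meas by measurable
  have l: "(\<lambda>n. g n y * kn n y) \<longlonglongrightarrow> f y * epd_kernel lam y" if "y \<noteq> 0" for y
    using that by (intro tendsto_mult lim kn_conv)
  show "(\<lambda>n. \<integral>y. g n y * kn n y \<partial>lborel) \<longlonglongrightarrow> (\<integral>y. f y * epd_kernel lam y \<partial>lborel)"
    "\<forall>\<^sub>F n in sequentially. integrable lborel (\<lambda>y. g n y * kn n y)"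
    "integrable lborel (\<lambda>y. f y * epd_kernel lam y)"
    using dominated_convergence_kernel[OF m bd l] by blast+
qed

lemma Zn_lim: "Zn \<longlonglongrightarrow> 2 * epd_mom lam 0"
proof -
  have "(\<lambda>n. \<integral>y. (\<lambda>n y. 1) n y * kn n y \<partial>lborel) \<longlonglongrightarrow> (\<integral>y. (\<lambda>y. 1) y * epd_kernel lam y \<partial>lborel)"
    by (rule kn_integral_conv(1)[of "\<lambda>n y. 1" "\<lambda>y. 1" 1 1]) (use one_le_wt[of _ 0] in auto)
  then show ?thesis using has_bochner_kernel[OF lam0] by (simp add: Zn_def[abs_def] has_bochner_integral_iff)
qed

lemma mom0_pos: "epd_mom lam 0 > 0" using lam0 by (intro epd_mom_pos) auto

lemma Zn_pos: "\<forall>\<^sub>F n in sequentially. Zn n > 0"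
  using order_tendstoD(1)[OF Zn_lim, of 0] mom0_pos by simp

lemma integral_Qn:
  assumes "Zn n > 0" "g \<in> borel_measurable borel"
  shows "integral\<^sup>L (Qn n) g = (\<integral>y. g y * kn n y \<partial>lborel) / Zn n"
    and "integrable lborel (\<lambda>y. g y * kn n y) \<Longrightarrow> integrable (Qn n) g"
proof -
  show "integral\<^sup>L (Qn n) g = (\<integral>y. g y * kn n y \<partial>lborel) / Zn n"
    unfolding Qn_def using assms kn_pos[of n]
    by (subst integral_density) (auto simp: less_imp_le mult.commute)
  show "integrable (Qn n) g" if "integrable lborel (\<lambda>y. g y * kn n y)"
    unfolding Qn_def using assms kn_pos[of n] that
    by (subst integrable_density) (auto simp: less_imp_le mult.commute)
qed

lemma Qn_integral_conv:
  assumes meas: "\<And>n. g n \<in> borel_measurable borel" "f \<in> borel_measurable borel"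
    and bound: "\<forall>\<^sub>F n in sequentially. \<forall>y. y \<noteq> 0 \<longrightarrow> \<bar>g n y\<bar> \<le> C * wt p y"
    and lim: "\<And>y. y \<noteq> 0 \<Longrightarrow> (\<lambda>n. g n y) \<longlonglongrightarrow> f y"
  shows "(\<lambda>n. integral\<^sup>L (Qn n) (g n)) \<longlonglongrightarrow> integral\<^sup>L (epd lam) f"
    and "\<forall>\<^sub>F n in sequentially. integrable (Qn n) (g n)"
proof -
  have K: "(\<lambda>n. \<integral>y. g n y * kn n y \<partial>lborel) \<longlonglongrightarrow> (\<integral>y. f y * epd_kernel lam y \<partial>lborel)"
    "\<forall>\<^sub>F n in sequentially. integrable lborel (\<lambda>y. g n y * kn n y)"
    using kn_integral_conv(1,2)[of g f C p] meas bound lim by blast+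
  have "(\<lambda>n. (\<integral>y. g n y * kn n y \<partial>lborel) / Zn n) \<longlonglongrightarrow> (\<integral>y. f y * epd_kernel lam y \<partial>lborel) / (2 * epd_mom lam 0)"
    using mom0_pos by (intro tendsto_divide K Zn_lim) auto
  also have "(\<integral>y. f y * epd_kernel lam y \<partial>lborel) / (2 * epd_mom lam 0) = integral\<^sup>L (epd lam) f"
    by (rule integral_epd(1)[OF lam0 meas(2), symmetric])
  finally show "(\<lambda>n. integral\<^sup>L (Qn n) (g n)) \<longlonglongrightarrow> integral\<^sup>L (epd lam) f"
  proof (rule Lim_transform_eventually)
    show "\<forall>\<^sub>F n in sequentially. (\<integral>y. g n y * kn n y \<partial>lborel) / Zn n = integral\<^sup>L (Qn n) (g n)"
      using Zn_pos by (rule eventually_mono) (rule integral_Qn(1)[symmetric], assumption, rule meas(1))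
  qed
  show "\<forall>\<^sub>F n in sequentially. integrable (Qn n) (g n)"
    using K(2) Zn_pos
    by (rule eventually_elim2) (rule integral_Qn(2), assumption, rule meas(1), assumption)
qed

lemma wt_bdd_conv:
  assumes "wt_bdd g"
  shows "(\<lambda>n. integral\<^sup>L (Qn n) g) \<longlonglongrightarrow> integral\<^sup>L (epd lam) g"
    and "\<forall>\<^sub>F n in sequentially. integrable (Qn n) g"
proof -
  obtain C p where g: "g \<in> borel_measurable borel" "\<And>y. y \<noteq> 0 \<Longrightarrow> \<bar>g y\<bar> \<le> C * wt p y"
    using assms unfolding wt_bdd_def by blast
  show "(\<lambda>n. integral\<^sup>L (Qn n) g) \<longlonglongrightarrow> integral\<^sup>L (epd lam) g"
    "\<forall>\<^sub>F n in sequentially. integrable (Qn n) g"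
    using Qn_integral_conv[of "\<lambda>n. g" g C p] g by auto
qed

lemma poly_bdd_integrable:
  assumes "poly_bdd h"
  shows "integrable (epd lam) h"
proof -
  obtain C p where h: "h \<in> borel_measurable borel" "\<And>y. y \<noteq> 0 \<Longrightarrow> \<bar>h y\<bar> \<le> C * wt p y"
    using poly_bdd_imp_wt_bdd[OF assms] unfolding wt_bdd_def by blast
  then have "integrable lborel (\<lambda>y. h y * epd_kernel lam y)"
    by (intro kn_integral_conv(3)[of "\<lambda>n. h" h C p]) auto
  then show ?thesis using integral_epd(2)[OF lam0 h(1)] by simp
qed

text \<open>With null mean 0, the scaled mean is the integral of \<open>g\<close> against the scaled
  kernel difference, divided by \<open>Zn\<close>. The drift of the normalizing constant would
  multiply the null mean and therefore drops out.\<close>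

lemma score_limit:
  assumes g: "poly_bdd g" and g0: "integral\<^sup>L (epd lam) g = 0"
  shows "(\<lambda>n. sqrt (real n) * integral\<^sup>L (Qn n) g) \<longlonglongrightarrow>
    - (\<beta> * (\<integral>y. g y * spow lam y \<partial>epd lam) + \<delta> * (\<integral>y. g y * kap lam y \<partial>epd lam)) / lam"
proof -
  obtain C p where C: "C \<ge> 0" and gm[measurable]: "g \<in> borel_measurable borel" and gb: "\<And>y. y \<noteq> 0 \<Longrightarrow> \<bar>g y\<bar> \<le> C * (1 + \<bar>y\<bar>) ^ p"
    using g unfolding poly_bdd_def by blast
  obtain B where B: "B \<ge> 0" "\<forall>\<^sub>F n in sequentially. \<forall>y. y \<noteq> 0 \<longrightarrow>
    \<bar>sqrt (real n) * (kn n y - epd_kernel lam y)\<bar> \<le> B * wt 5 y * epd_kernel (1/4) y"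
    by (rule kn_score_le)
  define s where "s n y = g y * (sqrt (real n) * (kn n y - epd_kernel lam y))" for n y
  define f where "f y = g y * (- ((\<beta> * spow lam y + \<delta> * kap lam y) / lam) * epd_kernel lam y)" for y
  have "\<forall>\<^sub>F n in sequentially. \<forall>y. y \<noteq> 0 \<longrightarrow> \<bar>s n y\<bar> \<le> (C * B) * wt (p + 5) y * epd_kernel (1/4) y"
    using B(2)
  proof (eventually_elim, intro allI impI)
    fix n and y :: real
    assume n: "\<forall>y. y \<noteq> 0 \<longrightarrow> \<bar>sqrt (real n) * (kn n y - epd_kernel lam y)\<bar> \<le> B * wt 5 y * epd_kernel (1/4) y"
      and y: "y \<noteq> 0"
    have "\<bar>s n y\<bar> \<le> (C * (1 + \<bar>y\<bar>) ^ p) * (B * wt 5 y * epd_kernel (1/4) y)"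
      unfolding s_def abs_mult[of "g y"] using gb[OF y] n y C by (intro mult_mono) auto
    then show "\<bar>s n y\<bar> \<le> (C * B) * wt (p + 5) y * epd_kernel (1/4) y"
      by (simp add: wt_def power_add mult_ac)
  qed
  moreover have "(\<lambda>n. s n y) \<longlonglongrightarrow> f y" if "y \<noteq> 0" for y
    unfolding s_def f_def by (intro tendsto_mult_left kn_score_conv that)
  moreover have "s n \<in> borel_measurable borel" "f \<in> borel_measurable borel" for n
    unfolding s_def[abs_def] f_def[abs_def] by measurable
  ultimately have lim: "(\<lambda>n. integral\<^sup>L lborel (s n)) \<longlonglongrightarrow> integral\<^sup>L lborel f"
    using dominated_convergence_kernel(1)[of s f "C * B" "p + 5"] by blast
  have gw: "wt_bdd g" by (rule poly_bdd_imp_wt_bdd[OF g])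
  obtain C' p' where C': "\<And>y. y \<noteq> 0 \<Longrightarrow> \<bar>g y\<bar> \<le> C' * wt p' y"
    using gw unfolding wt_bdd_def by blast
  note K = kn_integral_conv[of "\<lambda>n. g" g C' p', OF gm gm _ tendsto_const]
  have int0: "integrable lborel (\<lambda>y. g y * epd_kernel lam y)" by (rule K(3)) (use C' in auto)
  have int: "\<forall>\<^sub>F n in sequentially. integrable lborel (\<lambda>y. g y * kn n y)" by (rule K(2)) (use C' in auto)
  have z: "(\<integral>y. g y * epd_kernel lam y \<partial>lborel) = 0"
    using g0 integral_epd(1)[OF lam0 gm] mom0_pos by simp
  have "(\<lambda>n. integral\<^sup>L lborel (s n) / Zn n) \<longlonglongrightarrow> integral\<^sup>L lborel f / (2 * epd_mom lam 0)"
    using mom0_pos by (intro tendsto_divide lim Zn_lim) auto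
  then have "(\<lambda>n. sqrt (real n) * integral\<^sup>L (Qn n) g) \<longlonglongrightarrow> integral\<^sup>L lborel f / (2 * epd_mom lam 0)"
  proof (rule Lim_transform_eventually)
    show "\<forall>\<^sub>F n in sequentially. integral\<^sup>L lborel (s n) / Zn n = sqrt (real n) * integral\<^sup>L (Qn n) g"
      using int Zn_pos
    proof eventually_elim
      case (elim n)
      have "s n = (\<lambda>y. sqrt (real n) * (g y * kn n y - g y * epd_kernel lam y))"
        by (auto simp: s_def algebra_simps)
      then have "integral\<^sup>L lborel (s n) = sqrt (real n) * ((\<integral>y. g y * kn n y \<partial>lborel) - (\<integral>y. g y * epd_kernel lam y \<partial>lborel))"
        using elim int0 by simp
      then show ?case using integral_Qn(1)[OF elim(2) gm] z by simp
    qed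
  qed
  also have "integral\<^sup>L lborel f / (2 * epd_mom lam 0)
      = (\<integral>y. g y * (- ((\<beta> * spow lam y + \<delta> * kap lam y) / lam)) \<partial>epd lam)"
    by (subst integral_epd(1)[OF lam0]) (auto simp: f_def[abs_def] mult_ac)
  also have "\<dots> = (\<integral>y. - (\<beta> / lam) * (g y * spow lam y) - (\<delta> / lam) * (g y * kap lam y) \<partial>epd lam)"
    by (intro Bochner_Integration.integral_cong) (auto simp: algebra_simps add_divide_distrib)
  also have "\<dots> = - (\<beta> / lam) * (\<integral>y. g y * spow lam y \<partial>epd lam) - (\<delta> / lam) * (\<integral>y. g y * kap lam y \<partial>epd lam)"
  proof -
    from poly_bdd_integrable[OF poly_bdd_mult[OF g poly_bdd_spow[of lam]]]
      poly_bdd_integrable[OF poly_bdd_mult[OF g poly_bdd_kap[OF lam(1)]]]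
    show ?thesis using lam by simp
  qed
  finally show ?thesis by (simp add: add_divide_distrib diff_divide_distrib algebra_simps)
qed

end

section \<open>Triangular arrays\<close>

lemma (in prob_space) indep_sum_second_moment:
  fixes \<xi> :: "nat \<Rightarrow> 'a \<Rightarrow> real"
  assumes indep: "indep_vars (\<lambda>_. borel) \<xi> {..<n}"
    and int: "\<And>i. i < n \<Longrightarrow> integrable M (\<xi> i)" "\<And>i. i < n \<Longrightarrow> integrable M (\<lambda>\<omega>. (\<xi> i \<omega>)\<^sup>2)"
    and mean: "\<And>i. i < n \<Longrightarrow> expectation (\<xi> i) = 0"
  shows "integrable M (\<lambda>\<omega>. (\<Sum>i<n. \<xi> i \<omega>)\<^sup>2)"
    and "expectation (\<lambda>\<omega>. (\<Sum>i<n. \<xi> i \<omega>)\<^sup>2) = (\<Sum>i<n. expectation (\<lambda>\<omega>. (\<xi> i \<omega>)\<^sup>2))"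
proof -
  have pair: "integrable M (\<lambda>\<omega>. \<xi> i \<omega> * \<xi> j \<omega>) \<and>
      expectation (\<lambda>\<omega>. \<xi> i \<omega> * \<xi> j \<omega>) = (if i = j then expectation (\<lambda>\<omega>. (\<xi> i \<omega>)\<^sup>2) else 0)"
    if ij: "i < n" "j < n" for i j
  proof (cases "i = j")
    case True
    then show ?thesis using int(2)[OF ij(1)] by (simp add: power2_eq_square)
  next
    case False
    have sub: "indep_vars (\<lambda>_. borel) \<xi> {i, j}"
      by (rule indep_vars_subset[OF indep]) (use ij in auto)
    have "integrable M (\<lambda>\<omega>. \<Prod>k\<in>{i, j}. \<xi> k \<omega>)"
      by (rule indep_vars_integrable[OF _ sub]) (use int(1) ij in auto)
    moreover have "expectation (\<lambda>\<omega>. \<Prod>k\<in>{i, j}. \<xi> k \<omega>) = (\<Prod>k\<in>{i, j}. expectation (\<xi> k))"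
      by (rule indep_vars_lebesgue_integral[OF _ sub]) (use int(1) ij in auto)
    ultimately show ?thesis using False mean ij by simp
  qed
  have sq: "(\<Sum>i<n. \<xi> i \<omega>)\<^sup>2 = (\<Sum>i<n. \<Sum>j<n. \<xi> i \<omega> * \<xi> j \<omega>)" for \<omega>
    by (simp add: power2_eq_square sum_product)
  show "integrable M (\<lambda>\<omega>. (\<Sum>i<n. \<xi> i \<omega>)\<^sup>2)"
    unfolding sq using pair by (intro Bochner_Integration.integrable_sum) auto
  have "expectation (\<lambda>\<omega>. (\<Sum>i<n. \<xi> i \<omega>)\<^sup>2) = (\<Sum>i<n. \<Sum>j<n. expectation (\<lambda>\<omega>. \<xi> i \<omega> * \<xi> j \<omega>))"
    unfolding sq using pair
    by (subst Bochner_Integration.integral_sum; (intro Bochner_Integration.integrable_sum sum.cong refl)?)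
       (auto intro!: sum.cong Bochner_Integration.integral_sum)
  also have "\<dots> = (\<Sum>i<n. \<Sum>j<n. if i = j then expectation (\<lambda>\<omega>. (\<xi> i \<omega>)\<^sup>2) else 0)"
    using pair by (intro sum.cong refl) auto
  also have "\<dots> = (\<Sum>i<n. expectation (\<lambda>\<omega>. (\<xi> i \<omega>)\<^sup>2))"
    by (intro sum.cong refl) (simp add: sum.delta)
  finally show "expectation (\<lambda>\<omega>. (\<Sum>i<n. \<xi> i \<omega>)\<^sup>2) = (\<Sum>i<n. expectation (\<lambda>\<omega>. (\<xi> i \<omega>)\<^sup>2))" .
qed

text \<open>Independence is assumed within each row, and nothing is assumed about the joint law of
  different rows.\<close>

locale apd_array = apd_seq lam \<beta> \<delta> b th + prob_space M
  for lam \<beta> \<delta> :: real and b th :: "nat \<Rightarrow> real" and M :: "'a measure" +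
  fixes Y :: "nat \<Rightarrow> nat \<Rightarrow> 'a \<Rightarrow> real"
  assumes rows: "\<forall>\<^sub>F n in sequentially. indep_vars (\<lambda>_. borel) (Y n) {..<n} \<and>
    (\<forall>i<n. distr M borel (Y n i) = Qn n)"
begin

abbreviation root_n :: "nat \<times> 'a \<Rightarrow> real" where
  "root_n p \<equiv> sqrt (real (fst p))"

definition rsum :: "(real \<Rightarrow> real) \<Rightarrow> nat \<times> 'a \<Rightarrow> real" where
  "rsum g p = (\<Sum>i<fst p. g (Y (fst p) i (snd p)))"

lemma rsum_add: "rsum (\<lambda>y. f y + g y) p = rsum f p + rsum g p"
  and rsum_diff: "rsum (\<lambda>y. f y - g y) p = rsum f p - rsum g p"
  and rsum_cmult: "rsum (\<lambda>y. c * g y) p = c * rsum g p"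
  and rsum_const: "rsum (\<lambda>y. c) p = real (fst p) * c"
  by (simp_all add: rsum_def sum.distrib sum_subtractf sum_distrib_left)

lemma rows_measurable: "\<forall>\<^sub>F n in sequentially. \<forall>i<n. Y n i \<in> borel_measurable M"
  using rows by eventually_elim (auto simp: indep_vars_def)

lemma rsum_measurable:
  "g \<in> borel_measurable borel \<Longrightarrow> \<forall>\<^sub>F n in sequentially. (\<lambda>\<omega>. rsum g (n, \<omega>)) \<in> borel_measurable M"
  using rows_measurable
  by eventually_elim (auto simp: rsum_def intro!: borel_measurable_sum)

lemma row_expectation:
  fixes g :: "real \<Rightarrow> real"
  assumes "distr M borel (Y n i) = Qn n" "Y n i \<in> borel_measurable M" "g \<in> borel_measurable borel"
  shows "expectation (\<lambda>\<omega>. g (Y n i \<omega>)) = integral\<^sup>L (Qn n) g"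
    and "integrable (Qn n) g \<Longrightarrow> integrable M (\<lambda>\<omega>. g (Y n i \<omega>))"
  unfolding assms(1)[symmetric] using assms(2,3)
  by (simp_all add: integral_distr[OF assms(2)] integrable_distr_eq[OF assms(2)])

text \<open>Lets pointwise bounds that exclude the origin be applied to the observations.\<close>

lemma rows_neq_0: "\<forall>\<^sub>F p in prob_filter M. \<forall>i<fst p. Y (fst p) i (snd p) \<noteq> 0"
proof (rule eventually_prob_filter_AE)
  show "\<forall>\<^sub>F n in sequentially. AE \<omega> in M. \<forall>i<fst (n, \<omega>). Y (fst (n, \<omega>)) i (snd (n, \<omega>)) \<noteq> 0"
    using rows
  proof eventually_elim
    case (elim n)
    have "AE \<omega> in M. Y n i \<omega> \<noteq> 0" if i: "i < n" for i
    proof -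
      have m: "Y n i \<in> borel_measurable M" using elim i by (auto simp: indep_vars_def)
      have "AE y in Qn n. y \<noteq> 0"
        unfolding Qn_def by (subst AE_density) (use AE_neq_0 in auto)
      moreover have "distr M borel (Y n i) = Qn n" using elim i by blast
      ultimately have "AE y in distr M borel (Y n i). y \<noteq> 0" by (simp only:)
      then show ?thesis using m by (subst (asm) AE_distr_iff) auto
    qed
    then have "AE \<omega> in M. \<forall>i\<in>{..<n}. Y n i \<omega> \<noteq> 0" by (intro AE_finite_allI) auto
    then show ?case by (simp add: Ball_def)
  qed
qed

lemma row_second_moment:
  fixes g :: "nat \<Rightarrow> real \<Rightarrow> real"
  assumes g: "\<And>n. g n \<in> borel_measurable borel"
    and int: "\<forall>\<^sub>F n in sequentially. integrable (Qn n) (g n)" "\<forall>\<^sub>F n in sequentially. integrable (Qn n) (\<lambda>y. (g n y)\<^sup>2)"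
  shows "\<forall>\<^sub>F n in sequentially.
     integrable M (\<lambda>\<omega>. ((\<Sum>i<n. g n (Y n i \<omega>) - integral\<^sup>L (Qn n) (g n)) / sqrt (real n))\<^sup>2) \<and>
     expectation (\<lambda>\<omega>. ((\<Sum>i<n. g n (Y n i \<omega>) - integral\<^sup>L (Qn n) (g n)) / sqrt (real n))\<^sup>2)
       \<le> integral\<^sup>L (Qn n) (\<lambda>y. (g n y)\<^sup>2)"
  using rows int eventually_gt_at_top[of 0]
proof eventually_elim
  case (elim n)
  define m where "m = integral\<^sup>L (Qn n) (g n)"
  define \<xi> where "\<xi> i \<omega> = g n (Y n i \<omega>) - m" for i \<omega>
  have Ym: "Y n i \<in> borel_measurable M" if "i < n" for i
    using elim that by (auto simp: indep_vars_def)
  note E = row_expectation[OF _ Ym]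
  have d: "distr M borel (Y n i) = Qn n" if "i < n" for i using elim that by blast
  have i1: "integrable M (\<lambda>\<omega>. g n (Y n i \<omega>))" "expectation (\<lambda>\<omega>. g n (Y n i \<omega>)) = m" if "i < n" for i
    using row_expectation[OF d[OF that] Ym[OF that] g[of n]] elim by (auto simp: m_def)
  have i2: "integrable M (\<lambda>\<omega>. (g n (Y n i \<omega>))\<^sup>2)"
    "expectation (\<lambda>\<omega>. (g n (Y n i \<omega>))\<^sup>2) = integral\<^sup>L (Qn n) (\<lambda>y. (g n y)\<^sup>2)" if "i < n" for i
    using row_expectation[OF d[OF that] Ym[OF that], of "\<lambda>y. (g n y)\<^sup>2"] g[of n] elim by auto
  have ind: "indep_vars (\<lambda>_. borel) \<xi> {..<n}"
  proof -
    have "indep_vars (\<lambda>_. borel) (\<lambda>i \<omega>. (\<lambda>y. g n y - m) (Y n i \<omega>)) {..<n}"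
      by (rule indep_vars_compose2[where X="Y n" and M'="\<lambda>_. borel"]) (use elim g[of n] in auto)
    then show ?thesis by (simp add: \<xi>_def[abs_def])
  qed
  have sq: "(\<xi> i \<omega>)\<^sup>2 = (g n (Y n i \<omega>))\<^sup>2 - 2 * m * g n (Y n i \<omega>) + m\<^sup>2" for i \<omega>
    by (simp add: \<xi>_def power2_diff)
  have x1: "integrable M (\<xi> i)" "expectation (\<xi> i) = 0" "integrable M (\<lambda>\<omega>. (\<xi> i \<omega>)\<^sup>2)"
    "expectation (\<lambda>\<omega>. (\<xi> i \<omega>)\<^sup>2) \<le> integral\<^sup>L (Qn n) (\<lambda>y. (g n y)\<^sup>2)" if "i < n" for i
    unfolding sq using i1[OF that] i2[OF that]
    by (auto simp: \<xi>_def[abs_def] prob_space power2_eq_square)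
  have int2: "integrable M (\<lambda>\<omega>. (\<Sum>i<n. \<xi> i \<omega>)\<^sup>2)"
    and e2: "expectation (\<lambda>\<omega>. (\<Sum>i<n. \<xi> i \<omega>)\<^sup>2) = (\<Sum>i<n. expectation (\<lambda>\<omega>. (\<xi> i \<omega>)\<^sup>2))"
    using indep_sum_second_moment[OF ind x1(1,3,2)] by auto
  have "(\<Sum>i<n. expectation (\<lambda>\<omega>. (\<xi> i \<omega>)\<^sup>2)) \<le> (\<Sum>i<n. integral\<^sup>L (Qn n) (\<lambda>y. (g n y)\<^sup>2))"
    by (intro sum_mono x1) auto
  then have "expectation (\<lambda>\<omega>. (\<Sum>i<n. \<xi> i \<omega>)\<^sup>2) / real n \<le> integral\<^sup>L (Qn n) (\<lambda>y. (g n y)\<^sup>2)"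
    using elim unfolding e2 by (simp add: divide_le_eq mult.commute)
  moreover have "((\<Sum>i<n. g n (Y n i \<omega>) - integral\<^sup>L (Qn n) (g n)) / sqrt (real n))\<^sup>2 = (\<Sum>i<n. \<xi> i \<omega>)\<^sup>2 / real n" for \<omega>
    by (simp add: \<xi>_def m_def power_divide)
  ultimately show ?case using int2 by simp
qed

text \<open>Chebyshev's inequality for functions that change with \<open>n\<close>. It serves both
  the law of large numbers and the increments of the score under shrinking shifts.\<close>

lemma centered_row_conv:
  fixes g :: "nat \<Rightarrow> real \<Rightarrow> real"
  assumes g: "\<And>n. g n \<in> borel_measurable borel"
    and int: "\<forall>\<^sub>F n in sequentially. integrable (Qn n) (g n)" "\<forall>\<^sub>F n in sequentially. integrable (Qn n) (\<lambda>y. (g n y)\<^sup>2)"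
    and mean: "(\<lambda>n. sqrt (real n) * integral\<^sup>L (Qn n) (g n)) \<longlonglongrightarrow> l"
    and var: "(\<lambda>n. integral\<^sup>L (Qn n) (\<lambda>y. (g n y)\<^sup>2)) \<longlonglongrightarrow> 0"
  shows "((\<lambda>p. (\<Sum>i<fst p. g (fst p) (Y (fst p) i (snd p))) / root_n p) \<longlongrightarrow> l) (prob_filter M)"
proof -
  let ?U = "\<lambda>n \<omega>. ((\<Sum>i<n. g n (Y n i \<omega>) - integral\<^sup>L (Qn n) (g n)) / sqrt (real n))\<^sup>2"
  note R = row_second_moment[OF g int]
  have "((\<lambda>p. ?U (fst p) (snd p)) \<longlongrightarrow> 0) (prob_filter M)"
  proof (rule markov_tendsto_0)
    show "\<forall>\<^sub>F n in sequentially. integrable M (?U n)" using R by eventually_elim blast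
    show "(\<lambda>n. expectation (?U n)) \<longlonglongrightarrow> 0"
    proof (rule Lim_null_comparison[OF _ var])
      show "\<forall>\<^sub>F n in sequentially. norm (expectation (?U n)) \<le> integral\<^sup>L (Qn n) (\<lambda>y. (g n y)\<^sup>2)"
        using R by eventually_elim simp
    qed
  qed auto
  from tendsto_real_sqrt[OF this, unfolded real_sqrt_abs real_sqrt_zero]
  have 1: "((\<lambda>p. (\<Sum>i<fst p. g (fst p) (Y (fst p) i (snd p)) - integral\<^sup>L (Qn (fst p)) (g (fst p))) / root_n p) \<longlongrightarrow> 0) (prob_filter M)"
    by (rule tendsto_rabs_zero_cancel)
  have 2: "((\<lambda>p. root_n p * integral\<^sup>L (Qn (fst p)) (g (fst p))) \<longlongrightarrow> l) (prob_filter M)"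
    by (rule tendsto_fst_prob_filter[OF mean])
  have eq: "(\<Sum>i<n. x i - m) / sqrt (real n) + sqrt (real n) * m = (\<Sum>i<n. x i) / sqrt (real n)" for n m and x :: "nat \<Rightarrow> real"
    by (cases "n = 0") (simp_all add: sum_subtractf field_simps)
  show ?thesis using tendsto_add[OF 1 2] unfolding eq by simp
qed

text \<open>The special case of \<open>centered_row_conv\<close> for the functions
  \<open>g / sqrt n\<close>.\<close>

lemma lln:
  assumes g: "wt_bdd g" "wt_bdd (\<lambda>y. (g y)\<^sup>2)"
  shows "((\<lambda>p. rsum g p / real (fst p)) \<longlongrightarrow> integral\<^sup>L (epd lam) g) (prob_filter M)"
proof -
  have inv: "(\<lambda>n. 1 / sqrt (real n)) \<longlonglongrightarrow> 0"
    by (intro tendsto_divide_0[OF tendsto_const] filterlim_at_top_imp_at_infinity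
        filterlim_compose[OF sqrt_at_top filterlim_real_sequentially])
  define h where "h n y = g y / sqrt (real n)" for n y
  have m: "g \<in> borel_measurable borel" using g(1) by (rule wt_bdd_measurable)
  have "((\<lambda>p. (\<Sum>i<fst p. h (fst p) (Y (fst p) i (snd p))) / root_n p) \<longlongrightarrow> integral\<^sup>L (epd lam) g) (prob_filter M)"
  proof (rule centered_row_conv)
    show "h n \<in> borel_measurable borel" for n unfolding h_def[abs_def] using m by measurable
    show "\<forall>\<^sub>F n in sequentially. integrable (Qn n) (h n)"
      using wt_bdd_conv(2)[OF g(1)] by eventually_elim (simp add: h_def[abs_def])
    show "\<forall>\<^sub>F n in sequentially. integrable (Qn n) (\<lambda>y. (h n y)\<^sup>2)"
      using wt_bdd_conv(2)[OF g(2)] by eventually_elim (simp add: h_def power_divide)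
    show "(\<lambda>n. sqrt (real n) * integral\<^sup>L (Qn n) (h n)) \<longlonglongrightarrow> integral\<^sup>L (epd lam) g"
      using wt_bdd_conv(1)[OF g(1)]
    proof (rule Lim_transform_eventually)
      show "\<forall>\<^sub>F n in sequentially. integral\<^sup>L (Qn n) g = sqrt (real n) * integral\<^sup>L (Qn n) (h n)"
        using eventually_gt_at_top[of 0] by eventually_elim (simp add: h_def[abs_def])
    qed
    have "(\<lambda>n. (1 / sqrt (real n) * (1 / sqrt (real n))) * integral\<^sup>L (Qn n) (\<lambda>y. (g y)\<^sup>2)) \<longlonglongrightarrow> (0 * 0) * integral\<^sup>L (epd lam) (\<lambda>y. (g y)\<^sup>2)"
      by (intro tendsto_mult inv wt_bdd_conv(1)[OF g(2)])
    then show "(\<lambda>n. integral\<^sup>L (Qn n) (\<lambda>y. (h n y)\<^sup>2)) \<longlonglongrightarrow> 0"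
      by (simp add: h_def power_divide)
  qed
  moreover have "(\<Sum>i<n. h n (x i)) / sqrt (real n) = (\<Sum>i<n. g (x i)) / real n" for n and x :: "nat \<Rightarrow> real"
    by (simp add: h_def sum_divide_distrib[symmetric])
  ultimately show ?thesis by (simp add: rsum_def)
qed

text \<open>Second moments make the centred sums tight, and the assumed limit bounds the
  drift.\<close>

lemma clt_tight:
  assumes g: "wt_bdd g" "wt_bdd (\<lambda>y. (g y)\<^sup>2)"
    and mean: "(\<lambda>n. sqrt (real n) * integral\<^sup>L (Qn n) g) \<longlonglongrightarrow> l"
  shows "stoch_bounded M (\<lambda>p. rsum g p / root_n p)"
proof -
  have m: "g \<in> borel_measurable borel" using g(1) by (rule wt_bdd_measurable)
  let ?U = "\<lambda>n \<omega>. ((\<Sum>i<n. g (Y n i \<omega>) - integral\<^sup>L (Qn n) g) / sqrt (real n))\<^sup>2"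
  have R: "\<forall>\<^sub>F n in sequentially. integrable M (?U n) \<and> expectation (?U n) \<le> integral\<^sup>L (Qn n) (\<lambda>y. (g y)\<^sup>2)"
    using row_second_moment[of "\<lambda>n. g"] m wt_bdd_conv(2)[OF g(1)] wt_bdd_conv(2)[OF g(2)] by simp
  have "\<forall>\<^sub>F n in sequentially. integral\<^sup>L (Qn n) (\<lambda>y. (g y)\<^sup>2) < integral\<^sup>L (epd lam) (\<lambda>y. (g y)\<^sup>2) + 1"
    using order_tendstoD(2)[OF wt_bdd_conv(1)[OF g(2)]] by simp
  with R have "stoch_bounded M (\<lambda>p. ?U (fst p) (snd p))"
    by (intro markov_stoch_bounded[where B="integral\<^sup>L (epd lam) (\<lambda>y. (g y)\<^sup>2) + 1"])
       (auto elim: eventually_mono eventually_elim2)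
  moreover have "stoch_bounded M (\<lambda>p. 1)" by (rule tendsto_imp_stoch_bounded[OF tendsto_const])
  ultimately have "stoch_bounded M (\<lambda>p. ?U (fst p) (snd p) + 1)" by (rule stoch_bounded_add)
  then have "stoch_bounded M (\<lambda>p. (\<Sum>i<fst p. g (Y (fst p) i (snd p)) - integral\<^sup>L (Qn (fst p)) g) / root_n p)"
  proof (rule stoch_bounded_mono[where c=1])
    have "\<bar>x\<bar> \<le> 1 * \<bar>x\<^sup>2 + 1\<bar>" for x :: real
    proof -
      have "0 \<le> (\<bar>x\<bar> - 1)\<^sup>2" by simp
      then have "2 * \<bar>x\<bar> \<le> x\<^sup>2 + 1" by (simp add: power2_diff)
      then show ?thesis by simp
    qed
    then show "\<forall>\<^sub>F p in prob_filter M. \<bar>(\<Sum>i<fst p. g (Y (fst p) i (snd p)) - integral\<^sup>L (Qn (fst p)) g) / root_n p\<bar>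
        \<le> 1 * \<bar>?U (fst p) (snd p) + 1\<bar>"
      by (intro always_eventually allI)
  qed simp
  from stoch_bounded_add[OF this tendsto_imp_stoch_bounded[OF tendsto_fst_prob_filter[OF mean]]]
  have "stoch_bounded M (\<lambda>p. (\<Sum>i<fst p. g (Y (fst p) i (snd p)) - integral\<^sup>L (Qn (fst p)) g) / root_n p
      + root_n p * integral\<^sup>L (Qn (fst p)) g)" .
  moreover have eq: "(\<Sum>i<n. x i - m) / sqrt (real n) + sqrt (real n) * m = (\<Sum>i<n. x i) / sqrt (real n)" for n m and x :: "nat \<Rightarrow> real"
    by (cases "n = 0") (simp_all add: sum_subtractf field_simps)
  ultimately show ?thesis unfolding eq by (simp add: rsum_def)
qed

text \<open>First moments only: the square of \<open>wt q\<close> has a singularity of order 1 at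
  the origin, which is not integrable, so \<open>lln\<close> does not cover the Taylor
  remainders.\<close>

lemma average_bounded:
  assumes g: "wt_bdd g" and pos: "\<And>y. g y \<ge> 0"
  shows "stoch_bounded M (\<lambda>p. rsum g p / real (fst p))"
proof -
  let ?U = "\<lambda>n \<omega>. (\<Sum>i<n. g (Y n i \<omega>)) / real n"
  have m: "g \<in> borel_measurable borel" using g by (rule wt_bdd_measurable)
  have R: "\<forall>\<^sub>F n in sequentially. integrable M (?U n) \<and> expectation (?U n) = integral\<^sup>L (Qn n) g"
    using rows wt_bdd_conv(2)[OF g] eventually_gt_at_top[of 0]
  proof eventually_elim
    case (elim n)
    have Ym: "Y n i \<in> borel_measurable M" if "i < n" for i
      using elim that by (auto simp: indep_vars_def)
    have i1: "integrable M (\<lambda>\<omega>. g (Y n i \<omega>))" "expectation (\<lambda>\<omega>. g (Y n i \<omega>)) = integral\<^sup>L (Qn n) g" if "i < n" for i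
      using row_expectation[OF _ Ym[OF that] m] elim that by auto
    have "integrable M (\<lambda>\<omega>. \<Sum>i<n. g (Y n i \<omega>))"
      by (intro Bochner_Integration.integrable_sum) (use i1 in auto)
    moreover have "expectation (\<lambda>\<omega>. \<Sum>i<n. g (Y n i \<omega>)) = real n * integral\<^sup>L (Qn n) g"
      by (subst Bochner_Integration.integral_sum) (use i1 in auto)
    ultimately show ?case using elim by simp
  qed
  have "\<forall>\<^sub>F n in sequentially. integral\<^sup>L (Qn n) g < integral\<^sup>L (epd lam) g + 1"
    using order_tendstoD(2)[OF wt_bdd_conv(1)[OF g]] by simp
  with R have "stoch_bounded M (\<lambda>p. ?U (fst p) (snd p))"
    using pos
    by (intro markov_stoch_bounded[where B="integral\<^sup>L (epd lam) g + 1"])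
       (auto elim: eventually_mono eventually_elim2 intro!: sum_nonneg divide_nonneg_nonneg)
  then show ?thesis by (simp add: rsum_def)
qed

lemma inv_sqrt_fst: "((\<lambda>p. 1 / root_n p) \<longlongrightarrow> 0) (prob_filter M)"
proof -
  have "(\<lambda>n. 1 / sqrt (real n)) \<longlonglongrightarrow> 0"
    by (intro tendsto_divide_0[OF tendsto_const] filterlim_at_top_imp_at_infinity
        filterlim_compose[OF sqrt_at_top filterlim_real_sequentially])
  then show ?thesis by (rule tendsto_fst_prob_filter)
qed

end

section \<open>Taylor expansions with a singularity at the origin\<close>

lemma two_point_mvt:
  fixes f f' :: "real \<Rightarrow> real"
  assumes "\<And>u. \<bar>u - a\<bar> \<le> \<bar>c - a\<bar> \<Longrightarrow> (f has_real_derivative f' u) (at u)"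
  shows "\<exists>z. \<bar>z - a\<bar> \<le> \<bar>c - a\<bar> \<and> f c - f a = (c - a) * f' z"
proof (cases a c rule: linorder_cases)
  case less
  then have "\<exists>z. a < z \<and> z < c \<and> f c - f a = (c - a) * f' z"
    by (intro MVT2 assms) auto
  then obtain z where "a < z" "z < c" "f c - f a = (c - a) * f' z" by blast
  then show ?thesis by (intro exI[of _ z]) auto
next
  case greater
  then have "\<exists>z. c < z \<and> z < a \<and> f a - f c = (a - c) * f' z"
    by (intro MVT2 assms) auto
  then obtain z where "c < z" "z < a" "f a - f c = (a - c) * f' z" by blast
  then show ?thesis by (intro exI[of _ z]) (auto simp: algebra_simps)
qed auto

lemma segment_bounds:
  fixes y t u :: real
  assumes "2 * \<bar>t\<bar> \<le> \<bar>y\<bar>" "\<bar>u - y\<bar> \<le> \<bar>t\<bar>"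
  shows "\<bar>y\<bar> \<le> 2 * \<bar>u\<bar>" "\<bar>u\<bar> \<le> 2 * \<bar>y\<bar>"
  using assms by linarith+

lemma segment_powr_bound:
  fixes y u :: real
  assumes "y \<noteq> 0" "\<bar>y\<bar> \<le> 2 * \<bar>u\<bar>" "\<bar>u\<bar> \<le> 2 * \<bar>y\<bar>" "0 \<le> e" "e \<le> 2"
  shows "\<bar>u\<bar> powr (- e) * (1 + \<bar>u\<bar>) ^ q \<le> 4 * 2 ^ q * (\<bar>y\<bar> powr (- e) * (1 + \<bar>y\<bar>) ^ q)"
proof -
  have "\<bar>u\<bar> powr (- e) \<le> (\<bar>y\<bar> / 2) powr (- e)" using assms by (intro powr_mono2') auto
  also have "\<dots> = 2 powr e * \<bar>y\<bar> powr (- e)"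
    using assms by (simp add: powr_divide powr_minus_divide)
  also have "\<dots> \<le> 2 powr 2 * \<bar>y\<bar> powr (- e)" using assms by (intro mult_right_mono powr_mono) auto
  finally have 1: "\<bar>u\<bar> powr (- e) \<le> 4 * \<bar>y\<bar> powr (- e)" by simp
  have "(1 + \<bar>u\<bar>) ^ q \<le> (2 * (1 + \<bar>y\<bar>)) ^ q" using assms by (intro power_mono) auto
  then have 2: "(1 + \<bar>u\<bar>) ^ q \<le> 2 ^ q * (1 + \<bar>y\<bar>) ^ q" by (simp only: power_mult_distrib)
  have "\<bar>u\<bar> powr (- e) * (1 + \<bar>u\<bar>) ^ q \<le> (4 * \<bar>y\<bar> powr (- e)) * (2 ^ q * (1 + \<bar>y\<bar>) ^ q)"
    using 1 2 by (intro mult_mono) auto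
  then show ?thesis by (simp add: mult_ac)
qed

text \<open>Away from the origin the remainder is quadratic in \<open>t\<close>; within distance \<open>2 * \<bar>t\<bar>\<close> all terms
  are small separately.\<close>

lemma singular_taylor:
  fixes f f' f'' :: "real \<Rightarrow> real"
  assumes C: "C \<ge> 0" and f0: "f 0 = 0"
    and D: "\<And>u. u \<noteq> 0 \<Longrightarrow> (f has_real_derivative f' u) (at u)"
      "\<And>u. u \<noteq> 0 \<Longrightarrow> (f' has_real_derivative f'' u) (at u)"
    and B: "\<And>u. u \<noteq> 0 \<Longrightarrow> \<bar>f u\<bar> \<le> C * (\<bar>u\<bar> powr (3/4) * (1 + \<bar>u\<bar>) ^ q)"
      "\<And>u. u \<noteq> 0 \<Longrightarrow> \<bar>f' u\<bar> \<le> C * (\<bar>u\<bar> powr (-(1/4)) * (1 + \<bar>u\<bar>) ^ q)"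
      "\<And>u. u \<noteq> 0 \<Longrightarrow> \<bar>f'' u\<bar> \<le> C * (\<bar>u\<bar> powr (-(5/4)) * (1 + \<bar>u\<bar>) ^ q)"
    and y: "y \<noteq> 0" and t: "\<bar>t\<bar> \<le> 1"
  shows "\<bar>f (y - t) - f y + t * f' y\<bar> \<le> 26 * 4 ^ q * C * \<bar>t\<bar> powr (5/4) * wt q y"
proof (cases "t = 0")
  case False
  \<comment> \<open>Passing to the fourth roots of \<open>\<bar>t\<bar>\<close> and
    \<open>\<bar>y\<bar>\<close> turns all fractional powers below into integer powers.\<close>
  define S where "S = \<bar>t\<bar> powr (1/4)"
  define R where "R = \<bar>y\<bar> powr (1/4)"
  have SR: "S > 0" "R > 0" using False y by (auto simp: S_def R_def)
  have S: "\<bar>t\<bar> = S ^ 4" "\<bar>t\<bar> powr (3/4) = S ^ 3" "\<bar>t\<bar> powr (5/4) = S ^ 5"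
    unfolding S_def using False by (simp_all add: powr_power)
  have R: "\<bar>y\<bar> = R ^ 4" "\<bar>y\<bar> powr (3/4) = R ^ 3" "\<bar>y\<bar> powr (-(1/4)) = 1 / R"
    "\<bar>y\<bar> powr (-(5/4)) = 1 / R ^ 5" "\<bar>y\<bar> powr (-1/2) = 1 / R ^ 2"
    unfolding R_def using y by (simp_all add: powr_power powr_minus_divide)
  have w: "wt q y = (1 + \<bar>y\<bar>) ^ q / R\<^sup>2" unfolding wt_def R(5) by simp
  show ?thesis
  proof (cases "2 * \<bar>t\<bar> \<le> \<bar>y\<bar>")
    case True
    \<comment> \<open>The segment from \<open>y\<close> to \<open>y - t\<close> keeps a distance of
      at least \<open>\<bar>y\<bar> / 2\<close> from 0, so two mean value steps apply. Surplus
      powers of \<open>t\<close> are then traded for powers of \<open>y\<close> through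
      \<open>S \<le> R\<close>.\<close>
    have nz: "u \<noteq> 0" if "\<bar>u - y\<bar> \<le> \<bar>(y - t) - y\<bar>" for u
      using segment_bounds[OF True, of u] that y by auto
    obtain z where z: "\<bar>z - y\<bar> \<le> \<bar>(y - t) - y\<bar>" "f (y - t) - f y = ((y - t) - y) * f' z"
      using two_point_mvt[of y "y - t" f f'] D(1) nz by blast
    have nz2: "u \<noteq> 0" if "\<bar>u - y\<bar> \<le> \<bar>z - y\<bar>" for u using nz[of u] that z(1) by linarith
    obtain v where v: "\<bar>v - y\<bar> \<le> \<bar>z - y\<bar>" "f' z - f' y = (z - y) * f'' v"
      using two_point_mvt[of y z f' f''] D(2) nz2 by blast
    have vt: "\<bar>v - y\<bar> \<le> \<bar>t\<bar>" "\<bar>z - y\<bar> \<le> \<bar>t\<bar>" using v(1) z(1) by auto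
    have "f (y - t) - f y + t * f' y = - t * (z - y) * f'' v"
    proof -
      have "f (y - t) - f y + t * f' y = - t * (f' z - f' y)" unfolding z(2) by (simp add: algebra_simps)
      then show ?thesis unfolding v(2) by simp
    qed
    then have "\<bar>f (y - t) - f y + t * f' y\<bar> = \<bar>t\<bar> * \<bar>z - y\<bar> * \<bar>f'' v\<bar>" by (simp add: abs_mult)
    also have "\<dots> \<le> \<bar>t\<bar> * \<bar>t\<bar> * (C * (\<bar>v\<bar> powr (-(5/4)) * (1 + \<bar>v\<bar>) ^ q))"
      using vt B(3)[OF nz2[OF v(1)]] by (intro mult_mono) auto
    also have "\<dots> \<le> \<bar>t\<bar> * \<bar>t\<bar> * (C * (4 * 2 ^ q * (\<bar>y\<bar> powr (-(5/4)) * (1 + \<bar>y\<bar>) ^ q)))"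
      using C segment_bounds[OF True vt(1)] y by (intro mult_left_mono segment_powr_bound) auto
    also have "\<dots> = 4 * 2 ^ q * C * (S ^ 4 * S ^ 4 / R ^ 5) * (1 + \<bar>y\<bar>) ^ q"
      unfolding S(1) R(4) by simp
    also have "\<dots> \<le> 4 * 2 ^ q * C * (S ^ 5 / R\<^sup>2) * (1 + \<bar>y\<bar>) ^ q"
    proof -
      have "S \<le> R" unfolding S_def R_def using True by (intro powr_mono2) auto
      then have "S ^ 3 \<le> R ^ 3" using SR by (intro power_mono) auto
      then have "S ^ 5 * S ^ 3 * R\<^sup>2 \<le> S ^ 5 * R ^ 3 * R\<^sup>2" using SR by (intro mult_right_mono mult_left_mono) auto
      then have "S ^ 4 * S ^ 4 / R ^ 5 \<le> S ^ 5 / R\<^sup>2"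
        using SR by (simp add: divide_simps power_add[symmetric] mult.assoc)
      then show ?thesis using C by (intro mult_right_mono mult_left_mono) auto
    qed
    also have "\<dots> \<le> 26 * 4 ^ q * C * (S ^ 5 / R\<^sup>2) * (1 + \<bar>y\<bar>) ^ q"
    proof -
      have "(2::real) ^ q \<le> 4 ^ q" by (intro power_mono) auto
      then have "4 * 2 ^ q \<le> (26 * 4 ^ q :: real)" using zero_le_power[of "4::real" q] by linarith
      then show ?thesis using C SR by (intro mult_right_mono) auto
    qed
    finally show ?thesis unfolding w S(3) by simp
  next
    case False
    \<comment> \<open>Here \<open>R \<le> 2 * S\<close> allows the opposite exchange. All arguments
      have modulus at most 3, whence the factor \<open>4 ^ q\<close>.\<close>
    then have yt: "\<bar>y\<bar> < 2 * \<bar>t\<bar>" by simp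
    have RS: "R \<le> 2 * S"
    proof (rule ccontr)
      assume "\<not> ?thesis"
      then have "(2 * S) ^ 4 < R ^ 4" using SR by (intro power_strict_mono) auto
      moreover have "S ^ 4 > 0" using SR by simp
      ultimately show False using yt unfolding S(1) R(1) by (simp add: power_mult_distrib)
    qed
    have q4: "(1 + \<bar>u\<bar>) ^ q \<le> 4 ^ q" if "\<bar>u\<bar> \<le> 3" for u :: real using that by (intro power_mono) auto
    have fb: "\<bar>f u\<bar> \<le> 3 * 4 ^ q * C * S ^ 3" if u: "\<bar>u\<bar> \<le> 3 * \<bar>t\<bar>" for u
    proof (cases "u = 0")
      case False
      have "\<bar>u\<bar> powr (3/4) \<le> (3 * \<bar>t\<bar>) powr (3/4)" using u by (intro powr_mono2) auto
      also have "\<dots> = 3 powr (3/4) * S ^ 3" using S(2) by (simp add: powr_mult)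
      also have "\<dots> \<le> 3 powr 1 * S ^ 3" using SR by (intro mult_right_mono powr_mono) auto
      finally have "\<bar>u\<bar> powr (3/4) \<le> 3 * S ^ 3" by simp
      then have "C * (\<bar>u\<bar> powr (3/4) * (1 + \<bar>u\<bar>) ^ q) \<le> C * (3 * S ^ 3 * 4 ^ q)"
        using C u t SR by (intro mult_left_mono mult_mono q4) auto
      then show ?thesis using B(1)[OF False] by (simp add: mult_ac)
    qed (use f0 C SR in auto)
    have S3: "S ^ 3 \<le> 4 * (S ^ 5 / R\<^sup>2)"
    proof -
      have "R\<^sup>2 \<le> (2 * S)\<^sup>2" using RS SR by (intro power_mono) auto
      then have "S ^ 3 * R\<^sup>2 \<le> S ^ 3 * (4 * S\<^sup>2)" using SR by (intro mult_left_mono) (auto simp: power_mult_distrib)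
      then show ?thesis using SR by (simp add: divide_simps power_add[symmetric] mult.assoc mult.left_commute)
    qed
    have "\<bar>t * f' y\<bar> \<le> \<bar>t\<bar> * (C * (\<bar>y\<bar> powr (-(1/4)) * (1 + \<bar>y\<bar>) ^ q))"
      using B(2)[OF y] by (simp add: abs_mult mult_left_mono)
    also have "\<dots> \<le> \<bar>t\<bar> * (C * (\<bar>y\<bar> powr (-(1/4)) * 4 ^ q))"
      using C yt t by (intro mult_left_mono q4) auto
    also have "\<dots> = 4 ^ q * C * (S ^ 4 / R)" unfolding S(1) R(3) by simp
    also have "\<dots> \<le> 4 ^ q * C * (2 * (S ^ 5 / R\<^sup>2))"
    proof -
      have "S ^ 4 * R \<le> S ^ 4 * (2 * S)" using RS SR by (intro mult_left_mono) auto
      then have "S ^ 4 / R \<le> 2 * (S ^ 5 / R\<^sup>2)"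
        using SR by (simp add: divide_simps power2_eq_square eval_nat_numeral mult_ac)
      then show ?thesis using C by (intro mult_left_mono) auto
    qed
    also have "\<dots> = 2 * (4 ^ q * C * (S ^ 5 / R\<^sup>2))" by (rule mult.left_commute)
    finally have 3: "\<bar>t * f' y\<bar> \<le> 2 * (4 ^ q * C * (S ^ 5 / R\<^sup>2))" .
    \<comment> \<open>The two function values cost 12 units each and the linear term 2, which makes
      the constant 26.\<close>
    have "\<bar>f (y - t)\<bar> \<le> 3 * 4 ^ q * C * S ^ 3" "\<bar>f y\<bar> \<le> 3 * 4 ^ q * C * S ^ 3"
      using yt by (auto intro!: fb)
    moreover have "3 * 4 ^ q * C * S ^ 3 \<le> 3 * 4 ^ q * C * (4 * (S ^ 5 / R\<^sup>2))"
      using C S3 by (intro mult_left_mono) auto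
    moreover have "3 * 4 ^ q * C * (4 * (S ^ 5 / R\<^sup>2)) = 12 * (4 ^ q * C * (S ^ 5 / R\<^sup>2))" by simp
    ultimately have "\<bar>f (y - t) - f y + t * f' y\<bar> \<le> 26 * (4 ^ q * C * (S ^ 5 / R\<^sup>2))"
      using 3 by linarith
    also have "\<dots> \<le> 26 * (4 ^ q * C * (S ^ 5 / R\<^sup>2)) * (1 + \<bar>y\<bar>) ^ q"
    proof -
      have "0 \<le> 26 * (4 ^ q * C * (S ^ 5 / R\<^sup>2))" using C SR by simp
      moreover have "1 \<le> (1 + \<bar>y\<bar>) ^ q" by simp
      ultimately have "26 * (4 ^ q * C * (S ^ 5 / R\<^sup>2)) * 1 \<le> 26 * (4 ^ q * C * (S ^ 5 / R\<^sup>2)) * (1 + \<bar>y\<bar>) ^ q"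
        by (intro mult_left_mono)
      then show ?thesis by (simp only: mult_1_right)
    qed
    finally show ?thesis unfolding w S(3) by (simp add: mult_ac)
  qed
qed (use C wt_nonneg[of q y] in auto)

lemma abs_powr_weight:
  fixes u :: real
  assumes "u \<noteq> 0" "e \<le> s" "s \<le> e + real q"
  shows "\<bar>u\<bar> powr s \<le> \<bar>u\<bar> powr e * (1 + \<bar>u\<bar>) ^ q"
proof -
  have "\<bar>u\<bar> powr s = \<bar>u\<bar> powr e * \<bar>u\<bar> powr (s - e)" by (simp add: powr_add[symmetric])
  also have "\<dots> \<le> \<bar>u\<bar> powr e * (1 + \<bar>u\<bar>) ^ q" using assms by (intro mult_left_mono abs_powr_le) auto
  finally show ?thesis .
qed

lemma abs_powr_ln_weight:
  fixes u :: real
  assumes "u \<noteq> 0" "e + 1/4 \<le> s" "s + 1/4 \<le> e + real q"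
  shows "\<bar>u\<bar> powr s * \<bar>ln \<bar>u\<bar>\<bar> \<le> 8 * (\<bar>u\<bar> powr e * (1 + \<bar>u\<bar>) ^ q)"
proof -
  have "\<bar>u\<bar> powr s * \<bar>ln \<bar>u\<bar>\<bar> \<le> \<bar>u\<bar> powr s * ((\<bar>u\<bar> powr (1/4) + \<bar>u\<bar> powr (- (1/4))) / (1/4))"
    using assms by (intro mult_left_mono abs_ln_le) auto
  also have "\<dots> = 4 * (\<bar>u\<bar> powr s * \<bar>u\<bar> powr (1/4) + \<bar>u\<bar> powr s * \<bar>u\<bar> powr (- (1/4)))"
    by (simp add: distrib_left)
  also have "\<dots> = 4 * (\<bar>u\<bar> powr (s + 1/4) + \<bar>u\<bar> powr (s - 1/4))"
    by (simp only: powr_add[symmetric]) simp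
  also have "\<dots> \<le> 4 * (\<bar>u\<bar> powr e * (1 + \<bar>u\<bar>) ^ q + \<bar>u\<bar> powr e * (1 + \<bar>u\<bar>) ^ q)"
  proof -
    have "\<bar>u\<bar> powr (s + 1/4) \<le> \<bar>u\<bar> powr e * (1 + \<bar>u\<bar>) ^ q"
      by (rule abs_powr_weight) (use assms in auto)
    moreover have "\<bar>u\<bar> powr (s - 1/4) \<le> \<bar>u\<bar> powr e * (1 + \<bar>u\<bar>) ^ q"
      by (rule abs_powr_weight) (use assms in auto)
    ultimately show ?thesis by (intro mult_left_mono[OF add_mono]) simp_all
  qed
  finally show ?thesis by simp
qed

lemma abs_spow_le: "\<bar>spow p u\<bar> \<le> \<bar>u\<bar> powr p"
  by (auto simp: spow_def abs_mult sgn_if)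

lemma DERIV_abs_powr:
  assumes "u \<noteq> 0"
  shows "((\<lambda>u. \<bar>u\<bar> powr a) has_real_derivative a * spow (a - 1) u) (at u)"
    and "(spow a has_real_derivative a * \<bar>u\<bar> powr (a - 1)) (at u)"
    and "((\<lambda>u. ln \<bar>u\<bar>) has_real_derivative 1 / u) (at u)"
proof -
  consider (pos) "u \<in> {0<..}" | (neg) "u \<in> {..<0}" using assms by fastforce
  then have "((\<lambda>u. \<bar>u\<bar> powr a) has_real_derivative a * spow (a - 1) u) (at u) \<and>
    (spow a has_real_derivative a * \<bar>u\<bar> powr (a - 1)) (at u) \<and>
    ((\<lambda>u. ln \<bar>u\<bar>) has_real_derivative 1 / u) (at u)"
  proof cases
    case pos
    have "((\<lambda>u. u powr a) has_real_derivative a * spow (a - 1) u) (at u)"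
      "((\<lambda>u. u powr a) has_real_derivative a * \<bar>u\<bar> powr (a - 1)) (at u)"
      "(ln has_real_derivative 1 / u) (at u)"
      using pos by (auto intro!: derivative_eq_intros simp: spow_def)
    note this[THEN has_field_derivative_transform_within_open, OF _ pos]
    from this(1)[of "\<lambda>u. \<bar>u\<bar> powr a"] this(2)[of "spow a"] this(3)[of "\<lambda>u. ln \<bar>u\<bar>"]
    show ?thesis by (auto simp: spow_def)
  next
    case neg
    have "((\<lambda>u. (- u) powr a) has_real_derivative a * spow (a - 1) u) (at u)"
      "((\<lambda>u. - ((- u) powr a)) has_real_derivative a * \<bar>u\<bar> powr (a - 1)) (at u)"
      "((\<lambda>u. ln (- u)) has_real_derivative 1 / u) (at u)"
      using neg by (auto intro!: derivative_eq_intros simp: spow_def)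
    note this[THEN has_field_derivative_transform_within_open, OF _ neg]
    from this(1)[of "\<lambda>u. \<bar>u\<bar> powr a"] this(2)[of "spow a"] this(3)[of "\<lambda>u. ln \<bar>u\<bar>"]
    show ?thesis by (auto simp: spow_def)
  qed
  then show "((\<lambda>u. \<bar>u\<bar> powr a) has_real_derivative a * spow (a - 1) u) (at u)"
    "(spow a has_real_derivative a * \<bar>u\<bar> powr (a - 1)) (at u)"
    "((\<lambda>u. ln \<bar>u\<bar>) has_real_derivative 1 / u) (at u)" by blast+
qed

definition kap' :: "real \<Rightarrow> real \<Rightarrow> real" where
  "kap' lam u = spow (lam - 1) u * (lam * ln \<bar>u\<bar> + 1)"

lemma kap'_measurable [measurable]: "kap' lam \<in> borel_measurable borel"
  unfolding kap'_def[abs_def] by measurable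

lemma DERIV_kap:
  assumes "u \<noteq> 0"
  shows "(kap lam has_real_derivative kap' lam u) (at u)"
    and "(kap' lam has_real_derivative \<bar>u\<bar> powr (lam - 2) * (lam * (lam - 1) * ln \<bar>u\<bar> + (2 * lam - 1))) (at u)"
proof -
  have s: "\<bar>u\<bar> powr a * (1 / u) = spow (a - 1) u" "spow a u * (1 / u) = \<bar>u\<bar> powr (a - 1)" for a
    using assms by (auto simp: spow_def sgn_if powr_diff)
  have "(kap lam has_real_derivative lam * spow (lam - 1) u * ln \<bar>u\<bar> + 1 / u * \<bar>u\<bar> powr lam) (at u)"
    unfolding kap_def[abs_def] by (rule DERIV_mult DERIV_abs_powr assms)+
  moreover have "lam * spow (lam - 1) u * ln \<bar>u\<bar> + 1 / u * \<bar>u\<bar> powr lam = kap' lam u"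
    using s(1)[of lam] by (simp add: kap'_def algebra_simps)
  ultimately show "(kap lam has_real_derivative kap' lam u) (at u)" by simp
  have d: "((\<lambda>u. lam * ln \<bar>u\<bar> + 1) has_real_derivative lam * (1 / u)) (at u)"
    using DERIV_add[OF DERIV_cmult[OF DERIV_abs_powr(3)[OF assms]] DERIV_const] by simp
  have "(kap' lam has_real_derivative (lam - 1) * \<bar>u\<bar> powr (lam - 1 - 1) * (lam * ln \<bar>u\<bar> + 1)
      + lam * (1 / u) * spow (lam - 1) u) (at u)"
    unfolding kap'_def[abs_def] by (rule DERIV_mult DERIV_abs_powr(2)[OF assms] d)+
  moreover have "(lam - 1) * \<bar>u\<bar> powr (lam - 1 - 1) * (lam * ln \<bar>u\<bar> + 1) + lam * (1 / u) * spow (lam - 1) u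
      = \<bar>u\<bar> powr (lam - 2) * (lam * (lam - 1) * ln \<bar>u\<bar> + (2 * lam - 1))"
  proof -
    have "lam * (1 / u) * spow (lam - 1) u = lam * (spow (lam - 1) u * (1 / u))" by (simp only: mult_ac)
    also have "\<dots> = lam * \<bar>u\<bar> powr (lam - 2)" using s(2)[of "lam - 1"] by (simp only:) simp
    finally show ?thesis by (simp add: algebra_simps)
  qed
  ultimately show "(kap' lam has_real_derivative \<bar>u\<bar> powr (lam - 2) * (lam * (lam - 1) * ln \<bar>u\<bar> + (2 * lam - 1))) (at u)"
    by simp
qed

lemma kap'_le:
  assumes "1 \<le> lam" "lam \<le> 3" "u \<noteq> 0"
  shows "\<bar>kap' lam u\<bar> \<le> 100 * (\<bar>u\<bar> powr (-(1/4)) * (1 + \<bar>u\<bar>) ^ 4)"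
proof -
  have "\<bar>kap' lam u\<bar> \<le> \<bar>u\<bar> powr (lam - 1) * (lam * \<bar>ln \<bar>u\<bar>\<bar> + 1)"
    unfolding kap'_def abs_mult using assms
    by (intro mult_mono abs_spow_le order_trans[OF abs_triangle_ineq]) (auto simp: abs_mult)
  also have "\<dots> = lam * (\<bar>u\<bar> powr (lam - 1) * \<bar>ln \<bar>u\<bar>\<bar>) + \<bar>u\<bar> powr (lam - 1)" by (simp add: algebra_simps)
  also have "\<dots> \<le> 3 * (8 * (\<bar>u\<bar> powr (-(1/4)) * (1 + \<bar>u\<bar>) ^ 4)) + \<bar>u\<bar> powr (-(1/4)) * (1 + \<bar>u\<bar>) ^ 4"
  proof -
    have "\<bar>u\<bar> powr (lam - 1) * \<bar>ln \<bar>u\<bar>\<bar> \<le> 8 * (\<bar>u\<bar> powr (-(1/4)) * (1 + \<bar>u\<bar>) ^ 4)"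
      by (rule abs_powr_ln_weight) (use assms in auto)
    then have "lam * (\<bar>u\<bar> powr (lam - 1) * \<bar>ln \<bar>u\<bar>\<bar>) \<le> 3 * (8 * (\<bar>u\<bar> powr (-(1/4)) * (1 + \<bar>u\<bar>) ^ 4))"
      using assms by (intro mult_mono[of lam 3]) auto
    moreover have "\<bar>u\<bar> powr (lam - 1) \<le> \<bar>u\<bar> powr (-(1/4)) * (1 + \<bar>u\<bar>) ^ 4"
      by (rule abs_powr_weight) (use assms in auto)
    ultimately show ?thesis by (rule add_mono)
  qed
  also have "\<dots> \<le> 100 * (\<bar>u\<bar> powr (-(1/4)) * (1 + \<bar>u\<bar>) ^ 4)" by simp
  finally show ?thesis .
qed

text \<open>The exponents of \<open>singular_taylor\<close> are made for \<open>lam = 1\<close>: the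
  logarithm in \<open>kap\<close> and its derivatives costs a quarter power below the orders 1, 0
  and -1. What matters is that the remainder keeps an order in \<open>t\<close> above 1.\<close>

lemma kap_taylor:
  assumes "1 \<le> lam" "lam \<le> 3" "y \<noteq> 0" "\<bar>t\<bar> \<le> 1"
  shows "\<bar>kap lam (y - t) - kap lam y + t * kap' lam y\<bar> \<le> 26 * 4 ^ 4 * 100 * \<bar>t\<bar> powr (5/4) * wt 4 y"
proof (rule singular_taylor[OF _ _ DERIV_kap])
  show "\<bar>kap lam u\<bar> \<le> 100 * (\<bar>u\<bar> powr (3/4) * (1 + \<bar>u\<bar>) ^ 4)" if "u \<noteq> 0" for u
  proof -
    have "\<bar>kap lam u\<bar> = \<bar>u\<bar> powr lam * \<bar>ln \<bar>u\<bar>\<bar>" by (simp add: kap_def abs_mult)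
    also have "\<dots> \<le> 8 * (\<bar>u\<bar> powr (3/4) * (1 + \<bar>u\<bar>) ^ 4)" using that assms by (intro abs_powr_ln_weight) auto
    also have "\<dots> \<le> 100 * (\<bar>u\<bar> powr (3/4) * (1 + \<bar>u\<bar>) ^ 4)" by (intro mult_right_mono) auto
    finally show ?thesis .
  qed
  show "\<bar>\<bar>u\<bar> powr (lam - 2) * (lam * (lam - 1) * ln \<bar>u\<bar> + (2 * lam - 1))\<bar> \<le> 100 * (\<bar>u\<bar> powr (-(5/4)) * (1 + \<bar>u\<bar>) ^ 4)"
    if "u \<noteq> 0" for u
  proof -
    have "lam * (lam - 1) \<le> 3 * 2" using assms by (intro mult_mono) auto
    then have l: "0 \<le> lam * (lam - 1)" "lam * (lam - 1) \<le> 6" using assms by auto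
    have "\<bar>\<bar>u\<bar> powr (lam - 2) * (lam * (lam - 1) * ln \<bar>u\<bar> + (2 * lam - 1))\<bar>
        \<le> \<bar>u\<bar> powr (lam - 2) * (lam * (lam - 1) * \<bar>ln \<bar>u\<bar>\<bar> + (2 * lam - 1))"
      unfolding abs_mult[of "\<bar>u\<bar> powr (lam - 2)"] using l assms
      by (intro mult_mono order_trans[OF abs_triangle_ineq]) (auto simp: abs_mult)
    also have "\<dots> = (lam * (lam - 1)) * (\<bar>u\<bar> powr (lam - 2) * \<bar>ln \<bar>u\<bar>\<bar>) + (2 * lam - 1) * \<bar>u\<bar> powr (lam - 2)"
      by (simp add: algebra_simps)
    also have "\<dots> \<le> 6 * (8 * (\<bar>u\<bar> powr (-(5/4)) * (1 + \<bar>u\<bar>) ^ 4)) + 5 * (\<bar>u\<bar> powr (-(5/4)) * (1 + \<bar>u\<bar>) ^ 4)"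
    proof -
      have "\<bar>u\<bar> powr (lam - 2) * \<bar>ln \<bar>u\<bar>\<bar> \<le> 8 * (\<bar>u\<bar> powr (-(5/4)) * (1 + \<bar>u\<bar>) ^ 4)"
        by (rule abs_powr_ln_weight) (use assms that in auto)
      then have "(lam * (lam - 1)) * (\<bar>u\<bar> powr (lam - 2) * \<bar>ln \<bar>u\<bar>\<bar>) \<le> 6 * (8 * (\<bar>u\<bar> powr (-(5/4)) * (1 + \<bar>u\<bar>) ^ 4))"
        using l by (intro mult_mono[of "lam * (lam - 1)" 6]) auto
      moreover have "\<bar>u\<bar> powr (lam - 2) \<le> \<bar>u\<bar> powr (-(5/4)) * (1 + \<bar>u\<bar>) ^ 4"
        by (rule abs_powr_weight) (use assms that in auto)
      then have "(2 * lam - 1) * \<bar>u\<bar> powr (lam - 2) \<le> 5 * (\<bar>u\<bar> powr (-(5/4)) * (1 + \<bar>u\<bar>) ^ 4)"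
        using assms by (intro mult_mono[of "2 * lam - 1" 5]) auto
      ultimately show ?thesis by (rule add_mono)
    qed
    also have "\<dots> \<le> 100 * (\<bar>u\<bar> powr (-(5/4)) * (1 + \<bar>u\<bar>) ^ 4)" by simp
    finally show ?thesis .
  qed
qed (use assms kap'_le in \<open>auto simp: kap_def\<close>)

lemma power_taylor:
  assumes "1 \<le> lam" "lam \<le> 3" "y \<noteq> 0" "\<bar>t\<bar> \<le> 1"
  shows "\<bar>\<bar>y - t\<bar> powr lam - \<bar>y\<bar> powr lam + t * (lam * spow (lam - 1) y)\<bar> \<le> 26 * 4 ^ 4 * 6 * \<bar>t\<bar> powr (5/4) * wt 4 y"
    and "\<bar>spow lam (y - t) - spow lam y + t * (lam * \<bar>y\<bar> powr (lam - 1))\<bar> \<le> 26 * 4 ^ 4 * 6 * \<bar>t\<bar> powr (5/4) * wt 4 y"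
proof -
  have "lam * (lam - 1) \<le> 3 * 2" using assms by (intro mult_mono) auto
  then have l: "0 \<le> lam * (lam - 1)" "lam * (lam - 1) \<le> 6" using assms by auto
  have b0: "\<bar>u\<bar> powr lam \<le> 6 * (\<bar>u\<bar> powr (3/4) * (1 + \<bar>u\<bar>) ^ 4)"
    and b1: "lam * \<bar>u\<bar> powr (lam - 1) \<le> 6 * (\<bar>u\<bar> powr (-(1/4)) * (1 + \<bar>u\<bar>) ^ 4)"
    and b2: "lam * (lam - 1) * \<bar>u\<bar> powr (lam - 2) \<le> 6 * (\<bar>u\<bar> powr (-(5/4)) * (1 + \<bar>u\<bar>) ^ 4)" if "u \<noteq> 0" for u
  proof -
    have p: "\<bar>u\<bar> powr lam \<le> \<bar>u\<bar> powr (3/4) * (1 + \<bar>u\<bar>) ^ 4"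
      "\<bar>u\<bar> powr (lam - 1) \<le> \<bar>u\<bar> powr (-(1/4)) * (1 + \<bar>u\<bar>) ^ 4"
      "\<bar>u\<bar> powr (lam - 2) \<le> \<bar>u\<bar> powr (-(5/4)) * (1 + \<bar>u\<bar>) ^ 4"
      by (rule abs_powr_weight; use assms that in simp)+
    show "\<bar>u\<bar> powr lam \<le> 6 * (\<bar>u\<bar> powr (3/4) * (1 + \<bar>u\<bar>) ^ 4)"
      using mult_mono[OF _ p(1), of 1 6] by simp
    show "lam * \<bar>u\<bar> powr (lam - 1) \<le> 6 * (\<bar>u\<bar> powr (-(1/4)) * (1 + \<bar>u\<bar>) ^ 4)"
      by (rule mult_mono[OF _ p(2)]) (use assms in auto)
    show "lam * (lam - 1) * \<bar>u\<bar> powr (lam - 2) \<le> 6 * (\<bar>u\<bar> powr (-(5/4)) * (1 + \<bar>u\<bar>) ^ 4)"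
      by (rule mult_mono[OF _ p(3)]) (use l in auto)
  qed
  have e: "lam - 1 - 1 = lam - 2" by simp
  have ab: "\<bar>lam * spow (lam - 1) u\<bar> \<le> lam * \<bar>u\<bar> powr (lam - 1)"
    "\<bar>lam * ((lam - 1) * spow (lam - 2) u)\<bar> \<le> lam * (lam - 1) * \<bar>u\<bar> powr (lam - 2)" for u
    using assms abs_spow_le[of "lam - 1" u] abs_spow_le[of "lam - 2" u]
    by (auto simp: abs_mult mult.assoc intro!: mult_left_mono)
  have D: "((\<lambda>u. lam * spow (lam - 1) u) has_real_derivative lam * ((lam - 1) * \<bar>u\<bar> powr (lam - 2))) (at u)"
    "((\<lambda>u. lam * \<bar>u\<bar> powr (lam - 1)) has_real_derivative lam * ((lam - 1) * spow (lam - 2) u)) (at u)" if "u \<noteq> 0" for u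
    using DERIV_cmult[OF DERIV_abs_powr(2)[OF that, of "lam - 1"], of lam]
      DERIV_cmult[OF DERIV_abs_powr(1)[OF that, of "lam - 1"], of lam] unfolding e by auto
  have ab3: "\<bar>lam * ((lam - 1) * \<bar>u\<bar> powr (lam - 2))\<bar> = lam * (lam - 1) * \<bar>u\<bar> powr (lam - 2)" 
    "\<bar>lam * \<bar>u\<bar> powr (lam - 1)\<bar> = lam * \<bar>u\<bar> powr (lam - 1)" for u
    using assms l by (simp_all add: abs_mult)
  show "\<bar>\<bar>y - t\<bar> powr lam - \<bar>y\<bar> powr lam + t * (lam * spow (lam - 1) y)\<bar> \<le> 26 * 4 ^ 4 * 6 * \<bar>t\<bar> powr (5/4) * wt 4 y"
  proof (rule singular_taylor[OF _ _ DERIV_abs_powr(1) D(1)])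
    fix u :: real assume u: "u \<noteq> 0"
    show "\<bar>\<bar>u\<bar> powr lam\<bar> \<le> 6 * (\<bar>u\<bar> powr (3/4) * (1 + \<bar>u\<bar>) ^ 4)" using b0[OF u] by simp
    show "\<bar>lam * spow (lam - 1) u\<bar> \<le> 6 * (\<bar>u\<bar> powr (-(1/4)) * (1 + \<bar>u\<bar>) ^ 4)"
      by (rule order_trans[OF ab(1) b1[OF u]])
    show "\<bar>lam * ((lam - 1) * \<bar>u\<bar> powr (lam - 2))\<bar> \<le> 6 * (\<bar>u\<bar> powr (-(5/4)) * (1 + \<bar>u\<bar>) ^ 4)"
      unfolding ab3 by (rule b2[OF u])
  qed (use assms in auto)
  show "\<bar>spow lam (y - t) - spow lam y + t * (lam * \<bar>y\<bar> powr (lam - 1))\<bar> \<le> 26 * 4 ^ 4 * 6 * \<bar>t\<bar> powr (5/4) * wt 4 y"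
  proof (rule singular_taylor[OF _ _ DERIV_abs_powr(2) D(2)])
    fix u :: real assume u: "u \<noteq> 0"
    show "\<bar>spow lam u\<bar> \<le> 6 * (\<bar>u\<bar> powr (3/4) * (1 + \<bar>u\<bar>) ^ 4)"
      by (rule order_trans[OF abs_spow_le b0[OF u]])
    show "\<bar>lam * \<bar>u\<bar> powr (lam - 1)\<bar> \<le> 6 * (\<bar>u\<bar> powr (-(1/4)) * (1 + \<bar>u\<bar>) ^ 4)"
      unfolding ab3 by (rule b1[OF u])
    show "\<bar>lam * ((lam - 1) * spow (lam - 2) u)\<bar> \<le> 6 * (\<bar>u\<bar> powr (-(5/4)) * (1 + \<bar>u\<bar>) ^ 4)"
      by (rule order_trans[OF ab(2) b2[OF u]])
  qed (use assms in auto)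
qed

text \<open>From \<open>lam = 3/2\<close> on, the derivative of the score is no more singular than
  the weight. If \<open>y\<close> is comparable to \<open>s\<close> or smaller, both values are at
  most of order \<open>\<bar>s\<bar> powr (1/2)\<close>, and
  \<open>\<bar>s\<bar> powr (-(1/2))\<close> is at most a multiple of the weight.\<close>

lemma phi_shift_le:
  assumes lam: "3/2 \<le> lam" "lam \<le> 3" and y: "y \<noteq> 0" and s: "\<bar>s\<bar> \<le> 1"
  shows "\<bar>spow (lam - 1) (y - s) - spow (lam - 1) y\<bar> \<le> 128 * \<bar>s\<bar> * wt 2 y"
proof (cases "s = 0")
  case False
  show ?thesis
  proof (cases "2 * \<bar>s\<bar> \<le> \<bar>y\<bar>")
    case True
    have nz: "u \<noteq> 0" if "\<bar>u - y\<bar> \<le> \<bar>(y - s) - y\<bar>" for u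
      using segment_bounds[OF True, of u] that y by auto
    obtain z where z: "\<bar>z - y\<bar> \<le> \<bar>(y - s) - y\<bar>"
      "spow (lam - 1) (y - s) - spow (lam - 1) y = ((y - s) - y) * ((lam - 1) * \<bar>z\<bar> powr (lam - 1 - 1))"
      using two_point_mvt[of y "y - s" "spow (lam - 1)" "\<lambda>u. (lam - 1) * \<bar>u\<bar> powr (lam - 1 - 1)"]
        DERIV_abs_powr(2)[of _ "lam - 1"] nz by blast
    have sb: "\<bar>y\<bar> \<le> 2 * \<bar>z\<bar>" "\<bar>z\<bar> \<le> 2 * \<bar>y\<bar>" using segment_bounds[OF True, of z] z(1) by auto
    have "\<bar>spow (lam - 1) (y - s) - spow (lam - 1) y\<bar> = \<bar>s\<bar> * ((lam - 1) * \<bar>z\<bar> powr (lam - 2))"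
      unfolding z(2) using lam by (simp add: abs_mult)
    also have "\<dots> \<le> \<bar>s\<bar> * (2 * (\<bar>z\<bar> powr (-(1/2)) * (1 + \<bar>z\<bar>) ^ 2))"
    proof (rule mult_left_mono)
      have "\<bar>z\<bar> powr (lam - 2) \<le> \<bar>z\<bar> powr (-(1/2)) * (1 + \<bar>z\<bar>) ^ 2"
        by (rule abs_powr_weight) (use nz[OF z(1)] lam in auto)
      then show "(lam - 1) * \<bar>z\<bar> powr (lam - 2) \<le> 2 * (\<bar>z\<bar> powr (-(1/2)) * (1 + \<bar>z\<bar>) ^ 2)"
        using lam by (intro mult_mono[of "lam - 1" 2]) auto
    qed auto
    also have "\<dots> \<le> \<bar>s\<bar> * (2 * (4 * 2 ^ 2 * (\<bar>y\<bar> powr (-(1/2)) * (1 + \<bar>y\<bar>) ^ 2)))"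
      by (intro mult_left_mono segment_powr_bound y sb) auto
    also have "\<dots> = 32 * \<bar>s\<bar> * wt 2 y" by (simp add: wt_def)
    also have "\<dots> \<le> 128 * \<bar>s\<bar> * wt 2 y" using wt_nonneg[of 2 y] by (intro mult_right_mono) auto
    finally show ?thesis .
  next
    case False
    have sb: "\<bar>spow (lam - 1) u\<bar> \<le> 9 * (\<bar>s\<bar> * \<bar>s\<bar> powr (-(1/2)))" if u: "\<bar>u\<bar> \<le> 3 * \<bar>s\<bar>" for u
    proof -
      have "\<bar>spow (lam - 1) u\<bar> \<le> \<bar>u\<bar> powr (lam - 1)" by (rule abs_spow_le)
      also have "\<dots> \<le> (3 * \<bar>s\<bar>) powr (lam - 1)" using u lam by (intro powr_mono2) auto
      also have "\<dots> = 3 powr (lam - 1) * \<bar>s\<bar> powr (lam - 1)" by (simp add: powr_mult)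
      also have "\<dots> \<le> 3 powr 2 * \<bar>s\<bar> powr (1/2)"
        using lam s \<open>s \<noteq> 0\<close> by (intro mult_mono powr_mono powr_mono') auto
      also have "\<bar>s\<bar> powr (1/2) = \<bar>s\<bar> * \<bar>s\<bar> powr (-(1/2))"
        using \<open>s \<noteq> 0\<close> powr_mult_base[of "\<bar>s\<bar>" "-(1/2)"] by simp
      finally show ?thesis by simp
    qed
    have "\<bar>s\<bar> powr (-(1/2)) \<le> (\<bar>y\<bar> / 2) powr (-(1/2))" using False y by (intro powr_mono2') auto
    also have "\<dots> = 2 powr (1/2) * \<bar>y\<bar> powr (-(1/2))" using y by (simp add: powr_divide powr_minus_divide)
    also have "\<dots> \<le> 2 powr 1 * \<bar>y\<bar> powr (-(1/2))" by (intro mult_right_mono powr_mono) auto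
    also have "\<bar>y\<bar> powr (-(1/2)) \<le> wt 2 y" 
      unfolding wt_def by (simp add: mult_le_cancel_right1)
    finally have "\<bar>s\<bar> powr (-(1/2)) \<le> 2 * wt 2 y" by simp
    then have "\<bar>s\<bar> * \<bar>s\<bar> powr (-(1/2)) \<le> \<bar>s\<bar> * (2 * wt 2 y)" by (intro mult_left_mono) auto
    moreover have "\<bar>s\<bar> * (2 * wt 2 y) = 2 * (\<bar>s\<bar> * wt 2 y)" "128 * \<bar>s\<bar> * wt 2 y = 128 * (\<bar>s\<bar> * wt 2 y)"
      by simp_all
    moreover have "0 \<le> \<bar>s\<bar> * wt 2 y" using wt_nonneg[of 2 y] by simp
    ultimately have "9 * (\<bar>s\<bar> * \<bar>s\<bar> powr (-(1/2))) + 9 * (\<bar>s\<bar> * \<bar>s\<bar> powr (-(1/2))) \<le> 128 * \<bar>s\<bar> * wt 2 y"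
      by linarith
    moreover have "\<bar>spow (lam - 1) (y - s)\<bar> \<le> 9 * (\<bar>s\<bar> * \<bar>s\<bar> powr (-(1/2)))" "\<bar>spow (lam - 1) y\<bar> \<le> 9 * (\<bar>s\<bar> * \<bar>s\<bar> powr (-(1/2)))"
      using False by (auto intro!: sb)
    ultimately show ?thesis by linarith
  qed
qed (use wt_nonneg[of 2 y] in auto)

text \<open>The information identity: the second moment of the score equals the mean of its
  derivative, here through the recurrence of the moments.\<close>

lemma J_epd_eq: "lam > 1 \<Longrightarrow> J_epd lam = (lam - 1) * (epd_mom lam (lam - 2) / epd_mom lam 0)"
  using epd_mom_plus[of lam "lam - 2"] by (simp add: J_epd_def mult_2 algebra_simps)

section \<open>Mean and variance of the increments of the location score\<close>

context apd_seq
begin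

definition phi_shift :: "real \<Rightarrow> nat \<Rightarrow> real \<Rightarrow> real" where
  "phi_shift h n y = spow (lam - 1) (y - h / sqrt (real n)) - spow (lam - 1) y"

lemma phi_shift_measurable [measurable]: "phi_shift h n \<in> borel_measurable borel"
  unfolding phi_shift_def[abs_def] by measurable

lemma h_over_sqrt: "(\<lambda>n. h / sqrt (real n)) \<longlonglongrightarrow> 0"
  by (intro tendsto_divide_0[OF tendsto_const] filterlim_at_top_imp_at_infinity
      filterlim_compose[OF sqrt_at_top filterlim_real_sequentially])

text \<open>Supplies the hypotheses of \<open>centered_row_conv\<close>. The score is differentiable
  off the origin, and its scaled increments are dominated by the weight, so the limit is
  \<open>- h\<close> times the mean derivative.\<close>

lemma phi_shift_limits_smooth:
  assumes l: "3/2 \<le> lam"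
  shows "\<forall>\<^sub>F n in sequentially. integrable (Qn n) (phi_shift h n)"
    and "\<forall>\<^sub>F n in sequentially. integrable (Qn n) (\<lambda>y. (phi_shift h n y)\<^sup>2)"
    and "(\<lambda>n. sqrt (real n) * integral\<^sup>L (Qn n) (phi_shift h n)) \<longlonglongrightarrow> - h * J_epd lam"
    and "(\<lambda>n. integral\<^sup>L (Qn n) (\<lambda>y. (phi_shift h n y)\<^sup>2)) \<longlonglongrightarrow> 0"
proof -
  have small: "\<forall>\<^sub>F n in sequentially. \<bar>h / sqrt (real n)\<bar> \<le> 1"
    using tendstoD[OF h_over_sqrt[of h], of 1] by (auto elim!: eventually_mono)
  have bd: "\<bar>phi_shift h n y\<bar> \<le> 128 * \<bar>h / sqrt (real n)\<bar> * wt 2 y" if "\<bar>h / sqrt (real n)\<bar> \<le> 1" "y \<noteq> 0" for n y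
    unfolding phi_shift_def using phi_shift_le[OF l lam(2) that(2,1)] .
  have pw: "(\<lambda>n. phi_shift h n y) \<longlonglongrightarrow> 0" for y
  proof -
    have "continuous_on UNIV (spow (lam - 1))" using l by (intro continuous_intros) auto
    then have "isCont (spow (lam - 1)) (y - 0)" by (simp add: continuous_on_eq_continuous_at)
    then have "(\<lambda>n. spow (lam - 1) (y - h / sqrt (real n))) \<longlonglongrightarrow> spow (lam - 1) (y - 0)"
      by (rule isCont_tendsto_compose) (intro tendsto_intros h_over_sqrt)
    then show ?thesis unfolding phi_shift_def by (simp add: LIM_zero_iff)
  qed
  have sq_eq: "((\<lambda>n. sqrt (real n) * (h / sqrt (real n))) \<longlonglongrightarrow> h)"
  proof (rule Lim_transform_eventually[OF tendsto_const])
    show "\<forall>\<^sub>F n in sequentially. h = sqrt (real n) * (h / sqrt (real n))"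
      using eventually_gt_at_top[of 0] by eventually_elim simp
  qed
  have "\<forall>\<^sub>F n in sequentially. \<forall>y. y \<noteq> 0 \<longrightarrow> \<bar>sqrt (real n) * phi_shift h n y\<bar> \<le> (128 * \<bar>h\<bar>) * wt 2 y"
    using small eventually_gt_at_top[of 0]
  proof (eventually_elim, intro allI impI)
    fix n :: nat and y :: real assume n: "\<bar>h / sqrt (real n)\<bar> \<le> 1" "0 < n" and y: "y \<noteq> 0"
    have "\<bar>sqrt (real n) * phi_shift h n y\<bar> = sqrt (real n) * \<bar>phi_shift h n y\<bar>" by (simp add: abs_mult)
    also have "\<dots> \<le> sqrt (real n) * (128 * \<bar>h / sqrt (real n)\<bar> * wt 2 y)"
      by (intro mult_left_mono bd n y) auto
    also have "\<dots> = (128 * \<bar>h\<bar>) * wt 2 y" using n by (simp add: abs_divide)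
    finally show "\<bar>sqrt (real n) * phi_shift h n y\<bar> \<le> (128 * \<bar>h\<bar>) * wt 2 y" .
  qed
  moreover have "(\<lambda>n. sqrt (real n) * phi_shift h n y) \<longlonglongrightarrow> - (h * ((lam - 1) * \<bar>y\<bar> powr (lam - 2)))" if y: "y \<noteq> 0" for y
  proof -
    have "((\<lambda>s. spow (lam - 1) (y - s)) has_real_derivative (lam - 1) * \<bar>y - 0\<bar> powr (lam - 1 - 1) * (0 - 1)) (at 0)"
      using y by (intro DERIV_chain2[OF DERIV_abs_powr(2)] derivative_intros) auto
    from delta_tendsto[OF this h_over_sqrt[of h], of "\<lambda>n. sqrt (real n)" h]
    show ?thesis using sq_eq by (simp add: phi_shift_def mult_ac)
  qed
  ultimately have Q: "(\<lambda>n. integral\<^sup>L (Qn n) (\<lambda>y. sqrt (real n) * phi_shift h n y)) \<longlonglongrightarrow>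
      integral\<^sup>L (epd lam) (\<lambda>y. - (h * ((lam - 1) * \<bar>y\<bar> powr (lam - 2))))"
    and Qi: "\<forall>\<^sub>F n in sequentially. integrable (Qn n) (\<lambda>y. sqrt (real n) * phi_shift h n y)"
    using Qn_integral_conv[of "\<lambda>n y. sqrt (real n) * phi_shift h n y"
        "\<lambda>y. - (h * ((lam - 1) * \<bar>y\<bar> powr (lam - 2)))" "128 * \<bar>h\<bar>" 2] by auto
  show "\<forall>\<^sub>F n in sequentially. integrable (Qn n) (phi_shift h n)"
    using Qi eventually_gt_at_top[of 0] by eventually_elim simp
  have "has_bochner_integral (epd lam) (\<lambda>y. \<bar>y\<bar> powr (lam - 2)) (epd_mom lam (lam - 2) / epd_mom lam 0)"
    using l by (intro epd_moments) auto
  then have eqJ: "integral\<^sup>L (epd lam) (\<lambda>y. - (h * ((lam - 1) * \<bar>y\<bar> powr (lam - 2)))) = - h * J_epd lam"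
    using l by (simp add: J_epd_eq has_bochner_integral_iff)
  show "(\<lambda>n. sqrt (real n) * integral\<^sup>L (Qn n) (phi_shift h n)) \<longlonglongrightarrow> - h * J_epd lam"
    using Q unfolding eqJ integral_mult_right_zero .
  have "\<forall>\<^sub>F n in sequentially. \<forall>y. y \<noteq> 0 \<longrightarrow> \<bar>(phi_shift h n y)\<^sup>2\<bar> \<le> (128 * 2 ^ 3) * wt 4 y"
    using small
  proof (eventually_elim, intro allI impI)
    fix n and y :: real assume n: "\<bar>h / sqrt (real n)\<bar> \<le> 1" and y: "y \<noteq> 0"
    \<comment> \<open>The square of the weight would not be integrable, so one factor of the squared
      increment is bounded by the weight and the other polynomially.\<close>
    have b1: "\<bar>phi_shift h n y\<bar> \<le> 128 * wt 2 y"
    proof -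
      have "128 * \<bar>h / sqrt (real n)\<bar> * wt 2 y \<le> 128 * 1 * wt 2 y"
        using n wt_nonneg[of 2 y] by (intro mult_right_mono mult_left_mono) auto
      then show ?thesis using bd[OF n y] by simp
    qed
    have b2: "\<bar>phi_shift h n y\<bar> \<le> 2 ^ 3 * (1 + \<bar>y\<bar>) ^ 2"
    proof -
      have "\<bar>spow (lam - 1) u\<bar> \<le> (1 + \<bar>u\<bar>) ^ 2" for u
        using abs_spow_le[of "lam - 1" u] abs_powr_le[of "lam - 1" 2 u] lam by auto
      from this[of "y - h / sqrt (real n)"] this[of y]
      have le: "\<bar>phi_shift h n y\<bar> \<le> (1 + \<bar>y - h / sqrt (real n)\<bar>) ^ 2 + (1 + \<bar>y\<bar>) ^ 2"
        unfolding phi_shift_def by linarith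
      have "(1 + \<bar>y - h / sqrt (real n)\<bar>) ^ 2 \<le> (2 * (1 + \<bar>y\<bar>)) ^ 2"
      proof (rule power_mono)
        show "1 + \<bar>y - h / sqrt (real n)\<bar> \<le> 2 * (1 + \<bar>y\<bar>)"
          using n abs_triangle_ineq4[of y "h / sqrt (real n)"] abs_ge_zero[of y] by argo
      qed simp
      then have "(1 + \<bar>y - h / sqrt (real n)\<bar>) ^ 2 \<le> 4 * (1 + \<bar>y\<bar>) ^ 2" by (simp only: power_mult_distrib) simp
      then show ?thesis using le zero_le_power2[of "1 + \<bar>y\<bar>"] by simp
    qed
    have "\<bar>(phi_shift h n y)\<^sup>2\<bar> = \<bar>phi_shift h n y\<bar> * \<bar>phi_shift h n y\<bar>" by (simp add: power2_eq_square)
    also have "\<dots> \<le> (128 * wt 2 y) * (2 ^ 3 * (1 + \<bar>y\<bar>) ^ 2)"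
      using b1 b2 wt_nonneg[of 2 y] by (intro mult_mono) auto
    also have "\<dots> = (128 * 2 ^ 3) * wt 4 y" by (simp add: wt_def eval_nat_numeral)
    finally show "\<bar>(phi_shift h n y)\<^sup>2\<bar> \<le> (128 * 2 ^ 3) * wt 4 y" .
  qed
  moreover have "(\<lambda>n. (phi_shift h n y)\<^sup>2) \<longlonglongrightarrow> 0" for y
    using tendsto_power[OF pw[of y], of 2] by simp
  ultimately show "\<forall>\<^sub>F n in sequentially. integrable (Qn n) (\<lambda>y. (phi_shift h n y)\<^sup>2)"
    "(\<lambda>n. integral\<^sup>L (Qn n) (\<lambda>y. (phi_shift h n y)\<^sup>2)) \<longlonglongrightarrow> 0"
    using Qn_integral_conv[of "\<lambda>n y. (phi_shift h n y)\<^sup>2" "\<lambda>y. 0" "128 * 2 ^ 3" 4] by auto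
qed

lemma integral_sgn_shift:
  "has_bochner_integral lborel (\<lambda>u::real. sgn (u - h) - sgn u) (- 2 * h)"
proof -
  define A where "A = (if h \<ge> 0 then {0<..<h} else {h<..<0})"
  have "has_bochner_integral lborel (indicator A :: real \<Rightarrow> real) \<bar>h\<bar>"
  proof -
    have "A \<in> sets lborel" "emeasure lborel A < \<infinity>" "measure lborel A = \<bar>h\<bar>" by (auto simp: A_def)
    then show ?thesis using has_bochner_integral_real_indicator[of A lborel] by simp
  qed
  then have i: "has_bochner_integral lborel (\<lambda>u. (- 2 * sgn h) * indicator A u) ((- 2 * sgn h) * \<bar>h\<bar>)"
    by (rule has_bochner_integral_mult_right[rotated])
  have "AE u in lborel. (- 2 * sgn h) * indicator A u = sgn (u - h) - sgn u"
    using AE_lborel_singleton[of 0] AE_lborel_singleton[of h]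
    by eventually_elim (auto simp: A_def indicator_def sgn_if)
  moreover have "A \<in> sets borel" by (auto simp: A_def)
  ultimately have "has_bochner_integral lborel (\<lambda>u. sgn (u - h) - sgn u) ((- 2 * sgn h) * \<bar>h\<bar>)"
    using i by (subst has_bochner_integral_cong_AE[symmetric]) auto
  moreover have "(- 2 * sgn h) * \<bar>h\<bar> = - 2 * h" by (simp add: sgn_if)
  ultimately show ?thesis by (simp only:)
qed

text \<open>The sign score has no useful derivative, but its increment is supported, up to null
  sets, by an interval of length \<open>\<bar>h\<bar> / sqrt n\<close> at 0. Enlarging this interval
  by \<open>sqrt n\<close> makes the kernel flat with value 1 in the limit, and the density at 0
  takes the place of the mean derivative.\<close>

lemma phi_shift_limits_median:
  assumes l: "lam = 1"
  shows "\<forall>\<^sub>F n in sequentially. integrable (Qn n) (phi_shift h n)"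
    and "\<forall>\<^sub>F n in sequentially. integrable (Qn n) (\<lambda>y. (phi_shift h n y)\<^sup>2)"
    and "(\<lambda>n. sqrt (real n) * integral\<^sup>L (Qn n) (phi_shift h n)) \<longlonglongrightarrow> - h * J_epd lam"
    and "(\<lambda>n. integral\<^sup>L (Qn n) (\<lambda>y. (phi_shift h n y)\<^sup>2)) \<longlonglongrightarrow> 0"
proof -
  have sg: "phi_shift h n y = sgn (y - h / sqrt (real n)) - sgn y" for n y
    unfolding phi_shift_def by (simp add: l)
  have le2: "\<bar>phi_shift h n y\<bar> \<le> 2" for n y by (auto simp: sg sgn_if)
  have pb: "poly_bdd (\<lambda>y. 1)" by (rule poly_bdd_const)
  have int1: "\<forall>\<^sub>F n in sequentially. integrable (Qn n) (\<lambda>y. 1 :: real)"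
    using wt_bdd_conv(2)[OF poly_bdd_imp_wt_bdd[OF pb]] .
  show I1: "\<forall>\<^sub>F n in sequentially. integrable (Qn n) (phi_shift h n)"
    using int1
  proof eventually_elim
    case (elim n)
    then have "integrable (Qn n) (\<lambda>y. 2 * 1 :: real)" by (intro integrable_mult_right)
    then show ?case
      by (rule Bochner_Integration.integrable_bound) (use le2 in auto)
  qed
  show "\<forall>\<^sub>F n in sequentially. integrable (Qn n) (\<lambda>y. (phi_shift h n y)\<^sup>2)"
    using int1
  proof eventually_elim
    case (elim n)
    then have "integrable (Qn n) (\<lambda>y. 2\<^sup>2 * 1 :: real)" by (intro integrable_mult_right)
    then show ?case
    proof (rule Bochner_Integration.integrable_bound)
      have "\<bar>phi_shift h n y\<bar>\<^sup>2 \<le> 2\<^sup>2" for y using le2[of n y] by (intro power_mono) auto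
      then show "AE y in Qn n. norm ((phi_shift h n y)\<^sup>2) \<le> norm (2\<^sup>2 * 1 :: real)" by simp
    qed simp
  qed
  have J: "J_epd lam = 1 / epd_mom lam 0"
    using l by (simp add: J_epd_def epd_mom_def)
  \<comment> \<open>The integrand after the substitution \<open>y = u / sqrt n\<close>; the sign
    differences do not depend on \<open>n\<close> any more.\<close>
  define T where "T n u = (sgn (u - h) - sgn u) * kn n (u / sqrt (real n))" for n u
  have kn1: "(\<lambda>n. kn n (u / sqrt (real n))) \<longlonglongrightarrow> 1" for u
  proof -
    have "(\<lambda>n. 3 * \<bar>u / sqrt (real n)\<bar> powr (1/2)) \<longlonglongrightarrow> 3 * \<bar>0\<bar> powr (1/2)"
      by (intro tendsto_mult tendsto_powr' tendsto_rabs tendsto_const h_over_sqrt) auto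
    then have lim: "(\<lambda>n. 3 * \<bar>u / sqrt (real n)\<bar> powr (1/2)) \<longlonglongrightarrow> 0" by simp
    have "(\<lambda>n. (1 + b n * sgn (u / sqrt (real n))) * \<bar>u / sqrt (real n)\<bar> powr th n / lam) \<longlonglongrightarrow> 0"
    proof (rule Lim_null_comparison[OF _ lim])
      have "\<forall>\<^sub>F n in sequentially. \<bar>u / sqrt (real n)\<bar> < 1"
        using tendstoD[OF h_over_sqrt[of u], of 1] by (simp add: abs_divide)
      then show "\<forall>\<^sub>F n in sequentially. norm ((1 + b n * sgn (u / sqrt (real n))) * \<bar>u / sqrt (real n)\<bar> powr th n / lam)
          \<le> 3 * \<bar>u / sqrt (real n)\<bar> powr (1/2)"
        using param_bounds
      proof eventually_elim
        case (elim n)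
        define v where "v = u / sqrt (real n)"
        have "\<bar>1 + b n * sgn v\<bar> \<le> 3" using elim(2) by (auto simp: sgn_if)
        moreover have "\<bar>v\<bar> powr th n \<le> \<bar>v\<bar> powr (1/2)"
          using elim by (cases "v = 0") (auto simp: v_def intro!: powr_mono')
        ultimately have "\<bar>1 + b n * sgn v\<bar> * \<bar>v\<bar> powr th n \<le> 3 * \<bar>v\<bar> powr (1/2)"
          by (intro mult_mono) auto
        then show ?case using l by (simp add: v_def[symmetric] abs_mult)
      qed
    qed
    then have "(\<lambda>n. exp (- ((1 + b n * sgn (u / sqrt (real n))) * \<bar>u / sqrt (real n)\<bar> powr th n / lam))) \<longlonglongrightarrow> exp (- 0)"
      by (intro tendsto_intros)
    then show ?thesis by (simp add: kn_def apd_kernel_def)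
  qed
  have "(\<lambda>n. integral\<^sup>L lborel (T n)) \<longlonglongrightarrow> integral\<^sup>L lborel (\<lambda>u. sgn (u - h) - sgn u)"
  proof -
    obtain N where N: "\<And>n. n \<ge> N \<Longrightarrow> \<bar>b n\<bar> \<le> 1/2"
      using param_bounds unfolding eventually_sequentially by blast
    have k1: "kn n y \<le> 1" if "n \<ge> N" for n y
    proof -
      have "1 + b n * sgn y \<ge> 0" using N[OF that] by (auto simp: sgn_if)
      then show ?thesis using lam by (simp add: kn_def apd_kernel_def)
    qed
    have "(\<lambda>n. integral\<^sup>L lborel (T (n + N))) \<longlonglongrightarrow> integral\<^sup>L lborel (\<lambda>u. sgn (u - h) - sgn u)"
    proof (rule integral_dominated_convergence[where w="\<lambda>u. \<bar>sgn (u - h) - sgn u\<bar>"])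
      show "integrable lborel (\<lambda>u. \<bar>sgn (u - h) - sgn u\<bar>)"
        using integral_sgn_shift[of h] by (intro integrable_abs) (simp add: has_bochner_integral_iff)
      show "AE u in lborel. (\<lambda>n. T (n + N) u) \<longlonglongrightarrow> sgn (u - h) - sgn u"
      proof (rule AE_I2)
        fix u
        have "(\<lambda>n. T n u) \<longlonglongrightarrow> (sgn (u - h) - sgn u) * 1"
          unfolding T_def by (intro tendsto_mult_left kn1)
        then show "(\<lambda>n. T (n + N) u) \<longlonglongrightarrow> sgn (u - h) - sgn u"
          by (intro LIMSEQ_ignore_initial_segment) simp
      qed
      show "AE u in lborel. norm (T (n + N) u) \<le> \<bar>sgn (u - h) - sgn u\<bar>" for n
      proof (rule AE_I2)
        fix u
        show "norm (T (n + N) u) \<le> \<bar>sgn (u - h) - sgn u\<bar>"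
          using k1[of "n + N" "u / sqrt (real (n + N))"] kn_pos[of "n + N" "u / sqrt (real (n + N))"]
          unfolding T_def by (simp add: abs_mult mult_left_le)
      qed
    qed (auto simp: T_def[abs_def])
    then show ?thesis by (rule LIMSEQ_offset)
  qed
  then have "(\<lambda>n. integral\<^sup>L lborel (T n) / Zn n) \<longlonglongrightarrow> (- 2 * h) / (2 * epd_mom lam 0)"
    using integral_sgn_shift[of h] mom0_pos
    by (intro tendsto_divide Zn_lim) (auto simp: has_bochner_integral_iff)
  moreover have "\<forall>\<^sub>F n in sequentially. integral\<^sup>L lborel (T n) / Zn n = sqrt (real n) * integral\<^sup>L (Qn n) (phi_shift h n)"
    using Zn_pos eventually_gt_at_top[of 0]
  proof eventually_elim
    case (elim n)
    define c where "c = 1 / sqrt (real n)"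
    have c: "c > 0" "c * sqrt (real n) = 1" using elim by (auto simp: c_def)
    have "sgn (c * u - h * c) = sgn (u - h)" "sgn (c * u) = sgn u" for u
    proof -
      have "c * u - h * c = c * (u - h)" by (simp add: algebra_simps)
      then show "sgn (c * u - h * c) = sgn (u - h)" "sgn (c * u) = sgn u" using c by (simp_all add: sgn_mult)
    qed
    then have "phi_shift h n (0 + c * u) * kn n (0 + c * u) = T n u" for u
      by (simp add: sg T_def c_def)
    then have "(\<integral>y. phi_shift h n y * kn n y \<partial>lborel) = c * integral\<^sup>L lborel (T n)"
      using c by (subst lborel_integral_real_affine[where c=c and t=0]) auto
    then show ?case
      using c integral_Qn(1)[OF elim(1) phi_shift_measurable, of h n] by (simp add: field_simps)
  qed
  ultimately have "(\<lambda>n. sqrt (real n) * integral\<^sup>L (Qn n) (phi_shift h n)) \<longlonglongrightarrow> (- 2 * h) / (2 * epd_mom lam 0)"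
    by (rule Lim_transform_eventually)
  then show M: "(\<lambda>n. sqrt (real n) * integral\<^sup>L (Qn n) (phi_shift h n)) \<longlonglongrightarrow> - h * J_epd lam"
    by (simp add: J)
  have M0: "(\<lambda>n. integral\<^sup>L (Qn n) (phi_shift h n)) \<longlonglongrightarrow> 0"
    by (rule scaled_limit_0[OF M])
  have "(\<lambda>n. (- 2 * sgn h) * integral\<^sup>L (Qn n) (phi_shift h n)) \<longlonglongrightarrow> (- 2 * sgn h) * 0"
    by (intro tendsto_mult_left M0)
  then have M2: "(\<lambda>n. (- 2 * sgn h) * integral\<^sup>L (Qn n) (phi_shift h n)) \<longlonglongrightarrow> 0" by simp
  show "(\<lambda>n. integral\<^sup>L (Qn n) (\<lambda>y. (phi_shift h n y)\<^sup>2)) \<longlonglongrightarrow> 0"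
  proof (rule Lim_null_comparison[OF _ M2])
    show "\<forall>\<^sub>F n in sequentially. norm (integral\<^sup>L (Qn n) (\<lambda>y. (phi_shift h n y)\<^sup>2)) \<le> (- 2 * sgn h) * integral\<^sup>L (Qn n) (phi_shift h n)"
      using I1 eventually_gt_at_top[of 0]
    proof eventually_elim
      case (elim n)
      \<comment> \<open>The increment has the sign opposite to \<open>h\<close> and modulus at most
        2, so its square is bounded by twice its modulus and the first moment controls the
        second.\<close>
      have sq: "(phi_shift h n y)\<^sup>2 \<le> (- 2 * sgn h) * phi_shift h n y" for y
      proof -
        have "h / sqrt (real n) > 0 \<longleftrightarrow> h > 0" "h / sqrt (real n) < 0 \<longleftrightarrow> h < 0"
          using elim by (auto simp: zero_less_divide_iff divide_less_0_iff)
        then show ?thesis unfolding sg by (auto simp: sgn_if power2_eq_square split: if_splits)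
      qed
      have "integral\<^sup>L (Qn n) (\<lambda>y. (phi_shift h n y)\<^sup>2) \<le> integral\<^sup>L (Qn n) (\<lambda>y. (- 2 * sgn h) * phi_shift h n y)"
      proof (rule integral_mono')
        show "integrable (Qn n) (\<lambda>y. (- 2 * sgn h) * phi_shift h n y)" using elim(1) by (rule integrable_mult_right)
        show "0 \<le> (- 2 * sgn h) * phi_shift h n y" for y by (rule order_trans[OF zero_le_power2 sq])
      qed (rule sq)
      moreover have "integral\<^sup>L (Qn n) (\<lambda>y. (phi_shift h n y)\<^sup>2) \<ge> 0" by (rule integral_nonneg_AE) simp
      ultimately show ?case by simp
    qed
  qed
qed

end

section \<open>Expansion of the estimators and test statistics\<close>

text \<open>The standardized location estimate enters only through its comparison with the sign of the
  score, which covers the median of an even number of observations as well.\<close>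

locale apd_sample = apd_array lam \<beta> \<delta> b th M Y
  for lam \<beta> \<delta> :: real and b th :: "nat \<Rightarrow> real" and M :: "'a measure" and Y :: "nat \<Rightarrow> nat \<Rightarrow> 'a \<Rightarrow> real" +
  fixes t :: "nat \<times> 'a \<Rightarrow> real"
  assumes lam_alt: "lam = 1 \<or> 3/2 \<le> lam"
    and t_le: "\<And>p h. fst p > 0 \<Longrightarrow> rsum (\<lambda>y. spow (lam - 1) (y - h)) p < 0 \<Longrightarrow> t p \<le> h"
    and t_ge: "\<And>p h. fst p > 0 \<Longrightarrow> rsum (\<lambda>y. spow (lam - 1) (y - h)) p > 0 \<Longrightarrow> t p \<ge> h"
begin

lemma eventually_fst_pos: "\<forall>\<^sub>F p in prob_filter M. fst p > 0"
  by (rule eventually_prob_filter_AE) (use eventually_gt_at_top[of "0::nat"] in eventually_elim, simp)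

lemma odd_mean_0:
  fixes g :: "real \<Rightarrow> real"
  assumes "g \<in> borel_measurable borel" "\<And>y. g (- y) = - g y"
  shows "integral\<^sup>L (epd lam) g = 0"
  by (rule integral_epd_odd[OF lam0 assms])

lemma poly_square_wt: "poly_bdd g \<Longrightarrow> wt_bdd (\<lambda>y. (g y)\<^sup>2)"
  by (intro poly_bdd_imp_wt_bdd poly_bdd_power)

lemma phi_poly: "poly_bdd (spow (lam - 1))"
  using lam by (intro poly_bdd_spow) auto

lemma phi_tight: "stoch_bounded M (\<lambda>p. rsum (spow (lam - 1)) p / root_n p)"
proof (rule clt_tight[OF poly_bdd_imp_wt_bdd[OF phi_poly] poly_square_wt[OF phi_poly]])
  show "(\<lambda>n. sqrt (real n) * integral\<^sup>L (Qn n) (spow (lam - 1))) \<longlonglongrightarrow>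
    - (\<beta> * (\<integral>y. spow (lam - 1) y * spow lam y \<partial>epd lam) + \<delta> * (\<integral>y. spow (lam - 1) y * kap lam y \<partial>epd lam)) / lam"
    by (intro score_limit phi_poly odd_mean_0) (auto simp: spow_minus)
qed

text \<open>The smooth case and the median meet here: for each fixed \<open>h\<close> the sample
  score is asymptotically linear at scale \<open>1 / sqrt n\<close>.\<close>

lemma phi_shift_row_limit:
  "((\<lambda>p. (rsum (\<lambda>y. spow (lam - 1) (y - h / root_n p)) p - rsum (spow (lam - 1)) p) / root_n p)
     \<longlongrightarrow> - h * J_epd lam) (prob_filter M)"
proof -
  have "((\<lambda>p. (\<Sum>i<fst p. phi_shift h (fst p) (Y (fst p) i (snd p))) / root_n p) \<longlongrightarrow> - h * J_epd lam) (prob_filter M)"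
    using lam_alt
    by (intro centered_row_conv phi_shift_measurable)
       (use phi_shift_limits_median[of h] phi_shift_limits_smooth[of h] in \<open>elim disjE; simp\<close>)+
  then show ?thesis by (simp add: phi_shift_def rsum_def sum_subtractf)
qed

lemma J_pos: "J_epd lam > 0"
  by (rule J_epd_pos[OF lam(1)])

text \<open>The score is monotone in the location, so comparing it with its linear limit on a finite grid
  of points traps its root.\<close>

lemma location_expansion:
  "((\<lambda>p. root_n p * t p - rsum (spow (lam - 1)) p / root_n p / J_epd lam) \<longlongrightarrow> 0) (prob_filter M)"
proof (rule tendstoI)
  fix e :: real assume e: "e > 0"
  define J where "J = J_epd lam"
  have J: "J > 0" using J_pos by (simp add: J_def)
  define W where "W p = rsum (spow (lam - 1)) p / root_n p / J" for p
  define G where "G h p = (rsum (\<lambda>y. spow (lam - 1) (y - h / root_n p)) p - rsum (spow (lam - 1)) p) / root_n p" for h p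
  have "stoch_bounded M (\<lambda>p. (1 / J) * (rsum (spow (lam - 1)) p / root_n p))"
    by (intro stoch_bounded_cmult phi_tight)
  then have Wb: "stoch_bounded M W" by (simp add: W_def[abs_def] mult.commute)
  show "\<forall>\<^sub>F p in prob_filter M. dist (root_n p * t p - rsum (spow (lam - 1)) p / root_n p / J_epd lam) 0 < e"
    unfolding eventually_prob_filter
  proof (intro allI impI)
    fix \<eta> :: real assume \<eta>: "\<eta> > 0"
    then have \<eta>2: "\<eta> / 2 > 0" by simp
    obtain K where K: "\<forall>\<^sub>F n in sequentially. \<exists>A\<in>sets M. measure M A \<le> \<eta>/2 \<and> (\<forall>\<omega>\<in>space M - A. \<bar>W (n, \<omega>)\<bar> \<le> K)"
      using Wb \<eta>2 unfolding stoch_bounded_def by blast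
    define d where "d = e / 4"
    have d: "d > 0" using e by (simp add: d_def)
    \<comment> \<open>Large enough for the grid of mesh \<open>d\<close> to cover all values of
      modulus at most \<open>\<bar>K\<bar> + e\<close>, which contains \<open>W p\<close> with a
      margin for the shifts by \<open>d\<close>.\<close>
    define N where "N = \<lceil>(\<bar>K\<bar> + e) / d\<rceil> + 1"
    define H where "H = (\<lambda>k. of_int k * d) ` {- N..N}"
    have "finite H" by (simp add: H_def)
    have near: "\<exists>h\<in>H. x \<le> h \<and> h \<le> x + d" if x: "\<bar>x\<bar> \<le> \<bar>K\<bar> + e" for x
    proof -
      define k where "k = \<lceil>x / d\<rceil>"
      have k: "x / d \<le> of_int k" "of_int k < x / d + 1" unfolding k_def by linarith+
      have u: "x / d \<le> (\<bar>K\<bar> + e) / d" "- ((\<bar>K\<bar> + e) / d) \<le> x / d"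
        unfolding minus_divide_left using x d by (intro divide_right_mono; simp add: abs_le_iff)+
      have "of_int k \<le> (of_int N :: real)" "- (of_int N :: real) \<le> of_int k"
        using k u le_of_int_ceiling[of "(\<bar>K\<bar> + e) / d"] unfolding N_def of_int_add of_int_1 by linarith+
      then have "k \<in> {- N..N}" by (metis atLeastAtMost_iff of_int_le_iff of_int_minus)
      moreover have "x \<le> of_int k * d" "of_int k * d \<le> x + d"
        using k d by (simp_all add: field_simps)
      ultimately show ?thesis unfolding H_def by blast
    qed
    have "\<forall>\<^sub>F p in prob_filter M. \<forall>h\<in>H. \<bar>G h p - (- h * J)\<bar> < J * d"
    proof (rule eventually_ball_finite[OF \<open>finite H\<close>], rule ballI)
      fix h
      show "\<forall>\<^sub>F p in prob_filter M. \<bar>G h p - (- h * J)\<bar> < J * d"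
        using tendstoD[OF phi_shift_row_limit[of h], of "J * d"] J d
        by (simp add: G_def J_def dist_real_def)
    qed
    then have "\<forall>\<^sub>F p in prob_filter M. (\<forall>h\<in>H. \<bar>G h p - (- h * J)\<bar> < J * d) \<and> fst p > 0"
      using eventually_fst_pos by (rule eventually_conj)
    then have L: "\<forall>\<^sub>F n in sequentially. \<exists>A\<in>sets M. measure M A \<le> \<eta>/2 \<and>
        (\<forall>\<omega>\<in>space M - A. (\<forall>h\<in>H. \<bar>G h (n, \<omega>) - (- h * J)\<bar> < J * d) \<and> fst (n, \<omega>) > 0)"
      using \<eta>2 unfolding eventually_prob_filter by blast
    have key: "dist (root_n p * t p - rsum (spow (lam - 1)) p / root_n p / J_epd lam) 0 < e"
      if Wp: "\<bar>W p\<bar> \<le> K" and Gp: "(\<forall>h\<in>H. \<bar>G h p - (- h * J)\<bar> < J * d) \<and> fst p > 0" for p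
    proof -
      define r where "r = root_n p"
      have r: "r > 0" using Gp by (simp add: r_def)
      \<comment> \<open>In the variable \<open>h\<close> the score is \<open>J * W p\<close> plus
        its increment, so its root lies near \<open>W p\<close>.\<close>
      have score: "rsum (\<lambda>y. spow (lam - 1) (y - h / r)) p = r * (J * W p + G h p)" for h
      proof -
        have "a = r * (J * (x / r / J) + (a - x) / r)" for a x :: real
          using r J by (simp add: distrib_left)
        from this[of "rsum (\<lambda>y. spow (lam - 1) (y - h / r)) p" "rsum (spow (lam - 1)) p"]
        show ?thesis unfolding G_def W_def r_def .
      qed
      \<comment> \<open>At a grid point at least \<open>d\<close> to the right of \<open>W p\<close>
        the linear limit is at most \<open>- J * d\<close>, and the approximation error is below
        \<open>J * d\<close>, so the score is strictly negative there.\<close>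
      obtain h1 where h1: "h1 \<in> H" "W p + d \<le> h1" "h1 \<le> W p + d + d"
      proof -
        have "\<bar>W p + d\<bar> \<le> \<bar>K\<bar> + e" using Wp e unfolding d_def by linarith
        from near[OF this] show ?thesis using that by blast
      qed
      have "G h1 p < - h1 * J + J * d" using Gp h1(1) by force
      moreover have "J * (W p + d) \<le> J * h1" using J h1(2) by (intro mult_left_mono) auto
      ultimately have "J * W p + G h1 p < 0" by (simp add: algebra_simps)
      then have "rsum (\<lambda>y. spow (lam - 1) (y - h1 / r)) p < 0"
        unfolding score using r by (simp add: mult_pos_neg)
      then have "t p \<le> h1 / r" using Gp by (intro t_le) auto
      then have up: "r * t p \<le> W p + d + d" using h1(3) r by (simp add: field_simps)
      obtain h2 where h2: "h2 \<in> H" "W p - d - d \<le> h2" "h2 \<le> W p - d"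
      proof -
        have "\<bar>W p - d - d\<bar> \<le> \<bar>K\<bar> + e" using Wp e unfolding d_def by linarith
        from near[OF this] show ?thesis using that by auto
      qed
      have "G h2 p > - h2 * J - J * d" using Gp h2(1) by force
      moreover have "J * h2 \<le> J * (W p - d)" using J h2(3) by (intro mult_left_mono) auto
      ultimately have "J * W p + G h2 p > 0" by (simp add: algebra_simps)
      then have "rsum (\<lambda>y. spow (lam - 1) (y - h2 / r)) p > 0"
        unfolding score using r by simp
      then have "t p \<ge> h2 / r" using Gp by (intro t_ge) auto
      then have "r * t p \<ge> W p - d - d" using h2(2) r by (simp add: field_simps)
      with up have "\<bar>r * t p - W p\<bar> < e" using e by (simp add: d_def abs_le_iff)
      then show ?thesis unfolding r_def W_def J_def by simp
    qed
    show "\<forall>\<^sub>F n in sequentially. \<exists>A\<in>sets M. measure M A \<le> \<eta> \<and>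
        (\<forall>\<omega>\<in>space M - A. dist (sqrt (real (fst (n, \<omega>))) * t (n, \<omega>) - rsum (spow (lam - 1)) (n, \<omega>) / sqrt (real (fst (n, \<omega>))) / J_epd lam) 0 < e)"
      by (rule eventually_elim2[OF K L])
         (rule small_exception_conj[where a="\<eta>/2" and b="\<eta>/2"], assumption, assumption, rule key, auto)
  qed
qed

lemma t_tight: "stoch_bounded M (\<lambda>p. root_n p * t p)"
proof -
  have "stoch_bounded M (\<lambda>p. (root_n p * t p - rsum (spow (lam - 1)) p / root_n p / J_epd lam)
      + (1 / J_epd lam) * (rsum (spow (lam - 1)) p / root_n p))"
    by (intro stoch_bounded_add stoch_bounded_cmult phi_tight tendsto_imp_stoch_bounded[OF location_expansion])
  then show ?thesis by simp
qed

lemma t_0: "(t \<longlongrightarrow> 0) (prob_filter M)"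
proof -
  have "((\<lambda>p. 1 / root_n p * (root_n p * t p)) \<longlongrightarrow> 0) (prob_filter M)"
    by (rule tendsto_0_mult_stoch_bounded[OF inv_sqrt_fst t_tight])
  then show ?thesis
  proof (rule Lim_transform_eventually)
    show "\<forall>\<^sub>F p in prob_filter M. 1 / root_n p * (root_n p * t p) = t p"
      using eventually_fst_pos by eventually_elim simp
  qed
qed

text \<open>All observations share the random shift \<open>t\<close>. After division by
  \<open>sqrt n\<close> the remainder is of the size of \<open>\<bar>t\<bar> powr (1/4)\<close>
  times the tight \<open>\<bar>sqrt n * t\<bar>\<close> times a tight average, hence negligible; the
  average of \<open>f'\<close> is replaced by its null mean through the law of large
  numbers.\<close>

lemma shifted_sum_expansion:
  assumes taylor: "\<And>y s. y \<noteq> 0 \<Longrightarrow> \<bar>s\<bar> \<le> 1 \<Longrightarrow> \<bar>f (y - s) - f y + s * f' y\<bar> \<le> C * \<bar>s\<bar> powr (5/4) * wt q y"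
    and f': "wt_bdd f'" "wt_bdd (\<lambda>y. (f' y)\<^sup>2)"
  shows "((\<lambda>p. (rsum (\<lambda>y. f (y - t p)) p - rsum f p) / root_n p
      + integral\<^sup>L (epd lam) f' * (root_n p * t p)) \<longlongrightarrow> 0) (prob_filter M)"
proof -
  define E where "E p = (rsum (\<lambda>y. f (y - t p)) p - rsum f p + t p * rsum f' p) / root_n p" for p
  have small: "\<forall>\<^sub>F p in prob_filter M. \<bar>t p\<bar> \<le> 1"
    using tendstoD[OF t_0, of 1] by (auto elim: eventually_mono)
  have w: "wt_bdd (wt q)" by (rule wt_bddI[of _ 1 q]) (auto simp: wt_nonneg)
  have "((\<lambda>p. (C * (root_n p * \<bar>t p\<bar> powr (5/4))) * (rsum (wt q) p / real (fst p)) * root_n p / root_n p) \<longlongrightarrow> 0) (prob_filter M)"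
  proof -
    have t4: "((\<lambda>p. \<bar>t p\<bar> powr (1/4)) \<longlongrightarrow> 0) (prob_filter M)"
      using tendsto_powr'[OF tendsto_rabs[OF t_0] tendsto_const[of "1/4"]] by simp
    have "((\<lambda>p. \<bar>t p\<bar> powr (1/4) * (\<bar>root_n p * t p\<bar> * (rsum (wt q) p / real (fst p)))) \<longlongrightarrow> 0) (prob_filter M)"
    proof (rule tendsto_0_mult_stoch_bounded[OF t4], rule stoch_bounded_mult)
      show "stoch_bounded M (\<lambda>p. \<bar>root_n p * t p\<bar>)"
        by (rule stoch_bounded_mono[OF t_tight, where c=1]) auto
      show "stoch_bounded M (\<lambda>p. rsum (wt q) p / real (fst p))"
        by (rule average_bounded[OF w wt_nonneg])
    qed
    from tendsto_mult_left[OF this, of C]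
    have "((\<lambda>p. C * (\<bar>t p\<bar> powr (1/4) * (\<bar>root_n p * t p\<bar> * (rsum (wt q) p / real (fst p))))) \<longlongrightarrow> 0) (prob_filter M)"
      by simp
    then show ?thesis
    proof (rule Lim_transform_eventually)
      show "\<forall>\<^sub>F p in prob_filter M. C * (\<bar>t p\<bar> powr (1/4) * (\<bar>root_n p * t p\<bar> * (rsum (wt q) p / real (fst p))))
          = (C * (root_n p * \<bar>t p\<bar> powr (5/4))) * (rsum (wt q) p / real (fst p)) * root_n p / root_n p"
        using eventually_fst_pos
      proof eventually_elim
        case (elim p)
        have "\<bar>t p\<bar> * \<bar>t p\<bar> powr (1/4) = \<bar>t p\<bar> powr (5/4)"
          using powr_mult_base[of "\<bar>t p\<bar>" "1/4"] by simp
        then show ?case using elim by (simp add: abs_mult mult_ac)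
      qed
    qed
  qed
  then have E0: "(E \<longlongrightarrow> 0) (prob_filter M)"
  proof (rule Lim_null_comparison[rotated])
    show "\<forall>\<^sub>F p in prob_filter M. norm (E p) \<le> (C * (root_n p * \<bar>t p\<bar> powr (5/4))) * (rsum (wt q) p / real (fst p)) * root_n p / root_n p"
      using small rows_neq_0 eventually_fst_pos
    proof eventually_elim
      case (elim p)
      have "rsum (\<lambda>y. f (y - t p)) p - rsum f p + t p * rsum f' p = rsum (\<lambda>y. f (y - t p) - f y + t p * f' y) p"
        by (simp add: rsum_add rsum_diff rsum_cmult)
      then have "\<bar>rsum (\<lambda>y. f (y - t p)) p - rsum f p + t p * rsum f' p\<bar> \<le> rsum (\<lambda>y. \<bar>f (y - t p) - f y + t p * f' y\<bar>) p"
        by (simp add: rsum_def)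
      also have "\<dots> \<le> rsum (\<lambda>y. C * \<bar>t p\<bar> powr (5/4) * wt q y) p"
        unfolding rsum_def using elim by (intro sum_mono taylor) auto
      also have "\<dots> = C * \<bar>t p\<bar> powr (5/4) * rsum (wt q) p" by (simp add: rsum_cmult)
      finally have "norm (E p) \<le> C * \<bar>t p\<bar> powr (5/4) * rsum (wt q) p / root_n p"
        unfolding E_def by (simp add: abs_divide divide_right_mono)
      also have "\<dots> = (C * (root_n p * \<bar>t p\<bar> powr (5/4))) * (rsum (wt q) p / real (fst p)) * root_n p / root_n p"
      proof -
        have "c * w * x / r = c * (r * w) * (x / n) * r / r" if "n = r * r" "r \<noteq> 0" for n r c w x :: real
          using that by simp
        from this[of "real (fst p)" "root_n p"] show ?thesis using elim(3) by simp
      qed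
      finally show ?case .
    qed
  qed
  have "((\<lambda>p. integral\<^sup>L (epd lam) f' - rsum f' p / real (fst p)) \<longlongrightarrow> integral\<^sup>L (epd lam) f' - integral\<^sup>L (epd lam) f') (prob_filter M)"
    by (intro tendsto_diff tendsto_const lln f')
  then have "((\<lambda>p. (integral\<^sup>L (epd lam) f' - rsum f' p / real (fst p)) * (root_n p * t p)) \<longlongrightarrow> 0) (prob_filter M)"
    by (intro tendsto_0_mult_stoch_bounded[OF _ t_tight]) simp
  from tendsto_add[OF E0 this]
  have "((\<lambda>p. E p + (integral\<^sup>L (epd lam) f' - rsum f' p / real (fst p)) * (root_n p * t p)) \<longlongrightarrow> 0) (prob_filter M)" by simp
  then show ?thesis
  proof (rule Lim_transform_eventually)
    show "\<forall>\<^sub>F p in prob_filter M. E p + (integral\<^sup>L (epd lam) f' - rsum f' p / real (fst p)) * (root_n p * t p)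
        = (rsum (\<lambda>y. f (y - t p)) p - rsum f p) / root_n p + integral\<^sup>L (epd lam) f' * (root_n p * t p)"
      using eventually_fst_pos
    proof eventually_elim
      case (elim p)
      have r: "real (fst p) = root_n p * root_n p" "root_n p \<noteq> 0" using elim by auto
      have "t p * rsum f' p / root_n p = rsum f' p / real (fst p) * (root_n p * t p)"
      proof -
        have "x * y / r = y / n * (r * x)" if "n = r * r" "r \<noteq> 0" for n r x y :: real
          using that by simp
        from this[OF r] show ?thesis .
      qed
      then show ?case unfolding E_def add_divide_distrib left_diff_distrib by linarith
    qed
  qed
qed

text \<open>Moments after centring and before rescaling; \<open>ahat\<close> is the
  \<open>lam\<close>-th power of the scale estimate divided by \<sigma>.\<close>

definition ahat :: "nat \<times> 'a \<Rightarrow> real" where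
  "ahat p = rsum (\<lambda>y. \<bar>y - t p\<bar> powr lam) p / real (fst p)"

definition khat :: "nat \<times> 'a \<Rightarrow> real" where
  "khat p = rsum (\<lambda>y. kap lam (y - t p)) p / real (fst p)"

definition shat :: "nat \<times> 'a \<Rightarrow> real" where
  "shat p = rsum (\<lambda>y. spow lam (y - t p)) p / real (fst p)"

lemma scale_sqrt: "fst p > 0 \<Longrightarrow> root_n p * (x / real (fst p)) = x / root_n p"
proof -
  assume "fst p > 0"
  then have "real (fst p) = root_n p * root_n p" "root_n p \<noteq> 0" by auto
  then show ?thesis by (metis times_divide_eq_right mult_divide_mult_cancel_left mult_cancel_left)
qed

text \<open>The derivative of an even function is odd and has null mean 0, so estimating the
  location has no first-order effect. The same applies to \<open>khat\<close>.\<close>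

lemma ahat_expansion:
  "((\<lambda>p. root_n p * (ahat p - 1) - rsum (\<lambda>y. \<bar>y\<bar> powr lam - 1) p / root_n p) \<longlongrightarrow> 0) (prob_filter M)"
proof -
  have pb: "poly_bdd (\<lambda>y. lam * spow (lam - 1) y)" using phi_poly by (intro poly_bdd_mult poly_bdd_const)
  have z: "integral\<^sup>L (epd lam) (\<lambda>y. lam * spow (lam - 1) y) = 0"
    by (intro odd_mean_0) (auto simp: spow_minus)
  have "((\<lambda>p. (rsum (\<lambda>y. \<bar>y - t p\<bar> powr lam) p - rsum (\<lambda>y. \<bar>y\<bar> powr lam) p) / root_n p
      + integral\<^sup>L (epd lam) (\<lambda>y. lam * spow (lam - 1) y) * (root_n p * t p)) \<longlongrightarrow> 0) (prob_filter M)"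
    by (rule shifted_sum_expansion[where f="\<lambda>y. \<bar>y\<bar> powr lam"])
       (use power_taylor(1)[OF lam] pb in \<open>auto intro: poly_bdd_imp_wt_bdd poly_square_wt\<close>)
  then show ?thesis unfolding z
  proof (rule Lim_transform_eventually)
    show "\<forall>\<^sub>F p in prob_filter M. (rsum (\<lambda>y. \<bar>y - t p\<bar> powr lam) p - rsum (\<lambda>y. \<bar>y\<bar> powr lam) p) / root_n p + 0 * (root_n p * t p)
        = root_n p * (ahat p - 1) - rsum (\<lambda>y. \<bar>y\<bar> powr lam - 1) p / root_n p"
      using eventually_fst_pos
    proof eventually_elim
      case (elim p)
      have "real (fst p) / root_n p = root_n p" by (rule real_div_sqrt) simp
      then show ?case
        using scale_sqrt[OF elim, of "rsum (\<lambda>y. \<bar>y - t p\<bar> powr lam) p"]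
        by (simp add: ahat_def rsum_diff rsum_const right_diff_distrib diff_divide_distrib)
    qed
  qed
qed

lemma khat_expansion:
  "((\<lambda>p. root_n p * (khat p - E_K lam) - rsum (\<lambda>y. kap lam y - E_K lam) p / root_n p) \<longlongrightarrow> 0) (prob_filter M)"
proof -
  have m: "kap' lam \<in> borel_measurable borel" by simp
  have le: "\<bar>kap' lam y\<bar> \<le> 100 * (\<bar>y\<bar> powr (-(1/4)) * (1 + \<bar>y\<bar>) ^ 4)" if "y \<noteq> 0" for y
    by (rule kap'_le[OF lam that])
  have w1: "wt_bdd (kap' lam)"
  proof (rule wt_bddI[OF m, of 100 5])
    fix y :: real assume y: "y \<noteq> 0"
    have "\<bar>y\<bar> powr (-(1/4)) \<le> \<bar>y\<bar> powr (-(1/2)) * (1 + \<bar>y\<bar>) ^ 1"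
      by (rule abs_powr_weight) (use y in auto)
    then have "100 * (\<bar>y\<bar> powr (-(1/4)) * (1 + \<bar>y\<bar>) ^ 4) \<le> 100 * (\<bar>y\<bar> powr (-(1/2)) * (1 + \<bar>y\<bar>) ^ 1 * (1 + \<bar>y\<bar>) ^ 4)"
      by (intro mult_left_mono mult_right_mono) auto
    also have "\<dots> = 100 * wt 5 y" by (simp add: wt_def power_add[symmetric] eval_nat_numeral)
    finally show "\<bar>kap' lam y\<bar> \<le> 100 * wt 5 y" using le[OF y] by linarith
  qed simp
  have w2: "wt_bdd (\<lambda>y. (kap' lam y)\<^sup>2)"
  proof (rule wt_bddI[of _ 10000 8])
    fix y :: real assume y: "y \<noteq> 0"
    have "\<bar>kap' lam y\<bar>\<^sup>2 \<le> (100 * (\<bar>y\<bar> powr (-(1/4)) * (1 + \<bar>y\<bar>) ^ 4))\<^sup>2"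
      using le[OF y] by (intro power_mono) auto
    also have "\<dots> = 10000 * ((\<bar>y\<bar> powr (-(1/4)))\<^sup>2 * ((1 + \<bar>y\<bar>) ^ 4)\<^sup>2)" by (simp add: power_mult_distrib)
    also have "(\<bar>y\<bar> powr (-(1/4)))\<^sup>2 = \<bar>y\<bar> powr (-(1/2))" by (simp add: powr_power[symmetric] power2_eq_square powr_add[symmetric])
    also have "((1 + \<bar>y\<bar>) ^ 4)\<^sup>2 = (1 + \<bar>y\<bar>) ^ 8" by (simp add: power_mult[symmetric])
    finally show "\<bar>(kap' lam y)\<^sup>2\<bar> \<le> 10000 * wt 8 y" by (simp add: wt_def mult_ac)
  qed (use m in auto)
  have z: "integral\<^sup>L (epd lam) (kap' lam) = 0"
    by (intro odd_mean_0 m) (simp add: kap'_def spow_minus)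
  have "((\<lambda>p. (rsum (\<lambda>y. kap lam (y - t p)) p - rsum (kap lam) p) / root_n p
      + integral\<^sup>L (epd lam) (kap' lam) * (root_n p * t p)) \<longlongrightarrow> 0) (prob_filter M)"
    by (rule shifted_sum_expansion[OF kap_taylor[OF lam] w1 w2])
  then show ?thesis unfolding z
  proof (rule Lim_transform_eventually)
    show "\<forall>\<^sub>F p in prob_filter M. (rsum (\<lambda>y. kap lam (y - t p)) p - rsum (kap lam) p) / root_n p + 0 * (root_n p * t p)
        = root_n p * (khat p - E_K lam) - rsum (\<lambda>y. kap lam y - E_K lam) p / root_n p"
      using eventually_fst_pos
    proof eventually_elim
      case (elim p)
      have "real (fst p) * E_K lam / root_n p = root_n p * E_K lam"
        by (metis of_nat_0_le_iff real_div_sqrt times_divide_eq_left)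
      then show ?case
        using scale_sqrt[OF elim, of "rsum (\<lambda>y. kap lam (y - t p)) p"]
        by (simp add: khat_def rsum_diff rsum_const right_diff_distrib diff_divide_distrib)
    qed
  qed
qed

text \<open>The derivative of the odd function \<open>spow lam\<close> is even with mean
  \<open>infl_coeff lam * J_epd lam\<close>, so the location error matters. Inserting its expansion
  in terms of the score produces the projection residual \<open>infl_S\<close>.\<close>

lemma shat_expansion:
  "((\<lambda>p. root_n p * shat p - rsum (infl_S lam) p / root_n p) \<longlongrightarrow> 0) (prob_filter M)"
proof -
  have pb: "poly_bdd (\<lambda>y. lam * \<bar>y\<bar> powr (lam - 1))"
    using lam by (intro poly_bdd_mult poly_bdd_const poly_bdd_powr) auto
  have c: "integral\<^sup>L (epd lam) (\<lambda>y. lam * \<bar>y\<bar> powr (lam - 1)) = infl_coeff lam * J_epd lam"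
  proof -
    have "has_bochner_integral (epd lam) (\<lambda>y. \<bar>y\<bar> powr (lam - 1)) (epd_mom lam (lam - 1) / epd_mom lam 0)"
      using lam by (intro epd_moments) auto
    then have "integral\<^sup>L (epd lam) (\<lambda>y. lam * \<bar>y\<bar> powr (lam - 1)) = lam * (epd_mom lam (lam - 1) / epd_mom lam 0)"
      by (simp add: has_bochner_integral_iff)
    moreover have "epd_mom lam (2 * lam - 1) = lam * epd_mom lam (lam - 1)"
      using epd_mom_plus[OF lam0, of "lam - 1"] lam by (simp add: mult_2 algebra_simps)
    ultimately show ?thesis using m_pos[OF lam(1)] by (simp add: infl_coeff_def J_epd_def)
  qed
  have "((\<lambda>p. (rsum (\<lambda>y. spow lam (y - t p)) p - rsum (spow lam) p) / root_n p
      + integral\<^sup>L (epd lam) (\<lambda>y. lam * \<bar>y\<bar> powr (lam - 1)) * (root_n p * t p)) \<longlongrightarrow> 0) (prob_filter M)"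
    by (rule shifted_sum_expansion[where f="spow lam"])
       (use power_taylor(2)[OF lam] pb in \<open>auto intro: poly_bdd_imp_wt_bdd poly_square_wt\<close>)
  from tendsto_diff[OF this tendsto_mult_left[OF location_expansion, of "infl_coeff lam * J_epd lam"]]
  have "((\<lambda>p. (rsum (\<lambda>y. spow lam (y - t p)) p - rsum (spow lam) p) / root_n p
      + infl_coeff lam * J_epd lam * (root_n p * t p) -
      infl_coeff lam * J_epd lam * (root_n p * t p - rsum (spow (lam - 1)) p / root_n p / J_epd lam)) \<longlongrightarrow> 0) (prob_filter M)"
    unfolding c by simp
  then show ?thesis
  proof (rule Lim_transform_eventually)
    show "\<forall>\<^sub>F p in prob_filter M. (rsum (\<lambda>y. spow lam (y - t p)) p - rsum (spow lam) p) / root_n p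
      + infl_coeff lam * J_epd lam * (root_n p * t p) -
      infl_coeff lam * J_epd lam * (root_n p * t p - rsum (spow (lam - 1)) p / root_n p / J_epd lam)
      = root_n p * shat p - rsum (infl_S lam) p / root_n p"
      using eventually_fst_pos
    proof eventually_elim
      case (elim p)
      have e: "c * J * a - c * J * (a - x / J) = c * x" if "J \<noteq> 0" for c J a x :: real
        using that by (simp add: right_diff_distrib)
      have "rsum (infl_S lam) p = rsum (spow lam) p - infl_coeff lam * rsum (spow (lam - 1)) p"
        unfolding infl_S_def[abs_def] by (simp add: rsum_diff rsum_cmult)
      then show ?case
        using e[of "J_epd lam" "infl_coeff lam" "root_n p * t p" "rsum (spow (lam - 1)) p / root_n p"]
          scale_sqrt[OF elim, of "rsum (\<lambda>y. spow lam (y - t p)) p"] J_pos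
        by (simp add: shat_def diff_divide_distrib)
    qed
  qed
qed

end

section \<open>Expansions of the studentized statistics\<close>

lemma (in prob_space) stoch_bounded_close:
  assumes "((\<lambda>p. V p - W p) \<longlongrightarrow> 0) (prob_filter M)" "stoch_bounded M W"
  shows "stoch_bounded M V"
proof -
  have "stoch_bounded M (\<lambda>p. (V p - W p) + W p)"
    by (intro stoch_bounded_add tendsto_imp_stoch_bounded[OF assms(1)] assms(2))
  then show ?thesis by simp
qed

text \<open>\<open>T\<close> inherits tightness from \<open>W\<close>, so replacing the
  deterministic normalizer by its limit costs only a vanishing term.\<close>

lemma (in prob_space) studentized_expansion:
  assumes T: "((\<lambda>p. T p - D * W p) \<longlongrightarrow> 0) (prob_filter M)" and W: "stoch_bounded M W"
    and w: "w \<longlonglongrightarrow> s" and s: "s \<noteq> 0"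
  shows "((\<lambda>p. T p / w (fst p) - D / s * W p) \<longlongrightarrow> 0) (prob_filter M)"
proof -
  have "stoch_bounded M T"
    by (rule stoch_bounded_close[OF T stoch_bounded_cmult[OF W]])
  moreover have "((\<lambda>p. 1 / w (fst p) - 1 / s) \<longlongrightarrow> 1 / s - 1 / s) (prob_filter M)"
    using s by (intro tendsto_intros tendsto_fst_prob_filter[OF w])
  ultimately have "((\<lambda>p. (1 / w (fst p) - 1 / s) * T p) \<longlongrightarrow> 0) (prob_filter M)"
    by (intro tendsto_0_mult_stoch_bounded) simp_all
  from tendsto_add[OF this tendsto_mult_left[OF T, of "1 / s"]]
  have "((\<lambda>p. (1 / w (fst p) - 1 / s) * T p + 1 / s * (T p - D * W p)) \<longlongrightarrow> 0) (prob_filter M)" by simp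
  moreover have "(1 / w - 1 / s) * T + 1 / s * (T - D * W) = T / w - D / s * W" for w T W :: real
    by (simp add: left_diff_distrib right_diff_distrib)
  ultimately show ?thesis by simp
qed

context apd_sample
begin

lemma centered_tight:
  assumes "poly_bdd g" "integral\<^sup>L (epd lam) g = 0"
  shows "stoch_bounded M (\<lambda>p. rsum g p / root_n p)"
  by (rule clt_tight[OF poly_bdd_imp_wt_bdd[OF assms(1)] poly_square_wt[OF assms(1)] score_limit[OF assms]])

lemma root_n_consistent:
  assumes "stoch_bounded M (\<lambda>p. root_n p * (W p - c))"
  shows "(W \<longlongrightarrow> c) (prob_filter M)"
proof -
  have "((\<lambda>p. 1 / root_n p * (root_n p * (W p - c))) \<longlongrightarrow> 0) (prob_filter M)"
    by (rule tendsto_0_mult_stoch_bounded[OF inv_sqrt_fst assms])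
  moreover have "\<forall>\<^sub>F p in prob_filter M. 1 / root_n p * (root_n p * (W p - c)) = W p - c"
    using eventually_fst_pos by eventually_elim simp
  ultimately have "((\<lambda>p. W p - c) \<longlongrightarrow> 0) (prob_filter M)" by (rule Lim_transform_eventually)
  then show ?thesis by (rule LIM_zero_cancel)
qed

lemma infl_mean_0: "integral\<^sup>L (epd lam) (infl_S lam) = 0" "integral\<^sup>L (epd lam) (infl_K lam) = 0"
  using odd_mean_0[of "infl_S lam"] infl_K_moments(1)[OF lam(1)]
  by (simp_all add: infl_minus has_bochner_integral_iff)

lemmas infl_tight = centered_tight[OF poly_bdd_infl(1)[OF lam(1)] infl_mean_0(1)]
  centered_tight[OF poly_bdd_infl(2)[OF lam(1)] infl_mean_0(2)]

lemma ahat_tight: "stoch_bounded M (\<lambda>p. root_n p * (ahat p - 1))"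
proof (rule stoch_bounded_close[OF ahat_expansion centered_tight])
  interpret E: prob_space "epd lam" by (rule prob_space_epd[OF lam0])
  show "poly_bdd (\<lambda>y. \<bar>y\<bar> powr lam - 1)" using lam0 by (intro poly_bdd_diff poly_bdd_powr poly_bdd_const) auto
  show "(\<integral>y. \<bar>y\<bar> powr lam - 1 \<partial>epd lam) = 0"
    using infl_K_moments(5)[OF lam(1)] E.prob_space by (simp add: has_bochner_integral_iff)
qed

lemma khat_tight: "stoch_bounded M (\<lambda>p. root_n p * (khat p - E_K lam))"
proof (rule stoch_bounded_close[OF khat_expansion centered_tight])
  interpret E: prob_space "epd lam" by (rule prob_space_epd[OF lam0])
  show "poly_bdd (\<lambda>y. kap lam y - E_K lam)" using lam by (intro poly_bdd_diff poly_bdd_kap poly_bdd_const) auto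
  show "(\<integral>y. kap lam y - E_K lam \<partial>epd lam) = 0"
    using infl_K_moments(4)[OF lam(1)] E.prob_space by (simp add: has_bochner_integral_iff)
qed

lemma shat_tight: "stoch_bounded M (\<lambda>p. root_n p * shat p)"
  by (rule stoch_bounded_close[OF shat_expansion infl_tight(1)])

lemma ahat_1: "(ahat \<longlongrightarrow> 1) (prob_filter M)"
  by (rule root_n_consistent[OF ahat_tight])

lemma inverse_ahat: "((\<lambda>p. 1 / ahat p - 1) \<longlongrightarrow> 0) (prob_filter M)"
  using tendsto_diff[OF tendsto_divide[OF tendsto_const[of 1] ahat_1] tendsto_const[of 1]] by simp

definition Sst :: "nat \<times> 'a \<Rightarrow> real" where
  "Sst p = shat p / ahat p"

text \<open>Dividing by the scale \<open>c = ahat powr (1 / lam)\<close> turns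
  \<open>ln \<bar>u\<bar>\<close> into \<open>ln \<bar>u\<bar> - ln ahat / lam\<close>, and the last
  term is averaged against weights of mean 1.\<close>

definition Kst :: "nat \<times> 'a \<Rightarrow> real" where
  "Kst p = khat p / ahat p - ln (ahat p) / lam"

definition Knet :: "nat \<times> 'a \<Rightarrow> real" where
  "Knet p = max 0 (Kst p - lam / 2 * (Sst p)\<^sup>2)"

lemma Sst_expansion: "((\<lambda>p. root_n p * Sst p - rsum (infl_S lam) p / root_n p) \<longlongrightarrow> 0) (prob_filter M)"
proof -
  have "((\<lambda>p. (1 / ahat p - 1) * (root_n p * shat p)) \<longlongrightarrow> 0) (prob_filter M)"
    by (rule tendsto_0_mult_stoch_bounded[OF inverse_ahat shat_tight])
  from tendsto_add[OF this shat_expansion]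
  have "((\<lambda>p. (1 / ahat p - 1) * (root_n p * shat p) + (root_n p * shat p - rsum (infl_S lam) p / root_n p)) \<longlongrightarrow> 0) (prob_filter M)"
    by simp
  moreover have "(1 / a - 1) * (r * s) + (r * s - i) = r * (s / a) - i" for a r s i :: real
    by (simp add: left_diff_distrib)
  ultimately show ?thesis unfolding Sst_def by (simp only:)
qed

text \<open>The dependence on the scale is through \<open>E / a - ln a / lam\<close>, whose
  derivative at \<open>a = 1\<close> is \<open>- E - 1 / lam\<close>. This is the coefficient of the
  scale residual in \<open>infl_K\<close>.\<close>

lemma Kst_expansion:
  "((\<lambda>p. root_n p * (Kst p - E_K lam) - rsum (infl_K lam) p / root_n p) \<longlongrightarrow> 0) (prob_filter M)"
proof -
  define E where "E = E_K lam"
  define D where "D = - E - 1 / lam"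
  define f where "f x = E / x - ln x / lam" for x
  define I1 where "I1 p = rsum (\<lambda>y. kap lam y - E) p / root_n p" for p
  define I2 where "I2 p = rsum (\<lambda>y. \<bar>y\<bar> powr lam - 1) p / root_n p" for p
  have I: "rsum (infl_K lam) p / root_n p = I1 p + D * I2 p" for p
  proof -
    have "infl_K lam = (\<lambda>y. (kap lam y - E) + D * (\<bar>y\<bar> powr lam - 1))"
      by (auto simp: infl_K_def E_def D_def algebra_simps)
    then have "rsum (infl_K lam) p = rsum (\<lambda>y. kap lam y - E) p + D * rsum (\<lambda>y. \<bar>y\<bar> powr lam - 1) p"
      by (simp only: rsum_add rsum_cmult)
    then show ?thesis by (simp add: I1_def I2_def add_divide_distrib)
  qed
  have 1: "((\<lambda>p. (1 / ahat p - 1) * (root_n p * (khat p - E))) \<longlongrightarrow> 0) (prob_filter M)"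
    unfolding E_def by (rule tendsto_0_mult_stoch_bounded[OF inverse_ahat khat_tight])
  have "(f has_real_derivative D) (at 1)"
    unfolding f_def[abs_def] D_def using lam0 by (auto intro!: derivative_eq_intros)
  from delta_method[OF this ahat_1 ahat_tight]
  have 2: "((\<lambda>p. root_n p * (f (ahat p) - f 1) - D * (root_n p * (ahat p - 1))) \<longlongrightarrow> 0) (prob_filter M)" .
  have 3: "((\<lambda>p. root_n p * (khat p - E) - I1 p) \<longlongrightarrow> 0) (prob_filter M)"
    unfolding E_def I1_def by (rule khat_expansion)
  have 4: "((\<lambda>p. D * (root_n p * (ahat p - 1) - I2 p)) \<longlongrightarrow> 0) (prob_filter M)"
    unfolding I2_def using tendsto_mult_left[OF ahat_expansion, of D] by simp
  have "((\<lambda>p. (1 / ahat p - 1) * (root_n p * (khat p - E)) +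
     (root_n p * (f (ahat p) - f 1) - D * (root_n p * (ahat p - 1))) +
     (root_n p * (khat p - E) - I1 p) + D * (root_n p * (ahat p - 1) - I2 p)) \<longlongrightarrow> 0) (prob_filter M)"
    using tendsto_add[OF tendsto_add[OF tendsto_add[OF 1 2] 3] 4] by simp
  moreover have "(1 / a - 1) * (r * (k - E)) + (r * (f a - f 1) - D * (r * (a - 1))) + (r * (k - E) - i) + D * (r * (a - 1) - j)
      = r * ((k / a - ln a / lam) - E) - (i + D * j)" for a r k i j
    by (simp add: f_def left_diff_distrib right_diff_distrib)
  ultimately show ?thesis unfolding Kst_def I E_def[symmetric] by (simp only:)
qed

lemma Sst_tight: "stoch_bounded M (\<lambda>p. root_n p * Sst p)"
  by (rule stoch_bounded_close[OF Sst_expansion infl_tight(1)])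

text \<open>Since \<open>S\<close> is of order \<open>1 / sqrt n\<close>, its square is negligible
  at scale \<open>sqrt n\<close>. The truncation at 0 is inactive with probability tending to 1
  because \<open>E_K lam > 0\<close>.\<close>

lemma Knet_expansion:
  "((\<lambda>p. root_n p * (Knet p - E_K lam) - rsum (infl_K lam) p / root_n p) \<longlongrightarrow> 0) (prob_filter M)"
proof -
  let ?W = "\<lambda>p. Kst p - lam / 2 * (Sst p)\<^sup>2"
  have "((\<lambda>p. 1 / root_n p * (lam / 2 * ((root_n p * Sst p) * (root_n p * Sst p)))) \<longlongrightarrow> 0) (prob_filter M)"
    by (intro tendsto_0_mult_stoch_bounded[OF inv_sqrt_fst] stoch_bounded_cmult stoch_bounded_mult Sst_tight)
  moreover have "\<forall>\<^sub>F p in prob_filter M. 1 / root_n p * (lam / 2 * ((root_n p * Sst p) * (root_n p * Sst p)))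
      = root_n p * (lam / 2 * (Sst p)\<^sup>2)"
    using eventually_fst_pos by eventually_elim (simp add: power2_eq_square)
  ultimately have sq: "((\<lambda>p. root_n p * (lam / 2 * (Sst p)\<^sup>2)) \<longlongrightarrow> 0) (prob_filter M)"
    by (rule Lim_transform_eventually)
  have "((\<lambda>p. (root_n p * (Kst p - E_K lam) - rsum (infl_K lam) p / root_n p) - root_n p * (lam / 2 * (Sst p)\<^sup>2)) \<longlongrightarrow> 0) (prob_filter M)"
    using tendsto_diff[OF Kst_expansion sq] by simp
  moreover have "(r * (k - E) - i) - r * s = r * ((k - s) - E) - i" for r k E i s :: real
    by (simp add: right_diff_distrib)
  ultimately have W: "((\<lambda>p. root_n p * (?W p - E_K lam) - rsum (infl_K lam) p / root_n p) \<longlongrightarrow> 0) (prob_filter M)"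
    by (simp only:)
  have "(?W \<longlongrightarrow> E_K lam) (prob_filter M)"
    by (rule root_n_consistent[OF stoch_bounded_close[OF W infl_tight(2)]])
  then have "\<forall>\<^sub>F p in prob_filter M. ?W p > 0"
    using E_K_pos[OF lam0] by (intro order_tendstoD)
  then have "\<forall>\<^sub>F p in prob_filter M. root_n p * (?W p - E_K lam) - rsum (infl_K lam) p / root_n p
      = root_n p * (Knet p - E_K lam) - rsum (infl_K lam) p / root_n p"
    by eventually_elim (simp add: Knet_def)
  then show ?thesis by (rule Lim_transform_eventually[OF W])
qed

lemma Z_S_expansion:
  assumes "v \<longlonglongrightarrow> V_S lam"
  shows "((\<lambda>p. root_n p * Sst p / sqrt (v (fst p)) - 1 / sqrt (V_S lam) * (rsum (infl_S lam) p / root_n p)) \<longlongrightarrow> 0) (prob_filter M)"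
  using Sst_expansion V_S_pos[OF lam(1)]
  by (intro studentized_expansion[where D=1] infl_tight tendsto_real_sqrt assms) auto

lemma Z_star_K_expansion:
  "((\<lambda>p. root_n p * (Kst p - E_K lam) / sqrt (V_K lam) - 1 / sqrt (V_K lam) * (rsum (infl_K lam) p / root_n p)) \<longlongrightarrow> 0) (prob_filter M)"
  using Kst_expansion V_K_pos[OF lam0]
  by (intro studentized_expansion[where D=1 and w="\<lambda>n. sqrt (V_K lam)"] infl_tight tendsto_const) auto

text \<open>The fourth root has slope \<open>1/4 * E powr (- 3/4)\<close> at
  \<open>E = E_K lam\<close>, and the square of this slope is the factor
  \<open>1/16 * E powr (- 3/2)\<close> in the normalization. Hence the influence sum is the one of
  the untransformed statistic.\<close>

lemma Z_K_expansion:
  assumes e: "(\<lambda>n. sqrt (real n) * e n) \<longlonglongrightarrow> 0" and v: "v \<longlonglongrightarrow> 1 / 16 * E_K lam powr (- 3 / 2) * V_K lam"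
  shows "((\<lambda>p. root_n p * (Knet p powr (1 / 4) - E_K lam powr (1 / 4) * (1 + e (fst p))) / sqrt (v (fst p))
    - 1 / sqrt (V_K lam) * (rsum (infl_K lam) p / root_n p)) \<longlongrightarrow> 0) (prob_filter M)"
proof -
  define E where "E = E_K lam"
  define D where "D = 1 / 4 * E powr (- (3 / 4))"
  define I where "I p = rsum (infl_K lam) p / root_n p" for p
  have E: "E > 0" using E_K_pos[OF lam0] by (simp add: E_def)
  then have D: "D > 0" by (simp add: D_def)
  have exp: "((\<lambda>p. root_n p * (Knet p - E) - I p) \<longlongrightarrow> 0) (prob_filter M)"
    unfolding E_def I_def by (rule Knet_expansion)
  have I: "stoch_bounded M I" unfolding I_def[abs_def] by (rule infl_tight(2))
  note tight = stoch_bounded_close[OF exp I]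
  have "((\<lambda>x. x powr (1 / 4)) has_real_derivative D) (at E)"
    using E unfolding D_def by (auto intro!: derivative_eq_intros)
  from delta_method[OF this root_n_consistent[OF tight] tight]
  have 1: "((\<lambda>p. root_n p * (Knet p powr (1 / 4) - E powr (1 / 4)) - D * (root_n p * (Knet p - E))) \<longlongrightarrow> 0) (prob_filter M)" .
  have 2: "((\<lambda>p. E powr (1 / 4) * (root_n p * e (fst p))) \<longlongrightarrow> 0) (prob_filter M)"
    using tendsto_mult_left[OF tendsto_fst_prob_filter[OF e], of "E powr (1 / 4)"] by simp
  have 3: "((\<lambda>p. D * (root_n p * (Knet p - E) - I p)) \<longlongrightarrow> 0) (prob_filter M)"
    using tendsto_mult_left[OF exp, of D] by simp
  have "((\<lambda>p. (root_n p * (Knet p powr (1 / 4) - E powr (1 / 4)) - D * (root_n p * (Knet p - E)))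
      + D * (root_n p * (Knet p - E) - I p) - E powr (1 / 4) * (root_n p * e (fst p))) \<longlongrightarrow> 0) (prob_filter M)"
    using tendsto_diff[OF tendsto_add[OF 1 3] 2] by simp
  moreover have "(r * (k - q) - D * x) + D * (x - i) - q * (r * f) = r * (k - q * (1 + f)) - D * i" for r k q x i f
    by (simp add: right_diff_distrib distrib_left)
  ultimately have T: "((\<lambda>p. root_n p * (Knet p powr (1 / 4) - E powr (1 / 4) * (1 + e (fst p))) - D * I p) \<longlongrightarrow> 0) (prob_filter M)"
    by (simp only:)
  have s: "sqrt (1 / 16 * E powr (- 3 / 2) * V_K lam) = D * sqrt (V_K lam)"
  proof -
    have "1 / 16 * E powr (- 3 / 2) = D * D"
      unfolding D_def by (simp add: powr_add[symmetric])
    then show ?thesis using D by (simp add: real_sqrt_mult)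
  qed
  have "D / (D * sqrt (V_K lam)) = 1 / sqrt (V_K lam)" using D by simp
  moreover have "((\<lambda>p. root_n p * (Knet p powr (1 / 4) - E powr (1 / 4) * (1 + e (fst p))) / sqrt (v (fst p))
      - D / (D * sqrt (V_K lam)) * I p) \<longlongrightarrow> 0) (prob_filter M)"
  proof (rule studentized_expansion[OF T I])
    show "(\<lambda>n. sqrt (v n)) \<longlonglongrightarrow> D * sqrt (V_K lam)"
      unfolding s[symmetric] E_def by (rule tendsto_real_sqrt[OF v])
    show "D * sqrt (V_K lam) \<noteq> 0" using D V_K_pos[OF lam0] by simp
  qed
  ultimately show ?thesis unfolding I_def E_def by (simp only:)
qed

end

section \<open>The joint limit law\<close>

lemma inner_vector_2: "t \<bullet> (vector [x, y] :: real^2) = t $ 1 * x + t $ 2 * y"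
  by (simp add: inner_vec_def sum_2)

lemma norm_vector_2_le: "norm (vector [x, y] :: real^2) \<le> \<bar>x\<bar> + \<bar>y\<bar>"
  using norm_le_l1_cart[of "vector [x, y] :: real^2"] by (simp add: sum_2)

context apd_array
begin

lemma odd_has_bochner_0:
  assumes "poly_bdd h" "\<And>y. h (- y) = - h y"
  shows "has_bochner_integral (epd lam) h 0"
  using poly_bdd_integrable[OF assms(1)] integral_epd_odd[OF lam0 poly_bdd_measurable[OF assms(1)] assms(2)]
  by (simp add: has_bochner_integral_iff)

definition limit_mean :: "real^2" where
  "limit_mean = vector [- \<beta> * sqrt (V_S lam) / lam, - \<delta> * sqrt (V_K lam) / lam]"

text \<open>Linear combinations in the manner of Cramer and Wold. One influence function is odd and
  the other even, so all cross terms vanish, and each covariance with its own direction is the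
  square root of the variance after normalization.\<close>

lemma infl_comb_clt:
  assumes g_def: "g = (\<lambda>y. a / sqrt (V_S lam) * infl_S lam y + c / sqrt (V_K lam) * infl_K lam y)"
  shows "(\<lambda>n. \<integral>\<omega>. iexp ((\<Sum>i<n. g (Y n i \<omega>)) / sqrt (real n)) \<partial>M)
    \<longlonglongrightarrow> exp (\<i> * complex_of_real (- (\<beta> * (a * sqrt (V_S lam)) + \<delta> * (c * sqrt (V_K lam))) / lam) - complex_of_real (a\<^sup>2 + c\<^sup>2) / 2)"
proof -
  note pb = poly_bdd_infl[OF lam(1)]
  note mS = infl_S_moments[OF lam(1)] and mK = infl_K_moments[OF lam(1)]
  have vS: "V_S lam > 0" and vK: "V_K lam > 0" using V_S_pos[OF lam(1)] V_K_pos[OF lam0] by auto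
  have pspow: "poly_bdd (spow lam)" and pkap: "poly_bdd (kap lam)"
    using lam by (auto intro: poly_bdd_spow poly_bdd_kap)
  have pg: "poly_bdd g" unfolding g_def by (intro poly_bdd_add poly_bdd_mult poly_bdd_const pb)
  have p3: "wt_bdd (\<lambda>y. \<bar>g y\<bar> ^ 3)" by (intro poly_bdd_imp_wt_bdd poly_bdd_power poly_bdd_abs pg)
  have zS: "has_bochner_integral (epd lam) (infl_S lam) 0"
    by (rule odd_has_bochner_0[OF pb(1)]) (simp add: infl_minus)
  have SK: "has_bochner_integral (epd lam) (\<lambda>y. infl_S lam y * infl_K lam y) 0"
    by (rule odd_has_bochner_0) (auto intro!: poly_bdd_mult pb simp: infl_minus)
  have Sk: "has_bochner_integral (epd lam) (\<lambda>y. infl_S lam y * kap lam y) 0"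
    by (rule odd_has_bochner_0) (auto intro!: poly_bdd_mult pb pkap simp: infl_minus)
  have Ks: "has_bochner_integral (epd lam) (\<lambda>y. infl_K lam y * spow lam y) 0"
    by (rule odd_has_bochner_0) (auto intro!: poly_bdd_mult pb pspow simp: infl_minus spow_minus)
  have g0: "integral\<^sup>L (epd lam) g = 0"
    unfolding g_def using zS mK(1) by (simp add: has_bochner_integral_iff)
  have rat: "x / sqrt v * v = x * sqrt v" if "v > 0" for x v :: real
    using that by (metis less_imp_le real_div_sqrt times_divide_eq_left times_divide_eq_right)
  have gs: "(\<integral>y. g y * spow lam y \<partial>epd lam) = a * sqrt (V_S lam)"
  proof -
    have "has_bochner_integral (epd lam) (\<lambda>y. a / sqrt (V_S lam) * (infl_S lam y * spow lam y) + c / sqrt (V_K lam) * (infl_K lam y * spow lam y))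
      (a / sqrt (V_S lam) * V_S lam + c / sqrt (V_K lam) * 0)"
      by (intro has_bochner_integral_add has_bochner_integral_mult_right mS(1) Ks)
    moreover have "(\<lambda>y. g y * spow lam y) = (\<lambda>y. a / sqrt (V_S lam) * (infl_S lam y * spow lam y) + c / sqrt (V_K lam) * (infl_K lam y * spow lam y))"
      by (simp add: g_def fun_eq_iff distrib_right)
    ultimately show ?thesis using rat[OF vS, of a] by (simp add: has_bochner_integral_iff)
  qed
  have gk: "(\<integral>y. g y * kap lam y \<partial>epd lam) = c * sqrt (V_K lam)"
  proof -
    have "has_bochner_integral (epd lam) (\<lambda>y. a / sqrt (V_S lam) * (infl_S lam y * kap lam y) + c / sqrt (V_K lam) * (infl_K lam y * kap lam y))
      (a / sqrt (V_S lam) * 0 + c / sqrt (V_K lam) * V_K lam)"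
      by (intro has_bochner_integral_add has_bochner_integral_mult_right mK(2) Sk)
    moreover have "(\<lambda>y. g y * kap lam y) = (\<lambda>y. a / sqrt (V_S lam) * (infl_S lam y * kap lam y) + c / sqrt (V_K lam) * (infl_K lam y * kap lam y))"
      by (simp add: g_def fun_eq_iff distrib_right)
    ultimately show ?thesis using rat[OF vK, of c] by (simp add: has_bochner_integral_iff)
  qed
  have gg: "(\<integral>y. (g y)\<^sup>2 \<partial>epd lam) = a\<^sup>2 + c\<^sup>2"
  proof -
    define x where "x = a / sqrt (V_S lam)"
    define z where "z = c / sqrt (V_K lam)"
    have "has_bochner_integral (epd lam) (\<lambda>y. x\<^sup>2 * (infl_S lam y)\<^sup>2 + (2 * x * z) * (infl_S lam y * infl_K lam y) + z\<^sup>2 * (infl_K lam y)\<^sup>2)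
      (x\<^sup>2 * V_S lam + (2 * x * z) * 0 + z\<^sup>2 * V_K lam)"
      by (intro has_bochner_integral_add has_bochner_integral_mult_right mS(3) mK(3) SK)
    moreover have "(\<lambda>y. (g y)\<^sup>2) = (\<lambda>y. x\<^sup>2 * (infl_S lam y)\<^sup>2 + (2 * x * z) * (infl_S lam y * infl_K lam y) + z\<^sup>2 * (infl_K lam y)\<^sup>2)"
      by (simp add: g_def x_def[symmetric] z_def[symmetric] fun_eq_iff power2_eq_square algebra_simps)
    moreover have "x\<^sup>2 * V_S lam = a\<^sup>2" "z\<^sup>2 * V_K lam = c\<^sup>2"
      using vS vK by (simp_all add: x_def z_def power_divide)
    ultimately show ?thesis by (simp add: has_bochner_integral_iff)
  qed
  have third: "\<forall>\<^sub>F n in sequentially. integrable (Qn n) (\<lambda>y. \<bar>g y\<bar> ^ 3) \<and> (\<integral>y. \<bar>g y\<bar> ^ 3 \<partial>Qn n) \<le> (\<integral>y. \<bar>g y\<bar> ^ 3 \<partial>epd lam) + 1"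
  proof -
    have "\<forall>\<^sub>F n in sequentially. (\<integral>y. \<bar>g y\<bar> ^ 3 \<partial>Qn n) < (\<integral>y. \<bar>g y\<bar> ^ 3 \<partial>epd lam) + 1"
      by (rule order_tendstoD(2)[OF wt_bdd_conv(1)[OF p3]]) simp
    then show ?thesis using wt_bdd_conv(2)[OF p3] by eventually_elim simp
  qed
  have mean: "(\<lambda>n. sqrt (real n) * integral\<^sup>L (Qn n) g) \<longlonglongrightarrow> - (\<beta> * (a * sqrt (V_S lam)) + \<delta> * (c * sqrt (V_K lam))) / lam"
    using score_limit[OF pg g0] unfolding gs gk .
  have var: "(\<lambda>n. \<integral>y. (g y)\<^sup>2 \<partial>Qn n) \<longlonglongrightarrow> a\<^sup>2 + c\<^sup>2"
    using wt_bdd_conv(1)[OF poly_bdd_imp_wt_bdd[OF poly_bdd_power[OF pg, of 2]]] unfolding gg .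
  have indep: "\<forall>\<^sub>F n in sequentially. indep_vars (\<lambda>_. borel) (Y n) {..<n}"
    and distr: "\<forall>\<^sub>F n in sequentially. \<forall>i<n. distr M borel (Y n i) = Qn n"
    using rows by (auto elim: eventually_mono)
  show ?thesis
    using triangular_clt_char[OF indep distr poly_bdd_measurable[OF pg] third mean var] by simp
qed

text \<open>Characteristic functions tolerate errors that vanish in probability, since the
  difference of two characters is bounded by 2. It is therefore enough to treat the influence
  sums.\<close>

lemma joint_clt:
  fixes U V :: "nat \<times> 'a \<Rightarrow> real" and f :: "real^2 \<Rightarrow> real"
  assumes U: "((\<lambda>p. U p - 1 / sqrt (V_S lam) * (rsum (infl_S lam) p / root_n p)) \<longlongrightarrow> 0) (prob_filter M)"
    and V: "((\<lambda>p. V p - 1 / sqrt (V_K lam) * (rsum (infl_K lam) p / root_n p)) \<longlongrightarrow> 0) (prob_filter M)"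
    and meas: "\<forall>\<^sub>F n in sequentially. (\<lambda>\<omega>. U (n, \<omega>)) \<in> borel_measurable M \<and> (\<lambda>\<omega>. V (n, \<omega>)) \<in> borel_measurable M"
    and tight: "stoch_bounded M U" "stoch_bounded M V"
    and f: "continuous_on UNIV f" "bounded (range f)"
  shows "(\<lambda>n. \<integral>\<omega>. f (vector [U (n, \<omega>), V (n, \<omega>)]) \<partial>M) \<longlonglongrightarrow> (\<integral>z. f z \<partial>multivariate_normal limit_mean (mat 1))"
proof (rule bivariate_levy_continuity[where Z="\<lambda>n \<omega>. vector [U (n, \<omega>), V (n, \<omega>)]", OF prob_space_multivariate_normal sets_multivariate_normal _ _ _ f])
  show "\<forall>\<^sub>F n in sequentially. (\<lambda>\<omega>. vector [U (n, \<omega>), V (n, \<omega>)] :: real^2) \<in> borel_measurable M"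
    using meas by eventually_elim (auto intro: vector_2_measurable)
  show "stoch_bounded M (\<lambda>p. norm (vector [U (fst p, snd p), V (fst p, snd p)] :: real^2))"
  proof (rule stoch_bounded_mono[where c=1 and V="\<lambda>p. \<bar>U p\<bar> + \<bar>V p\<bar>"])
    show "stoch_bounded M (\<lambda>p. \<bar>U p\<bar> + \<bar>V p\<bar>)"
      by (intro stoch_bounded_add stoch_bounded_mono[OF tight(1), where c=1] stoch_bounded_mono[OF tight(2), where c=1]) auto
    show "\<forall>\<^sub>F p in prob_filter M. \<bar>norm (vector [U (fst p, snd p), V (fst p, snd p)] :: real^2)\<bar> \<le> 1 * \<bar>\<bar>U p\<bar> + \<bar>V p\<bar>\<bar>"
      using norm_vector_2_le by (intro always_eventually) simp
  qed simp
  fix t :: "real^2"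
  define a where "a = t $ 1"
  define c where "c = t $ 2"
  define g where "g = (\<lambda>y. a / sqrt (V_S lam) * infl_S lam y + c / sqrt (V_K lam) * infl_K lam y)"
  have gm: "g \<in> borel_measurable borel" unfolding g_def by measurable
  define L where "L p = a * U p + c * V p" for p
  define R where "R p = rsum g p / root_n p" for p
  have "((\<lambda>p. a * (U p - 1 / sqrt (V_S lam) * (rsum (infl_S lam) p / root_n p))
      + c * (V p - 1 / sqrt (V_K lam) * (rsum (infl_K lam) p / root_n p))) \<longlongrightarrow> a * 0 + c * 0) (prob_filter M)"
    by (intro tendsto_intros U V)
  moreover have "a * (U p - 1 / sqrt (V_S lam) * (rsum (infl_S lam) p / root_n p))
      + c * (V p - 1 / sqrt (V_K lam) * (rsum (infl_K lam) p / root_n p)) = L p - R p" for p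
    unfolding L_def R_def g_def rsum_add rsum_cmult right_diff_distrib add_divide_distrib by simp
  ultimately have LR: "((\<lambda>p. L p - R p) \<longlongrightarrow> 0) (prob_filter M)" by simp
  define h where "h p = iexp (L p) - iexp (R p)" for p
  have "((\<lambda>p. iexp (L p - R p) - 1) \<longlongrightarrow> iexp 0 - 1) (prob_filter M)"
    by (intro tendsto_intros LR)
  moreover have "norm (iexp (L p - R p) - 1) = norm (h p)" for p
  proof -
    have "h p = iexp (R p) * (iexp (L p - R p) - 1)"
      by (simp add: h_def right_diff_distrib exp_add[symmetric] ring_distribs)
    then show ?thesis by (simp add: norm_mult)
  qed
  ultimately have "((\<lambda>p. norm (h p)) \<longlongrightarrow> 0) (prob_filter M)"
    using tendsto_norm_zero[of "\<lambda>p. iexp (L p - R p) - 1" "prob_filter M"] by simp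
  then have h0: "(h \<longlongrightarrow> 0) (prob_filter M)" by (rule tendsto_norm_zero_cancel)
  have mL: "\<forall>\<^sub>F n in sequentially. (\<lambda>\<omega>. iexp (L (n, \<omega>))) \<in> borel_measurable M \<and> (\<lambda>\<omega>. iexp (R (n, \<omega>))) \<in> borel_measurable M"
    using meas rsum_measurable[OF gm]
  proof eventually_elim
    case (elim n)
    have im: "(\<lambda>x. iexp x) \<in> borel_measurable borel"
      by (intro borel_measurable_continuous_onI continuous_intros)
    have "(\<lambda>\<omega>. L (n, \<omega>)) \<in> borel_measurable M"
      unfolding L_def using elim by (intro borel_measurable_add borel_measurable_times borel_measurable_const) auto
    moreover have "(\<lambda>\<omega>. R (n, \<omega>)) \<in> borel_measurable M"
      unfolding R_def fst_conv using elim by (intro borel_measurable_divide borel_measurable_const) auto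
    ultimately show ?case
      using measurable_compose[OF _ im] by blast
  qed
  have "(\<lambda>n. \<integral>\<omega>. h (n, \<omega>) \<partial>M) \<longlonglongrightarrow> 0"
  proof (rule expectation_tendsto_0[OF h0, where B=2])
    show "norm (h p) \<le> 2" for p
      unfolding h_def by (rule order_trans[OF norm_triangle_ineq4]) simp
    show "\<forall>\<^sub>F n in sequentially. (\<lambda>\<omega>. h (n, \<omega>)) \<in> borel_measurable M"
      using mL by eventually_elim (auto simp: h_def)
  qed
  moreover have "(\<lambda>n. \<integral>\<omega>. iexp (R (n, \<omega>)) \<partial>M) \<longlonglongrightarrow> (\<integral>z. iexp (t \<bullet> z) \<partial>multivariate_normal limit_mean (mat 1))"
  proof -
    have "t \<bullet> limit_mean = - (\<beta> * (a * sqrt (V_S lam)) + \<delta> * (c * sqrt (V_K lam))) / lam"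
      by (simp add: limit_mean_def inner_vector_2 a_def c_def add_divide_distrib diff_divide_distrib
          mult.left_commute[of \<beta>] mult.left_commute[of \<delta>])
    moreover have "(norm t)\<^sup>2 = a\<^sup>2 + c\<^sup>2"
      unfolding power2_norm_eq_inner by (simp add: inner_vec_def sum_2 a_def c_def power2_eq_square)
    ultimately have "(\<integral>z. iexp (t \<bullet> z) \<partial>multivariate_normal limit_mean (mat 1))
        = exp (\<i> * complex_of_real (- (\<beta> * (a * sqrt (V_S lam)) + \<delta> * (c * sqrt (V_K lam))) / lam) - complex_of_real (a\<^sup>2 + c\<^sup>2) / 2)"
    proof -
      assume m: "t \<bullet> limit_mean = - (\<beta> * (a * sqrt (V_S lam)) + \<delta> * (c * sqrt (V_K lam))) / lam"
        and v: "(norm t)\<^sup>2 = a\<^sup>2 + c\<^sup>2"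
      show ?thesis unfolding m[symmetric] v[symmetric] char_multivariate_normal
        by (simp add: exp_of_real[symmetric] exp_add[symmetric])
    qed
    then show ?thesis using infl_comb_clt[OF g_def] by (simp add: R_def rsum_def)
  qed
  ultimately have "(\<lambda>n. (\<integral>\<omega>. h (n, \<omega>) \<partial>M) + (\<integral>\<omega>. iexp (R (n, \<omega>)) \<partial>M)) \<longlonglongrightarrow> (\<integral>z. iexp (t \<bullet> z) \<partial>multivariate_normal limit_mean (mat 1))"
    using tendsto_add by fastforce
  then show "(\<lambda>n. \<integral>\<omega>. iexp (t \<bullet> vector [U (n, \<omega>), V (n, \<omega>)]) \<partial>M) \<longlonglongrightarrow> (\<integral>z. iexp (t \<bullet> z) \<partial>multivariate_normal limit_mean (mat 1))"
  proof (rule Lim_transform_eventually)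
    show "\<forall>\<^sub>F n in sequentially. (\<integral>\<omega>. h (n, \<omega>) \<partial>M) + (\<integral>\<omega>. iexp (R (n, \<omega>)) \<partial>M) = (\<integral>\<omega>. iexp (t \<bullet> vector [U (n, \<omega>), V (n, \<omega>)]) \<partial>M)"
      using mL
    proof eventually_elim
      case (elim n)
      have "integrable M (\<lambda>\<omega>. iexp (L (n, \<omega>)))" "integrable M (\<lambda>\<omega>. iexp (R (n, \<omega>)))"
        using elim by (auto intro!: integrable_const_bound[where B=1])
      then show ?case by (simp add: h_def L_def inner_vector_2 a_def c_def)
    qed
  qed
qed

end

section \<open>Ratios of statistics with the same expansion\<close>

lemma AE_multivariate_normal_coordinate:
  "AE z in multivariate_normal (m :: real^'d) (mat 1). z $ k \<noteq> 0"
proof -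
  let ?H = "{z :: real^'d. axis k 1 \<bullet> z = 0}"
  have H: "?H \<in> sets lborel" using closed_hyperplane by (simp add: borel_closed)
  have "negligible ?H" by (rule negligible_hyperplane) (auto simp: axis_eq_0_iff)
  then have "emeasure lborel ?H = 0"
    unfolding negligible_iff_null_sets null_sets_completion_iff[OF H] by (rule null_setsD1)
  then have "AE z in lborel. (z :: real^'d) $ k \<noteq> 0"
    using H by (intro AE_I[where N="?H"]) (auto simp: inner_axis')
  then show ?thesis
    unfolding multivariate_normal_identity by (subst AE_density) auto
qed

text \<open>The weak limit gives the hyperplane of vanishing second coordinate no mass, so
  continuous functions shrinking to its indicator have small limiting expectation. This bounds the
  probability that \<open>V\<close> is close to 0, which the ratio statement needs.\<close>

lemma (in prob_space) normal_limit_avoids_zero: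
  fixes U V :: "nat \<times> 'a \<Rightarrow> real"
  assumes conv: "\<And>f :: real^2 \<Rightarrow> real. continuous_on UNIV f \<Longrightarrow> bounded (range f) \<Longrightarrow>
      (\<lambda>n. \<integral>\<omega>. f (vector [U (n, \<omega>), V (n, \<omega>)]) \<partial>M) \<longlonglongrightarrow> (\<integral>z. f z \<partial>multivariate_normal m (mat 1))"
    and meas: "\<forall>\<^sub>F n in sequentially. (\<lambda>\<omega>. V (n, \<omega>)) \<in> borel_measurable M"
    and \<eta>: "\<eta> > 0"
  obtains e where "e > 0" "\<forall>\<^sub>F n in sequentially. \<exists>A\<in>sets M. measure M A \<le> \<eta> \<and> (\<forall>\<omega>\<in>space M - A. \<bar>V (n, \<omega>)\<bar> > e)"
proof -
  \<comment> \<open>A tent over the hyperplane: at least 1 where the second coordinate is at most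
    \<open>1 / real (Suc k)\<close> in modulus, and 0 from twice that on.\<close>
  define f where "f k z = max 0 (2 - real (Suc k) * \<bar>z $ 2\<bar>)" for k and z :: "real^2"
  interpret N: prob_space "multivariate_normal m (mat 1)" by (rule prob_space_multivariate_normal)
  have fc: "continuous_on UNIV (f k)" for k
    unfolding f_def[abs_def] by (intro continuous_intros)
  have fb: "0 \<le> f k z" "f k z \<le> 2" for k z by (auto simp: f_def)
  have fbd: "bounded (range (f k))" for k
    using fb by (intro boundedI[where B=2]) auto
  have fm: "f k \<in> borel_measurable (multivariate_normal m (mat 1))" for k
    unfolding measurable_cong_sets[OF sets_multivariate_normal refl]
    using fc by (rule borel_measurable_continuous_onI)
  have "(\<lambda>k. \<integral>z. f k z \<partial>multivariate_normal m (mat 1)) \<longlonglongrightarrow> (\<integral>z. 0 \<partial>multivariate_normal m (mat 1))"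
  proof (rule integral_dominated_convergence[where w="\<lambda>_. 2"])
    show "AE z in multivariate_normal m (mat 1). (\<lambda>k. f k z) \<longlonglongrightarrow> 0"
      using AE_multivariate_normal_coordinate[where m=m and k=2]
    proof eventually_elim
      case (elim z)
      have "\<forall>\<^sub>F k in sequentially. real k > 2 / \<bar>z $ 2\<bar>"
        using filterlim_real_sequentially by (simp add: filterlim_at_top_dense)
      then have "\<forall>\<^sub>F k in sequentially. f k z = 0"
      proof eventually_elim
        case (elim k)
        then have "2 < real (Suc k) * \<bar>z $ 2\<bar>" using \<open>z $ 2 \<noteq> 0\<close> by (simp add: field_simps)
        then show ?case by (simp add: f_def)
      qed
      then show ?case by (rule tendsto_eventually)
    qed
    show "AE z in multivariate_normal m (mat 1). norm (f k z) \<le> 2" for k using fb by auto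
  qed (use fm in auto)
  then have "\<forall>\<^sub>F k in sequentially. (\<integral>z. f k z \<partial>multivariate_normal m (mat 1)) < \<eta>"
    using \<eta> by (intro order_tendstoD) auto
  then obtain k where k: "(\<integral>z. f k z \<partial>multivariate_normal m (mat 1)) < \<eta>"
    by (auto simp: eventually_sequentially)
  show ?thesis
  proof (rule that[of "1 / real (Suc k)"])
    show "\<forall>\<^sub>F n in sequentially. \<exists>A\<in>sets M. measure M A \<le> \<eta> \<and> (\<forall>\<omega>\<in>space M - A. \<bar>V (n, \<omega>)\<bar> > 1 / real (Suc k))"
      using meas order_tendstoD(2)[OF conv[OF fc fbd] k]
    proof eventually_elim
      case (elim n)
      let ?u = "\<lambda>\<omega>. max 0 (2 - real (Suc k) * \<bar>V (n, \<omega>)\<bar>)"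
      have u: "?u \<omega> = f k (vector [U (n, \<omega>), V (n, \<omega>)])" for \<omega> by (simp add: f_def)
      have um: "?u \<in> borel_measurable M" using elim(1) by measurable
      have "\<exists>A\<in>sets M. measure M A \<le> \<eta> \<and> (\<forall>\<omega>\<in>space M - A. \<bar>?u \<omega>\<bar> < 1)"
      proof (rule markov_exception)
        show "integrable M ?u" by (rule integrable_const_bound[where B=2]) (use um in auto)
        show "expectation ?u \<le> 1 * \<eta>" using elim(2) unfolding u by simp
      qed auto
      then obtain A where A: "A \<in> sets M" "measure M A \<le> \<eta>" "\<And>\<omega>. \<omega> \<in> space M - A \<Longrightarrow> \<bar>?u \<omega>\<bar> < 1" by blast
      have "\<bar>V (n, \<omega>)\<bar> > 1 / real (Suc k)" if "\<omega> \<in> space M - A" for \<omega>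
      proof -
        have "1 < real (Suc k) * \<bar>V (n, \<omega>)\<bar>" using A(3)[OF that] by linarith
        then show ?thesis by (simp add: divide_less_eq mult.commute)
      qed
      then show ?case using A(1,2) by blast
    qed
  qed simp
qed

text \<open>A vanishing difference controls the ratio only where the statistic stays away from 0.
  There \<open>1 / V\<close> is tight, and the ratio is
  \<open>1 / (1 - (V - V') / V)\<close>.\<close>

lemma (in prob_space) ratio_tendsto_1:
  fixes V V' :: "nat \<times> 'a \<Rightarrow> real"
  assumes close: "((\<lambda>p. V p - V' p) \<longlongrightarrow> 0) (prob_filter M)"
    and avoid: "\<And>\<eta>. \<eta> > 0 \<Longrightarrow> \<exists>e>0. \<forall>\<^sub>F n in sequentially.
      \<exists>A\<in>sets M. measure M A \<le> \<eta> \<and> (\<forall>\<omega>\<in>space M - A. \<bar>V (n, \<omega>)\<bar> > e)"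
  shows "((\<lambda>p. V p / V' p) \<longlongrightarrow> 1) (prob_filter M)"
proof -
  have nz: "\<forall>\<^sub>F p in prob_filter M. V p \<noteq> 0"
    unfolding eventually_prob_filter
  proof (intro allI impI)
    fix \<eta> :: real assume "\<eta> > 0"
    then obtain e where "e > 0" "\<forall>\<^sub>F n in sequentially.
      \<exists>A\<in>sets M. measure M A \<le> \<eta> \<and> (\<forall>\<omega>\<in>space M - A. \<bar>V (n, \<omega>)\<bar> > e)" using avoid by blast
    from this(2) show "\<forall>\<^sub>F n in sequentially. \<exists>A\<in>sets M. measure M A \<le> \<eta> \<and> (\<forall>\<omega>\<in>space M - A. V (n, \<omega>) \<noteq> 0)"
      by (rule eventually_mono) (use \<open>e > 0\<close> in force)
  qed
  have inv: "stoch_bounded M (\<lambda>p. 1 / V p)"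
    unfolding stoch_bounded_def
  proof (intro allI impI)
    fix \<eta> :: real assume "\<eta> > 0"
    then obtain e where e: "e > 0" "\<forall>\<^sub>F n in sequentially.
      \<exists>A\<in>sets M. measure M A \<le> \<eta> \<and> (\<forall>\<omega>\<in>space M - A. \<bar>V (n, \<omega>)\<bar> > e)" using avoid by blast
    have le: "\<bar>1 / x\<bar> \<le> 1 / e" if "\<bar>x\<bar> > e" for x :: real
      using that e(1) by (simp add: abs_divide frac_le)
    from e(2) have "\<forall>\<^sub>F n in sequentially. \<exists>A\<in>sets M. measure M A \<le> \<eta> \<and> (\<forall>\<omega>\<in>space M - A. \<bar>1 / V (n, \<omega>)\<bar> \<le> 1 / e)"
      by (rule eventually_mono) (use le in blast)
    then show "\<exists>K. \<forall>\<^sub>F n in sequentially. \<exists>A\<in>sets M. measure M A \<le> \<eta> \<and> (\<forall>\<omega>\<in>space M - A. \<bar>1 / V (n, \<omega>)\<bar> \<le> K)" by blast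
  qed
  have "((\<lambda>p. 1 - (V p - V' p) * (1 / V p)) \<longlongrightarrow> 1 - 0) (prob_filter M)"
    by (intro tendsto_diff tendsto_const tendsto_0_mult_stoch_bounded[OF close inv])
  then have "((\<lambda>p. 1 / (1 - (V p - V' p) * (1 / V p))) \<longlongrightarrow> 1 / (1 - 0)) (prob_filter M)"
    by (intro tendsto_divide tendsto_const) auto
  then have "((\<lambda>p. 1 / (1 - (V p - V' p) * (1 / V p))) \<longlongrightarrow> 1) (prob_filter M)" by simp
  moreover have "\<forall>\<^sub>F p in prob_filter M. 1 / (1 - (V p - V' p) * (1 / V p)) = V p / V' p"
    using nz
  proof eventually_elim
    case (elim p)
    then have "1 - (V p - V' p) * (1 / V p) = V' p / V p" by (simp add: diff_divide_distrib)
    then show ?case by (simp only: divide_divide_eq_right mult_1_left)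
  qed
  ultimately show ?thesis by (rule Lim_transform_eventually)
qed

section \<open>Reduction to the standardized sample\<close>

lemma spow_scale: "c > 0 \<Longrightarrow> spow p (c * u) = c powr p * spow p u"
  by (simp add: spow_def abs_mult powr_mult sgn_mult)

lemma mscore_affine:
  assumes "\<sigma> > 0"
  shows "mscore lam n x (\<mu> + \<sigma> * h) = \<sigma> powr (lam - 1) * (\<Sum>i<n. spow (lam - 1) ((x i - \<mu>) / \<sigma> - h))"
proof -
  have "x i - (\<mu> + \<sigma> * h) = \<sigma> * ((x i - \<mu>) / \<sigma> - h)" for i
    using assms by (simp add: field_simps)
  then show ?thesis unfolding mscore_def by (simp add: spow_scale[OF assms] sum_distrib_left)
qed

text \<open>The statistics are invariant under location and scale, so \<mu> and \<sigma> disappear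
  once the data and the location estimate are standardized.\<close>

lemma stats_standardize:
  fixes x y :: "nat \<Rightarrow> real"
  assumes lam: "lam \<ge> 1" and \<sigma>: "\<sigma> > 0" and n: "n > 0"
    and y: "\<And>i. y i = (x i - \<mu>) / \<sigma>" and t: "t = (mu_hat lam n x - \<mu>) / \<sigma>"
    and a: "a = (\<Sum>i<n. \<bar>y i - t\<bar> powr lam) / real n" "a > 0"
  shows "S_stat lam n x = (\<Sum>i<n. spow lam (y i - t)) / real n / a"
    and "K_stat lam n x = (\<Sum>i<n. kap lam (y i - t)) / real n / a - ln a / lam"
proof -
  define c where "c = a powr (1 / lam)"
  have c: "c > 0" "c powr lam = a" "ln c = ln a / lam"
    using lam a(2) by (simp_all add: c_def powr_powr ln_powr)
  have xy: "x i - mu_hat lam n x = \<sigma> * (y i - t)" for i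
    using \<sigma> by (simp add: y t diff_divide_distrib[symmetric])
  have "(\<Sum>i<n. \<bar>x i - mu_hat lam n x\<bar> powr lam) / real n = \<sigma> powr lam * a"
    using \<sigma> by (simp add: xy a(1) abs_mult powr_mult sum_distrib_left)
  then have "sigma_hat lam n x = \<sigma> * c"
    using \<sigma> lam a(2) by (simp add: sigma_hat_def powr_mult powr_powr c_def)
  then have Y: "Y_hat lam n x i = (y i - t) / c" for i
    using \<sigma> by (simp add: Y_hat_def xy)
  have S: "\<bar>u / c\<bar> powr lam * sgn (u / c) = spow lam u / a" for u
    using c by (simp add: spow_def powr_divide sgn_divide)
  show "S_stat lam n x = (\<Sum>i<n. spow lam (y i - t)) / real n / a"
    unfolding S_stat_def Y S by (simp add: sum_divide_distrib[symmetric])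
  have K: "\<bar>u / c\<bar> powr lam * ln \<bar>u / c\<bar> = kap lam u / a - \<bar>u\<bar> powr lam * (ln c / a)" for u
  proof (cases "u = 0")
    case False
    then have "ln \<bar>u / c\<bar> = ln \<bar>u\<bar> - ln c" using c by (simp add: ln_div)
    moreover have "\<bar>u / c\<bar> powr lam = \<bar>u\<bar> powr lam / a" using c by (simp add: powr_divide)
    ultimately show ?thesis by (simp add: kap_def right_diff_distrib diff_divide_distrib)
  qed (simp add: kap_def)
  have "K_stat lam n x = (\<Sum>i<n. kap lam (y i - t)) / a / real n - (\<Sum>i<n. \<bar>y i - t\<bar> powr lam) / real n * (ln c / a)"
    unfolding K_stat_def Y K
    by (simp add: sum_subtractf sum_divide_distrib[symmetric] sum_distrib_right[symmetric] diff_divide_distrib)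
  also have "(\<Sum>i<n. \<bar>y i - t\<bar> powr lam) / real n * (ln c / a) = ln a / lam"
    unfolding a(1)[symmetric] using a(2) c(3) by simp
  finally show "K_stat lam n x = (\<Sum>i<n. kap lam (y i - t)) / real n / a - ln a / lam" by simp
qed

text \<open>With \<open>A = \<theta> powr p\<close> and \<open>B = (1 - \<theta>) powr p\<close>
  this is \<open>(A - B) / (A + B)\<close>. Written as a hyperbolic tangent of the logit, it can be
  differentiated in one chain while \<open>p\<close> varies.\<close>

definition apd_skew :: "real \<Rightarrow> real \<Rightarrow> real" where
  "apd_skew \<theta> p = tanh (p * (ln \<theta> - ln (1 - \<theta>)) / 2)"

lemma apd_delta_over_A:
  assumes "0 < \<theta>" "\<theta> < 1" "y \<noteq> 0"
  shows "apd_delta \<theta> p / apd_A \<theta> p y = 1 + apd_skew \<theta> p * sgn y"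
proof -
  define A where "A = \<theta> powr p"
  define B where "B = (1 - \<theta>) powr p"
  have AB: "A > 0" "B > 0" using assms by (simp_all add: A_def B_def)
  have "exp (- 2 * (p * (ln \<theta> - ln (1 - \<theta>)) / 2)) = exp (p * ln (1 - \<theta>) - p * ln \<theta>)"
    by (simp add: right_diff_distrib)
  also have "\<dots> = B / A" using assms by (simp add: exp_diff A_def B_def powr_def)
  finally have "apd_skew \<theta> p = (1 - B / A) / (1 + B / A)" unfolding apd_skew_def tanh_real_altdef by simp
  moreover have "1 - B / A = (A - B) / A" "1 + B / A = (A + B) / A"
    using AB by (simp_all add: diff_divide_distrib add_divide_distrib)
  ultimately have skew: "apd_skew \<theta> p = (A - B) / (A + B)" using AB by simp
  have d: "apd_delta \<theta> p = 2 * A * B / (A + B)" by (simp add: apd_delta_def A_def B_def)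
  have "A + B \<noteq> 0" using AB by simp
  show ?thesis
  proof (cases "y < 0")
    case True
    then have "apd_delta \<theta> p / apd_A \<theta> p y = 2 * B / (A + B)" using AB by (simp add: d apd_A_def A_def[symmetric])
    also have "\<dots> = 1 - (A - B) / (A + B)" using \<open>A + B \<noteq> 0\<close> by (simp add: field_simps)
    finally show ?thesis using True by (simp add: skew)
  next
    case False
    then have "apd_delta \<theta> p / apd_A \<theta> p y = 2 * A / (A + B)" using AB by (simp add: d apd_A_def B_def[symmetric])
    also have "\<dots> = 1 + (A - B) / (A + B)" using \<open>A + B \<noteq> 0\<close> by (simp add: field_simps)
    finally show ?thesis using False assms(3) by (simp add: skew)
  qed
qed

text \<open>The logit has slope 4 at 1/2 and \<open>tanh\<close> has slope 1 at 0, so the scaled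
  limit is \<open>lam / 2 * 4 * d\<close>.\<close>

lemma apd_skew_limit:
  assumes h: "(\<lambda>n. sqrt (real n) * (\<theta> n - 1 / 2)) \<longlonglongrightarrow> d" and p: "p \<longlonglongrightarrow> lam"
  shows "(\<lambda>n. sqrt (real n) * apd_skew (\<theta> n) (p n)) \<longlonglongrightarrow> 2 * lam * d"
proof -
  define f where "f x = ln x - ln (1 - x)" for x :: real
  define u where "u n = p n / 2 * f (\<theta> n)" for n
  have \<theta>: "\<theta> \<longlonglongrightarrow> 1 / 2" using scaled_limit_0[OF h] by (rule LIM_zero_cancel)
  have "(f has_real_derivative 4) (at (1 / 2))"
    unfolding f_def[abs_def] by (auto intro!: derivative_eq_intros)
  from delta_tendsto[OF this \<theta> h] have "(\<lambda>n. sqrt (real n) * f (\<theta> n)) \<longlonglongrightarrow> 4 * d" by (simp add: f_def)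
  from tendsto_mult[OF tendsto_divide[OF p tendsto_const[of 2]] this]
  have u: "(\<lambda>n. sqrt (real n) * u n) \<longlonglongrightarrow> 2 * lam * d"
    unfolding u_def by (simp add: mult_ac)
  have "(tanh has_real_derivative 1) (at (0::real))"
    by (auto intro!: derivative_eq_intros)
  from delta_tendsto[OF this scaled_limit_0[OF u], of "\<lambda>n. sqrt (real n)"] u
  show ?thesis by (simp add: apd_skew_def u_def f_def mult.commute)
qed

text \<open>The normalizing constant is not computed: being the factor in a probability density, it
  must be the reciprocal of the integral of the kernel.\<close>

lemma (in prob_space) apd_standardized_distr:
  assumes X: "distributed M lborel X (apd_density lam \<theta> p \<mu> \<sigma>)"
    and \<theta>: "0 < \<theta>" "\<theta> < 1" "p > 0" and \<sigma>: "\<sigma> > 0" and lam: "lam > 0"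
  defines "k \<equiv> apd_kernel lam (apd_skew \<theta> p) p"
  shows "distr M borel (\<lambda>\<omega>. (X \<omega> - \<mu>) / \<sigma>) = density lborel (\<lambda>y. ennreal (k y / integral\<^sup>L lborel k))"
proof -
  define D where "D = (apd_delta \<theta> p / lam) powr (1 / p) / Gamma (1 + 1 / p)"
  have D: "D \<ge> 0" unfolding D_def using \<theta>(3) by (intro divide_nonneg_nonneg powr_ge_zero less_imp_le[OF Gamma_real_pos]) (simp_all add: add_pos_pos)
  have km: "k \<in> borel_measurable borel" unfolding k_def by measurable
  have kpos: "k y > 0" for y by (simp add: k_def apd_kernel_def)
  have dens: "apd_density lam \<theta> p \<mu> \<sigma> ((y - - \<mu> / \<sigma>) / (1 / \<sigma>)) = D * k y / \<sigma>" for y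
  proof -
    have y: "((y - - \<mu> / \<sigma>) / (1 / \<sigma>) - \<mu>) / \<sigma> = y" using \<sigma> by (simp add: field_simps)
    have "exp (- (1 / lam) * (apd_delta \<theta> p / apd_A \<theta> p y) * \<bar>y\<bar> powr p) = k y"
    proof (cases "y = 0")
      case False
      show ?thesis unfolding apd_delta_over_A[OF \<theta>(1,2) False] k_def apd_kernel_def by simp
    qed (simp add: k_def apd_kernel_def)
    then show ?thesis unfolding apd_density_def Let_def y by (simp add: D_def)
  qed
  have "distributed M lborel (\<lambda>\<omega>. - \<mu> / \<sigma> + 1 / \<sigma> * X \<omega>)
      (\<lambda>y. ennreal (apd_density lam \<theta> p \<mu> \<sigma> ((y - - \<mu> / \<sigma>) / (1 / \<sigma>))) / ennreal \<bar>1 / \<sigma>\<bar>)"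
    using \<sigma> by (intro distributed_affine[OF X]) auto
  moreover have "ennreal (apd_density lam \<theta> p \<mu> \<sigma> ((y - - \<mu> / \<sigma>) / (1 / \<sigma>))) / ennreal \<bar>1 / \<sigma>\<bar> = ennreal (D * k y)" for y
    unfolding dens using \<sigma> D kpos[of y] by (subst divide_ennreal) auto
  moreover have "(\<lambda>\<omega>. - \<mu> / \<sigma> + 1 / \<sigma> * X \<omega>) = (\<lambda>\<omega>. (X \<omega> - \<mu>) / \<sigma>)"
    by (simp add: fun_eq_iff diff_divide_distrib)
  ultimately have Y: "distributed M lborel (\<lambda>\<omega>. (X \<omega> - \<mu>) / \<sigma>) (\<lambda>y. ennreal (D * k y))" by simp
  have Ym: "(\<lambda>\<omega>. (X \<omega> - \<mu>) / \<sigma>) \<in> borel_measurable M"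
    using distributed_measurable[OF Y] by simp
  have eq: "distr M borel (\<lambda>\<omega>. (X \<omega> - \<mu>) / \<sigma>) = density lborel (\<lambda>y. ennreal (D * k y))"
    using distributed_distr_eq_density[OF Y] by (simp cong: distr_cong)
  interpret Q: prob_space "distr M borel (\<lambda>\<omega>. (X \<omega> - \<mu>) / \<sigma>)" by (rule prob_space_distr[OF Ym])
  have "(\<integral>\<^sup>+y. ennreal (D * k y) \<partial>lborel) = emeasure (density lborel (\<lambda>y. ennreal (D * k y))) UNIV"
    using km by (subst emeasure_density) auto
  also have "\<dots> = 1" unfolding eq[symmetric] using Q.emeasure_space_1 by simp
  finally have "(\<integral>y. D * k y \<partial>lborel) = 1"
    using km D less_imp_le[OF kpos] by (subst integral_eq_nn_integral) auto
  then have "D * integral\<^sup>L lborel k = 1" by simp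
  then have "D * k y = k y / integral\<^sup>L lborel k" for y
    by (metis mult.commute mult_zero_right nonzero_eq_divide_eq zero_neq_one mult.left_commute mult_1_right)
  then show ?thesis unfolding eq by simp
qed

lemma (in prob_space) distributed_atomless:
  fixes X :: "'a \<Rightarrow> real"
  assumes "distributed M lborel X f"
  shows "emeasure (distr M borel X) {c} = 0"
proof -
  have f: "f \<in> borel_measurable lborel" by (rule distributed_borel_measurable[OF assms])
  have "distr M borel X = density lborel f"
    using distributed_distr_eq_density[OF assms] by (simp cong: distr_cong)
  moreover have "emeasure (density lborel f) {c} = 0"
    using f by (subst emeasure_density) (auto intro!: nn_integral_null_set)
  ultimately show ?thesis by simp
qed

text \<open>The criterion with bounded continuous functions speaks about genuine distributions at
  every index, so the finitely many variables that may fail to be measurable are replaced by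
  0.\<close>

lemma (in prob_space) weak_conv_distrI:
  fixes W :: "nat \<Rightarrow> 'a \<Rightarrow> real"
  assumes N: "real_distribution N" and meas: "\<forall>\<^sub>F n in sequentially. W n \<in> borel_measurable M"
    and conv: "\<And>f :: real \<Rightarrow> real. continuous_on UNIV f \<Longrightarrow> bounded (range f) \<Longrightarrow> (\<lambda>n. \<integral>\<omega>. f (W n \<omega>) \<partial>M) \<longlonglongrightarrow> integral\<^sup>L N f"
  shows "weak_conv_m (\<lambda>n. distr M borel (W n)) N"
proof -
  define W' where "W' n = (if W n \<in> borel_measurable M then W n else (\<lambda>_. 0))" for n
  have W'm: "W' n \<in> borel_measurable M" for n by (simp add: W'_def)
  have ev: "\<forall>\<^sub>F n in sequentially. W' n = W n" using meas by eventually_elim (simp add: W'_def)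
  have "weak_conv_m (\<lambda>n. distr M borel (W' n)) N"
  proof (rule integral_bdd_continuous_conv_imp_weak_conv[OF _ N])
    show "real_distribution (distr M borel (W' n))" for n using W'm by (rule real_distribution_distr)
    fix f :: "real \<Rightarrow> real" assume f: "\<And>x. isCont f x" "\<And>x. \<bar>f x\<bar> \<le> 1"
    have fc: "continuous_on UNIV f" using f(1) by (simp add: continuous_at_imp_continuous_on)
    have "bounded (range f)" using f(2) by (intro boundedI[where B=1]) auto
    from conv[OF fc this] have "(\<lambda>n. \<integral>\<omega>. f (W' n \<omega>) \<partial>M) \<longlonglongrightarrow> integral\<^sup>L N f"
      by (rule Lim_transform_eventually) (use ev in eventually_elim, simp)
    then show "(\<lambda>n. integral\<^sup>L (distr M borel (W' n)) f) \<longlonglongrightarrow> integral\<^sup>L N f"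
      by (subst integral_distr[OF W'm borel_measurable_continuous_onI[OF fc]])
  qed
  then show ?thesis
    unfolding weak_conv_m_def weak_conv_def
  proof (intro allI impI)
    fix x
    assume *: "\<forall>x. isCont (cdf N) x \<longrightarrow> (\<lambda>n. cdf (distr M borel (W' n)) x) \<longlonglongrightarrow> cdf N x" and x: "isCont (cdf N) x"
    from * x have "(\<lambda>n. cdf (distr M borel (W' n)) x) \<longlonglongrightarrow> cdf N x" by blast
    then show "(\<lambda>n. cdf (distr M borel (W n)) x) \<longlonglongrightarrow> cdf N x"
      by (rule Lim_transform_eventually) (use ev in eventually_elim, simp)
  qed
qed

lemma norm_vector_2_sq: "(norm (vector [x, y] :: real^2))\<^sup>2 = x\<^sup>2 + y\<^sup>2"
  unfolding power2_norm_eq_inner by (simp add: inner_vec_def sum_2 power2_eq_square)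

lemma real_distribution_noncentral_chi_square2: "real_distribution (noncentral_chi_square2 \<xi>)"
  unfolding noncentral_chi_square2_def
  by (rule prob_space.real_distribution_distr[OF prob_space_multivariate_normal])
     (simp add: measurable_cong_sets[OF sets_multivariate_normal refl])

lemma integral_noncentral_chi_square2:
  fixes m :: "real^2" and f :: "real \<Rightarrow> real"
  assumes m: "(norm m)\<^sup>2 = \<xi>" and f: "continuous_on UNIV f" "bounded (range f)"
  shows "integral\<^sup>L (noncentral_chi_square2 \<xi>) f = (\<integral>z. f ((norm z)\<^sup>2) \<partial>multivariate_normal m (mat 1))"
proof -
  have "(norm (vector [sqrt \<xi>, 0] :: real^2))\<^sup>2 = (norm m)\<^sup>2"
    using m by (simp add: norm_vector_2_sq flip: m)
  then have "norm (vector [sqrt \<xi>, 0] :: real^2) = norm m" by simp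
  from multivariate_normal_norm_invariant[OF this f]
  show ?thesis
    unfolding noncentral_chi_square2_def
    by (subst integral_distr) (auto simp: measurable_cong_sets[OF sets_multivariate_normal refl] borel_measurable_continuous_onI[OF f(1)])
qed

section \<open>Finite-sample corrections and the final assembly\<close>

lemma correction_null:
  fixes c \<alpha> :: "nat \<Rightarrow> real"
  assumes "\<And>n. \<bar>c n\<bar> \<le> B" "\<And>n. s \<le> \<alpha> n" "r < s"
  shows "(\<lambda>n. real n powr r * (c n / real n powr \<alpha> n)) \<longlonglongrightarrow> 0"
proof (rule Lim_null_comparison)
  have B: "B \<ge> 0" using assms(1)[of 0] by simp
  show "\<forall>\<^sub>F n in sequentially. norm (real n powr r * (c n / real n powr \<alpha> n)) \<le> B * real n powr (r - s)"
    using eventually_ge_at_top[of 1]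
  proof eventually_elim
    case (elim n)
    have "norm (real n powr r * (c n / real n powr \<alpha> n)) = \<bar>c n\<bar> * real n powr (r - \<alpha> n)"
      by (simp add: abs_mult abs_divide powr_diff)
    also have "\<dots> \<le> B * real n powr (r - s)"
      using assms elim B by (intro mult_mono powr_mono) auto
    finally show ?case .
  qed
  have "(\<lambda>n. real n powr (r - s)) \<longlonglongrightarrow> 0"
    using assms(3) by (intro tendsto_neg_powr filterlim_real_sequentially) auto
  then show "(\<lambda>n. B * real n powr (r - s)) \<longlonglongrightarrow> 0" by (rule tendsto_mult_right_zero)
qed

text \<open>Hides the table of constants and its dependence on parity. The correction to the mean is
  multiplied by \<open>sqrt n\<close>, so its exponent has to exceed 1/2; for the corrections to the
  variances positive exponents are enough.\<close>

lemma test_statistics_form: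
  obtains e v w :: "nat \<Rightarrow> real" where
    "(\<lambda>n. sqrt (real n) * e n) \<longlonglongrightarrow> 0" "v \<longlonglongrightarrow> V_S lam" "w \<longlonglongrightarrow> 1 / 16 * E_K lam powr (- 3 / 2) * V_K lam"
    "\<forall>n x. Z_S lam n x = sqrt (real n) * S_stat lam n x / sqrt (v n)"
    "\<forall>n x. Z_K_net lam n x = sqrt (real n) * (K_net lam n x powr (1 / 4) - E_K lam powr (1 / 4) * (1 + e n)) / sqrt (w n)"
proof -
  define k where "k = apd_consts lam"
  define \<alpha>1 where "\<alpha>1 n = fst (k n)" for n
  define c1 where "c1 n = fst (snd (k n))" for n
  define \<alpha>2 where "\<alpha>2 n = fst (snd (snd (k n)))" for n
  define c2 where "c2 n = fst (snd (snd (snd (k n))))" for n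
  define \<alpha>3 where "\<alpha>3 n = fst (snd (snd (snd (snd (k n)))))" for n
  define c3 where "c3 n = fst (snd (snd (snd (snd (snd (k n))))))" for n
  define \<alpha>4 where "\<alpha>4 n = fst (snd (snd (snd (snd (snd (snd (k n)))))))" for n
  define c4 where "c4 n = snd (snd (snd (snd (snd (snd (snd (k n)))))))" for n
  note defs = \<alpha>1_def c1_def \<alpha>2_def c2_def \<alpha>3_def c3_def \<alpha>4_def c4_def
  have k: "apd_consts lam n = (\<alpha>1 n, c1 n, \<alpha>2 n, c2 n, \<alpha>3 n, c3 n, \<alpha>4 n, c4 n)" for n
    by (simp add: defs k_def)
  \<comment> \<open>104 exceeds the modulus of every tabulated constant, the largest being
    103.871.\<close>
  have c: "\<bar>c1 n\<bar> \<le> 104" "\<bar>c2 n\<bar> \<le> 104" "\<bar>c3 n\<bar> \<le> 104" "\<bar>c4 n\<bar> \<le> 104"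
    and \<alpha>: "1/2 \<le> \<alpha>1 n" "4/5 \<le> \<alpha>2 n" "1/2 \<le> \<alpha>3 n" "1/2 \<le> \<alpha>4 n" for n
    by (simp_all add: defs k_def apd_consts_def)
  have pos: "\<forall>\<^sub>F n in sequentially. real n powr 0 * x n = x n" "\<forall>\<^sub>F n in sequentially. real n powr (1/2) * x n = sqrt (real n) * x n"
    for x :: "nat \<Rightarrow> real"
    using eventually_gt_at_top[of "0::nat"] by (eventually_elim, simp add: powr_half_sqrt)+
  have l1: "(\<lambda>n. c1 n / real n powr \<alpha>1 n) \<longlonglongrightarrow> 0"
    by (rule Lim_transform_eventually[OF correction_null[OF c(1) \<alpha>(1), of 0] pos(1)]) simp
  have l2: "(\<lambda>n. sqrt (real n) * (c2 n / real n powr \<alpha>2 n)) \<longlonglongrightarrow> 0"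
    by (rule Lim_transform_eventually[OF correction_null[OF c(2) \<alpha>(2), of "1/2"] pos(2)]) simp
  have l3: "(\<lambda>n. c3 n / real n powr \<alpha>3 n) \<longlonglongrightarrow> 0"
    by (rule Lim_transform_eventually[OF correction_null[OF c(3) \<alpha>(3), of 0] pos(1)]) simp
  have l4: "(\<lambda>n. c4 n / real n powr \<alpha>4 n) \<longlonglongrightarrow> 0"
    by (rule Lim_transform_eventually[OF correction_null[OF c(4) \<alpha>(4), of 0] pos(1)]) simp
  show ?thesis
  proof (rule that[OF l2])
    show "(\<lambda>n. V_S lam * (1 + c1 n / real n powr \<alpha>1 n)) \<longlonglongrightarrow> V_S lam"
      using tendsto_mult_left[OF tendsto_add[OF tendsto_const[of 1] l1], of "V_S lam"] by simp
    show "(\<lambda>n. 1 / 16 * E_K lam powr (- 3 / 2) * V_K lam * (1 + c3 n / real n powr \<alpha>3 n + c4 n / real n powr \<alpha>4 n))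
        \<longlonglongrightarrow> 1 / 16 * E_K lam powr (- 3 / 2) * V_K lam"
      using tendsto_mult_left[OF tendsto_add[OF tendsto_add[OF tendsto_const[of 1] l3] l4], of "1 / 16 * E_K lam powr (- 3 / 2) * V_K lam"]
      by simp
  qed (simp_all add: Z_S_def Z_K_net_def k)
qed

theorem corollary3p11:
  fixes lam \<mu> \<sigma> \<delta>1 \<delta>2 :: real
    and \<theta>1 \<theta>2 \<epsilon>1 \<epsilon>2 :: "nat \<Rightarrow> real"
    and M :: "'a measure"
    and X :: "nat \<Rightarrow> nat \<Rightarrow> 'a \<Rightarrow> real"
  assumes lam_cases: "lam \<in> {1, 1.5, 2, 2.5, 3}"
    and sigma: "\<sigma> > 0"
    and eps1: "\<epsilon>1 \<longlonglongrightarrow> 0"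
    and eps2: "\<epsilon>2 \<longlonglongrightarrow> 0"
    and theta1: "\<And>n. n \<ge> 1 \<Longrightarrow> \<theta>1 n = 1 / 2 + \<delta>1 / sqrt (real n) * (1 + \<epsilon>1 n)"
    and theta2: "\<And>n. n \<ge> 1 \<Longrightarrow> \<theta>2 n = lam + \<delta>2 / sqrt (real n) * (1 + \<epsilon>2 n)"
    and prob: "prob_space M"
    and sample: "\<forall>\<^sub>F n in sequentially. 0 < \<theta>1 n \<and> \<theta>1 n < 1 \<and> 0 < \<theta>2 n \<and>
      prob_space.indep_vars M (\<lambda>_. borel) (X n) {..<n} \<and>
      (\<forall>i<n. distributed M lborel (X n i) (apd_density lam (\<theta>1 n) (\<theta>2 n) \<mu> \<sigma>))"
  shows "(AE \<omega> in M. (\<lambda>n. Z_S lam n (\<lambda>i. X n i \<omega>) / Z_star_S lam n (\<lambda>i. X n i \<omega>)) \<longlonglongrightarrow> 1) \<and>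
    converges_in_probability M
      (\<lambda>n \<omega>. Z_K_net lam n (\<lambda>i. X n i \<omega>) / Z_star_K lam n (\<lambda>i. X n i \<omega>)) 1 \<and>
    converges_in_distribution M
      (\<lambda>n \<omega>. vector [Z_S lam n (\<lambda>i. X n i \<omega>), Z_K_net lam n (\<lambda>i. X n i \<omega>)] :: real ^ 2)
      (multivariate_normal (vector [- \<delta>1 * sqrt (V1 lam), - \<delta>2 * sqrt (V2 lam)]) (mat 1)) \<and>
    weak_conv_m (\<lambda>n. distr M borel (\<lambda>\<omega>. X_APD lam n (\<lambda>i. X n i \<omega>)))
      (noncentral_chi_square2 (\<delta>1\<^sup>2 * V1 lam + \<delta>2\<^sup>2 * V2 lam))"
proof -
  interpret prob_space M by (rule prob)
  have lam: "1 \<le> lam" "lam \<le> 3" "lam = 1 \<or> 3/2 \<le> lam" using lam_cases by auto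
  define b where "b n = apd_skew (\<theta>1 n) (\<theta>2 n)" for n
  define Y where "Y n i \<omega> = (X n i \<omega> - \<mu>) / \<sigma>" for n i \<omega>
  define t where "t p = (mu_hat lam (fst p) (\<lambda>i. X (fst p) i (snd p)) - \<mu>) / \<sigma>" for p
  have th1: "(\<lambda>n. sqrt (real n) * (\<theta>1 n - 1 / 2)) \<longlonglongrightarrow> \<delta>1"
  proof (rule Lim_transform_eventually)
    show "(\<lambda>n. \<delta>1 * (1 + \<epsilon>1 n)) \<longlonglongrightarrow> \<delta>1"
      using tendsto_mult_left[OF tendsto_add[OF tendsto_const[of 1] eps1], of \<delta>1] by simp
    show "\<forall>\<^sub>F n in sequentially. \<delta>1 * (1 + \<epsilon>1 n) = sqrt (real n) * (\<theta>1 n - 1 / 2)"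
      using eventually_ge_at_top[of 1] by eventually_elim (simp add: theta1)
  qed
  have th2: "(\<lambda>n. sqrt (real n) * (\<theta>2 n - lam)) \<longlonglongrightarrow> \<delta>2"
  proof (rule Lim_transform_eventually)
    show "(\<lambda>n. \<delta>2 * (1 + \<epsilon>2 n)) \<longlonglongrightarrow> \<delta>2"
      using tendsto_mult_left[OF tendsto_add[OF tendsto_const[of 1] eps2], of \<delta>2] by simp
    show "\<forall>\<^sub>F n in sequentially. \<delta>2 * (1 + \<epsilon>2 n) = sqrt (real n) * (\<theta>2 n - lam)"
      using eventually_ge_at_top[of 1] by eventually_elim (simp add: theta2)
  qed
  have b_lim: "(\<lambda>n. sqrt (real n) * b n) \<longlonglongrightarrow> 2 * lam * \<delta>1"
    unfolding b_def by (rule apd_skew_limit[OF th1 LIM_zero_cancel[OF scaled_limit_0[OF th2]]])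
  interpret A: apd_seq lam "2 * lam * \<delta>1" \<delta>2 b \<theta>2
    by unfold_locales (use lam b_lim th2 in auto)
  have rows: "\<forall>\<^sub>F n in sequentially. indep_vars (\<lambda>_. borel) (Y n) {..<n} \<and> (\<forall>i<n. distr M borel (Y n i) = A.Qn n)"
    using sample
  proof eventually_elim
    case (elim n)
    have "indep_vars (\<lambda>_. borel) (\<lambda>i \<omega>. (\<lambda>x. (x - \<mu>) / \<sigma>) (X n i \<omega>)) {..<n}"
      using elim by (intro indep_vars_compose2[where Y="\<lambda>i x. (x - \<mu>) / \<sigma>"]) auto
    moreover have "distr M borel (\<lambda>\<omega>. (X n i \<omega> - \<mu>) / \<sigma>) = A.Qn n" if "i < n" for i
      unfolding A.Qn_def A.kn_def A.Zn_def b_def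
      using elim that lam sigma by (intro apd_standardized_distr) auto
    ultimately show ?case by (simp add: Y_def[abs_def])
  qed
  interpret C: apd_array lam "2 * lam * \<delta>1" \<delta>2 b \<theta>2 M Y
    by unfold_locales (rule rows)
  have score: "mscore lam (fst p) (\<lambda>i. X (fst p) i (snd p)) (\<mu> + \<sigma> * h)
      = \<sigma> powr (lam - 1) * C.rsum (\<lambda>y. spow (lam - 1) (y - h)) p" for p h
    unfolding mscore_affine[OF sigma] C.rsum_def Y_def ..
  interpret B: apd_sample lam "2 * lam * \<delta>1" \<delta>2 b \<theta>2 M Y t
  proof unfold_locales
    show "lam = 1 \<or> 3/2 \<le> lam" by (rule lam)
    show "t p \<le> h" if "fst p > 0" "C.rsum (\<lambda>y. spow (lam - 1) (y - h)) p < 0" for p h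
    proof -
      have "mscore lam (fst p) (\<lambda>i. X (fst p) i (snd p)) (\<mu> + \<sigma> * h) < 0"
        unfolding score using that sigma by (simp add: mult_pos_neg)
      from mu_hat_le[OF lam(1) that(1) this] show ?thesis using sigma by (simp add: t_def field_simps)
    qed
    show "t p \<ge> h" if "fst p > 0" "C.rsum (\<lambda>y. spow (lam - 1) (y - h)) p > 0" for p h
    proof -
      have "mscore lam (fst p) (\<lambda>i. X (fst p) i (snd p)) (\<mu> + \<sigma> * h) > 0"
        unfolding score using that sigma by simp
      from mu_hat_ge[OF lam(1) that(1) this] show ?thesis using sigma by (simp add: t_def field_simps)
    qed
  qed

  \<comment> \<open>The identities need a positive scale, which holds eventually along the filter
    because \<open>ahat\<close> tends to 1.\<close>
  have stats: "\<forall>\<^sub>F p in prob_filter M. S_stat lam (fst p) (\<lambda>i. X (fst p) i (snd p)) = B.Sst p \<and>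
      K_stat lam (fst p) (\<lambda>i. X (fst p) i (snd p)) = B.Kst p \<and>
      K_net lam (fst p) (\<lambda>i. X (fst p) i (snd p)) = B.Knet p"
    using order_tendstoD(1)[OF B.ahat_1, of 0, simplified] B.eventually_fst_pos
  proof eventually_elim
    case (elim p)
    have y: "Y (fst p) i (snd p) = (X (fst p) i (snd p) - \<mu>) / \<sigma>" for i by (rule Y_def)
    have a: "B.ahat p = (\<Sum>i<fst p. \<bar>Y (fst p) i (snd p) - t p\<bar> powr lam) / real (fst p)"
      by (simp add: B.ahat_def C.rsum_def)
    note st = stats_standardize[OF lam(1) sigma elim(2) y t_def a elim(1)]
    have "S_stat lam (fst p) (\<lambda>i. X (fst p) i (snd p)) = B.Sst p"
      unfolding st(1) B.Sst_def B.shat_def C.rsum_def ..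
    moreover have "K_stat lam (fst p) (\<lambda>i. X (fst p) i (snd p)) = B.Kst p"
      unfolding st(2) B.Kst_def B.khat_def C.rsum_def ..
    ultimately
    show ?case by (simp add: K_net_def B.Knet_def)
  qed
  obtain e v w where e: "(\<lambda>n. sqrt (real n) * e n) \<longlonglongrightarrow> 0" and v: "v \<longlonglongrightarrow> V_S lam"
    and w: "w \<longlonglongrightarrow> 1 / 16 * E_K lam powr (- 3 / 2) * V_K lam"
    and Z: "\<forall>n x. Z_S lam n x = sqrt (real n) * S_stat lam n x / sqrt (v n)"
      "\<forall>n x. Z_K_net lam n x = sqrt (real n) * (K_net lam n x powr (1 / 4) - E_K lam powr (1 / 4) * (1 + e n)) / sqrt (w n)"
    by (rule test_statistics_form[of lam])
  define U where "U p = Z_S lam (fst p) (\<lambda>i. X (fst p) i (snd p))" for p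
  define V where "V p = Z_K_net lam (fst p) (\<lambda>i. X (fst p) i (snd p))" for p
  define V' where "V' p = Z_star_K lam (fst p) (\<lambda>i. X (fst p) i (snd p))" for p
  let ?IS = "\<lambda>p. 1 / sqrt (V_S lam) * (C.rsum (infl_S lam) p / C.root_n p)"
  let ?IK = "\<lambda>p. 1 / sqrt (V_K lam) * (C.rsum (infl_K lam) p / C.root_n p)"
  have U: "((\<lambda>p. U p - ?IS p) \<longlongrightarrow> 0) (prob_filter M)"
    by (rule Lim_transform_eventually[OF B.Z_S_expansion[OF v]])
       (use stats in eventually_elim, simp add: U_def Z)
  have V: "((\<lambda>p. V p - ?IK p) \<longlongrightarrow> 0) (prob_filter M)"
    by (rule Lim_transform_eventually[OF B.Z_K_expansion[OF e w]])
       (use stats in eventually_elim, simp add: V_def Z)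
  have V': "((\<lambda>p. V' p - ?IK p) \<longlongrightarrow> 0) (prob_filter M)"
    by (rule Lim_transform_eventually[OF B.Z_star_K_expansion])
       (use stats in eventually_elim, simp add: V'_def Z_star_K_def)
  have tight: "stoch_bounded M U" "stoch_bounded M V"
    by (rule stoch_bounded_close[OF U stoch_bounded_cmult[OF B.infl_tight(1)]]
        stoch_bounded_close[OF V stoch_bounded_cmult[OF B.infl_tight(2)]])+
  have meas: "\<forall>\<^sub>F n in sequentially. (\<lambda>\<omega>. U (n, \<omega>)) \<in> borel_measurable M \<and>
      (\<lambda>\<omega>. V (n, \<omega>)) \<in> borel_measurable M \<and> (\<lambda>\<omega>. V' (n, \<omega>)) \<in> borel_measurable M"
    using sample eventually_gt_at_top[of 0]
  proof eventually_elim
    case (elim n)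
    then have "X n i \<in> borel_measurable M" if "i < n" for i
      using that distributed_measurable[of M lborel "X n i"] by auto
    from Z_measurable[OF lam(1) \<open>0 < n\<close> this] show ?case by (simp add: U_def V_def V'_def)
  qed
  define m :: "real^2" where "m = vector [- \<delta>1 * sqrt (V1 lam), - \<delta>2 * sqrt (V2 lam)]"
  \<comment> \<open>The factor 4 reflects the skewness limit \<open>2 * lam * \<delta>1\<close>:
    divided by \<open>lam\<close> it gives the mean
    \<open>- 2 * \<delta>1 * sqrt (V_S lam)\<close>.\<close>
  have V12: "V1 lam = 4 * V_S lam" "V2 lam = V_K lam / lam\<^sup>2"
    by (simp_all add: V1_def V_S_def V2_def V_K_def power2_eq_square power3_eq_cube)
  have "sqrt (V1 lam) = 2 * sqrt (V_S lam)" "sqrt (V2 lam) = sqrt (V_K lam) / lam"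
    using lam by (simp_all add: V12 real_sqrt_mult real_sqrt_divide)
  then have m: "C.limit_mean = m"
    using lam by (simp add: C.limit_mean_def m_def mult.left_commute[of \<delta>1])
  have V12_nonneg: "V1 lam \<ge> 0" "V2 lam \<ge> 0"
    unfolding V12 using V_S_pos[OF lam(1)] V_K_pos[of lam] lam by simp_all
  have dist: "(\<lambda>n. \<integral>\<omega>. f (vector [U (n, \<omega>), V (n, \<omega>)]) \<partial>M) \<longlonglongrightarrow> (\<integral>z. f z \<partial>multivariate_normal m (mat 1))"
    if "continuous_on UNIV f" "bounded (range f)" for f :: "real^2 \<Rightarrow> real"
    unfolding m[symmetric] using meas by (intro C.joint_clt U V tight that) (auto elim: eventually_mono)

  have ratio_S: "AE \<omega> in M. (\<lambda>n. Z_S lam n (\<lambda>i. X n i \<omega>) / Z_star_S lam n (\<lambda>i. X n i \<omega>)) \<longlonglongrightarrow> 1"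
  proof -
    obtain n0 where n0: "\<And>n. n \<ge> n0 \<Longrightarrow> indep_vars (\<lambda>_. borel) (X n) {..<n} \<and>
      (\<forall>i<n. distributed M lborel (X n i) (apd_density lam (\<theta>1 n) (\<theta>2 n) \<mu> \<sigma>))"
      using sample unfolding eventually_sequentially by blast
    \<comment> \<open>Countably many null events are united, so nothing about the joint law of
      samples of different sizes enters.\<close>
    have "AE \<omega> in M. \<forall>n. n \<ge> max 3 n0 \<longrightarrow> S_stat lam n (\<lambda>i. X n i \<omega>) \<noteq> 0"
      unfolding AE_all_countable
    proof
      fix n
      show "AE \<omega> in M. n \<ge> max 3 n0 \<longrightarrow> S_stat lam n (\<lambda>i. X n i \<omega>) \<noteq> 0"
      proof (cases "n \<ge> max 3 n0")
        case True
        then have "AE \<omega> in M. S_stat lam n (\<lambda>i. X n i \<omega>) \<noteq> 0"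
          using n0[of n] by (intro AE_S_stat_nonzero[OF lam(1)]) (auto intro: distributed_atomless)
        then show ?thesis by eventually_elim simp
      qed auto
    qed
    then show ?thesis
    proof eventually_elim
      case (elim \<omega>)
      have pos: "V_S lam > 0" by (rule V_S_pos[OF lam(1)])
      \<comment> \<open>Once \<open>S\<close> is nonzero it cancels, and the ratio is a
        deterministic sequence.\<close>
      have "(\<lambda>n. sqrt (V_S lam) / sqrt (v n)) \<longlonglongrightarrow> sqrt (V_S lam) / sqrt (V_S lam)"
        using pos by (intro tendsto_divide tendsto_const tendsto_real_sqrt v) auto
      then have "(\<lambda>n. sqrt (V_S lam) / sqrt (v n)) \<longlonglongrightarrow> 1" using pos by simp
      moreover have "\<forall>\<^sub>F n in sequentially. sqrt (V_S lam) / sqrt (v n)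
          = Z_S lam n (\<lambda>i. X n i \<omega>) / Z_star_S lam n (\<lambda>i. X n i \<omega>)"
        using eventually_ge_at_top[of "max 3 n0"]
      proof eventually_elim
        case (elim n)
        then have "S_stat lam n (\<lambda>i. X n i \<omega>) \<noteq> 0" "n > 0" using \<open>\<forall>n. n \<ge> max 3 n0 \<longrightarrow> _ n\<close> by auto
        then show ?case by (simp add: Z Z_star_S_def)
      qed
      ultimately show ?case by (rule Lim_transform_eventually)
    qed
  qed

  have ratio_K: "converges_in_probability M (\<lambda>n \<omega>. Z_K_net lam n (\<lambda>i. X n i \<omega>) / Z_star_K lam n (\<lambda>i. X n i \<omega>)) 1"
  proof (rule tendsto_imp_converges_in_probability)
    have "((\<lambda>p. V p - V' p) \<longlongrightarrow> 0) (prob_filter M)"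
      using tendsto_diff[OF V V'] by simp
    moreover have "\<exists>e>0. \<forall>\<^sub>F n in sequentially. \<exists>A\<in>sets M. measure M A \<le> \<eta> \<and> (\<forall>\<omega>\<in>space M - A. \<bar>V (n, \<omega>)\<bar> > e)"
      if "\<eta> > 0" for \<eta>
    proof -
      have "\<forall>\<^sub>F n in sequentially. (\<lambda>\<omega>. V (n, \<omega>)) \<in> borel_measurable M" using meas by eventually_elim simp
      from normal_limit_avoids_zero[OF dist this that] show ?thesis by blast
    qed
    ultimately have "((\<lambda>p. V p / V' p) \<longlongrightarrow> 1) (prob_filter M)" by (rule ratio_tendsto_1)
    then show "((\<lambda>p. Z_K_net lam (fst p) (\<lambda>i. X (fst p) i (snd p)) / Z_star_K lam (fst p) (\<lambda>i. X (fst p) i (snd p))) \<longlongrightarrow> 1) (prob_filter M)"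
      by (simp add: V_def V'_def)
    show "\<forall>\<^sub>F n in sequentially. (\<lambda>\<omega>. Z_K_net lam n (\<lambda>i. X n i \<omega>) / Z_star_K lam n (\<lambda>i. X n i \<omega>)) \<in> borel_measurable M"
      using meas by eventually_elim (auto simp: V_def V'_def)
  qed

  have joint: "converges_in_distribution M
      (\<lambda>n \<omega>. vector [Z_S lam n (\<lambda>i. X n i \<omega>), Z_K_net lam n (\<lambda>i. X n i \<omega>)] :: real ^ 2) (multivariate_normal m (mat 1))"
    unfolding converges_in_distribution_def
  proof (intro conjI allI impI)
    show "\<forall>\<^sub>F n in sequentially. (\<lambda>\<omega>. vector [Z_S lam n (\<lambda>i. X n i \<omega>), Z_K_net lam n (\<lambda>i. X n i \<omega>)] :: real ^ 2) \<in> borel_measurable M"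
      using meas by eventually_elim (auto simp: U_def V_def intro: vector_2_measurable)
    show "(\<lambda>n. \<integral>\<omega>. f (vector [Z_S lam n (\<lambda>i. X n i \<omega>), Z_K_net lam n (\<lambda>i. X n i \<omega>)]) \<partial>M) \<longlonglongrightarrow> (\<integral>z. f z \<partial>multivariate_normal m (mat 1))"
      if "continuous_on UNIV f \<and> bounded (range f)" for f :: "real^2 \<Rightarrow> real"
      using dist[of f] that by (simp add: U_def V_def)
  qed

  have "weak_conv_m (\<lambda>n. distr M borel (\<lambda>\<omega>. X_APD lam n (\<lambda>i. X n i \<omega>))) (noncentral_chi_square2 (\<delta>1\<^sup>2 * V1 lam + \<delta>2\<^sup>2 * V2 lam))"
  proof (rule weak_conv_distrI[OF real_distribution_noncentral_chi_square2])
    show "\<forall>\<^sub>F n in sequentially. (\<lambda>\<omega>. X_APD lam n (\<lambda>i. X n i \<omega>)) \<in> borel_measurable M"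
      using meas by eventually_elim (auto simp: U_def V_def X_APD_def)
    fix f :: "real \<Rightarrow> real" assume f: "continuous_on UNIV f" "bounded (range f)"
    have "continuous_on UNIV (\<lambda>z::real^2. f ((norm z)\<^sup>2))"
      by (rule continuous_on_compose2[OF f(1)]) (auto intro!: continuous_intros)
    moreover have "bounded (range (\<lambda>z::real^2. f ((norm z)\<^sup>2)))"
      by (rule bounded_subset[OF f(2)]) auto
    ultimately have "(\<lambda>n. \<integral>\<omega>. f ((norm (vector [U (n, \<omega>), V (n, \<omega>)] :: real^2))\<^sup>2) \<partial>M)
        \<longlonglongrightarrow> (\<integral>z. f ((norm z)\<^sup>2) \<partial>multivariate_normal m (mat 1))"
      by (rule dist)
    moreover have m2: "(norm m)\<^sup>2 = \<delta>1\<^sup>2 * V1 lam + \<delta>2\<^sup>2 * V2 lam"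
      using V12_nonneg by (simp add: m_def norm_vector_2_sq power_mult_distrib)
    ultimately show "(\<lambda>n. \<integral>\<omega>. f (X_APD lam n (\<lambda>i. X n i \<omega>)) \<partial>M)
        \<longlonglongrightarrow> integral\<^sup>L (noncentral_chi_square2 (\<delta>1\<^sup>2 * V1 lam + \<delta>2\<^sup>2 * V2 lam)) f"
      unfolding integral_noncentral_chi_square2[OF m2 f] by (simp add: norm_vector_2_sq X_APD_def U_def V_def)
  qed
  then show ?thesis using ratio_S ratio_K joint unfolding m_def by blast
qed

end
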